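(* Let $\varepsilon>0$ with $\Lambda_\varepsilon>0$, let $P_0$ be non-atomic, let $P_\varepsilon$ be an $\varepsilon$-NormCRM$(\rho,\kappa P_0)$, let $\boldsymbol\theta=(\theta_1,\dots,\theta_n)$ be a sample from $P_\varepsilon$, with distinct values $\boldsymbol\theta^*=(\theta_1^*,\dots,\theta_k^* )$ having multiplicities $n_1,\dots,n_k$ in $\boldsymbol\theta$, and let $U:=\Gamma_n/T_\varepsilon$, where $\Gamma_n\sim\text{gamma}(n,1)$ is independent of everything else. Then the conditional distribution of $P_\varepsilon$, given $\boldsymbol\theta^*$ (with its multiplicities) and $U=u$, is the law of a random probability measure $P_\varepsilon^*$ satisfying the distributional equation $$P_\varepsilon^*(\cdot)\stackrel{d}{=}w\,P^{(na)}_{\varepsilon,u}(\cdot)+(1-w)\sum_{j=1}^kP_j^{(a)}\delta_{\theta_j^*}(\cdot),$$ where: 1. $P^{(na)}_{\varepsilon,u}$, the process of non-allocated jumps, is distributed as an $\varepsilon$-NormCRM$(e^{-u\,\cdot}\rho(\cdot),\kappa P_0)$ given that exactly $N_{na}$ jumps of the process were obtained, and the posterior law of $N_{na}$ (given $\boldsymbol\theta^*$ and $U=u$) is $$\frac{\Lambda_{\varepsilon,u}}{k+\Lambda_{\varepsilon,u}}\,\mathcal{P}_1(\Lambda_{\varepsilon,u})+\frac{k}{k+\Lambda_{\varepsilon,u}}\,\mathcal{P}_0(\Lambda_{\varepsilon,u});$$ 2. the allocated jumps $\{P_1^{(a)},\dots,P_k^{(a)}\}$ associated with the fixed points of discontinuity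 $\boldsymbol\theta^*$ are obtained by normalization, $P_j^{(a)}=J_j^{(a)}/\sum_{i=1}^kJ_i^{(a)}$, of independent random variables $J_1^{(a)},\dots,J_k^{(a)}$, where $J_j^{(a)}$ has density proportional to $s^{n_j}e^{-us}\rho(s)\mathbb{I}_{(\varepsilon,+\infty)}(s)$, $j=1,\dots,k$; 3. $P^{(na)}_{\varepsilon,u}$ and $\{J_1^{(a)},\dots,J_k^{(a)}\}$ are independent, conditionally on $\boldsymbol l^*=(l_1^*,\dots,l_k^* )$, the vector of indices of the allocated jumps; 4. $w=0$ when $N_{na}=0$, and otherwise $w=T_{\varepsilon,u}/\big(T_{\varepsilon,u}+\sum_{j=1}^kJ_j^{(a)}\big)$, where $T_{\varepsilon,u}$ is the total sum of the (unnormalized) jumps of $P^{(na)}_{\varepsilon,u}$; 5. the posterior law of $U$ given $\boldsymbol\theta^*$ has density on the positive reals $$f_{U|\boldsymbol\theta^*}(u|\boldsymbol\theta^* )\propto u^{n-1}e^{\Lambda_{\varepsilon,u}-\Lambda_\varepsilon}\,\frac{\Lambda_{\varepsilon,u}+k}{\Lambda_\varepsilon}\prod_{i=1}^k\int_\varepsilon^{+\infty}\kappa\, s^{n_i}e^{-us}\rho(s)\,ds,\qquad u>0.$$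
   Context: Setting. $\Theta\subset\mathbb{R}^m$ is a Borel set, $P_0$ is a probability measure on $\Theta$, $\kappa>0$, and $\rho:(0,+\infty)\to[0,+\infty)$ is measurable with $\int_0^{+\infty}\min\{1,s\}\rho(s)\,ds<\infty$ and $\int_0^{+\infty}\rho(s)\,ds=+\infty$. For $\varepsilon>0$ put $\Lambda_\varepsilon:=\kappa\int_\varepsilon^{+\infty}\rho(s)\,ds$ (which is finite), $\Lambda_{\varepsilon,u}:=\kappa\int_\varepsilon^{+\infty}e^{-us}\rho(s)\,ds$ for $u\ge0$, and, when $\Lambda_\varepsilon>0$, let $\rho_\varepsilon(s):=\frac{\kappa\rho(s)}{\Lambda_\varepsilon}\mathbb{I}_{(\varepsilon,+\infty)}(s)$, a probability density. $\varepsilon$-NormCRM$(\rho,\kappa P_0)$: let $N_\varepsilon\sim\text{Poisson}(\Lambda_\varepsilon)$; conditionally on $N_\varepsilon$, let $J_0,J_1,\dots,J_{N_\varepsilon}$ be iid with density $\rho_\varepsilon$ and, independently of these, let $\tau_0,\dots,\tau_{N_\varepsilon}$ be iid from $P_0$. With $T_\varepsilon=\sum_{j=0}^{N_\varepsilon}J_j$, the random probability measure $P_\varepsilon=\sum_{j=0}^{N_\varepsilon}\frac{J_j}{T_\varepsilon}\delta_{\tau_j}$ is called an $\varepsilon$-NormCRM$(\rho,\kappa P_0)$. The number of jumps of such a process is $N_\varepsilon+1$. Thus an $\varepsilon$-NormCRM$(e^{-u\cdot}\rho(\cdot),\kappa P_0)$ given that exactly $r\ge1$ jumps were obtained is $\sum_{j=1}^{r}\frac{J_j}{\sum_{i}J_i}\delta_{\tau_j}$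 with $J_1,\dots,J_r$ iid with density proportional to $e^{-us}\rho(s)\mathbb{I}_{(\varepsilon,+\infty)}(s)$ and, independently, $\tau_1,\dots,\tau_r$ iid from $P_0$; when $r=0$ there is no such process, and the corresponding term is absent (weight $w=0$). A sample $\boldsymbol\theta$ from $P_\varepsilon$ means that, conditionally on $P_\varepsilon$, $\theta_1,\dots,\theta_n$ are iid from $P_\varepsilon$. The allocated jumps of $P_\varepsilon$ are those with indices $l_1^*,\dots,l_k^*\in\{0,\dots,N_\varepsilon\}$ such that $\tau_{l_i^*}=\theta_i^*$, $i=1,\dots,k$; the remaining $N_{na}:=N_\varepsilon+1-k$ jumps are the non-allocated ones. Superscripts $(a)$ and $(na)$ refer to allocated and non-allocated jumps. For $i\in\{0,1\}$, $\mathcal{P}_i(\lambda)$ denotes the shifted Poisson distribution on $\{i,i+1,i+2,\dots\}$ with mean $i+\lambda$, i.e. the law of $i+X$ with $X\sim\text{Poisson}(\lambda)$. *)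

theory Defs
  imports "HOL-Probability.Probability"
begin

text \<open>
  Throughout, \<open>P0\<close> is a probability measure on the Borel sigma-algebra of \<open>\<Theta>\<close>.
  The same object also serves as the measurable space in which locations take their values:
  constructions such as \<^term>\<open>prob_algebra P0\<close> depend on \<open>P0\<close> only through its sigma-algebra.
\<close>

subsection \<open>Discrete measures\<close>

text \<open>
  The measure \<open>\<Sum>j\<in>I. (J j / (\<Sum>i\<in>I. J i)) \<delta>\<^sub>(\<tau> j)\<close>.  For \<open>I = {}\<close> it is the null measure.
\<close>
definition norm_atoms :: "'a measure \<Rightarrow> 'i set \<Rightarrow> ('i \<Rightarrow> real) \<Rightarrow> ('i \<Rightarrow> 'a) \<Rightarrow> 'a measure" where
  "norm_atoms S I J \<tau> = distr (point_measure I (\<lambda>j. ennreal (J j / (\<Sum>i\<in>I. J i)))) S \<tau>"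

lemma emeasure_norm_atoms:
  assumes "finite I" "\<And>j. j \<in> I \<Longrightarrow> \<tau> j \<in> space S" "A \<in> sets S"
  shows "emeasure (norm_atoms S I J \<tau>) A = (\<Sum>j\<in>I. ennreal (J j / (\<Sum>i\<in>I. J i)) * indicator A (\<tau> j))"
proof -
  let ?p = "\<lambda>j. ennreal (J j / (\<Sum>i\<in>I. J i))"
  have "\<tau> \<in> point_measure I ?p \<rightarrow>\<^sub>M S"
    using assms(2) by (auto simp: point_measure_def)
  then have "emeasure (norm_atoms S I J \<tau>) A = emeasure (point_measure I ?p) (\<tau> -` A \<inter> I)"
    using assms(3) by (simp add: norm_atoms_def emeasure_distr space_point_measure)
  also have "\<dots> = (\<Sum>j\<in>\<tau> -` A \<inter> I. ?p j)"
    using assms(1) by (intro emeasure_point_measure_finite) auto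
  also have "\<dots> = (\<Sum>j\<in>I. ?p j * indicator A (\<tau> j))"
    using assms(1) by (intro sum.mono_neutral_cong_left) (auto simp: indicator_def)
  finally show ?thesis .
qed

definition mix_measure :: "real \<Rightarrow> 'a measure \<Rightarrow> 'a measure \<Rightarrow> 'a measure" where
  "mix_measure w A B = measure_of (space A) (sets A)
     (\<lambda>X. ennreal w * emeasure A X + ennreal (1 - w) * emeasure B X)"

lemma emeasure_mix_measure:
  assumes "sets A = sets B" "X \<in> sets A"
  shows "emeasure (mix_measure w A B) X = ennreal w * emeasure A X + ennreal (1 - w) * emeasure B X"
proof -
  let ?\<mu> = "\<lambda>X. ennreal w * emeasure A X + ennreal (1 - w) * emeasure B X"
  have "countably_additive (sets A) ?\<mu>"
  proof (rule countably_additiveI)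
    fix F :: "nat \<Rightarrow> 'a set"
    assume F: "range F \<subseteq> sets A" "disjoint_family F"
    have "(\<Sum>i. ?\<mu> (F i)) = ennreal w * (\<Sum>i. emeasure A (F i)) + ennreal (1 - w) * (\<Sum>i. emeasure B (F i))"
      by (simp add: suminf_add[symmetric])
    also have "\<dots> = ?\<mu> (\<Union>i. F i)"
      using F assms(1) by (simp add: suminf_emeasure)
    finally show "(\<Sum>i. ?\<mu> (F i)) = ?\<mu> (\<Union>i. F i)" .
  qed
  moreover have "positive (sets A) ?\<mu>"
    by (simp add: positive_def)
  ultimately show ?thesis
    unfolding mix_measure_def using assms(2) sets.sigma_algebra_axioms
    by (intro emeasure_measure_of_sigma) auto
qed

definition non_atomic :: "'a measure \<Rightarrow> bool" where
  "non_atomic M \<longleftrightarrow> (\<forall>A\<in>sets M. 0 < emeasure M A \<longrightarrow>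
     (\<exists>B\<in>sets M. B \<subseteq> A \<and> 0 < emeasure M B \<and> emeasure M B < emeasure M A))"

subsection \<open>Regular conditional distributions\<close>

text \<open>
  The kernel \<open>K\<close> is a version of the conditional distribution of \<open>X\<close> given \<open>Y\<close> on the event \<open>E\<close>.
  \<open>X\<close> and \<open>Y\<close> need to take their values in \<open>MX\<close> and \<open>MY\<close> only almost surely on \<open>E\<close>
  (for \<open>X\<close> this follows by taking \<open>A = space MX\<close>).
  If \<open>E\<close> ranges over the events \<open>{D = d}\<close> of a discrete variable \<open>D\<close>, and \<open>K\<close> depends on \<open>d\<close>,
  this is conditioning on the pair \<open>(D, Y)\<close>, where the space of values of \<open>Y\<close> may depend on \<open>d\<close>.
\<close>
definition cond_distr_on ::
  "'w measure \<Rightarrow> 'w set \<Rightarrow> ('w \<Rightarrow> 'x) \<Rightarrow> 'x measure \<Rightarrow> ('w \<Rightarrow> 'y) \<Rightarrow> 'y measure \<Rightarrow> ('y \<Rightarrow> 'x measure) \<Rightarrow> bool"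
where
  "cond_distr_on M E X MX Y MY K \<longleftrightarrow>
     K \<in> MY \<rightarrow>\<^sub>M prob_algebra MX \<and>
     (AE \<omega> in M. \<omega> \<in> E \<longrightarrow> Y \<omega> \<in> space MY) \<and>
     (\<forall>B\<in>sets MY. {\<omega>\<in>E. Y \<omega> \<in> B} \<in> sets M) \<and>
     (\<forall>A\<in>sets MX. \<forall>B\<in>sets MY.
        {\<omega>\<in>E. X \<omega> \<in> A \<and> Y \<omega> \<in> B} \<in> sets M \<and>
        emeasure M {\<omega>\<in>E. X \<omega> \<in> A \<and> Y \<omega> \<in> B} =
          (\<integral>\<^sup>+\<omega>. emeasure (K (Y \<omega>)) A * indicator {\<omega>\<in>E. Y \<omega> \<in> B} \<omega> \<partial>M))"

text \<open>Conditional independence of \<open>X\<close> and \<open>Z\<close> given \<open>Y\<close>, on the event \<open>E\<close>.\<close>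
definition cond_indep_on ::
  "'w measure \<Rightarrow> 'w set \<Rightarrow> ('w \<Rightarrow> 'x) \<Rightarrow> 'x measure \<Rightarrow> ('w \<Rightarrow> 'z) \<Rightarrow> 'z measure \<Rightarrow>
   ('w \<Rightarrow> 'y) \<Rightarrow> 'y measure \<Rightarrow> bool"
where
  "cond_indep_on M E X MX Z MZ Y MY \<longleftrightarrow>
     (\<exists>K L. cond_distr_on M E X MX Y MY K \<and> cond_distr_on M E Z MZ Y MY L \<and>
        cond_distr_on M E (\<lambda>\<omega>. (X \<omega>, Z \<omega>)) (MX \<Otimes>\<^sub>M MZ) Y MY (\<lambda>y. K y \<Otimes>\<^sub>M L y))"

subsection \<open>The process\<close>

text \<open>
  Jumps and values of \<open>U\<close> live on \<open>(0, \<infinity>)\<close>, so that the kernels below are probability measures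
  at every point of the conditioning space.
\<close>
abbreviation pos_borel :: "real measure" where
  "pos_borel \<equiv> restrict_space borel {0<..}"

text \<open>The law on \<open>(0, \<infinity>)\<close> whose density is proportional to \<open>g\<close>.\<close>
definition density_propto :: "(real \<Rightarrow> real) \<Rightarrow> real measure" where
  "density_propto g = density (restrict_space lborel {0<..})
     (\<lambda>s. ennreal (g s) / (\<integral>\<^sup>+t. ennreal (g t) \<partial>restrict_space lborel {0<..}))"

definition Lam :: "(real \<Rightarrow> real) \<Rightarrow> real \<Rightarrow> real \<Rightarrow> real" where
  "Lam \<rho> \<kappa> \<epsilon> = \<kappa> * (LINT s:{\<epsilon><..}|lborel. \<rho> s)"

text \<open>\<open>Lam (tilt u \<rho>) \<kappa> \<epsilon>\<close> is \<open>\<Lambda>\<close> with indices \<open>\<epsilon>, u\<close>.\<close>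
definition tilt :: "real \<Rightarrow> (real \<Rightarrow> real) \<Rightarrow> real \<Rightarrow> real" where
  "tilt u \<rho> s = exp (- u * s) * \<rho> s"

definition jump_law :: "(real \<Rightarrow> real) \<Rightarrow> real \<Rightarrow> real \<Rightarrow> real measure" where
  "jump_law \<rho> \<kappa> \<epsilon> = density (restrict_space lborel {0<..})
     (\<lambda>s. ennreal (\<kappa> * \<rho> s / Lam \<rho> \<kappa> \<epsilon> * indicator {\<epsilon><..} s))"

text \<open>
  \<open>N\<close> and the pairs \<open>(J j, \<tau> j)\<close>, \<open>j \<le> N\<close>, generate an \<open>\<epsilon>\<close>-NormCRM; nothing but measurability
  is required of \<open>J j\<close> and \<open>\<tau> j\<close> on \<open>{N < j}\<close>.
\<close>
definition eps_NormCRM ::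
  "'w measure \<Rightarrow> (real \<Rightarrow> real) \<Rightarrow> real \<Rightarrow> 'a measure \<Rightarrow> real \<Rightarrow>
   ('w \<Rightarrow> nat) \<Rightarrow> (nat \<Rightarrow> 'w \<Rightarrow> real) \<Rightarrow> (nat \<Rightarrow> 'w \<Rightarrow> 'a) \<Rightarrow> bool"
where
  "eps_NormCRM M \<rho> \<kappa> P0 \<epsilon> N J \<tau> \<longleftrightarrow>
     N \<in> M \<rightarrow>\<^sub>M count_space UNIV \<and> (\<forall>j. J j \<in> borel_measurable M) \<and> (\<forall>j. \<tau> j \<in> M \<rightarrow>\<^sub>M P0) \<and>
     distr M (count_space UNIV) N = measure_pmf (poisson_pmf (Lam \<rho> \<kappa> \<epsilon>)) \<and>
     (\<forall>m. cond_distr_on M {\<omega>\<in>space M. N \<omega> = m}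
        (\<lambda>\<omega>. \<lambda>j\<in>{..m}. (J j \<omega>, \<tau> j \<omega>)) (Pi\<^sub>M {..m} (\<lambda>_. pos_borel \<Otimes>\<^sub>M P0))
        N (count_space UNIV)
        (\<lambda>_. Pi\<^sub>M {..m} (\<lambda>_. jump_law \<rho> \<kappa> \<epsilon> \<Otimes>\<^sub>M P0)))"

definition crm_measure :: "'a measure \<Rightarrow> ('w \<Rightarrow> nat) \<Rightarrow> (nat \<Rightarrow> 'w \<Rightarrow> real) \<Rightarrow> (nat \<Rightarrow> 'w \<Rightarrow> 'a) \<Rightarrow> 'w \<Rightarrow> 'a measure"
where
  "crm_measure P0 N J \<tau> \<omega> = norm_atoms P0 {..N \<omega>} (\<lambda>j. J j \<omega>) (\<lambda>j. \<tau> j \<omega>)"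

definition crm_total :: "('w \<Rightarrow> nat) \<Rightarrow> (nat \<Rightarrow> 'w \<Rightarrow> real) \<Rightarrow> 'w \<Rightarrow> real" where
  "crm_total N J \<omega> = (\<Sum>j\<le>N \<omega>. J j \<omega>)"

text \<open>
  Given the jumps and locations, \<open>\<theta> 0, \<dots>, \<theta> (n - 1)\<close> are iid from the process.  Conditioning on
  the normalized process alone would leave the joint law of the sample and the total mass,
  hence that of \<open>\<Gamma> / T\<close> and the sample, undetermined.
\<close>
definition crm_sample ::
  "'w measure \<Rightarrow> 'a measure \<Rightarrow> ('w \<Rightarrow> nat) \<Rightarrow> (nat \<Rightarrow> 'w \<Rightarrow> real) \<Rightarrow> (nat \<Rightarrow> 'w \<Rightarrow> 'a) \<Rightarrow>
   nat \<Rightarrow> (nat \<Rightarrow> 'w \<Rightarrow> 'a) \<Rightarrow> bool"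
where
  "crm_sample M P0 N J \<tau> n \<theta> \<longleftrightarrow>
     (\<forall>i<n. \<theta> i \<in> M \<rightarrow>\<^sub>M P0) \<and>
     (\<forall>m. cond_distr_on M {\<omega>\<in>space M. N \<omega> = m}
        (\<lambda>\<omega>. \<lambda>i\<in>{..<n}. \<theta> i \<omega>) (Pi\<^sub>M {..<n} (\<lambda>_. P0))
        (\<lambda>\<omega>. \<lambda>j\<in>{..m}. (J j \<omega>, \<tau> j \<omega>)) (Pi\<^sub>M {..m} (\<lambda>_. pos_borel \<Otimes>\<^sub>M P0))
        (\<lambda>x. Pi\<^sub>M {..<n} (\<lambda>_. norm_atoms P0 {..m} (\<lambda>j. fst (x j)) (\<lambda>j. snd (x j)))))"

subsection \<open>Distinct values, allocated and non-allocated jumps\<close>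

text \<open>The distinct values in order of first appearance (\<^const>\<open>remdups\<close> keeps last occurrences).\<close>
definition distinct_values :: "nat \<Rightarrow> (nat \<Rightarrow> 'w \<Rightarrow> 'a) \<Rightarrow> 'w \<Rightarrow> 'a list" where
  "distinct_values n \<theta> \<omega> = rev (remdups (rev (map (\<lambda>i. \<theta> i \<omega>) [0..<n])))"

definition multiplicity_of :: "nat \<Rightarrow> (nat \<Rightarrow> 'w \<Rightarrow> 'a) \<Rightarrow> nat \<Rightarrow> 'w \<Rightarrow> nat" where
  "multiplicity_of n \<theta> j \<omega> = card {i. i < n \<and> \<theta> i \<omega> = distinct_values n \<theta> \<omega> ! j}"

text \<open>
  \<^const>\<open>Least\<close> only makes the choice definite: for non-atomic \<open>P0\<close> the index is almost surely unique.
\<close>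
definition alloc_index ::
  "('w \<Rightarrow> nat) \<Rightarrow> (nat \<Rightarrow> 'w \<Rightarrow> 'a) \<Rightarrow> nat \<Rightarrow> (nat \<Rightarrow> 'w \<Rightarrow> 'a) \<Rightarrow> nat \<Rightarrow> 'w \<Rightarrow> nat" where
  "alloc_index N \<tau> n \<theta> i \<omega> = (LEAST j. j \<le> N \<omega> \<and> \<tau> j \<omega> = distinct_values n \<theta> \<omega> ! i)"

definition nonalloc_indices ::
  "('w \<Rightarrow> nat) \<Rightarrow> (nat \<Rightarrow> 'w \<Rightarrow> 'a) \<Rightarrow> nat \<Rightarrow> (nat \<Rightarrow> 'w \<Rightarrow> 'a) \<Rightarrow> 'w \<Rightarrow> nat set" where
  "nonalloc_indices N \<tau> n \<theta> \<omega> =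
     {..N \<omega>} - (\<lambda>i. alloc_index N \<tau> n \<theta> i \<omega>) ` {..<length (distinct_values n \<theta> \<omega>)}"

subsection \<open>Posterior laws\<close>

text \<open>The (unnormalized) jumps and locations of an \<open>\<epsilon>\<close>-NormCRM given that it has exactly \<open>r\<close> jumps.\<close>
definition jumps_given :: "(real \<Rightarrow> real) \<Rightarrow> real \<Rightarrow> 'a measure \<Rightarrow> real \<Rightarrow> nat \<Rightarrow> (nat \<Rightarrow> real \<times> 'a) measure" where
  "jumps_given \<rho> \<kappa> P0 \<epsilon> r = Pi\<^sub>M {..<r} (\<lambda>_. jump_law \<rho> \<kappa> \<epsilon> \<Otimes>\<^sub>M P0)"

text \<open>The joint law of the process with exactly \<open>r\<close> jumps and of its total mass.\<close>
definition NormCRM_given ::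
  "(real \<Rightarrow> real) \<Rightarrow> real \<Rightarrow> 'a measure \<Rightarrow> real \<Rightarrow> nat \<Rightarrow> ('a measure \<times> real) measure" where
  "NormCRM_given \<rho> \<kappa> P0 \<epsilon> r =
     distr (jumps_given \<rho> \<kappa> P0 \<epsilon> r) (subprob_algebra P0 \<Otimes>\<^sub>M borel)
       (\<lambda>x. (norm_atoms P0 {..<r} (\<lambda>j. fst (x j)) (\<lambda>j. snd (x j)), \<Sum>j<r. fst (x j)))"

definition shifted_poisson :: "nat \<Rightarrow> real \<Rightarrow> nat pmf" where
  "shifted_poisson i L = map_pmf (\<lambda>x. i + x) (poisson_pmf L)"

definition nonalloc_number_law :: "nat \<Rightarrow> real \<Rightarrow> nat pmf" where
  "nonalloc_number_law k L =
     bind_pmf (bernoulli_pmf (L / (real k + L))) (\<lambda>b. shifted_poisson (if b then 1 else 0) L)"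

definition alloc_jumps_law ::
  "(real \<Rightarrow> real) \<Rightarrow> real \<Rightarrow> nat \<Rightarrow> (nat \<Rightarrow> nat) \<Rightarrow> real \<Rightarrow> (nat \<Rightarrow> real) measure" where
  "alloc_jumps_law \<rho> \<epsilon> k ns u =
     Pi\<^sub>M {..<k} (\<lambda>j. density_propto (\<lambda>s. s ^ ns j * exp (- u * s) * \<rho> s * indicator {\<epsilon><..} s))"

text \<open>\<open>r\<close> non-allocated jumps with sum \<open>T\<close>, allocated jumps with sum \<open>S\<close>.\<close>
definition nonalloc_weight :: "nat \<Rightarrow> real \<Rightarrow> real \<Rightarrow> real" where
  "nonalloc_weight r T S = (if r = 0 then 0 else T / (T + S))"

text \<open>
  The law of the random probability measure described in the posterior characterization,
  at distinct values \<open>t 0, \<dots>, t (k - 1)\<close> with multiplicities \<open>ns\<close> and at \<open>U = u\<close>.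
\<close>
definition posterior_law ::
  "(real \<Rightarrow> real) \<Rightarrow> real \<Rightarrow> 'a measure \<Rightarrow> real \<Rightarrow> nat \<Rightarrow> (nat \<Rightarrow> nat) \<Rightarrow> (nat \<Rightarrow> 'a) \<Rightarrow> real \<Rightarrow> 'a measure measure"
where
  "posterior_law \<rho> \<kappa> P0 \<epsilon> k ns t u =
     measure_pmf (nonalloc_number_law k (Lam (tilt u \<rho>) \<kappa> \<epsilon>)) \<bind> (\<lambda>r.
       distr (jumps_given (tilt u \<rho>) \<kappa> P0 \<epsilon> r \<Otimes>\<^sub>M alloc_jumps_law \<rho> \<epsilon> k ns u) (prob_algebra P0)
         (\<lambda>(x, a). mix_measure (nonalloc_weight r (\<Sum>j<r. fst (x j)) (\<Sum>j<k. a j))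
            (norm_atoms P0 {..<r} (\<lambda>j. fst (x j)) (\<lambda>j. snd (x j)))
            (norm_atoms P0 {..<k} a t)))"

definition U_posterior_density ::
  "(real \<Rightarrow> real) \<Rightarrow> real \<Rightarrow> real \<Rightarrow> nat \<Rightarrow> nat \<Rightarrow> (nat \<Rightarrow> nat) \<Rightarrow> real \<Rightarrow> real" where
  "U_posterior_density \<rho> \<kappa> \<epsilon> n k ns u =
     u ^ (n - 1) * exp (Lam (tilt u \<rho>) \<kappa> \<epsilon> - Lam \<rho> \<kappa> \<epsilon>)
       * ((Lam (tilt u \<rho>) \<kappa> \<epsilon> + real k) / Lam \<rho> \<kappa> \<epsilon>)
       * (\<Prod>i<k. LINT s:{\<epsilon><..}|lborel. \<kappa> * s ^ ns i * exp (- u * s) * \<rho> s)"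

end

theory Submission
  imports Defs
begin

text \<open>
  Given \<open>N = m\<close>, a sample is obtained by choosing for every observation the atom from which it comes.
  As \<open>P0\<close> charges no point, the locations of the atoms are almost surely distinct.  A sample with \<open>k\<close>
  distinct values and multiplicities \<open>ns\<close> is then explained by exactly one pair: an injection
  \<open>l\<close> of \<open>{..<k}\<close> into \<open>{..m}\<close> that selects the allocated atoms, and a pattern \<open>c\<close> that tells which of the
  distinct values observation \<open>i\<close> takes (\<open>sum_patterns\<close>).  Given the jumps, such a pair has
  probability \<open>(\<Prod>j<k. J (l j) ^ ns j) / T ^ n\<close>, where \<open>T\<close> is the sum of all jumps.

  The denominator couples the jumps, and \<open>U = \<Gamma> / T\<close> is designed to remove it.  The substitution
  \<open>\<gamma> = u T\<close> in the gamma density produces \<open>T ^ n * u ^ (n - 1) * exp (- u * T) / (n - 1)!\<close>.  Here \<open>T ^ n\<close>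
  cancels the denominator, and \<open>exp (- u * T)\<close> is a product over the jumps.  So, given \<open>U = u\<close>, the jumps are
  independent again: allocated jump \<open>j\<close> has a density proportional to \<open>s ^ ns j * exp (- u * s)\<close> with
  respect to its prior law, and a non-allocated one to \<open>exp (- u * s)\<close>.  The locations are
  unaffected (\<open>nn_integral_allocated\<close>).

  It remains to sum over \<open>m\<close> and \<open>l\<close>.  Write \<open>\<mu> d u\<close> for the integral of \<open>s ^ d * exp (- u * s)\<close> under the prior
  law of a jump and \<open>\<Lambda>u = \<Lambda> * \<mu> 0 u\<close>.  With \<open>r = m + 1 - k\<close> non-allocated jumps, each pair contributes
  \<open>u ^ (n - 1) / (n - 1)! * (\<Prod>j<k. \<mu> (ns j) u) * \<mu> 0 u ^ r\<close>, to be multiplied by the Poisson weight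
  \<open>exp (- \<Lambda>) * \<Lambda> ^ m / m!\<close>.  There are \<open>(m + 1)! / r!\<close> injections.  Hence the sum over \<open>l\<close> gives, up to factors
  that depend on \<open>u\<close> only, \<open>(r + k) * \<Lambda>u ^ r / r!\<close>.  The summand \<open>r\<close> of \<open>r + k\<close> gives the shifted
  and the summand \<open>k\<close> the unshifted Poisson law, and the sum over \<open>r\<close> is \<open>(\<Lambda>u + k) * exp \<Lambda>u\<close>, which
  explains the density of \<open>U\<close> (\<open>pmf_poisson_injections\<close>, \<open>nn_integral_posterior\<close>).

  If the labels \<open>l\<close> are kept and only \<open>m\<close> is summed, then \<open>l\<close> enters solely through the condition that \<open>m\<close> is
  at least as large as every label.  Given the labels, \<open>N\<close> thus has a Poisson law conditioned on
  this event, while the allocated jumps stay independent of the rest (\<open>nn_integral_labelled\<close>); this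
  is the conditional independence.  The conditional distributions are read off from these formulas
  (\<open>cond_distr_onI_latent\<close>, \<open>cond_distr_U\<close>).  The representation as a mixture holds path by path, by separating the two
  groups of indices (\<open>norm_atoms_disjoint_Un\<close>).

  The underlying probability space need not be complete, and jumps may fail to be positive on a
  null set.  Integrals are therefore computed with corrected variables that are measurable everywhere
  (\<open>pos_atoms\<close>), and the measurability of the original ones on the conditioning event is shown
  separately (\<open>meas_on\<close>).
\<close>

section \<open>Discrete measures\<close>

lemma sets_norm_atoms [simp, measurable_cong]: "sets (norm_atoms S I J \<tau>) = sets S"
  by (simp add: norm_atoms_def)

lemma space_norm_atoms [simp]: "space (norm_atoms S I J \<tau>) = space S"
  by (simp add: norm_atoms_def)

lemma sets_mix_measure [simp]: "sets (mix_measure w A B) = sets A"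
  by (simp add: mix_measure_def)

lemma space_mix_measure [simp]: "space (mix_measure w A B) = space A"
  by (simp add: mix_measure_def)

lemma norm_atoms_reindex:
  assumes "finite R" "bij_betw b R I"
    and "\<And>j. j \<in> R \<Longrightarrow> J' j = J (b j)" "\<And>j. j \<in> R \<Longrightarrow> \<tau>' j = \<tau> (b j)"
    and "\<And>i. i \<in> I \<Longrightarrow> \<tau> i \<in> space S"
  shows "norm_atoms S I J \<tau> = norm_atoms S R J' \<tau>'"
proof (rule measure_eqI)
  fix A assume "A \<in> sets (norm_atoms S I J \<tau>)"
  then have A: "A \<in> sets S" by simp
  have fin: "finite I" using assms(1,2) bij_betw_finite by blast
  have inI: "b j \<in> I" if "j \<in> R" for j using assms(2) that by (auto simp: bij_betw_def)
  have sm: "(\<Sum>i\<in>I. J i) = (\<Sum>j\<in>R. J' j)"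
    by (subst sum.reindex_bij_betw[OF assms(2), symmetric]) (simp add: assms(3))
  have "emeasure (norm_atoms S I J \<tau>) A = (\<Sum>i\<in>I. ennreal (J i / (\<Sum>i\<in>I. J i)) * indicator A (\<tau> i))"
    using fin assms(5) A by (rule emeasure_norm_atoms)
  also have "\<dots> = (\<Sum>j\<in>R. ennreal (J' j / (\<Sum>j\<in>R. J' j)) * indicator A (\<tau>' j))"
    unfolding sm by (subst sum.reindex_bij_betw[OF assms(2), symmetric]) (simp add: assms(3,4))
  also have "\<dots> = emeasure (norm_atoms S R J' \<tau>') A"
    using assms A inI by (intro emeasure_norm_atoms[symmetric]) auto
  finally show "emeasure (norm_atoms S I J \<tau>) A = emeasure (norm_atoms S R J' \<tau>') A" .
qed simp

lemma emeasure_norm_atoms_real: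
  assumes "finite I" "\<And>j. j \<in> I \<Longrightarrow> \<tau> j \<in> space S" "A \<in> sets S" "\<And>j. j \<in> I \<Longrightarrow> 0 < J j"
  shows "emeasure (norm_atoms S I J \<tau>) A = ennreal ((\<Sum>j\<in>I. J j * indicator A (\<tau> j)) / (\<Sum>j\<in>I. J j))"
proof -
  have s0: "0 \<le> (\<Sum>j\<in>I. J j)"
    using assms(4) by (intro sum_nonneg) (auto intro: less_imp_le)
  have "emeasure (norm_atoms S I J \<tau>) A = (\<Sum>j\<in>I. ennreal (J j / (\<Sum>i\<in>I. J i)) * indicator A (\<tau> j))"
    by (rule emeasure_norm_atoms) (use assms in auto)
  also have "\<dots> = (\<Sum>j\<in>I. ennreal (J j / (\<Sum>i\<in>I. J i) * indicator A (\<tau> j)))"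
    by (intro sum.cong refl) (auto simp: indicator_def)
  also have "\<dots> = ennreal (\<Sum>j\<in>I. J j / (\<Sum>i\<in>I. J i) * indicator A (\<tau> j))"
    using s0 assms(4)
    by (intro sum_ennreal) (metis indicator_pos_le less_imp_le mult_nonneg_nonneg divide_nonneg_nonneg)
  also have "(\<Sum>j\<in>I. J j / (\<Sum>i\<in>I. J i) * indicator A (\<tau> j)) = (\<Sum>j\<in>I. J j * indicator A (\<tau> j)) / (\<Sum>j\<in>I. J j)"
    by (simp add: sum_divide_distrib)
  finally show ?thesis .
qed

lemma prob_space_norm_atoms:
  assumes "finite I" "I \<noteq> {}" "\<And>j. j \<in> I \<Longrightarrow> \<tau> j \<in> space S" "\<And>j. j \<in> I \<Longrightarrow> 0 < J j"
  shows "prob_space (norm_atoms S I J \<tau>)"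
proof (rule prob_spaceI)
  have "0 < (\<Sum>j\<in>I. J j)" using assms by (intro sum_pos) auto
  moreover have "(\<Sum>j\<in>I. J j * indicator (space S) (\<tau> j)) = (\<Sum>j\<in>I. J j)"
    using assms by (intro sum.cong) auto
  ultimately show "emeasure (norm_atoms S I J \<tau>) (space (norm_atoms S I J \<tau>)) = 1"
    using assms by (simp add: emeasure_norm_atoms_real)
qed

lemma norm_atoms_empty: "norm_atoms S {} J \<tau> = null_measure S"
  by (rule measure_eqI) (simp, subst emeasure_norm_atoms, simp_all)

text \<open>
  This splits the process into its allocated and non-allocated parts.  The weight is the share of \<open>R\<close>
  in the total mass; it vanishes when \<open>R\<close> is empty, and then the null measure gets weight \<open>0\<close>.
\<close>
lemma norm_atoms_disjoint_Un:
  assumes "finite R" "finite K" "R \<inter> K = {}" "K \<noteq> {}"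
    and \<tau>: "\<And>j. j \<in> R \<union> K \<Longrightarrow> \<tau> j \<in> space S" and J: "\<And>j. j \<in> R \<union> K \<Longrightarrow> 0 < J j"
  shows "norm_atoms S (R \<union> K) J \<tau> =
    mix_measure (sum J R / (sum J R + sum J K)) (norm_atoms S R J \<tau>) (norm_atoms S K J \<tau>)"
proof (rule measure_eqI)
  fix A assume "A \<in> sets (norm_atoms S (R \<union> K) J \<tau>)"
  then have A: "A \<in> sets S" by simp
  define a b where "a = sum J R" and "b = sum J K"
  define p q where "p = (\<Sum>j\<in>R. J j * indicator A (\<tau> j))" and "q = (\<Sum>j\<in>K. J j * indicator A (\<tau> j))"
  have b: "0 < b" unfolding b_def using assms by (intro sum_pos) auto
  have a: "0 \<le> a" unfolding a_def using J by (intro sum_nonneg) (auto intro: less_imp_le)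
  have p: "0 \<le> p" unfolding p_def using J by (intro sum_nonneg mult_nonneg_nonneg) (auto intro: less_imp_le)
  have q: "0 \<le> q" unfolding q_def using J by (intro sum_nonneg mult_nonneg_nonneg) (auto intro: less_imp_le)
  \<comment> \<open>If \<open>a = 0\<close>, then \<open>R\<close> is empty, and the convention \<open>p / 0 = 0\<close> gives the correct value.\<close>
  have p0: "p = 0" if "a = 0"
  proof -
    have "R = {}"
    proof (rule ccontr)
      assume "R \<noteq> {}"
      then have "0 < a" unfolding a_def using assms by (intro sum_pos) auto
      then show False using that by simp
    qed
    then show ?thesis by (simp add: p_def)
  qed
  have "emeasure (norm_atoms S (R \<union> K) J \<tau>) A = ennreal ((p + q) / (a + b))"
  proof -
    have "(\<Sum>j\<in>R \<union> K. J j * indicator A (\<tau> j)) = p + q" "sum J (R \<union> K) = a + b"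
      unfolding p_def q_def a_def b_def using assms(1-3) by (simp_all only: sum.union_disjoint)
    then show ?thesis using assms A by (subst emeasure_norm_atoms_real) auto
  qed
  also have "(p + q) / (a + b) = a / (a + b) * (p / a) + (1 - a / (a + b)) * (q / b)"
  proof -
    have "1 - a / (a + b) = b / (a + b)" using a b by (simp add: field_simps)
    then show ?thesis using a b p0 by (cases "a = 0") (simp_all add: add_divide_distrib)
  qed
  also have "ennreal \<dots> = ennreal (a / (a + b)) * ennreal (p / a) + ennreal (1 - a / (a + b)) * ennreal (q / b)"
    using a b p q by (subst ennreal_plus) (auto simp: ennreal_mult[symmetric] field_simps)
  also have "\<dots> = emeasure (mix_measure (a / (a + b)) (norm_atoms S R J \<tau>) (norm_atoms S K J \<tau>)) A"
  proof -
    have "emeasure (norm_atoms S R J \<tau>) A = ennreal (p / a)" "emeasure (norm_atoms S K J \<tau>) A = ennreal (q / b)"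
      using assms A by (auto simp: emeasure_norm_atoms_real p_def q_def a_def b_def)
    then show ?thesis using A by (subst emeasure_mix_measure) auto
  qed
  finally show "emeasure (norm_atoms S (R \<union> K) J \<tau>) A =
    emeasure (mix_measure (sum J R / (sum J R + sum J K)) (norm_atoms S R J \<tau>) (norm_atoms S K J \<tau>)) A"
    by (simp add: a_def b_def)
qed simp

lemma measurable_emeasure_norm_atoms:
  assumes [measurable]: "finite I" "\<And>j. j \<in> I \<Longrightarrow> J j \<in> borel_measurable M"
    "\<And>j. j \<in> I \<Longrightarrow> \<tau> j \<in> M \<rightarrow>\<^sub>M S" "A \<in> sets S"
  shows "(\<lambda>\<omega>. emeasure (norm_atoms S I (\<lambda>j. J j \<omega>) (\<lambda>j. \<tau> j \<omega>)) A) \<in> borel_measurable M"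
proof -
  have "(\<lambda>\<omega>. \<Sum>j\<in>I. ennreal (J j \<omega> / (\<Sum>i\<in>I. J i \<omega>)) * indicator A (\<tau> j \<omega>)) \<in> borel_measurable M"
    by measurable
  then show ?thesis
    by (rule measurable_cong[THEN iffD1, rotated], intro emeasure_norm_atoms[symmetric])
       (use assms(1,4) measurable_space[OF assms(3)] in auto)
qed

lemma measurable_norm_atoms_prob:
  assumes "finite I" "I \<noteq> {}" "\<And>j. j \<in> I \<Longrightarrow> J j \<in> borel_measurable M"
    "\<And>j. j \<in> I \<Longrightarrow> \<tau> j \<in> M \<rightarrow>\<^sub>M S" "\<And>j \<omega>. j \<in> I \<Longrightarrow> \<omega> \<in> space M \<Longrightarrow> 0 < J j \<omega>"
  shows "(\<lambda>\<omega>. norm_atoms S I (\<lambda>j. J j \<omega>) (\<lambda>j. \<tau> j \<omega>)) \<in> M \<rightarrow>\<^sub>M prob_algebra S"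
proof (rule measurable_prob_algebraI)
  show pr: "prob_space (norm_atoms S I (\<lambda>j. J j \<omega>) (\<lambda>j. \<tau> j \<omega>))" if "\<omega> \<in> space M" for \<omega>
    using assms that by (intro prob_space_norm_atoms) (auto dest: measurable_space)
  show "(\<lambda>\<omega>. norm_atoms S I (\<lambda>j. J j \<omega>) (\<lambda>j. \<tau> j \<omega>)) \<in> M \<rightarrow>\<^sub>M subprob_algebra S"
    using assms by (intro measurable_subprob_algebra measurable_emeasure_norm_atoms prob_space_imp_subprob_space pr) auto
qed

text \<open>
  The target is the space of subprobability measures because an empty set of atoms gives the null measure.
\<close>
lemma measurable_norm_atoms_subprob:
  assumes "finite I" "space S \<noteq> {}" "\<And>j. j \<in> I \<Longrightarrow> J j \<in> borel_measurable M"
    "\<And>j. j \<in> I \<Longrightarrow> \<tau> j \<in> M \<rightarrow>\<^sub>M S" "\<And>j \<omega>. j \<in> I \<Longrightarrow> \<omega> \<in> space M \<Longrightarrow> 0 < J j \<omega>"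
  shows "(\<lambda>\<omega>. norm_atoms S I (\<lambda>j. J j \<omega>) (\<lambda>j. \<tau> j \<omega>)) \<in> M \<rightarrow>\<^sub>M subprob_algebra S"
proof (cases "I = {}")
  case True
  then show ?thesis using assms(2) by (simp add: norm_atoms_empty)
next
  case False
  then show ?thesis using assms by (intro measurable_prob_algebraD measurable_norm_atoms_prob) auto
qed

text \<open>
  The first component may be the null measure where its weight is \<open>0\<close>; elsewhere it must have mass \<open>1\<close>
  for the mixture to be a probability measure.
\<close>
lemma measurable_mix_measure:
  assumes w: "w \<in> borel_measurable M" "\<And>\<omega>. \<omega> \<in> space M \<Longrightarrow> 0 \<le> w \<omega> \<and> w \<omega> \<le> 1"
    and A: "A \<in> M \<rightarrow>\<^sub>M subprob_algebra S" and B: "B \<in> M \<rightarrow>\<^sub>M prob_algebra S"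
    and prob: "\<And>\<omega>. \<omega> \<in> space M \<Longrightarrow> w \<omega> \<noteq> 0 \<Longrightarrow> prob_space (A \<omega>)"
  shows "(\<lambda>\<omega>. mix_measure (w \<omega>) (A \<omega>) (B \<omega>)) \<in> M \<rightarrow>\<^sub>M prob_algebra S"
proof (rule measurable_prob_algebraI)
  note [measurable] = w(1) A measurable_prob_algebraD[OF B]
  have sA: "sets (A \<omega>) = sets S" "space (A \<omega>) = space S" if "\<omega> \<in> space M" for \<omega>
    using subprob_measurableD[OF A that] by auto
  have sB: "sets (B \<omega>) = sets S" "space (B \<omega>) = space S" if "\<omega> \<in> space M" for \<omega>
    using subprob_measurableD[OF measurable_prob_algebraD[OF B] that] by auto
  have eq: "emeasure (mix_measure (w \<omega>) (A \<omega>) (B \<omega>)) X =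
      ennreal (w \<omega>) * emeasure (A \<omega>) X + ennreal (1 - w \<omega>) * emeasure (B \<omega>) X"
    if "\<omega> \<in> space M" "X \<in> sets S" for \<omega> X
    using that sA sB by (intro emeasure_mix_measure) auto
  show pr: "prob_space (mix_measure (w \<omega>) (A \<omega>) (B \<omega>))" if \<omega>: "\<omega> \<in> space M" for \<omega>
  proof (rule prob_spaceI)
    have "prob_space (B \<omega>)" using measurable_space[OF B \<omega>] by (simp add: space_prob_algebra)
    then have B1: "emeasure (B \<omega>) (space S) = 1"
      using prob_space.emeasure_space_1 sB(2)[OF \<omega>] by metis
    have A1: "ennreal (w \<omega>) * emeasure (A \<omega>) (space S) = ennreal (w \<omega>)"
      using prob_space.emeasure_space_1[OF prob[OF \<omega>]] sA(2)[OF \<omega>] by (cases "w \<omega> = 0") auto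
    show "emeasure (mix_measure (w \<omega>) (A \<omega>) (B \<omega>)) (space (mix_measure (w \<omega>) (A \<omega>) (B \<omega>))) = 1"
      using w(2)[OF \<omega>] by (simp add: eq \<omega> sA(2) A1 B1 ennreal_plus[symmetric] del: ennreal_plus)
  qed
  show "(\<lambda>\<omega>. mix_measure (w \<omega>) (A \<omega>) (B \<omega>)) \<in> M \<rightarrow>\<^sub>M subprob_algebra S"
  proof (rule measurable_subprob_algebra)
    show "subprob_space (mix_measure (w a) (A a) (B a))" if "a \<in> space M" for a
      using pr[OF that] by (rule prob_space_imp_subprob_space)
    show "sets (mix_measure (w a) (A a) (B a)) = sets S" if "a \<in> space M" for a
      using sA that by simp
    fix X assume [measurable]: "X \<in> sets S"
    have "(\<lambda>\<omega>. ennreal (w \<omega>) * emeasure (A \<omega>) X + ennreal (1 - w \<omega>) * emeasure (B \<omega>) X) \<in> borel_measurable M"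
      by measurable
    then show "(\<lambda>a. emeasure (mix_measure (w a) (A a) (B a)) X) \<in> borel_measurable M"
      by (rule measurable_cong[THEN iffD1, rotated]) (simp add: eq)
  qed
qed

section \<open>Disintegration along a kernel\<close>

text \<open>
  The definition of a conditional distribution speaks of rectangles only, and rectangles determine a
  finite measure on a product.  Hence the kernel integrates every jointly measurable function.
  \<open>X\<close> and \<open>Y\<close> are replaced by versions \<open>X'\<close> and \<open>Y'\<close> that are measurable on the whole space:
  \<open>X\<close> and \<open>Y\<close> may leave their spaces of values on a null set.
\<close>
lemma nn_integral_cond_distr_on:
  assumes "prob_space M" and E [measurable]: "E \<in> sets M"
    and c: "cond_distr_on M E X MX Y MY K"
    and X' [measurable]: "X' \<in> M \<rightarrow>\<^sub>M MX" and Y' [measurable]: "Y' \<in> M \<rightarrow>\<^sub>M MY"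
    and eqX: "AE \<omega> in M. \<omega> \<in> E \<longrightarrow> X \<omega> = X' \<omega>" and eqY: "AE \<omega> in M. \<omega> \<in> E \<longrightarrow> Y \<omega> = Y' \<omega>"
    and g [measurable]: "g \<in> borel_measurable (MX \<Otimes>\<^sub>M MY)"
  shows "(\<integral>\<^sup>+\<omega>. indicator E \<omega> * g (X' \<omega>, Y' \<omega>) \<partial>M) =
    (\<integral>\<^sup>+\<omega>. indicator E \<omega> * (\<integral>\<^sup>+x. g (x, Y' \<omega>) \<partial>K (Y' \<omega>)) \<partial>M)"
proof -
  interpret prob_space M by fact
  have K: "K \<in> MY \<rightarrow>\<^sub>M prob_algebra MX" using c by (simp add: cond_distr_on_def)
  note K' [measurable] = measurable_prob_algebraD[OF K]
  have KY [measurable]: "(\<lambda>\<omega>. K (Y' \<omega>)) \<in> M \<rightarrow>\<^sub>M subprob_algebra MX" by measurable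
  \<comment> \<open>\<open>\<mu>1\<close> and \<open>\<mu>2\<close> are the two measures against which \<open>g\<close> is integrated.\<close>
  define ME where "ME = density M (indicator E)"
  define \<mu>1 where "\<mu>1 = distr ME (MX \<Otimes>\<^sub>M MY) (\<lambda>\<omega>. (X' \<omega>, Y' \<omega>))"
  define \<mu>2 where "\<mu>2 = ME \<bind> (\<lambda>\<omega>. distr (K (Y' \<omega>)) (MX \<Otimes>\<^sub>M MY) (\<lambda>x. (x, Y' \<omega>)))"
  have sME [simp, measurable_cong]: "sets ME = sets M" and spME: "space ME = space M" by (simp_all add: ME_def)
  have kern: "(\<lambda>\<omega>. distr (K (Y' \<omega>)) (MX \<Otimes>\<^sub>M MY) (\<lambda>x. (x, Y' \<omega>))) \<in> ME \<rightarrow>\<^sub>M subprob_algebra (MX \<Otimes>\<^sub>M MY)"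
  proof -
    have "(\<lambda>\<omega>. distr (K (Y' \<omega>)) (MX \<Otimes>\<^sub>M MY) (\<lambda>x. (x, Y' \<omega>))) \<in> M \<rightarrow>\<^sub>M subprob_algebra (MX \<Otimes>\<^sub>M MY)"
      by (rule measurable_distr2[where M=MX]) measurable
    then show ?thesis by (simp cong: measurable_cong_sets)
  qed
  have i2: "(\<integral>\<^sup>+z. f z \<partial>\<mu>2) = (\<integral>\<^sup>+\<omega>. indicator E \<omega> * (\<integral>\<^sup>+x. f (x, Y' \<omega>) \<partial>K (Y' \<omega>)) \<partial>M)"
    if [measurable]: "f \<in> borel_measurable (MX \<Otimes>\<^sub>M MY)" for f
  proof -
    have "(\<integral>\<^sup>+z. f z \<partial>\<mu>2) = (\<integral>\<^sup>+\<omega>. (\<integral>\<^sup>+z. f z \<partial>distr (K (Y' \<omega>)) (MX \<Otimes>\<^sub>M MY) (\<lambda>x. (x, Y' \<omega>))) \<partial>ME)"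
      unfolding \<mu>2_def by (rule nn_integral_bind[OF _ kern]) measurable
    also have "\<dots> = (\<integral>\<^sup>+\<omega>. (\<integral>\<^sup>+x. f (x, Y' \<omega>) \<partial>K (Y' \<omega>)) \<partial>ME)"
    proof (intro nn_integral_cong)
      fix \<omega> assume "\<omega> \<in> space ME"
      then have w: "\<omega> \<in> space M" by (simp add: spME)
      have [measurable_cong]: "sets (K (Y' \<omega>)) = sets MX"
        using subprob_measurableD(2)[OF KY w] .
      have "(\<lambda>x. (x, Y' \<omega>)) \<in> K (Y' \<omega>) \<rightarrow>\<^sub>M MX \<Otimes>\<^sub>M MY"
        using measurable_space[OF Y' w] \<open>sets (K (Y' \<omega>)) = sets MX\<close>
        by (intro measurable_Pair measurable_ident_sets measurable_const) auto
      then show "(\<integral>\<^sup>+z. f z \<partial>distr (K (Y' \<omega>)) (MX \<Otimes>\<^sub>M MY) (\<lambda>x. (x, Y' \<omega>))) = (\<integral>\<^sup>+x. f (x, Y' \<omega>) \<partial>K (Y' \<omega>))"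
        by (subst nn_integral_distr) auto
    qed
    also have "\<dots> = (\<integral>\<^sup>+\<omega>. indicator E \<omega> * (\<integral>\<^sup>+x. f (x, Y' \<omega>) \<partial>K (Y' \<omega>)) \<partial>M)"
    proof -
      have "(\<lambda>\<omega>. \<integral>\<^sup>+x. f (x, Y' \<omega>) \<partial>K (Y' \<omega>)) \<in> borel_measurable M"
        by (rule nn_integral_measurable_subprob_algebra2[where N=MX]) measurable
      then show ?thesis unfolding ME_def by (subst nn_integral_density) auto
    qed
    finally show ?thesis .
  qed
  have i1: "(\<integral>\<^sup>+z. f z \<partial>\<mu>1) = (\<integral>\<^sup>+\<omega>. indicator E \<omega> * f (X' \<omega>, Y' \<omega>) \<partial>M)"
    if [measurable]: "f \<in> borel_measurable (MX \<Otimes>\<^sub>M MY)" for f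
    unfolding \<mu>1_def ME_def by (simp add: nn_integral_distr nn_integral_density)
  have eq: "\<mu>1 = \<mu>2"
  proof (rule measure_eqI_generator_eq[OF Int_stable_pair_measure_generator[of MX MY],
        where \<Omega>="space MX \<times> space MY" and A="\<lambda>_. space MX \<times> space MY"])
    show "{a \<times> b |a b. a \<in> sets MX \<and> b \<in> sets MY} \<subseteq> Pow (space MX \<times> space MY)"
      by (rule pair_measure_closed)
    show "sets \<mu>1 = sigma_sets (space MX \<times> space MY) {a \<times> b |a b. a \<in> sets MX \<and> b \<in> sets MY}"
      by (simp add: \<mu>1_def sets_pair_measure)
    have "sets \<mu>2 = sets (MX \<Otimes>\<^sub>M MY)"
      unfolding \<mu>2_def by (rule sets_bind) (auto simp: spME not_empty)
    then show "sets \<mu>2 = sigma_sets (space MX \<times> space MY) {a \<times> b |a b. a \<in> sets MX \<and> b \<in> sets MY}"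
      by (simp add: sets_pair_measure)
    have m2 [measurable_cong]: "sets \<mu>2 = sets (MX \<Otimes>\<^sub>M MY)" by fact
    show "emeasure \<mu>1 (space MX \<times> space MY) \<noteq> \<infinity>" 
    proof -
      have "emeasure \<mu>1 (space MX \<times> space MY) = (\<integral>\<^sup>+z. indicator (space MX \<times> space MY) z \<partial>\<mu>1)"
        by (subst nn_integral_indicator) (simp_all add: \<mu>1_def sets.top)
      also have "\<dots> = (\<integral>\<^sup>+\<omega>. indicator E \<omega> * indicator (space MX \<times> space MY) (X' \<omega>, Y' \<omega>) \<partial>M)"
        by (rule i1) measurable
      also have "\<dots> \<le> (\<integral>\<^sup>+\<omega>. 1 \<partial>M)"
        by (intro nn_integral_mono) (simp split: split_indicator)
      finally have "emeasure \<mu>1 (space MX \<times> space MY) \<le> 1" by (simp add: emeasure_space_1)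
      then show ?thesis by (metis ennreal_one_less_top infinity_ennreal_def leD)
    qed
    fix Z assume "Z \<in> {a \<times> b |a b. a \<in> sets MX \<and> b \<in> sets MY}"
    then obtain A B where Z: "Z = A \<times> B" and [measurable]: "A \<in> sets MX" "B \<in> sets MY" by auto
    have "emeasure \<mu>1 Z = (\<integral>\<^sup>+\<omega>. indicator E \<omega> * indicator Z (X' \<omega>, Y' \<omega>) \<partial>M)"
      by (subst i1[symmetric]) (auto simp: Z \<mu>1_def)
    also have "\<dots> = (\<integral>\<^sup>+\<omega>. indicator {\<omega>\<in>E. X \<omega> \<in> A \<and> Y \<omega> \<in> B} \<omega> \<partial>M)"
      using eqX eqY by (intro nn_integral_cong_AE) (auto simp: Z indicator_def)
    also have "\<dots> = emeasure M {\<omega>\<in>E. X \<omega> \<in> A \<and> Y \<omega> \<in> B}"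
      using c by (intro nn_integral_indicator) (simp add: cond_distr_on_def)
    also have "\<dots> = (\<integral>\<^sup>+\<omega>. emeasure (K (Y \<omega>)) A * indicator {\<omega>\<in>E. Y \<omega> \<in> B} \<omega> \<partial>M)"
      using c by (simp add: cond_distr_on_def)
    also have "\<dots> = (\<integral>\<^sup>+\<omega>. indicator E \<omega> * (\<integral>\<^sup>+x. indicator Z (x, Y' \<omega>) \<partial>K (Y' \<omega>)) \<partial>M)"
    proof (rule nn_integral_cong_AE, rule AE_mp[OF eqY], rule AE_I2, rule impI)
      fix \<omega> assume a: "\<omega> \<in> E \<longrightarrow> Y \<omega> = Y' \<omega>" 
      show "emeasure (K (Y \<omega>)) A * indicator {\<omega> \<in> E. Y \<omega> \<in> B} \<omega> = indicator E \<omega> * (\<integral>\<^sup>+ x. indicator Z (x, Y' \<omega>) \<partial>K (Y' \<omega>))"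
      proof (cases "\<omega> \<in> E")
        case True
        then have w: "\<omega> \<in> space M" using sets.sets_into_space[OF E] by auto
        have s: "A \<in> sets (K (Y' \<omega>))" using subprob_measurableD(2)[OF KY w] by simp
        have "(\<integral>\<^sup>+ x. indicator Z (x, Y' \<omega>) \<partial>K (Y' \<omega>)) = (\<integral>\<^sup>+ x. indicator A x * indicator B (Y' \<omega>) \<partial>K (Y' \<omega>))"
          by (simp add: Z indicator_times)
        also have "\<dots> = emeasure (K (Y' \<omega>)) A * indicator B (Y' \<omega>)"
          using s by (subst nn_integral_multc) auto
        finally show ?thesis using True a by (simp add: indicator_def)
      qed simp
    qed
    also have "\<dots> = emeasure \<mu>2 Z"
      by (subst i2[symmetric]) (auto simp: Z m2)
    finally show "emeasure \<mu>1 Z = emeasure \<mu>2 Z" .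
  qed auto
  show ?thesis using i1[OF g] i2[OF g] eq by simp
qed

section \<open>Product measures and an Erlang integral\<close>

lemma PiM_density:
  assumes "finite I" and M: "\<And>i. prob_space (M i)" "\<And>i. prob_space (density (M i) (f i))"
    and f [measurable]: "\<And>i. f i \<in> borel_measurable (M i)"
  shows "Pi\<^sub>M I (\<lambda>i. density (M i) (f i)) = density (Pi\<^sub>M I M) (\<lambda>x. \<Prod>i\<in>I. f i (x i))"
proof -
  let ?P = "Pi\<^sub>M I M"
  interpret M: product_prob_space M by (rule product_prob_spaceI) (use M in auto)
  interpret D: product_prob_space "\<lambda>i. density (M i) (f i)" by (rule product_prob_spaceI) (use M in auto)
  show ?thesis
  proof (rule D.PiM_eqI[symmetric])
    show "sets (density (?P) (\<lambda>x. \<Prod>i\<in>I. f i (x i))) = sets (Pi\<^sub>M I (\<lambda>i. density (M i) (f i)))"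
      by (simp cong: sets_PiM_cong)
    fix A assume "\<And>i. i \<in> I \<Longrightarrow> A i \<in> sets (density (M i) (f i))"
    then have A [measurable]: "\<And>i. i \<in> I \<Longrightarrow> A i \<in> sets (M i)" by simp
    have "emeasure (density (?P) (\<lambda>x. \<Prod>i\<in>I. f i (x i))) (Pi\<^sub>E I A) =
      (\<integral>\<^sup>+x. (\<Prod>i\<in>I. f i (x i)) * indicator (Pi\<^sub>E I A) x \<partial>?P)"
      using \<open>finite I\<close> by (intro emeasure_density) (auto intro!: sets_PiM_I_finite)
    also have "\<dots> = (\<integral>\<^sup>+x. (\<Prod>i\<in>I. f i (x i) * indicator (A i) (x i)) \<partial>?P)"
    proof (intro nn_integral_cong)
      fix x assume "x \<in> space (?P)"
      then have "(indicator (Pi\<^sub>E I A) x :: ennreal) = (\<Prod>i\<in>I. indicator (A i) (x i))"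
        using \<open>finite I\<close> by (auto simp: indicator_def space_PiM PiE_iff)
      then show "(\<Prod>i\<in>I. f i (x i)) * indicator (Pi\<^sub>E I A) x = (\<Prod>i\<in>I. f i (x i) * indicator (A i) (x i))"
        by (simp only: prod.distrib)
    qed
    also have "\<dots> = (\<Prod>i\<in>I. \<integral>\<^sup>+x. f i x * indicator (A i) x \<partial>M i)"
      using \<open>finite I\<close> by (intro M.product_nn_integral_prod) auto
    also have "\<dots> = (\<Prod>i\<in>I. emeasure (density (M i) (f i)) (A i))"
      by (intro prod.cong refl emeasure_density[symmetric]) auto
    finally show "emeasure (density (?P) (\<lambda>x. \<Prod>i\<in>I. f i (x i))) (Pi\<^sub>E I A) =
      (\<Prod>i\<in>I. emeasure (density (M i) (f i)) (A i))" .
  qed fact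
qed

text \<open>
  Two disjoint subfamilies of a finite iid family are independent iid families, whichever way their
  indices are listed.  This separates the allocated atoms (listed by \<open>l\<close>) from the others
  (listed by \<open>b\<close>).
\<close>
lemma nn_integral_PiM_split:
  fixes N :: "'n measure" and l :: "'k \<Rightarrow> 'i" and b :: "'r \<Rightarrow> 'i"
  assumes N: "prob_space N" and "finite I"
    and l: "inj_on l K" and b: "inj_on b R" and I: "l ` K \<union> b ` R = I" "l ` K \<inter> b ` R = {}"
    and H [measurable]: "H \<in> borel_measurable (Pi\<^sub>M K (\<lambda>_. N) \<Otimes>\<^sub>M Pi\<^sub>M R (\<lambda>_. N))"
  shows "(\<integral>\<^sup>+x. H (\<lambda>i\<in>K. x (l i), \<lambda>j\<in>R. x (b j)) \<partial>Pi\<^sub>M I (\<lambda>_. N)) =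
    (\<integral>\<^sup>+a. \<integral>\<^sup>+y. H (a, y) \<partial>Pi\<^sub>M R (\<lambda>_. N) \<partial>Pi\<^sub>M K (\<lambda>_. N))"
proof -
  let ?K = "Pi\<^sub>M K (\<lambda>_. N)"
  let ?R = "Pi\<^sub>M R (\<lambda>_. N)"
  let ?I = "Pi\<^sub>M I (\<lambda>_. N)"
  interpret P: product_sigma_finite "\<lambda>_ :: 'i. N"
    by (rule product_sigma_finite.intro, rule prob_space_imp_sigma_finite) (rule N)
  interpret PK: product_sigma_finite "\<lambda>_ :: 'k. N"
    by (rule product_sigma_finite.intro, rule prob_space_imp_sigma_finite) (rule N)
  interpret PR: product_sigma_finite "\<lambda>_ :: 'r. N"
    by (rule product_sigma_finite.intro, rule prob_space_imp_sigma_finite) (rule N)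
  interpret R: prob_space "?R" by (rule prob_space_PiM) (rule N)
  interpret K: prob_space "?K" by (rule prob_space_PiM) (rule N)
  have fin: "finite K" "finite R"
    using \<open>finite I\<close> I l b by (metis finite_Un finite_imageD)+
  \<comment> \<open>\<open>\<phi>\<close> merges the two families; it maps the product law to the law of the whole family, since both
    agree on boxes.\<close>
  define \<phi> where "\<phi> = (\<lambda>(a :: 'k \<Rightarrow> 'n, y :: 'r \<Rightarrow> 'n). \<lambda>i\<in>I. if i \<in> l ` K then a (inv_into K l i) else y (inv_into R b i))"
  have inv: "inv_into K l i \<in> K" if "i \<in> l ` K" for i using that by (rule inv_into_into)
  have inv': "inv_into R b i \<in> R" if "i \<in> I" "i \<notin> l ` K" for i using that I by (auto intro: inv_into_into)
  have \<phi> [measurable]: "\<phi> \<in> ?K \<Otimes>\<^sub>M ?R \<rightarrow>\<^sub>M ?I"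
    unfolding \<phi>_def split_beta'
  proof (rule measurable_restrict)
    fix i assume i: "i \<in> I"
    show "(\<lambda>x. if i \<in> l ` K then fst x (inv_into K l i) else snd x (inv_into R b i))
       \<in> ?K \<Otimes>\<^sub>M ?R \<rightarrow>\<^sub>M N"
      using inv[of i] inv'[OF i] by (cases "i \<in> l ` K") auto
  qed
  have \<phi>l: "\<phi> (a, y) (l k) = a k" if "k \<in> K" for a y k
    using that I l by (auto simp: \<phi>_def)
  have \<phi>b: "\<phi> (a, y) (b j) = y j" if "j \<in> R" for a y j
  proof -
    have "b j \<notin> l ` K" using that I by auto
    then show ?thesis using that I b by (auto simp: \<phi>_def)
  qed
  have "distr (?K \<Otimes>\<^sub>M ?R) (?I) \<phi> = ?I"
  proof (rule P.PiM_eqI)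
    fix A assume A: "\<And>i. i \<in> I \<Longrightarrow> A i \<in> sets N"
    have AK: "Pi\<^sub>E K (\<lambda>k. A (l k)) \<in> sets (?K)" and AR: "Pi\<^sub>E R (\<lambda>j. A (b j)) \<in> sets (?R)"
      using fin A I by (auto intro!: sets_PiM_I_finite)
    have AI: "Pi\<^sub>E I A \<in> sets (?I)" using \<open>finite I\<close> A by (intro sets_PiM_I_finite) auto
    have pre: "\<phi> -` Pi\<^sub>E I A \<inter> space (?K \<Otimes>\<^sub>M ?R) =
      Pi\<^sub>E K (\<lambda>k. A (l k)) \<times> Pi\<^sub>E R (\<lambda>j. A (b j))"
    proof (intro set_eqI iffI)
      fix z assume z: "z \<in> \<phi> -` Pi\<^sub>E I A \<inter> space (?K \<Otimes>\<^sub>M ?R)"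
      obtain a y where [simp]: "z = (a, y)" by (cases z)
      have \<phi>A: "\<phi> (a, y) i \<in> A i" if "i \<in> I" for i using z that by (auto simp: PiE_iff)
      have "a k \<in> A (l k)" if "k \<in> K" for k using \<phi>A[of "l k"] \<phi>l[OF that] that I by auto
      moreover have "y j \<in> A (b j)" if "j \<in> R" for j using \<phi>A[of "b j"] \<phi>b[OF that] that I by auto
      ultimately show "z \<in> Pi\<^sub>E K (\<lambda>k. A (l k)) \<times> Pi\<^sub>E R (\<lambda>j. A (b j))"
        using z by (auto simp: space_pair_measure space_PiM PiE_iff)
    next
      fix z assume z: "z \<in> Pi\<^sub>E K (\<lambda>k. A (l k)) \<times> Pi\<^sub>E R (\<lambda>j. A (b j))"
      obtain a y where [simp]: "z = (a, y)" by (cases z)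
      have sp: "z \<in> space (?K \<Otimes>\<^sub>M ?R)"
        using z sets.sets_into_space[OF AK] sets.sets_into_space[OF AR] by (auto simp: space_pair_measure)
      have "\<phi> z i \<in> A i" if "i \<in> I" for i
      proof -
        from that I consider k where "k \<in> K" "i = l k" | j where "j \<in> R" "i = b j" by blast
        then show ?thesis using z \<phi>l \<phi>b by cases (auto simp: PiE_iff)
      qed
      moreover have "\<phi> z \<in> extensional I" by (simp add: \<phi>_def)
      ultimately show "z \<in> \<phi> -` Pi\<^sub>E I A \<inter> space (?K \<Otimes>\<^sub>M ?R)"
        using sp by (auto simp: PiE_iff)
    qed
    have "emeasure (distr (?K \<Otimes>\<^sub>M ?R) (?I) \<phi>) (Pi\<^sub>E I A) =
      emeasure (?K) (Pi\<^sub>E K (\<lambda>k. A (l k))) * emeasure (?R) (Pi\<^sub>E R (\<lambda>j. A (b j)))"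
      using AK AR AI by (simp add: emeasure_distr pre R.emeasure_pair_measure_Times)
    also have "\<dots> = (\<Prod>k\<in>K. emeasure N (A (l k))) * (\<Prod>j\<in>R. emeasure N (A (b j)))"
      using fin A I by (auto simp: PK.emeasure_PiM PR.emeasure_PiM)
    also have "\<dots> = (\<Prod>i\<in>l ` K. emeasure N (A i)) * (\<Prod>i\<in>b ` R. emeasure N (A i))"
      using l b by (simp add: prod.reindex)
    also have "\<dots> = (\<Prod>i\<in>I. emeasure N (A i))"
      unfolding I(1)[symmetric] using fin I by (intro prod.union_disjoint[symmetric]) auto
    finally show "emeasure (distr (?K \<Otimes>\<^sub>M ?R) (?I) \<phi>) (Pi\<^sub>E I A) =
      (\<Prod>i\<in>I. emeasure N (A i))" .
  qed (use \<open>finite I\<close> in auto)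
  then have "(\<integral>\<^sup>+x. H (\<lambda>i\<in>K. x (l i), \<lambda>j\<in>R. x (b j)) \<partial>?I) =
    (\<integral>\<^sup>+x. H (\<lambda>i\<in>K. x (l i), \<lambda>j\<in>R. x (b j)) \<partial>distr (?K \<Otimes>\<^sub>M ?R) (?I) \<phi>)"
    by simp
  also have "\<dots> = (\<integral>\<^sup>+z. H (\<lambda>i\<in>K. \<phi> z (l i), \<lambda>j\<in>R. \<phi> z (b j)) \<partial>(?K \<Otimes>\<^sub>M ?R))"
  proof (rule nn_integral_distr[OF \<phi>])
    have "(\<lambda>x. (\<lambda>i\<in>K. x (l i), \<lambda>j\<in>R. x (b j))) \<in> ?I \<rightarrow>\<^sub>M ?K \<Otimes>\<^sub>M ?R"
      using I by (intro measurable_Pair measurable_restrict measurable_component_singleton) auto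
    from measurable_compose[OF this H]
    show "(\<lambda>x. H (\<lambda>i\<in>K. x (l i), \<lambda>j\<in>R. x (b j))) \<in> borel_measurable (distr (?K \<Otimes>\<^sub>M ?R) (?I) \<phi>)"
      by simp
  qed
  also have "\<dots> = (\<integral>\<^sup>+z. H z \<partial>(?K \<Otimes>\<^sub>M ?R))"
  proof (intro nn_integral_cong)
    fix z assume "z \<in> space (?K \<Otimes>\<^sub>M ?R)"
    then obtain a y where z: "z = (a, y)" "a \<in> extensional K" "y \<in> extensional R"
      by (auto simp: space_pair_measure space_PiM PiE_iff)
    have "(\<lambda>i\<in>K. \<phi> z (l i)) = a" "(\<lambda>j\<in>R. \<phi> z (b j)) = y"
      using z by (auto simp: \<phi>l \<phi>b extensional_def restrict_def fun_eq_iff)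
    then show "H (\<lambda>i\<in>K. \<phi> z (l i), \<lambda>j\<in>R. \<phi> z (b j)) = H z" using z by simp
  qed
  also have "\<dots> = (\<integral>\<^sup>+a. \<integral>\<^sup>+y. H (a, y) \<partial>?R \<partial>?K)"
    by (rule R.nn_integral_fst[symmetric]) measurable
  finally show ?thesis .
qed

lemma nn_integral_PiM_unzip:
  fixes A :: "'a measure" and B :: "'b measure" and K :: "'k set"
  assumes A: "prob_space A" and B: "prob_space B" and "finite K"
    and H [measurable]: "H \<in> borel_measurable (Pi\<^sub>M K (\<lambda>_. A) \<Otimes>\<^sub>M Pi\<^sub>M K (\<lambda>_. B))"
  shows "(\<integral>\<^sup>+x. H (\<lambda>i\<in>K. fst (x i), \<lambda>i\<in>K. snd (x i)) \<partial>Pi\<^sub>M K (\<lambda>_. A \<Otimes>\<^sub>M B)) =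
    (\<integral>\<^sup>+a. \<integral>\<^sup>+t. H (a, t) \<partial>Pi\<^sub>M K (\<lambda>_. B) \<partial>Pi\<^sub>M K (\<lambda>_. A))"
proof -
  let ?A = "Pi\<^sub>M K (\<lambda>_. A)"
  let ?B = "Pi\<^sub>M K (\<lambda>_. B)"
  let ?AB = "Pi\<^sub>M K (\<lambda>_. A \<Otimes>\<^sub>M B)"
  interpret A: prob_space A by fact
  interpret B: prob_space B by fact
  interpret PA: product_sigma_finite "\<lambda>_ :: 'k. A"
    by (rule product_sigma_finite.intro, rule prob_space_imp_sigma_finite) (rule A)
  interpret PB: product_sigma_finite "\<lambda>_ :: 'k. B"
    by (rule product_sigma_finite.intro, rule prob_space_imp_sigma_finite) (rule B)
  interpret PAB: product_sigma_finite "\<lambda>_ :: 'k. A \<Otimes>\<^sub>M B"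
    by (rule product_sigma_finite.intro, rule prob_space_imp_sigma_finite) (rule prob_space_pair[OF A B])
  interpret KB: prob_space "?B" by (rule prob_space_PiM) (rule B)
  define \<phi> where "\<phi> = (\<lambda>(a :: 'k \<Rightarrow> 'a, t :: 'k \<Rightarrow> 'b). \<lambda>i\<in>K. (a i, t i))"
  have \<phi> [measurable]: "\<phi> \<in> ?A \<Otimes>\<^sub>M ?B \<rightarrow>\<^sub>M ?AB"
    unfolding \<phi>_def split_beta' by (rule measurable_restrict) measurable
  have "distr (?A \<Otimes>\<^sub>M ?B) (?AB) \<phi> = ?AB"
  proof (rule PAB.PiM_eqI)
    fix C assume C [measurable]: "\<And>i. i \<in> K \<Longrightarrow> C i \<in> sets (A \<Otimes>\<^sub>M B)"
    have CK [measurable]: "Pi\<^sub>E K C \<in> sets (?AB)" using \<open>finite K\<close> C by (intro sets_PiM_I_finite) auto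
    have "emeasure (distr (?A \<Otimes>\<^sub>M ?B) (?AB) \<phi>) (Pi\<^sub>E K C) =
      (\<integral>\<^sup>+z. indicator (Pi\<^sub>E K C) z \<partial>distr (?A \<Otimes>\<^sub>M ?B) (?AB) \<phi>)"
      by (rule nn_integral_indicator[symmetric]) simp
    also have "\<dots> = (\<integral>\<^sup>+z. indicator (Pi\<^sub>E K C) (\<phi> z) \<partial>(?A \<Otimes>\<^sub>M ?B))"
      by (rule nn_integral_distr[OF \<phi>]) simp
    also have "\<dots> = (\<integral>\<^sup>+a. \<integral>\<^sup>+t. indicator (Pi\<^sub>E K C) (\<phi> (a, t)) \<partial>?B \<partial>?A)"
      by (rule KB.nn_integral_fst[symmetric]) measurable
    also have "\<dots> = (\<integral>\<^sup>+a. (\<Prod>i\<in>K. \<integral>\<^sup>+s. indicator (C i) (a i, s) \<partial>B) \<partial>?A)"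
    proof (intro nn_integral_cong)
      fix a assume a: "a \<in> space (?A)"
      have "(\<integral>\<^sup>+t. indicator (Pi\<^sub>E K C) (\<phi> (a, t)) \<partial>?B) =
        (\<integral>\<^sup>+t. (\<Prod>i\<in>K. indicator (C i) (a i, t i)) \<partial>?B)"
        using \<open>finite K\<close> by (intro nn_integral_cong) (auto simp: \<phi>_def indicator_def PiE_iff)
      also have "\<dots> = (\<Prod>i\<in>K. \<integral>\<^sup>+s. indicator (C i) (a i, s) \<partial>B)"
      proof (rule PB.product_nn_integral_prod[OF \<open>finite K\<close>])
        fix i assume "i \<in> K"
        then have "a i \<in> space A" using a by (auto simp: space_PiM PiE_iff)
        then show "(\<lambda>s. indicator (C i) (a i, s) :: ennreal) \<in> borel_measurable B"
          using C[OF \<open>i \<in> K\<close>] by measurable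
      qed
      finally show "(\<integral>\<^sup>+t. indicator (Pi\<^sub>E K C) (\<phi> (a, t)) \<partial>?B) =
        (\<Prod>i\<in>K. \<integral>\<^sup>+s. indicator (C i) (a i, s) \<partial>B)" .
    qed
    also have "\<dots> = (\<Prod>i\<in>K. \<integral>\<^sup>+x. \<integral>\<^sup>+s. indicator (C i) (x, s) \<partial>B \<partial>A)"
      using \<open>finite K\<close> C by (intro PA.product_nn_integral_prod) measurable
    also have "\<dots> = (\<Prod>i\<in>K. emeasure (A \<Otimes>\<^sub>M B) (C i))"
      using C by (intro prod.cong refl B.emeasure_pair_measure[symmetric])
    finally show "emeasure (distr (?A \<Otimes>\<^sub>M ?B) (?AB) \<phi>) (Pi\<^sub>E K C) =
      (\<Prod>i\<in>K. emeasure (A \<Otimes>\<^sub>M B) (C i))" .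
  qed (use \<open>finite K\<close> in auto)
  then have "(\<integral>\<^sup>+x. H (\<lambda>i\<in>K. fst (x i), \<lambda>i\<in>K. snd (x i)) \<partial>?AB) =
    (\<integral>\<^sup>+x. H (\<lambda>i\<in>K. fst (x i), \<lambda>i\<in>K. snd (x i)) \<partial>distr (?A \<Otimes>\<^sub>M ?B) (?AB) \<phi>)"
    by simp
  also have "\<dots> = (\<integral>\<^sup>+z. H (\<lambda>i\<in>K. fst (\<phi> z i), \<lambda>i\<in>K. snd (\<phi> z i)) \<partial>(?A \<Otimes>\<^sub>M ?B))"
    by (rule nn_integral_distr[OF \<phi>]) measurable
  also have "\<dots> = (\<integral>\<^sup>+z. H z \<partial>(?A \<Otimes>\<^sub>M ?B))"
  proof (intro nn_integral_cong)
    fix z assume "z \<in> space (?A \<Otimes>\<^sub>M ?B)"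
    then obtain a y where z: "z = (a, y)" "a \<in> extensional K" "y \<in> extensional K"
      by (auto simp: space_pair_measure space_PiM PiE_iff)
    have "(\<lambda>i\<in>K. fst (\<phi> z i)) = a" "(\<lambda>i\<in>K. snd (\<phi> z i)) = y"
      using z by (auto simp: \<phi>_def extensional_def restrict_def fun_eq_iff)
    then show "H (\<lambda>i\<in>K. fst (\<phi> z i), \<lambda>i\<in>K. snd (\<phi> z i)) = H z" using z by simp
  qed
  also have "\<dots> = (\<integral>\<^sup>+a. \<integral>\<^sup>+t. H (a, t) \<partial>?B \<partial>?A)"
    by (rule KB.nn_integral_fst[symmetric]) measurable
  finally show ?thesis .
qed

text \<open>
  The substitution \<open>\<gamma> = u T\<close>.  Its result contains the power \<open>T ^ Suc n\<close>, which compensates the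
  normalization of the jumps, and the factor \<open>exp (- u T)\<close>, which is multiplicative in the jumps.
\<close>
lemma nn_integral_erlang_scale:
  assumes "0 < T" and [measurable]: "g \<in> borel_measurable (restrict_space borel {0<..})"
  shows "(\<integral>\<^sup>+\<gamma>. ennreal (erlang_density n 1 \<gamma>) * (indicator {0<..} \<gamma> * g (\<gamma> / T)) \<partial>lborel) =
    (\<integral>\<^sup>+u. ennreal (T ^ Suc n * u ^ n * exp (- u * T) / fact n) * g u \<partial>restrict_space lborel {0<..})"
proof -
  have g': "(\<lambda>x. indicator {0<..} x * g x) \<in> borel_measurable borel"
    using assms(2) by (subst (asm) borel_measurable_restrict_space_iff_ennreal) (auto simp: mult.commute)
  have "(\<lambda>\<gamma>. indicator {0<..} (\<gamma> / T) * g (\<gamma> / T)) \<in> borel_measurable borel"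
    by (rule measurable_compose[OF _ g']) measurable
  then have m [measurable]: "(\<lambda>\<gamma>. indicator {0<..} \<gamma> * g (\<gamma> / T)) \<in> borel_measurable borel"
    using assms(1) by (simp add: indicator_def zero_less_divide_iff)
  have "(\<integral>\<^sup>+\<gamma>. ennreal (erlang_density n 1 \<gamma>) * (indicator {0<..} \<gamma> * g (\<gamma> / T)) \<partial>lborel) =
    ennreal \<bar>T\<bar> * (\<integral>\<^sup>+u. ennreal (erlang_density n 1 (0 + T * u)) * (indicator {0<..} (0 + T * u) * g ((0 + T * u) / T)) \<partial>lborel)"
    using assms(1) by (intro nn_integral_real_affine) auto
  also have "\<dots> = (\<integral>\<^sup>+u. ennreal \<bar>T\<bar> * (ennreal (erlang_density n 1 (0 + T * u)) * (indicator {0<..} (0 + T * u) * g ((0 + T * u) / T))) \<partial>lborel)"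
  proof (rule nn_integral_cmult[symmetric])
    have "(\<lambda>u. ennreal (erlang_density n 1 (T * u)) * (indicator {0<..} u * g u)) \<in> borel_measurable lborel"
      using g' by measurable
    then show "(\<lambda>u. ennreal (erlang_density n 1 (0 + T * u)) * (indicator {0<..} (0 + T * u) * g ((0 + T * u) / T))) \<in> borel_measurable lborel"
      using assms(1) by (simp add: indicator_def zero_less_mult_iff)
  qed
  also have "\<dots> = (\<integral>\<^sup>+u. (ennreal (T ^ Suc n * u ^ n * exp (- u * T) / fact n) * g u) * indicator {0<..} u \<partial>lborel)"
  proof (intro nn_integral_cong)
    fix u :: real
    show "ennreal \<bar>T\<bar> * (ennreal (erlang_density n 1 (0 + T * u)) * (indicator {0<..} (0 + T * u) * g ((0 + T * u) / T))) =
      ennreal (T ^ Suc n * u ^ n * exp (- u * T) / fact n) * g u * indicator {0<..} u"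
    proof (cases "0 < u")
      case True
      have "0 < T * u" using assms(1) True by simp
      then have "ennreal T * ennreal (erlang_density n 1 (T * u)) = ennreal (T ^ Suc n * u ^ n * exp (- u * T) / fact n)"
        using True assms(1)
        by (subst ennreal_mult[symmetric]) (simp_all add: erlang_density_def power_mult_distrib mult.commute not_less)
      then show ?thesis using True assms(1) by (simp add: mult.assoc[symmetric] zero_less_mult_iff)
    qed (use assms(1) in \<open>simp add: zero_less_mult_iff\<close>)
  qed
  also have "\<dots> = (\<integral>\<^sup>+u. ennreal (T ^ Suc n * u ^ n * exp (- u * T) / fact n) * g u \<partial>restrict_space lborel {0<..})"
    by (subst nn_integral_restrict_space) auto
  finally show ?thesis .
qed

section \<open>Samples and the order of first appearance\<close>

definition firsts :: "'b list \<Rightarrow> 'b list" where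
  "firsts xs = rev (remdups (rev xs))"

lemma set_firsts [simp]: "set (firsts xs) = set xs"
  and distinct_firsts [simp]: "distinct (firsts xs)"
  by (simp_all add: firsts_def)

lemma firsts_map_inj_on: "inj_on f (set xs) \<Longrightarrow> firsts (map f xs) = map f (firsts xs)"
proof -
  have "inj_on f (set xs) \<Longrightarrow> remdups (map f xs) = map f (remdups xs)" for xs
    by (induction xs) (auto simp: inj_on_def)
  then show "inj_on f (set xs) \<Longrightarrow> firsts (map f xs) = map f (firsts xs)"
    by (simp add: firsts_def rev_map)
qed

lemma distinct_values_firsts: "distinct_values n \<theta> \<omega> = firsts (map (\<lambda>i. \<theta> i \<omega>) [0..<n])"
  by (simp add: distinct_values_def firsts_def)

text \<open>
  A pattern assigns to every observation the index of its value among the distinct values.  As these are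
  numbered in the order of first appearance, the first occurrences in a pattern must read \<open>0, 1, \<dots>, k - 1\<close>.
\<close>
definition patterns :: "nat \<Rightarrow> nat \<Rightarrow> (nat \<Rightarrow> nat) \<Rightarrow> (nat \<Rightarrow> nat) set" where
  "patterns n k ns = {c \<in> {..<n} \<rightarrow>\<^sub>E {..<k}. firsts (map c [0..<n]) = [0..<k] \<and>
     (\<forall>j<k. card {i. i < n \<and> c i = j} = ns j)}"

text \<open>
  The possible choices of the \<open>k\<close> allocated atoms among those with indices \<open>0, \<dots>, m\<close>.
\<close>
definition injections :: "nat \<Rightarrow> nat \<Rightarrow> (nat \<Rightarrow> nat) set" where
  "injections k m = {l \<in> {..<k} \<rightarrow>\<^sub>E {..m}. inj_on l {..<k}}"

lemma finite_patterns: "finite (patterns n k ns)"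
  by (rule finite_subset[OF _ finite_PiE[of "{..<n}" "\<lambda>_. {..<k}"]]) (auto simp: patterns_def)

lemma finite_injections: "finite (injections k m)"
  by (rule finite_subset[OF _ finite_PiE[of "{..<k}" "\<lambda>_. {..m}"]]) (auto simp: injections_def)

lemma card_injections:
  assumes "k \<le> m + 1"
  shows "real (card (injections k m)) * fact (m + 1 - k) = fact (m + 1)"
proof -
  have "card (injections k m) = prod ((-) (card {..m})) {0..<card {..<k}}"
    unfolding injections_def by (subst card_inj_on_subset_funcset) auto
  also have "\<dots> = (\<Prod>i<k. m + 1 - i)" by (simp add: lessThan_atLeast0)
  finally have "card (injections k m) = (\<Prod>i<k. m + 1 - i)" .
  moreover have "(\<Prod>i<k. m + 1 - i) * fact (m + 1 - k) = (fact (m + 1) :: nat)"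
    using assms
  proof (induction k)
    case (Suc k)
    have "(fact (m + 1 - k) :: nat) = (m + 1 - k) * fact (m + 1 - Suc k)"
      using Suc.prems by (subst fact_reduce) auto
    then show ?case using Suc by (simp add: mult.assoc)
  qed simp
  ultimately show ?thesis by (metis of_nat_fact of_nat_mult)
qed

lemma injections_empty: "m + 1 < k \<Longrightarrow> injections k m = {}"
proof (rule ccontr)
  assume "m + 1 < k" "injections k m \<noteq> {}"
  then obtain l where "l ` {..<k} \<subseteq> {..m}" "inj_on l {..<k}" by (auto simp: injections_def)
  then have "card {..<k} \<le> card {..m}" by (intro card_inj_on_le) auto
  then show False using \<open>m + 1 < k\<close> by simp
qed

lemma injectionsD:
  assumes "l \<in> injections k m"
  shows "inj_on l {..<k}" "\<And>j. j < k \<Longrightarrow> l j \<le> m" "k \<le> m + 1" "l \<in> extensional {..<k}"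
proof -
  show "k \<le> m + 1" using assms injections_empty[of m k] by (cases "m + 1 < k") auto
qed (use assms in \<open>auto simp: injections_def PiE_iff\<close>)

lemma patternsD:
  assumes "c \<in> patterns n k ns"
  shows "\<And>i. i < n \<Longrightarrow> c i < k" "firsts (map c [0..<n]) = [0..<k]"
    "\<And>j. j < k \<Longrightarrow> card {i. i < n \<and> c i = j} = ns j" "c \<in> extensional {..<n}"
  using assms by (auto simp: patterns_def PiE_iff)

lemma prod_pattern:
  fixes p :: "nat \<Rightarrow> 'b :: comm_monoid_mult"
  assumes "c \<in> patterns n k ns"
  shows "(\<Prod>i<n. p (c i)) = (\<Prod>j<k. p j ^ ns j)"
proof -
  have "(\<Prod>i<n. p (c i)) = (\<Prod>j<k. \<Prod>i\<in>{i\<in>{..<n}. c i = j}. p (c i))"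
    using patternsD(1)[OF assms] by (intro prod.group[symmetric]) auto
  also have "\<dots> = (\<Prod>j<k. p j ^ ns j)"
    using patternsD(3)[OF assms] by (intro prod.cong refl) (simp add: lessThan_def)
  finally show ?thesis .
qed

text \<open>
  If observation \<open>i\<close> is the atom of index \<open>l (c i)\<close>, then \<open>l\<close> and \<open>c\<close> can be recovered from the
  sample, because distinct indices carry distinct locations.
\<close>
lemma sample_of_pattern:
  assumes inj: "inj_on (\<lambda>j. \<tau> j \<omega>) {..N \<omega>}" and l: "l \<in> injections k (N \<omega>)" and c: "c \<in> patterns n k ns"
    and \<theta>: "\<And>i. i < n \<Longrightarrow> \<theta> i \<omega> = \<tau> (l (c i)) \<omega>"
  shows "distinct_values n \<theta> \<omega> = map (\<lambda>j. \<tau> (l j) \<omega>) [0..<k]"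
    and "j < k \<Longrightarrow> multiplicity_of n \<theta> j \<omega> = ns j"
    and "j < k \<Longrightarrow> alloc_index N \<tau> n \<theta> j \<omega> = l j"
proof -
  have injl: "inj_on (\<lambda>j. \<tau> (l j) \<omega>) {..<k}"
    using inj injectionsD(1,2)[OF l] by (auto simp: inj_on_def)
  have "map (\<lambda>i. \<theta> i \<omega>) [0..<n] = map (\<lambda>j. \<tau> (l j) \<omega>) (map c [0..<n])"
    using \<theta> by simp
  moreover have "inj_on (\<lambda>j. \<tau> (l j) \<omega>) (set (map c [0..<n]))"
    using injl patternsD(1)[OF c] by (auto simp: inj_on_def)
  ultimately show dv: "distinct_values n \<theta> \<omega> = map (\<lambda>j. \<tau> (l j) \<omega>) [0..<k]"
    by (simp add: distinct_values_firsts firsts_map_inj_on patternsD(2)[OF c] del: map_map)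
  show "multiplicity_of n \<theta> j \<omega> = ns j" if "j < k"
  proof -
    have "{i. i < n \<and> \<theta> i \<omega> = \<tau> (l j) \<omega>} = {i. i < n \<and> c i = j}"
      using \<theta> inj_onD[OF injl] patternsD(1)[OF c] that by auto
    then show ?thesis using that patternsD(3)[OF c that] by (simp add: multiplicity_of_def dv)
  qed
  show "alloc_index N \<tau> n \<theta> j \<omega> = l j" if "j < k"
    unfolding alloc_index_def
  proof (rule Least_equality)
    show "l j \<le> N \<omega> \<and> \<tau> (l j) \<omega> = distinct_values n \<theta> \<omega> ! j"
      using that injectionsD(2)[OF l] by (simp add: dv)
    show "l j \<le> a" if "a \<le> N \<omega> \<and> \<tau> a \<omega> = distinct_values n \<theta> \<omega> ! j" for a
      using that \<open>j < k\<close> injectionsD(2)[OF l] inj_onD[OF inj, of a "l j"] by (simp add: dv)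
  qed
qed

lemma pattern_of_sample:
  assumes inj: "inj_on (\<lambda>j. \<tau> j \<omega>) {..N \<omega>}" and \<theta>: "\<And>i. i < n \<Longrightarrow> \<theta> i \<omega> \<in> (\<lambda>j. \<tau> j \<omega>) ` {..N \<omega>}"
    and len: "length (distinct_values n \<theta> \<omega>) = k" and mult: "\<And>j. j < k \<Longrightarrow> multiplicity_of n \<theta> j \<omega> = ns j"
  obtains l c where "l \<in> injections k (N \<omega>)" "c \<in> patterns n k ns" "\<And>i. i < n \<Longrightarrow> \<theta> i \<omega> = \<tau> (l (c i)) \<omega>"
proof -
  define d where "d = distinct_values n \<theta> \<omega>"
  have dd: "distinct d" and ds: "set d = (\<lambda>i. \<theta> i \<omega>) ` {..<n}"
    by (auto simp: d_def distinct_values_firsts)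
  have injd: "inj_on (\<lambda>j. d ! j) {..<k}"
    using dd len by (auto simp: inj_on_def d_def nth_eq_iff_index_eq)
  have "\<exists>a. a \<le> N \<omega> \<and> \<tau> a \<omega> = d ! j" if "j < k" for j
  proof -
    have "d ! j \<in> set d" using that len by (simp add: d_def)
    then show ?thesis using \<theta> ds by fastforce
  qed
  then obtain l0 where l0: "\<And>j. j < k \<Longrightarrow> l0 j \<le> N \<omega> \<and> \<tau> (l0 j) \<omega> = d ! j" by metis
  define l where "l = restrict l0 {..<k}"
  have l: "l \<in> injections k (N \<omega>)"
    unfolding injections_def
  proof (intro CollectI conjI)
    show "l \<in> {..<k} \<rightarrow>\<^sub>E {..N \<omega>}" using l0 by (auto simp: l_def)
    show "inj_on l {..<k}"
    proof (rule inj_onI)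
      fix x y assume xy: "x \<in> {..<k}" "y \<in> {..<k}" "l x = l y"
      then have "d ! x = d ! y" using l0[of x] l0[of y] by (simp add: l_def)
      then show "x = y" using inj_onD[OF injd] xy by blast
    qed
  qed
  have "\<exists>j. j < k \<and> d ! j = \<theta> i \<omega>" if "i < n" for i
    using that ds len by (metis d_def imageI in_set_conv_nth lessThan_iff)
  then obtain c0 where c0: "\<And>i. i < n \<Longrightarrow> c0 i < k \<and> d ! (c0 i) = \<theta> i \<omega>" by metis
  define c where "c = restrict c0 {..<n}"
  have cE: "c \<in> {..<n} \<rightarrow>\<^sub>E {..<k}" using c0 by (auto simp: c_def)
  have mapc: "map (\<lambda>i. \<theta> i \<omega>) [0..<n] = map ((!) d) (map c [0..<n])"
    using c0 by (simp add: c_def)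
  have injc: "inj_on ((!) d) (set (map c [0..<n]))"
    using c0 by (intro inj_on_subset[OF injd]) (auto simp: c_def)
  have "d = map ((!) d) (firsts (map c [0..<n]))"
    unfolding firsts_map_inj_on[OF injc, symmetric] mapc[symmetric]
    by (simp add: d_def distinct_values_firsts)
  moreover have "d = map ((!) d) [0..<k]"
    using len by (simp add: d_def map_nth[symmetric] del: map_nth) (metis map_nth)
  ultimately have eq: "map ((!) d) (firsts (map c [0..<n])) = map ((!) d) [0..<k]" by simp
  have "set (firsts (map c [0..<n])) \<union> set [0..<k] \<subseteq> {..<k}" using c0 by (auto simp: c_def)
  then have "firsts (map c [0..<n]) = [0..<k]"
    using eq injd by (metis inj_on_subset map_inj_on)
  moreover have "card {i. i < n \<and> c i = j} = ns j" if "j < k" for j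
  proof -
    have "{i. i < n \<and> c i = j} = {i. i < n \<and> \<theta> i \<omega> = d ! j}"
      using c0 inj_onD[OF injd] that by (auto simp: c_def)
    then show ?thesis using mult[OF that] by (simp add: multiplicity_of_def d_def)
  qed
  ultimately have "c \<in> patterns n k ns" using cE by (simp add: patterns_def)
  moreover have "\<theta> i \<omega> = \<tau> (l (c i)) \<omega>" if "i < n" for i
    using c0[OF that] l0 that by (simp add: c_def l_def)
  ultimately show ?thesis using l that by blast
qed

text \<open>
  The event that the sample has the prescribed multiplicities is a disjoint union, over the possible
  allocations, of events for which the probabilities are products: a sample from distinct atoms is
  explained by at most one pair of an injection and a pattern, and by one precisely on this event.
\<close>
lemma sum_patterns:
  fixes h :: "(nat \<Rightarrow> nat) \<Rightarrow> ennreal"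
  assumes inj: "inj_on (\<lambda>j. \<tau> j \<omega>) {..N \<omega>}" and \<theta>: "\<And>i. i < n \<Longrightarrow> \<theta> i \<omega> \<in> (\<lambda>j. \<tau> j \<omega>) ` {..N \<omega>}"
  shows "(\<Sum>l\<in>injections k (N \<omega>). \<Sum>c\<in>patterns n k ns. of_bool (\<forall>i<n. \<theta> i \<omega> = \<tau> (l (c i)) \<omega>) * h l) =
    of_bool (length (distinct_values n \<theta> \<omega>) = k \<and> (\<forall>j<k. multiplicity_of n \<theta> j \<omega> = ns j)) *
      h (\<lambda>j\<in>{..<k}. alloc_index N \<tau> n \<theta> j \<omega>)"
proof (cases "length (distinct_values n \<theta> \<omega>) = k \<and> (\<forall>j<k. multiplicity_of n \<theta> j \<omega> = ns j)")
  case True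
  obtain l c where lc: "l \<in> injections k (N \<omega>)" "c \<in> patterns n k ns" "\<And>i. i < n \<Longrightarrow> \<theta> i \<omega> = \<tau> (l (c i)) \<omega>"
    proof (rule pattern_of_sample[where \<tau>=\<tau> and N=N and \<theta>=\<theta> and \<omega>=\<omega> and n=n and k=k and ns=ns])
  qed (use inj \<theta> True that in auto)
  have restr: "l' = (\<lambda>j\<in>{..<k}. alloc_index N \<tau> n \<theta> j \<omega>)"
    if "l' \<in> injections k (N \<omega>)" "c' \<in> patterns n k ns" "\<forall>i<n. \<theta> i \<omega> = \<tau> (l' (c' i)) \<omega>" for l' c'
    using sample_of_pattern(3)[where \<tau>=\<tau> and N=N and \<omega>=\<omega> and \<theta>=\<theta>, OF inj that(1,2)] that(3) injectionsD(4)[OF that(1)]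
    by (auto simp: fun_eq_iff extensional_def)
  have l: "l = (\<lambda>j\<in>{..<k}. alloc_index N \<tau> n \<theta> j \<omega>)" using restr[OF lc(1,2)] lc(3) by blast
  have uniq: "l' = l \<and> c' = c" if a: "l' \<in> injections k (N \<omega>)" "c' \<in> patterns n k ns"
    "\<forall>i<n. \<theta> i \<omega> = \<tau> (l' (c' i)) \<omega>" for l' c'
  proof -
    have l': "l' = l" using restr[OF a] l by simp
    have "c' i = c i" for i
    proof (cases "i < n")
      case True
      have "c i < k" "c' i < k" using patternsD(1)[OF lc(2) True] patternsD(1)[OF a(2) True] by auto
      moreover have "\<tau> (l (c' i)) \<omega> = \<tau> (l (c i)) \<omega>" using a(3) lc(3) True l' by auto
      ultimately show ?thesis
        using inj_onD[OF inj, of "l (c' i)" "l (c i)"] injectionsD(2)[OF lc(1)] inj_onD[OF injectionsD(1)[OF lc(1)], of "c' i" "c i"]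
        by auto
    next
      case False
      then show ?thesis using patternsD(4)[OF lc(2)] patternsD(4)[OF a(2)] by (auto simp: extensional_def)
    qed
    then show ?thesis using l' by auto
  qed
  have "(\<Sum>l'\<in>injections k (N \<omega>). \<Sum>c'\<in>patterns n k ns. of_bool (\<forall>i<n. \<theta> i \<omega> = \<tau> (l' (c' i)) \<omega>) * h l') =
    (\<Sum>l'\<in>injections k (N \<omega>). if l' = l then h l else 0)"
  proof (intro sum.cong refl)
    fix l' assume l'in: "l' \<in> injections k (N \<omega>)"
    have "(\<Sum>c'\<in>patterns n k ns. of_bool (\<forall>i<n. \<theta> i \<omega> = \<tau> (l' (c' i)) \<omega>) * h l') =
      (\<Sum>c'\<in>patterns n k ns. if c' = c then (if l' = l then h l else 0) else 0)"
    proof (intro sum.cong refl)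
      fix c' assume "c' \<in> patterns n k ns"
      with uniq[OF l'in this] lc(3)
      show "of_bool (\<forall>i<n. \<theta> i \<omega> = \<tau> (l' (c' i)) \<omega>) * h l' = (if c' = c then (if l' = l then h l else 0) else 0)"
        by auto
    qed
    also have "\<dots> = (if l' = l then h l else 0)"
      using lc(2) by (simp add: finite_patterns)
    finally show "(\<Sum>c'\<in>patterns n k ns. of_bool (\<forall>i<n. \<theta> i \<omega> = \<tau> (l' (c' i)) \<omega>) * h l') = (if l' = l then h l else 0)" .
  qed
  also have "\<dots> = h l" using lc(1) by (simp add: finite_injections)
  finally show ?thesis using True l by simp
next
  case False
  have "\<not> (\<forall>i<n. \<theta> i \<omega> = \<tau> (l (c i)) \<omega>)" if "l \<in> injections k (N \<omega>)" "c \<in> patterns n k ns" for l c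
  proof
    assume *: "\<forall>i<n. \<theta> i \<omega> = \<tau> (l (c i)) \<omega>"
    note s = sample_of_pattern(1,2)[where \<tau>=\<tau> and N=N and \<omega>=\<omega> and \<theta>=\<theta>, OF inj that]
    have "length (distinct_values n \<theta> \<omega>) = k" using s(1) * by simp
    moreover have "multiplicity_of n \<theta> j \<omega> = ns j" if "j < k" for j using s(2) * that by simp
    ultimately show False using False by blast
  qed
  then have "(\<Sum>l\<in>injections k (N \<omega>). \<Sum>c\<in>patterns n k ns. of_bool (\<forall>i<n. \<theta> i \<omega> = \<tau> (l (c i)) \<omega>) * h l) = 0"
    by (intro sum.neutral ballI) simp
  moreover have "(of_bool (length (distinct_values n \<theta> \<omega>) = k \<and> (\<forall>j<k. multiplicity_of n \<theta> j \<omega> = ns j)) :: ennreal) = 0"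
    using False by (simp only: of_bool_def if_False)
  ultimately show ?thesis by simp
qed

section \<open>Exponential tilting and size biasing\<close>

lemma measurable_density_kernel:
  assumes \<mu>: "prob_space \<mu>" "sets \<mu> = sets S"
    and f [measurable]: "(\<lambda>(u, x). f u x) \<in> borel_measurable (MU \<Otimes>\<^sub>M S)"
    and pr: "\<And>u. u \<in> space MU \<Longrightarrow> prob_space (density \<mu> (f u))"
  shows "(\<lambda>u. density \<mu> (f u)) \<in> MU \<rightarrow>\<^sub>M prob_algebra S"
proof (rule measurable_prob_algebraI[OF pr measurable_subprob_algebra])
  interpret prob_space \<mu> by fact
  note [measurable_cong] = \<mu>(2)
  fix A assume [measurable]: "A \<in> sets S"
  have eq: "emeasure (density \<mu> (f u)) A = (\<integral>\<^sup>+x. f u x * indicator A x \<partial>\<mu>)" if [measurable]: "u \<in> space MU" for u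
    by (rule emeasure_density) measurable
  have "(\<lambda>u. \<integral>\<^sup>+x. f u x * indicator A x \<partial>\<mu>) \<in> borel_measurable MU" by measurable
  then show "(\<lambda>u. emeasure (density \<mu> (f u)) A) \<in> borel_measurable MU"
    by (rule measurable_cong[THEN iffD1, rotated]) (simp add: eq)
qed (use \<mu> pr prob_space_imp_subprob_space in auto)

abbreviation pos_lborel :: "real measure" where
  "pos_lborel \<equiv> restrict_space lborel {0<..}"

lemma sets_pos_lborel [measurable_cong]: "sets pos_lborel = sets pos_borel"
  by (simp add: sets_restrict_space)

lemma space_pos_borel: "space pos_borel = {0<..}" "space pos_lborel = {0<..}"
  by (simp_all add: space_restrict_space)

lemma measurable_pos_borel_id [measurable]: "(\<lambda>x. x) \<in> pos_borel \<rightarrow>\<^sub>M borel"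
  by (rule measurable_restrict_space1) simp

lemma sigma_finite_pos_lborel: "sigma_finite_measure pos_lborel"
  by (rule sigma_finite_measure_restrict_space) (auto intro: sigma_finite_lborel)

locale jump_distribution = prob_space F for F :: "real measure" +
  assumes sets_F [measurable_cong]: "sets F = sets pos_borel"
begin

lemma space_F: "space F = {0<..}"
  using sets_eq_imp_space_eq[OF sets_F] by (simp add: space_restrict_space)

definition tilted_moment :: "nat \<Rightarrow> real \<Rightarrow> ennreal" where
  "tilted_moment d u = (\<integral>\<^sup>+s. ennreal (s ^ d * exp (- u * s)) \<partial>F)"

text \<open>
  For \<open>U = u\<close> this is the posterior law of a jump whose atom has been observed \<open>d\<close> times; \<open>d = 0\<close> is the
  case of a non-allocated jump, for which \<open>tilted_moment 0\<close> is the Laplace transform of \<open>F\<close>.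
\<close>
definition size_biased :: "nat \<Rightarrow> real \<Rightarrow> real measure" where
  "size_biased d u = density F (\<lambda>s. ennreal (s ^ d * exp (- u * s)) / tilted_moment d u)"

lemma sets_size_biased [simp, measurable_cong]: "sets (size_biased d u) = sets pos_borel"
  by (simp add: size_biased_def sets_F)

lemma measurable_tilted_moment [measurable]: "tilted_moment d \<in> borel_measurable pos_borel"
  unfolding tilted_moment_def by measurable

lemma tilted_moment_pos: "0 < tilted_moment d u"
proof -
  have "tilted_moment d u \<noteq> 0"
  proof
    assume "tilted_moment d u = 0"
    then have "AE s in F. ennreal (s ^ d * exp (- u * s)) = 0"
      unfolding tilted_moment_def by (subst (asm) nn_integral_0_iff_AE) measurable
    moreover have "AE s in F. 0 < ennreal (s ^ d * exp (- u * s))"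
      by (rule AE_I2) (simp add: space_F)
    ultimately have "AE s in F. False" by eventually_elim simp
    then show False by simp
  qed
  then show ?thesis by (simp add: zero_less_iff_neq_zero)
qed

text \<open>
  The decay of \<open>exp (- u * s)\<close> outweighs every power of \<open>s\<close>, so this holds even if \<open>F\<close> itself has no finite moments.
\<close>
lemma tilted_moment_finite:
  assumes "0 < u"
  shows "tilted_moment d u < \<infinity>"
proof -
  have b: "s ^ d * exp (- u * s) \<le> fact d / u ^ d" if "0 < s" for s
  proof -
    \<comment> \<open>One term of the exponential series bounds the power.\<close>
    have "(u * s) ^ d / fact d \<le> exp (u * s)"
    proof -
      have "(u * s) ^ d /\<^sub>R fact d \<le> (\<Sum>n. (u * s) ^ n /\<^sub>R fact n)"
        using assms that summable_exp_generic[of "u * s"]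
        by (intro order_trans[OF _ sum_le_suminf[of _ "{d}"]]) auto
      then show ?thesis by (simp add: exp_def divide_inverse mult.commute)
    qed
    then show ?thesis using assms by (simp add: exp_minus field_simps power_mult_distrib)
  qed
  have "tilted_moment d u \<le> (\<integral>\<^sup>+s. ennreal (fact d / u ^ d) \<partial>F)"
    unfolding tilted_moment_def using b by (intro nn_integral_mono ennreal_leI) (auto simp: space_F)
  also have "\<dots> = ennreal (fact d / u ^ d)" by (simp add: emeasure_space_1)
  finally show ?thesis by (rule order.strict_trans1) simp
qed

lemma prob_space_size_biased:
  assumes "0 < u"
  shows "prob_space (size_biased d u)"
proof (rule prob_spaceI)
  have "emeasure (size_biased d u) (space (size_biased d u)) = (\<integral>\<^sup>+s. ennreal (s ^ d * exp (- u * s)) / tilted_moment d u \<partial>F)"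
    unfolding size_biased_def by (subst emeasure_density) (auto intro!: nn_integral_cong)
  also have "\<dots> = tilted_moment d u / tilted_moment d u"
    unfolding tilted_moment_def by (rule nn_integral_divide) measurable
  also have "\<dots> = 1"
    using tilted_moment_pos[of d u] tilted_moment_finite[OF assms, of d] by (intro ennreal_divide_self) auto
  finally show "emeasure (size_biased d u) (space (size_biased d u)) = 1" .
qed

lemma PiM_size_biased:
  assumes "finite I" "0 < u"
  shows "Pi\<^sub>M I (\<lambda>i. size_biased (d i) u) =
    density (Pi\<^sub>M I (\<lambda>_. F)) (\<lambda>a. \<Prod>i\<in>I. ennreal (a i ^ d i * exp (- u * a i)) / tilted_moment (d i) u)"
  unfolding size_biased_def
  by (rule PiM_density) (use assms prob_space_size_biased prob_space_axioms in \<open>auto simp: size_biased_def\<close>)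

lemma measurable_PiM_size_biased:
  assumes "finite I"
  shows "(\<lambda>u. Pi\<^sub>M I (\<lambda>i. size_biased (d i) u)) \<in> pos_borel \<rightarrow>\<^sub>M prob_algebra (Pi\<^sub>M I (\<lambda>_. pos_borel))"
proof -
  let ?P = "Pi\<^sub>M I (\<lambda>_. F)"
  let ?B = "Pi\<^sub>M I (\<lambda>_. pos_borel)"
  have "(\<lambda>u. density (?P) (\<lambda>a. \<Prod>i\<in>I. ennreal (a i ^ d i * exp (- u * a i)) / tilted_moment (d i) u))
    \<in> pos_borel \<rightarrow>\<^sub>M prob_algebra (?B)"
  proof (rule measurable_density_kernel)
    show "prob_space (?P)" by (rule prob_space_PiM) unfold_locales
    show "sets (?P) = sets (?B)" by (simp add: sets_F cong: sets_PiM_cong)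
    have [measurable]: "(\<lambda>x. snd x i) \<in> pos_borel \<Otimes>\<^sub>M ?B \<rightarrow>\<^sub>M borel" if "i \<in> I" for i
      using that by (intro measurable_compose[OF _ measurable_pos_borel_id]) measurable
    show "(\<lambda>(u, a). \<Prod>i\<in>I. ennreal (a i ^ d i * exp (- u * a i)) / tilted_moment (d i) u)
      \<in> borel_measurable (pos_borel \<Otimes>\<^sub>M ?B)"
      unfolding split_beta' by measurable
    fix u assume "u \<in> space pos_borel"
    then have u: "0 < u" by (simp add: space_pos_borel)
    show "prob_space (density (?P) (\<lambda>a. \<Prod>i\<in>I. ennreal (a i ^ d i * exp (- u * a i)) / tilted_moment (d i) u))"
      unfolding PiM_size_biased[OF assms u, symmetric]
      by (rule prob_space_PiM) (rule prob_space_size_biased[OF u])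
  qed
  then show ?thesis
    by (rule measurable_cong[THEN iffD1, rotated]) (simp add: PiM_size_biased assms space_pos_borel)
qed

lemma nn_integral_PiM_size_biased:
  assumes "finite I" "0 < u" and [measurable]: "h \<in> borel_measurable (Pi\<^sub>M I (\<lambda>_. pos_borel))"
  shows "(\<integral>\<^sup>+a. ennreal (\<Prod>i\<in>I. a i ^ d i * exp (- u * a i)) * h a \<partial>Pi\<^sub>M I (\<lambda>_. F)) =
    (\<Prod>i\<in>I. tilted_moment (d i) u) * (\<integral>\<^sup>+a. h a \<partial>Pi\<^sub>M I (\<lambda>i. size_biased (d i) u))"
proof -
  let ?P = "Pi\<^sub>M I (\<lambda>_. F)"
  let ?B = "Pi\<^sub>M I (\<lambda>_. pos_borel)"
  have [measurable_cong]: "sets (?P) = sets (?B)" by (simp add: sets_F cong: sets_PiM_cong)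
  have [measurable]: "(\<lambda>x. x i) \<in> ?B \<rightarrow>\<^sub>M borel" if "i \<in> I" for i
    using that by (intro measurable_compose[OF _ measurable_pos_borel_id]) measurable
  have "(\<Prod>i\<in>I. tilted_moment (d i) u) * (\<integral>\<^sup>+a. h a \<partial>Pi\<^sub>M I (\<lambda>i. size_biased (d i) u)) =
    (\<Prod>i\<in>I. tilted_moment (d i) u) * (\<integral>\<^sup>+a. (\<Prod>i\<in>I. ennreal (a i ^ d i * exp (- u * a i)) / tilted_moment (d i) u) * h a \<partial>?P)"
  proof -
    have "h \<in> borel_measurable (?P)"
      using assms(3) by (simp add: sets_F cong: measurable_cong_sets sets_PiM_cong)
    then show ?thesis unfolding PiM_size_biased[OF assms(1,2)] by (subst nn_integral_density) auto
  qed
  also have "\<dots> = (\<integral>\<^sup>+a. (\<Prod>i\<in>I. tilted_moment (d i) u) * ((\<Prod>i\<in>I. ennreal (a i ^ d i * exp (- u * a i)) / tilted_moment (d i) u) * h a) \<partial>?P)"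
    by (rule nn_integral_cmult[symmetric]) measurable
  also have "\<dots> = (\<integral>\<^sup>+a. ennreal (\<Prod>i\<in>I. a i ^ d i * exp (- u * a i)) * h a \<partial>?P)"
  proof (intro nn_integral_cong)
    fix a assume "a \<in> space (?P)"
    then have a: "0 < a i" if "i \<in> I" for i using that by (auto simp: space_PiM space_F PiE_iff)
    have "(\<Prod>i\<in>I. tilted_moment (d i) u) * (\<Prod>i\<in>I. ennreal (a i ^ d i * exp (- u * a i)) / tilted_moment (d i) u) =
      (\<Prod>i\<in>I. ennreal (a i ^ d i * exp (- u * a i)))"
      unfolding prod.distrib[symmetric]
    proof (intro prod.cong refl)
      fix i
      show "tilted_moment (d i) u * (ennreal (a i ^ d i * exp (- u * a i)) / tilted_moment (d i) u) = ennreal (a i ^ d i * exp (- u * a i))"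
        using tilted_moment_pos[of "d i" u] tilted_moment_finite[OF assms(2), of "d i"]
        by (metis ennreal_mult_divide_eq ennreal_times_divide infinity_ennreal_def less_irrefl mult.commute)
    qed
    also have "\<dots> = ennreal (\<Prod>i\<in>I. a i ^ d i * exp (- u * a i))"
      using a by (intro prod_ennreal) (auto intro: less_imp_le)
    finally show "(\<Prod>i\<in>I. tilted_moment (d i) u) * ((\<Prod>i\<in>I. ennreal (a i ^ d i * exp (- u * a i)) / tilted_moment (d i) u) * h a) =
      ennreal (\<Prod>i\<in>I. a i ^ d i * exp (- u * a i)) * h a"
      by (simp add: mult.assoc[symmetric])
  qed
  finally show ?thesis ..
qed

text \<open>
  This makes the posterior density of \<open>U\<close> integrable.  For fixed jumps \<open>a\<close> with sum \<open>T\<close>, the integral over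
  \<open>u\<close> is a gamma integral with value \<open>(n - 1)! (\<Prod>j<k. a j ^ ns j) / T ^ n\<close>, and each \<open>a j\<close> is at most \<open>T\<close>.
\<close>
lemma nn_integral_tilted_moment_le:
  fixes ns :: "nat \<Rightarrow> nat"
  assumes "(\<Sum>j<k. ns j) = n" "1 \<le> n" "1 \<le> k"
  shows "(\<integral>\<^sup>+u. ennreal (u ^ (n - 1)) * (\<Prod>j<k. tilted_moment (ns j) u) \<partial>pos_lborel) \<le> fact (n - 1)"
proof -
  let ?P = "Pi\<^sub>M {..<k} (\<lambda>_. F)"
  let ?B = "Pi\<^sub>M {..<k} (\<lambda>_. pos_borel)"
  interpret P: product_sigma_finite "\<lambda>_ :: nat. F"
    by (rule product_sigma_finite.intro, rule prob_space_imp_sigma_finite) unfold_locales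
  interpret PK: prob_space "?P" by (rule prob_space_PiM) unfold_locales
  interpret L: sigma_finite_measure pos_lborel by (rule sigma_finite_pos_lborel)
  interpret PL: pair_sigma_finite pos_lborel "?P" ..
  have [measurable_cong]: "sets (?P) = sets (?B)" by (simp add: sets_F cong: sets_PiM_cong)
  have [measurable]: "(\<lambda>x. snd x i) \<in> pos_borel \<Otimes>\<^sub>M ?B \<rightarrow>\<^sub>M borel" if "i \<in> {..<k}" for i
    using that by (intro measurable_compose[OF _ measurable_pos_borel_id]) measurable
  have [measurable]: "(\<lambda>x. x i) \<in> ?B \<rightarrow>\<^sub>M borel" if "i \<in> {..<k}" for i
    using that by (intro measurable_compose[OF _ measurable_pos_borel_id]) measurable
  have "(\<integral>\<^sup>+u. ennreal (u ^ (n - 1)) * (\<Prod>j<k. tilted_moment (ns j) u) \<partial>pos_lborel) =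
    (\<integral>\<^sup>+u. \<integral>\<^sup>+a. ennreal (u ^ (n - 1)) * (\<Prod>j<k. ennreal (a j ^ ns j * exp (- u * a j))) \<partial>?P \<partial>pos_lborel)"
  proof (intro nn_integral_cong)
    fix u
    have "(\<Prod>j<k. tilted_moment (ns j) u) = (\<integral>\<^sup>+a. (\<Prod>j<k. ennreal (a j ^ ns j * exp (- u * a j))) \<partial>?P)"
      unfolding tilted_moment_def 
      by (subst P.product_nn_integral_prod[of "{..<k}" "\<lambda>j s. ennreal (s ^ ns j * exp (- u * s))"]) simp_all
    then show "ennreal (u ^ (n - 1)) * (\<Prod>j<k. tilted_moment (ns j) u) =
      (\<integral>\<^sup>+a. ennreal (u ^ (n - 1)) * (\<Prod>j<k. ennreal (a j ^ ns j * exp (- u * a j))) \<partial>?P)"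
      by (subst nn_integral_cmult) measurable
  qed
  \<comment> \<open>Tonelli: the bound is uniform in the jumps, so they are integrated last.\<close>
  also have "\<dots> = (\<integral>\<^sup>+a. \<integral>\<^sup>+u. ennreal (u ^ (n - 1)) * (\<Prod>j<k. ennreal (a j ^ ns j * exp (- u * a j))) \<partial>pos_lborel \<partial>?P)"
    by (rule PL.Fubini'[symmetric]) measurable
  also have "\<dots> \<le> (\<integral>\<^sup>+a. fact (n - 1) \<partial>?P)"
  proof (intro nn_integral_mono)
    fix a assume "a \<in> space (?P)"
    then have a: "0 < a i" if "i < k" for i using that by (auto simp: space_PiM space_F PiE_iff)
    define T where "T = (\<Sum>j<k. a j)"
    have aT: "a j \<le> T" if "j < k" for j
      unfolding T_def using that a by (intro member_le_sum) (auto intro: less_imp_le)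
    have T: "0 < T" using aT[of 0] a[of 0] assms by simp
    have "(\<Prod>j<k. a j ^ ns j) \<le> (\<Prod>j<k. T ^ ns j)"
      using a aT by (intro prod_mono conjI power_mono zero_le_power) (auto intro: less_imp_le)
    also have "\<dots> = T ^ n" by (simp add: power_sum[symmetric] assms)
    finally have pT: "(\<Prod>j<k. a j ^ ns j) \<le> T ^ n" .
    have p0: "0 \<le> (\<Prod>j<k. a j ^ ns j)" using a by (intro prod_nonneg) (auto intro: less_imp_le)
    have "(\<integral>\<^sup>+u. ennreal (u ^ (n - 1)) * (\<Prod>j<k. ennreal (a j ^ ns j * exp (- u * a j))) \<partial>pos_lborel) \<le>
      (\<integral>\<^sup>+u. fact (n - 1) * (ennreal (T ^ Suc (n - 1) * u ^ (n - 1) * exp (- u * T) / fact (n - 1)) * 1) \<partial>pos_lborel)"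
    proof (intro nn_integral_mono)
      fix u :: real assume "u \<in> space pos_lborel"
      then have u: "0 < u" by (simp add: space_pos_borel)
      have "(\<Prod>j<k. ennreal (a j ^ ns j * exp (- u * a j))) = ennreal (\<Prod>j<k. a j ^ ns j * exp (- u * a j))"
        using a by (intro prod_ennreal) (auto intro: less_imp_le)
      also have "(\<Prod>j<k. a j ^ ns j * exp (- u * a j)) = (\<Prod>j<k. a j ^ ns j) * exp (- u * T)"
        by (simp add: prod.distrib T_def sum_distrib_left exp_sum[symmetric] sum_negf)
      finally have "ennreal (u ^ (n - 1)) * (\<Prod>j<k. ennreal (a j ^ ns j * exp (- u * a j))) =
        ennreal (u ^ (n - 1) * ((\<Prod>j<k. a j ^ ns j) * exp (- u * T)))"
        using u by (simp add: ennreal_mult')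
      also have "\<dots> \<le> ennreal (u ^ (n - 1) * (T ^ n * exp (- u * T)))"
        using u pT by (intro ennreal_leI mult_left_mono mult_right_mono) auto
      also have "\<dots> = ennreal (fact (n - 1) * (T ^ Suc (n - 1) * u ^ (n - 1) * exp (- u * T) / fact (n - 1)))"
        using assms(2) by (simp add: mult_ac)
      also have "\<dots> = fact (n - 1) * (ennreal (T ^ Suc (n - 1) * u ^ (n - 1) * exp (- u * T) / fact (n - 1)) * 1)"
        using u T by (subst ennreal_mult) (auto simp: ennreal_fact)
      finally show "ennreal (u ^ (n - 1)) * (\<Prod>j<k. ennreal (a j ^ ns j * exp (- u * a j))) \<le>
        fact (n - 1) * (ennreal (T ^ Suc (n - 1) * u ^ (n - 1) * exp (- u * T) / fact (n - 1)) * 1)" .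
    qed
    also have "\<dots> = fact (n - 1) * (\<integral>\<^sup>+u. (ennreal (T ^ Suc (n - 1) * u ^ (n - 1) * exp (- u * T) / fact (n - 1)) * 1) \<partial>pos_lborel)"
      by (rule nn_integral_cmult) measurable
    also have "\<dots> = fact (n - 1) * (\<integral>\<^sup>+\<gamma>. ennreal (erlang_density (n - 1) 1 \<gamma>) * (indicator {0<..} \<gamma> * 1) \<partial>lborel)"
      by (subst nn_integral_erlang_scale[OF T, symmetric]) auto
    also have "\<dots> \<le> fact (n - 1) * (\<integral>\<^sup>+\<gamma>. ennreal (erlang_density (n - 1) 1 \<gamma>) \<partial>lborel)"
      by (intro mult_left_mono nn_integral_mono) (auto simp: indicator_def)
    also have "\<dots> = fact (n - 1)"
    proof -
      have "prob_space (density lborel (erlang_density (n - 1) 1))" by (rule prob_space_erlang_density) simp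
      from prob_space.emeasure_space_1[OF this] show ?thesis by (simp add: emeasure_density)
    qed
    finally show "(\<integral>\<^sup>+u. ennreal (u ^ (n - 1)) * (\<Prod>j<k. ennreal (a j ^ ns j * exp (- u * a j))) \<partial>pos_lborel) \<le> fact (n - 1)" .
  qed
  also have "\<dots> = fact (n - 1)" by (simp add: PK.emeasure_space_1)
  finally show ?thesis .
qed

end

locale marked_jump_distribution = jump_distribution + P0: prob_space P0 for P0 :: "'a measure"
begin

abbreviation atoms_law :: "'i set \<Rightarrow> ('i \<Rightarrow> real \<times> 'a) measure" where
  "atoms_law I \<equiv> Pi\<^sub>M I (\<lambda>_. F \<Otimes>\<^sub>M P0)"

lemma PiM_marked:
  assumes "finite I" "0 < u"
  shows "Pi\<^sub>M I (\<lambda>_. size_biased 0 u \<Otimes>\<^sub>M P0) =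
    density (atoms_law I) (\<lambda>y. \<Prod>i\<in>I. ennreal (exp (- u * fst (y i))) / tilted_moment 0 u)"
proof -
  have eq: "size_biased 0 u \<Otimes>\<^sub>M P0 = density (F \<Otimes>\<^sub>M P0) (\<lambda>z. ennreal (exp (- u * fst z)) / tilted_moment 0 u)"
  proof -
    have "size_biased 0 u \<Otimes>\<^sub>M density P0 (\<lambda>_. 1) =
        density (F \<Otimes>\<^sub>M P0) (\<lambda>(s, t). ennreal (s ^ 0 * exp (- u * s)) / tilted_moment 0 u * 1)"
      unfolding size_biased_def
      by (rule pair_measure_density)
        (auto simp: density_1 intro!: P0.sigma_finite_measure_axioms)
    then show ?thesis by (simp add: density_1 split_beta')
  qed
  have "prob_space (size_biased 0 u \<Otimes>\<^sub>M P0)"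
    by (rule prob_space_pair[OF prob_space_size_biased[OF assms(2)]]) unfold_locales
  then show ?thesis
    unfolding eq using assms prob_space_pair[OF prob_space_axioms P0.prob_space_axioms]
    by (intro PiM_density) auto
qed

lemma measurable_PiM_marked:
  assumes "finite I"
  shows "(\<lambda>u. Pi\<^sub>M I (\<lambda>_. size_biased 0 u \<Otimes>\<^sub>M P0)) \<in> pos_borel \<rightarrow>\<^sub>M prob_algebra (Pi\<^sub>M I (\<lambda>_. pos_borel \<Otimes>\<^sub>M P0))"
proof -
  have "(\<lambda>u. density (atoms_law I) (\<lambda>y. \<Prod>i\<in>I. ennreal (exp (- u * fst (y i))) / tilted_moment 0 u))
    \<in> pos_borel \<rightarrow>\<^sub>M prob_algebra (Pi\<^sub>M I (\<lambda>_. pos_borel \<Otimes>\<^sub>M P0))"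
  proof (rule measurable_density_kernel)
    show "prob_space (atoms_law I)" by (rule prob_space_PiM, rule prob_space_pair) unfold_locales
    show "sets (atoms_law I) = sets (Pi\<^sub>M I (\<lambda>_. pos_borel \<Otimes>\<^sub>M P0))"
      by (intro sets_PiM_cong sets_pair_measure_cong) (auto simp: sets_F)
    have [measurable]: "(\<lambda>x. fst (snd x i)) \<in> pos_borel \<Otimes>\<^sub>M Pi\<^sub>M I (\<lambda>_. pos_borel \<Otimes>\<^sub>M P0) \<rightarrow>\<^sub>M borel" if "i \<in> I" for i
      using that by (intro measurable_compose[OF _ measurable_pos_borel_id]) measurable
    show "(\<lambda>(u, y). \<Prod>i\<in>I. ennreal (exp (- u * fst (y i))) / tilted_moment 0 u)
      \<in> borel_measurable (pos_borel \<Otimes>\<^sub>M Pi\<^sub>M I (\<lambda>_. pos_borel \<Otimes>\<^sub>M P0))"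
      unfolding split_beta' by measurable
    fix u assume "u \<in> space pos_borel"
    then have u: "0 < u" by (simp add: space_pos_borel)
    show "prob_space (density (atoms_law I) (\<lambda>y. \<Prod>i\<in>I. ennreal (exp (- u * fst (y i))) / tilted_moment 0 u))"
      unfolding PiM_marked[OF assms u, symmetric]
      by (intro prob_space_PiM prob_space_pair prob_space_size_biased u P0.prob_space_axioms)
  qed
  then show ?thesis
    by (rule measurable_cong[THEN iffD1, rotated]) (simp add: PiM_marked assms space_pos_borel)
qed

lemma nn_integral_PiM_marked:
  fixes h :: "('i \<Rightarrow> real \<times> 'a) \<Rightarrow> ennreal"
  assumes "finite I" "0 < u" and [measurable]: "h \<in> borel_measurable (Pi\<^sub>M I (\<lambda>_. pos_borel \<Otimes>\<^sub>M P0))"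
  shows "(\<integral>\<^sup>+y. ennreal (\<Prod>i\<in>I. exp (- u * fst (y i))) * h y \<partial>atoms_law I) =
    tilted_moment 0 u ^ card I * (\<integral>\<^sup>+y. h y \<partial>Pi\<^sub>M I (\<lambda>_. size_biased 0 u \<Otimes>\<^sub>M P0))"
proof -
  have [measurable_cong]: "sets (atoms_law I) = sets (Pi\<^sub>M I (\<lambda>_. pos_borel \<Otimes>\<^sub>M P0))"
    by (intro sets_PiM_cong sets_pair_measure_cong) (auto simp: sets_F)
  have [measurable]: "(\<lambda>x. fst (x i)) \<in> Pi\<^sub>M I (\<lambda>_. pos_borel \<Otimes>\<^sub>M P0) \<rightarrow>\<^sub>M borel" if "i \<in> I" for i
    using that by (intro measurable_compose[OF _ measurable_pos_borel_id]) measurable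
  have q: "tilted_moment 0 u * (ennreal x / tilted_moment 0 u) = ennreal x" for x
    using tilted_moment_pos[of 0 u] tilted_moment_finite[OF assms(2), of 0]
    by (metis ennreal_mult_divide_eq ennreal_times_divide infinity_ennreal_def less_irrefl mult.commute)
  have "tilted_moment 0 u ^ card I * (\<integral>\<^sup>+y. h y \<partial>Pi\<^sub>M I (\<lambda>_. size_biased 0 u \<Otimes>\<^sub>M P0)) =
    tilted_moment 0 u ^ card I * (\<integral>\<^sup>+y. (\<Prod>i\<in>I. ennreal (exp (- u * fst (y i))) / tilted_moment 0 u) * h y \<partial>atoms_law I)"
  proof -
    have "h \<in> borel_measurable (atoms_law I)"
      using assms(3) \<open>sets (atoms_law I) = _\<close> by (simp cong: measurable_cong_sets)
    then show ?thesis unfolding PiM_marked[OF assms(1,2)] by (subst nn_integral_density) auto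
  qed
  also have "\<dots> = (\<integral>\<^sup>+y. tilted_moment 0 u ^ card I * ((\<Prod>i\<in>I. ennreal (exp (- u * fst (y i))) / tilted_moment 0 u) * h y) \<partial>atoms_law I)"
    by (rule nn_integral_cmult[symmetric]) measurable
  also have "\<dots> = (\<integral>\<^sup>+y. ennreal (\<Prod>i\<in>I. exp (- u * fst (y i))) * h y \<partial>atoms_law I)"
  proof (intro nn_integral_cong)
    fix y :: "'i \<Rightarrow> real \<times> 'a"
    have "tilted_moment 0 u ^ card I * (\<Prod>i\<in>I. ennreal (exp (- u * fst (y i))) / tilted_moment 0 u) =
      (\<Prod>i\<in>I. tilted_moment 0 u * (ennreal (exp (- u * fst (y i))) / tilted_moment 0 u))"
      by (simp only: prod.distrib prod_constant)
    also have "\<dots> = ennreal (\<Prod>i\<in>I. exp (- u * fst (y i)))"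
      unfolding q by (intro prod_ennreal) auto
    finally show "tilted_moment 0 u ^ card I * ((\<Prod>i\<in>I. ennreal (exp (- u * fst (y i))) / tilted_moment 0 u) * h y) =
      ennreal (\<Prod>i\<in>I. exp (- u * fst (y i))) * h y"
      by (simp add: mult.assoc[symmetric])
  qed
  finally show ?thesis ..
qed

end

section \<open>The sampling model\<close>

text \<open>
  A kernel of probability measures forces the conditioned variable into its space of values, by
  taking that whole space as the event.
\<close>
lemma cond_distr_on_AE_space:
  assumes "prob_space M" and c: "cond_distr_on M E X MX Y MY K" and E: "E \<in> sets M"
  shows "AE \<omega> in M. \<omega> \<in> E \<longrightarrow> X \<omega> \<in> space MX"
proof -
  interpret prob_space M by fact
  define G where "G = {\<omega>\<in>E. X \<omega> \<in> space MX \<and> Y \<omega> \<in> space MY}"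
  have K: "K \<in> MY \<rightarrow>\<^sub>M prob_algebra MX" and AEY: "AE \<omega> in M. \<omega> \<in> E \<longrightarrow> Y \<omega> \<in> space MY"
    and YB: "{\<omega>\<in>E. Y \<omega> \<in> space MY} \<in> sets M" and G: "G \<in> sets M"
    and eq: "emeasure M G = (\<integral>\<^sup>+\<omega>. emeasure (K (Y \<omega>)) (space MX) * indicator {\<omega>\<in>E. Y \<omega> \<in> space MY} \<omega> \<partial>M)"
    using c unfolding cond_distr_on_def G_def by auto
  note eq
  also have "\<dots> = (\<integral>\<^sup>+\<omega>. indicator E \<omega> \<partial>M)"
  proof (rule nn_integral_cong_AE, rule AE_mp[OF AEY], rule AE_I2, rule impI)
    fix \<omega> assume *: "\<omega> \<in> E \<longrightarrow> Y \<omega> \<in> space MY"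
    have "emeasure (K (Y \<omega>)) (space MX) = 1" if "\<omega> \<in> E"
    proof -
      have "K (Y \<omega>) \<in> space (prob_algebra MX)" using measurable_space[OF K] * that by auto
      then have "prob_space (K (Y \<omega>))" "space (K (Y \<omega>)) = space MX"
        by (auto simp: space_prob_algebra dest: sets_eq_imp_space_eq)
      then show ?thesis using prob_space.emeasure_space_1 by metis
    qed
    then show "emeasure (K (Y \<omega>)) (space MX) * indicator {\<omega> \<in> E. Y \<omega> \<in> space MY} \<omega> = indicator E \<omega>"
      using * by (auto simp: indicator_def)
  qed
  also have "\<dots> = emeasure M E" using E by simp
  finally have "emeasure M (E - G) = 0"
    using G E by (subst emeasure_Diff) (auto simp: G_def emeasure_eq_measure)
  then have "AE \<omega> in M. \<omega> \<notin> E - G" using G E by (intro AE_not_in) (auto simp: null_sets_def)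
  then show ?thesis by eventually_elim (auto simp: G_def)
qed

text \<open>
  The intensity of the process enters only through the law \<open>F\<close> of a jump and the mean \<open>\<Lambda>\<close> of \<open>N\<close>,
  and non-atomicity in the form that \<open>P0\<close> charges no point.
\<close>
locale crm_sampling = marked_jump_distribution F P0 + M: prob_space M
  for F :: "real measure" and P0 :: "('a :: {second_countable_topology, metric_space}) measure"
    and M :: "'w measure" +
  fixes \<Lambda> :: real and N :: "'w \<Rightarrow> nat" and J :: "nat \<Rightarrow> 'w \<Rightarrow> real" and \<tau> \<theta> :: "nat \<Rightarrow> 'w \<Rightarrow> 'a"
    and \<Gamma> :: "'w \<Rightarrow> real" and n k :: nat and ns :: "nat \<Rightarrow> nat"
  assumes P0_id [measurable]: "(\<lambda>x. x) \<in> P0 \<rightarrow>\<^sub>M borel"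
    and P0_singleton [measurable]: "\<And>x. x \<in> space P0 \<Longrightarrow> {x} \<in> sets P0"
    and P0_null: "\<And>x. x \<in> space P0 \<Longrightarrow> emeasure P0 {x} = 0"
    and \<Lambda>: "0 < \<Lambda>" and n: "1 \<le> n" and k: "1 \<le> k" and ns: "(\<Sum>j<k. ns j) = n"
    and N [measurable]: "N \<in> M \<rightarrow>\<^sub>M count_space UNIV"
    and J [measurable]: "\<And>j. J j \<in> borel_measurable M"
    and \<tau> [measurable]: "\<And>j. \<tau> j \<in> M \<rightarrow>\<^sub>M P0"
    and N_law: "distr M (count_space UNIV) N = measure_pmf (poisson_pmf \<Lambda>)"
    and jumps: "\<And>m. cond_distr_on M {\<omega>\<in>space M. N \<omega> = m}
        (\<lambda>\<omega>. \<lambda>j\<in>{..m}. (J j \<omega>, \<tau> j \<omega>)) (Pi\<^sub>M {..m} (\<lambda>_. pos_borel \<Otimes>\<^sub>M P0))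
        N (count_space UNIV) (\<lambda>_. atoms_law {..m})"
    and sample: "crm_sample M P0 N J \<tau> n \<theta>"
    and \<Gamma>_law: "distributed M lborel \<Gamma> (erlang_density (n - 1) 1)"
    and \<Gamma>_indep: "M.indep_set
           (sets (vimage_algebra (space M) \<Gamma> borel))
           (sets (vimage_algebra (space M)
              (\<lambda>\<omega>. (N \<omega>, \<lambda>j. (J j \<omega>, \<tau> j \<omega>), \<lambda>i\<in>{..<n}. \<theta> i \<omega>))
              (count_space UNIV \<Otimes>\<^sub>M Pi\<^sub>M UNIV (\<lambda>_. borel \<Otimes>\<^sub>M P0) \<Otimes>\<^sub>M Pi\<^sub>M {..<n} (\<lambda>_. P0))))"
begin

lemma \<theta> [measurable]: "i < n \<Longrightarrow> \<theta> i \<in> M \<rightarrow>\<^sub>M P0"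
  using sample by (auto simp: crm_sample_def)

lemma \<Gamma> [measurable]: "\<Gamma> \<in> borel_measurable M"
  using distributed_measurable[OF \<Gamma>_law] by simp

abbreviation MX :: "nat \<Rightarrow> (nat \<Rightarrow> real \<times> 'a) measure" where
  "MX m \<equiv> Pi\<^sub>M {..m} (\<lambda>_. pos_borel \<Otimes>\<^sub>M P0)"

abbreviation M\<theta> :: "(nat \<Rightarrow> 'a) measure" where
  "M\<theta> \<equiv> Pi\<^sub>M {..<n} (\<lambda>_. P0)"

abbreviation number_event :: "nat \<Rightarrow> 'w set" where
  "number_event m \<equiv> {\<omega>\<in>space M. N \<omega> = m}"

text \<open>
  A jump may fail to be positive on a null set, which would take it out of \<^term>\<open>pos_borel\<close>.  The value \<open>1\<close>
  there is arbitrary; it yields variables that are measurable everywhere.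
\<close>
definition pos_jump :: "nat \<Rightarrow> 'w \<Rightarrow> real" where
  "pos_jump j \<omega> = (if 0 < J j \<omega> then J j \<omega> else 1)"

definition pos_atoms :: "nat \<Rightarrow> 'w \<Rightarrow> nat \<Rightarrow> real \<times> 'a" where
  "pos_atoms m \<omega> = (\<lambda>j\<in>{..m}. (pos_jump j \<omega>, \<tau> j \<omega>))"

definition sample_fun :: "'w \<Rightarrow> nat \<Rightarrow> 'a" where
  "sample_fun \<omega> = (\<lambda>i\<in>{..<n}. \<theta> i \<omega>)"

definition jumps_law :: "nat \<Rightarrow> (nat \<Rightarrow> real \<times> 'a) measure" where
  "jumps_law m = atoms_law {..m}"

definition sample_kernel :: "nat \<Rightarrow> (nat \<Rightarrow> real \<times> 'a) \<Rightarrow> (nat \<Rightarrow> 'a) measure" where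
  "sample_kernel m x = Pi\<^sub>M {..<n} (\<lambda>_. norm_atoms P0 {..m} (\<lambda>j. fst (x j)) (\<lambda>j. snd (x j)))"

lemma sets_jumps_law [simp, measurable_cong]: "sets (jumps_law m) = sets (MX m)"
  unfolding jumps_law_def by (intro sets_PiM_cong sets_pair_measure_cong) (auto simp: sets_F)

lemma space_jumps_law: "space (jumps_law m) = space (MX m)"
  by (rule sets_eq_imp_space_eq) simp

lemma prob_space_marked: "prob_space (F \<Otimes>\<^sub>M P0)"
  by (rule prob_space_pair) unfold_locales

lemma prob_space_jumps_law: "prob_space (jumps_law m)"
  unfolding jumps_law_def by (rule prob_space_PiM) (rule prob_space_marked)

lemma measurable_MX [measurable (raw)]:
  assumes "f \<in> A \<rightarrow>\<^sub>M MX m" "j \<le> m"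
  shows "(\<lambda>x. fst (f x j)) \<in> borel_measurable A" "(\<lambda>x. snd (f x j)) \<in> A \<rightarrow>\<^sub>M P0"
    "(\<lambda>x. fst (f x j)) \<in> A \<rightarrow>\<^sub>M pos_borel"
proof -
  have *: "(\<lambda>x. f x j) \<in> A \<rightarrow>\<^sub>M pos_borel \<Otimes>\<^sub>M P0"
    using assms by (intro measurable_compose[OF assms(1)] measurable_component_singleton) auto
  show "(\<lambda>x. snd (f x j)) \<in> A \<rightarrow>\<^sub>M P0" "(\<lambda>x. fst (f x j)) \<in> A \<rightarrow>\<^sub>M pos_borel"
    using * by measurable
  from measurable_compose[OF this(2) measurable_pos_borel_id]
  show "(\<lambda>x. fst (f x j)) \<in> borel_measurable A" .
qed

lemma space_MX: "x \<in> space (MX m) \<Longrightarrow> j \<le> m \<Longrightarrow> 0 < fst (x j) \<and> snd (x j) \<in> space P0"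
  by (auto simp: space_PiM PiE_iff space_pair_measure space_pos_borel mem_Times_iff)

lemma pos_atoms [measurable]: "pos_atoms m \<in> M \<rightarrow>\<^sub>M MX m"
proof -
  have "pos_jump j \<in> M \<rightarrow>\<^sub>M pos_borel" for j
    unfolding pos_jump_def[abs_def] by (rule measurable_restrict_space2) auto
  then show ?thesis unfolding pos_atoms_def by measurable
qed

lemma sample_fun [measurable]: "sample_fun \<in> M \<rightarrow>\<^sub>M M\<theta>"
  unfolding sample_fun_def by (rule measurable_restrict) simp

lemma number_event [measurable]: "number_event m \<in> sets M"
  by measurable

lemma AE_jumps_pos: "AE \<omega> in M. \<forall>j\<le>N \<omega>. 0 < J j \<omega>"
proof -
  have "AE \<omega> in M. \<forall>m. \<omega> \<in> number_event m \<longrightarrow> (\<lambda>j\<in>{..m}. (J j \<omega>, \<tau> j \<omega>)) \<in> space (MX m)"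
    unfolding AE_all_countable
    using cond_distr_on_AE_space[OF M.prob_space_axioms jumps number_event] by blast
  with AE_space show ?thesis
  proof eventually_elim
    case (elim \<omega>)
    have "(\<lambda>j\<in>{..N \<omega>}. (J j \<omega>, \<tau> j \<omega>)) \<in> space (MX (N \<omega>))" using elim by auto
    from space_MX[OF this] show ?case by auto
  qed
qed

lemma pos_atoms_eq: "\<forall>j\<le>N \<omega>. 0 < J j \<omega> \<Longrightarrow> (\<lambda>j\<in>{..N \<omega>}. (J j \<omega>, \<tau> j \<omega>)) = pos_atoms (N \<omega>) \<omega>"
  by (auto simp: pos_atoms_def pos_jump_def)

lemma AE_pos_atoms: "AE \<omega> in M. \<omega> \<in> number_event m \<longrightarrow> (\<lambda>j\<in>{..m}. (J j \<omega>, \<tau> j \<omega>)) = pos_atoms m \<omega>"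
  using AE_jumps_pos by eventually_elim (auto simp: pos_atoms_eq)

lemma emeasure_number_event: "emeasure M (number_event m) = ennreal (pmf (poisson_pmf \<Lambda>) m)"
proof -
  have "emeasure (distr M (count_space UNIV) N) {m} = emeasure M (number_event m)"
    by (subst emeasure_distr) (auto intro!: arg_cong[where f="emeasure M"])
  then show ?thesis by (simp add: N_law emeasure_pmf_single)
qed

lemma nn_integral_jumps:
  assumes [measurable]: "g \<in> borel_measurable (MX m)"
  shows "(\<integral>\<^sup>+\<omega>. indicator (number_event m) \<omega> * g (pos_atoms m \<omega>) \<partial>M) = ennreal (pmf (poisson_pmf \<Lambda>) m) * (\<integral>\<^sup>+x. g x \<partial>jumps_law m)"
proof -
  have "(\<integral>\<^sup>+\<omega>. indicator (number_event m) \<omega> * (\<lambda>(x, y). g x) (pos_atoms m \<omega>, N \<omega>) \<partial>M) =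
    (\<integral>\<^sup>+\<omega>. indicator (number_event m) \<omega> * (\<integral>\<^sup>+x. (\<lambda>(x, y). g x) (x, N \<omega>) \<partial>atoms_law {..m}) \<partial>M)"
    by (rule nn_integral_cond_distr_on[OF M.prob_space_axioms number_event jumps pos_atoms N AE_pos_atoms]) auto
  also have "\<dots> = (\<integral>\<^sup>+x. g x \<partial>jumps_law m) * emeasure M (number_event m)"
    unfolding jumps_law_def by (subst mult.commute) (simp add: nn_integral_cmult_indicator)
  finally show ?thesis by (simp add: emeasure_number_event mult.commute)
qed

lemma sample_cond:
  "cond_distr_on M (number_event m) sample_fun M\<theta> (\<lambda>\<omega>. \<lambda>j\<in>{..m}. (J j \<omega>, \<tau> j \<omega>)) (MX m) (sample_kernel m)"
  using sample unfolding crm_sample_def sample_fun_def[abs_def] sample_kernel_def[abs_def] by simp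

lemma measurable_sample_kernel: "sample_kernel m \<in> MX m \<rightarrow>\<^sub>M prob_algebra M\<theta>"
  using sample_cond by (simp add: cond_distr_on_def)

lemma nn_integral_sample:
  assumes [measurable]: "g \<in> borel_measurable (M\<theta> \<Otimes>\<^sub>M MX m)"
  shows "(\<integral>\<^sup>+\<omega>. indicator (number_event m) \<omega> * g (sample_fun \<omega>, pos_atoms m \<omega>) \<partial>M) =
    ennreal (pmf (poisson_pmf \<Lambda>) m) * (\<integral>\<^sup>+x. \<integral>\<^sup>+t. g (t, x) \<partial>sample_kernel m x \<partial>jumps_law m)"
proof -
  have "(\<integral>\<^sup>+\<omega>. indicator (number_event m) \<omega> * g (sample_fun \<omega>, pos_atoms m \<omega>) \<partial>M) =
    (\<integral>\<^sup>+\<omega>. indicator (number_event m) \<omega> * (\<integral>\<^sup>+t. g (t, pos_atoms m \<omega>) \<partial>sample_kernel m (pos_atoms m \<omega>)) \<partial>M)"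
    by (rule nn_integral_cond_distr_on[OF M.prob_space_axioms number_event sample_cond sample_fun pos_atoms _ AE_pos_atoms]) auto
  also have "\<dots> = ennreal (pmf (poisson_pmf \<Lambda>) m) * (\<integral>\<^sup>+x. \<integral>\<^sup>+t. g (t, x) \<partial>sample_kernel m x \<partial>jumps_law m)"
  proof (rule nn_integral_jumps)
    show "(\<lambda>x. \<integral>\<^sup>+t. g (t, x) \<partial>sample_kernel m x) \<in> borel_measurable (MX m)"
      by (rule nn_integral_measurable_subprob_algebra2[OF _ measurable_prob_algebraD[OF measurable_sample_kernel]]) measurable
  qed
  finally show ?thesis .
qed

definition gamma_law :: "real measure" where
  "gamma_law = density lborel (\<lambda>x. ennreal (erlang_density (n - 1) 1 x))"

lemma sets_gamma_law [simp, measurable_cong]: "sets gamma_law = sets borel"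
  by (simp add: gamma_law_def)

lemma prob_space_gamma_law: "prob_space gamma_law"
  unfolding gamma_law_def by (rule prob_space_erlang_density) simp

text \<open>
  The variables generate the process: given \<open>N = m\<close>, first the atoms, then the sample, and independently
  of both the gamma variable.
\<close>
lemma nn_integral_sample_gamma:
  assumes [measurable]: "g \<in> borel_measurable ((M\<theta> \<Otimes>\<^sub>M MX m) \<Otimes>\<^sub>M borel)"
  shows "(\<integral>\<^sup>+\<omega>. indicator (number_event m) \<omega> * g ((sample_fun \<omega>, pos_atoms m \<omega>), \<Gamma> \<omega>) \<partial>M) =
    ennreal (pmf (poisson_pmf \<Lambda>) m) * (\<integral>\<^sup>+x. \<integral>\<^sup>+t. \<integral>\<^sup>+\<gamma>. g ((t, x), \<gamma>) \<partial>gamma_law \<partial>sample_kernel m x \<partial>jumps_law m)"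
proof -
  \<comment> \<open>By independence \<open>\<Gamma>\<close> and \<open>V\<close> have a product law; the sample and the corrected atoms are the
    function \<open>\<Phi>\<close> of \<open>V\<close>.\<close>
  define V where "V = (\<lambda>\<omega>. (N \<omega>, \<lambda>j. (J j \<omega>, \<tau> j \<omega>), \<lambda>i\<in>{..<n}. \<theta> i \<omega>))"
  define MV where "MV = count_space (UNIV :: nat set) \<Otimes>\<^sub>M Pi\<^sub>M (UNIV :: nat set) (\<lambda>_. (borel :: real measure) \<Otimes>\<^sub>M P0) \<Otimes>\<^sub>M M\<theta>"
  have V [measurable]: "V \<in> M \<rightarrow>\<^sub>M MV"
    unfolding V_def MV_def
    by (intro measurable_Pair measurable_PiM_single' measurable_restrict) (auto simp: space_pair_measure measurable_space[OF \<tau>])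
  define \<Phi> where "\<Phi> = (\<lambda>v :: nat \<times> (nat \<Rightarrow> real \<times> 'a) \<times> (nat \<Rightarrow> 'a). ((snd (snd v), \<lambda>j\<in>{..m}. (if 0 < fst (fst (snd v) j) then fst (fst (snd v) j) else (1::real), snd (fst (snd v) j)))))"
  have \<Phi> [measurable]: "\<Phi> \<in> MV \<rightarrow>\<^sub>M M\<theta> \<Otimes>\<^sub>M MX m"
    unfolding \<Phi>_def
  proof (intro measurable_Pair measurable_restrict)
    show "(\<lambda>x. snd (snd x)) \<in> MV \<rightarrow>\<^sub>M M\<theta>" unfolding MV_def by measurable
    fix j :: nat
    have *: "(\<lambda>v. fst (snd v) j) \<in> MV \<rightarrow>\<^sub>M borel \<Otimes>\<^sub>M P0" unfolding MV_def by measurable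
    show "(\<lambda>v. snd (fst (snd v) j)) \<in> MV \<rightarrow>\<^sub>M P0" using * by measurable
    have [measurable]: "(\<lambda>v. fst (fst (snd v) j)) \<in> borel_measurable MV" using * by measurable
    show "(\<lambda>v. if 0 < fst (fst (snd v) j) then fst (fst (snd v) j) else 1) \<in> MV \<rightarrow>\<^sub>M pos_borel"
      by (rule measurable_restrict_space2) auto
  qed
  have \<Phi>V: "\<Phi> (V \<omega>) = (sample_fun \<omega>, pos_atoms m \<omega>)" for \<omega>
    by (simp add: \<Phi>_def V_def sample_fun_def pos_atoms_def pos_jump_def cong: if_cong)
  have fV: "fst (V \<omega>) = N \<omega>" for \<omega> by (simp add: V_def)
  have fst_MV [measurable]: "fst \<in> MV \<rightarrow>\<^sub>M count_space UNIV" unfolding MV_def by measurable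
  interpret DV: prob_space "distr M MV V" by (rule M.prob_space_distr) measurable
  interpret D\<Gamma>: prob_space "distr M borel \<Gamma>" by (rule M.prob_space_distr) measurable
  have eq: "distr M borel \<Gamma> \<Otimes>\<^sub>M distr M MV V = distr M (borel \<Otimes>\<^sub>M MV) (\<lambda>\<omega>. (\<Gamma> \<omega>, V \<omega>))"
  proof (rule pair_measure_eqI)
    fix A B assume "A \<in> sets (distr M borel \<Gamma>)" "B \<in> sets (distr M MV V)"
    then have A [measurable]: "A \<in> sets borel" and B [measurable]: "B \<in> sets MV" by auto
    have "M.prob ((\<Gamma> -` A \<inter> space M) \<inter> (V -` B \<inter> space M)) = M.prob (\<Gamma> -` A \<inter> space M) * M.prob (V -` B \<inter> space M)"
      by (rule M.indep_setD[OF \<Gamma>_indep])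
        (use A B in \<open>auto simp: V_def[symmetric] MV_def[symmetric] intro!: in_vimage_algebra\<close>)
    moreover have "(\<lambda>\<omega>. (\<Gamma> \<omega>, V \<omega>)) -` (A \<times> B) \<inter> space M = (\<Gamma> -` A \<inter> space M) \<inter> (V -` B \<inter> space M)" by auto
    ultimately show "emeasure (distr M borel \<Gamma>) A * emeasure (distr M MV V) B =
        emeasure (distr M (borel \<Otimes>\<^sub>M MV) (\<lambda>\<omega>. (\<Gamma> \<omega>, V \<omega>))) (A \<times> B)"
      by (simp add: emeasure_distr M.emeasure_eq_measure ennreal_mult)
  qed (auto intro: DV.sigma_finite_measure_axioms D\<Gamma>.sigma_finite_measure_axioms)
  have g: "distr M borel \<Gamma> = gamma_law"
    using distributed_distr_eq_density[OF \<Gamma>_law] by (simp add: gamma_law_def cong: distr_cong)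
  interpret G: prob_space gamma_law by (rule prob_space_gamma_law)
  interpret GD: pair_sigma_finite gamma_law "distr M MV V" ..
  define H where "H = (\<lambda>z. indicator {m} (fst (snd z)) * g (\<Phi> (snd z), fst z) :: ennreal)"
  have "(\<lambda>z. (\<Phi> (snd z), fst z)) \<in> borel \<Otimes>\<^sub>M MV \<rightarrow>\<^sub>M (M\<theta> \<Otimes>\<^sub>M MX m) \<Otimes>\<^sub>M borel"
    by (intro measurable_Pair measurable_compose[OF measurable_snd \<Phi>] measurable_fst)
  from measurable_compose[OF this assms]
  have m1: "(\<lambda>z. g (\<Phi> (snd z), fst z)) \<in> borel_measurable (borel \<Otimes>\<^sub>M MV)" .
  have m2: "(\<lambda>z. indicator {m} (fst (snd z)) :: ennreal) \<in> borel_measurable (borel \<Otimes>\<^sub>M MV)"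
    by (rule measurable_compose[OF measurable_compose[OF measurable_snd fst_MV]]) simp
  have H [measurable]: "H \<in> borel_measurable (borel \<Otimes>\<^sub>M MV)" unfolding H_def using m1 m2 by measurable
  have "(\<integral>\<^sup>+\<omega>. indicator (number_event m) \<omega> * g ((sample_fun \<omega>, pos_atoms m \<omega>), \<Gamma> \<omega>) \<partial>M) = (\<integral>\<^sup>+\<omega>. H (\<Gamma> \<omega>, V \<omega>) \<partial>M)"
    by (intro nn_integral_cong) (auto simp: H_def \<Phi>V indicator_def fV)
  also have "\<dots> = (\<integral>\<^sup>+z. H z \<partial>distr M (borel \<Otimes>\<^sub>M MV) (\<lambda>\<omega>. (\<Gamma> \<omega>, V \<omega>)))"
    by (rule nn_integral_distr[symmetric]) measurable
  also have "\<dots> = (\<integral>\<^sup>+z. H z \<partial>(gamma_law \<Otimes>\<^sub>M distr M MV V))"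
    by (simp add: eq[symmetric] g)
  also have "\<dots> = (\<integral>\<^sup>+v. \<integral>\<^sup>+\<gamma>. H (\<gamma>, v) \<partial>gamma_law \<partial>distr M MV V)"
    by (rule GD.nn_integral_snd[symmetric]) measurable
  also have "\<dots> = (\<integral>\<^sup>+\<omega>. \<integral>\<^sup>+\<gamma>. H (\<gamma>, V \<omega>) \<partial>gamma_law \<partial>M)"
    by (rule nn_integral_distr) measurable
  also have "\<dots> = (\<integral>\<^sup>+\<omega>. indicator (number_event m) \<omega> * (\<integral>\<^sup>+\<gamma>. g ((sample_fun \<omega>, pos_atoms m \<omega>), \<gamma>) \<partial>gamma_law) \<partial>M)"
    by (intro nn_integral_cong) (auto simp: H_def \<Phi>V indicator_def fV)
  also have "\<dots> = ennreal (pmf (poisson_pmf \<Lambda>) m) * (\<integral>\<^sup>+x. \<integral>\<^sup>+t. \<integral>\<^sup>+\<gamma>. g ((t, x), \<gamma>) \<partial>gamma_law \<partial>sample_kernel m x \<partial>jumps_law m)"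
    by (rule nn_integral_sample[of "\<lambda>z. \<integral>\<^sup>+\<gamma>. g (z, \<gamma>) \<partial>gamma_law"]) measurable
  finally show ?thesis .
qed

text \<open>
  Given the location of atom \<open>i\<close>, that of atom \<open>j\<close> hits it with probability \<open>0\<close>, since \<open>P0\<close> charges no
  point.
\<close>
lemma AE_atoms_distinct_law: "AE x in jumps_law m. inj_on (\<lambda>j. snd (x j)) {..m}"
proof -
  have "AE x in jumps_law m. snd (x i) \<noteq> snd (x j)" if ij: "i \<le> m" "j \<le> m" "i \<noteq> j" for i j
  proof -
    \<comment> \<open>Equality is written as a vanishing distance, which is a measurable condition.\<close>
    define H :: "(nat \<Rightarrow> real \<times> 'a) \<times> (nat \<Rightarrow> real \<times> 'a) \<Rightarrow> ennreal" where
      "H = (\<lambda>(a, y). of_bool (dist (snd (a i)) (snd (y j)) = 0))"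
    have mi: "(\<lambda>z. snd (fst z i)) \<in> atoms_law {i} \<Otimes>\<^sub>M atoms_law ({..m} - {i}) \<rightarrow>\<^sub>M borel"
      by (rule measurable_compose[OF _ P0_id]) measurable
    have mj: "(\<lambda>z. snd (snd z j)) \<in> atoms_law {i} \<Otimes>\<^sub>M atoms_law ({..m} - {i}) \<rightarrow>\<^sub>M borel"
      using ij by (intro measurable_compose[OF _ P0_id]) measurable
    have H: "H \<in> borel_measurable (atoms_law {i} \<Otimes>\<^sub>M atoms_law ({..m} - {i}))"
      unfolding H_def split_beta' using borel_measurable_dist[OF mi mj] by measurable
    have "(\<integral>\<^sup>+x. of_bool (snd (x i) = snd (x j)) \<partial>jumps_law m) =
      (\<integral>\<^sup>+x. H (\<lambda>i'\<in>{i}. x (id i'), \<lambda>j'\<in>{..m} - {i}. x (id j')) \<partial>jumps_law m)"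
      using ij by (simp add: H_def)
    also have "\<dots> = (\<integral>\<^sup>+a. \<integral>\<^sup>+y. H (a, y) \<partial>atoms_law ({..m} - {i}) \<partial>atoms_law {i})"
      unfolding jumps_law_def
      by (rule nn_integral_PiM_split[OF prob_space_marked _ _ _ _ _ H]) (use ij in auto)
    also have "\<dots> = (\<integral>\<^sup>+a. 0 \<partial>atoms_law {i})"
    proof (intro nn_integral_cong)
      fix a assume "a \<in> space (atoms_law {i})"
      then have a: "snd (a i) \<in> space P0" by (auto simp: space_PiM space_pair_measure PiE_iff mem_Times_iff)
      have "emeasure (F \<Otimes>\<^sub>M P0) (space F \<times> {snd (a i)}) = 0"
        using a P0_null by (subst P0.emeasure_pair_measure_Times) auto
      then have "space F \<times> {snd (a i)} \<in> null_sets (F \<Otimes>\<^sub>M P0)"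
        using a by (intro null_setsI) (auto intro: pair_measureI)
      then have "AE z in F \<Otimes>\<^sub>M P0. snd (a i) \<noteq> snd z"
        by (rule AE_I') (auto simp: space_pair_measure)
      then have "AE y in atoms_law ({..m} - {i}). snd (a i) \<noteq> snd (y j)"
        using ij prob_space_marked by (intro AE_PiM_component) auto
      then have "AE y in atoms_law ({..m} - {i}). H (a, y) = 0"
        by eventually_elim (simp add: H_def)
      from nn_integral_cong_AE[OF this]
      show "(\<integral>\<^sup>+y. H (a, y) \<partial>atoms_law ({..m} - {i})) = 0" by simp
    qed
    finally have z: "(\<integral>\<^sup>+x. of_bool (snd (x i) = snd (x j)) \<partial>jumps_law m) = (0 :: ennreal)" by simp
    have mi: "(\<lambda>x. snd (x i)) \<in> borel_measurable (jumps_law m)" "(\<lambda>x. snd (x j)) \<in> borel_measurable (jumps_law m)"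
      using ij by (auto intro!: measurable_compose[OF _ P0_id])
    have "(\<lambda>x. of_bool (snd (x i) = snd (x j)) :: ennreal) \<in> borel_measurable (jumps_law m)"
    proof -
      have "(\<lambda>x. of_bool (dist (snd (x i)) (snd (x j)) = 0) :: ennreal) \<in> borel_measurable (jumps_law m)"
        using borel_measurable_dist[OF mi] by measurable
      then show ?thesis by simp
    qed
    then have "AE x in jumps_law m. of_bool (snd (x i) = snd (x j)) = (0 :: ennreal)"
      using z by (subst (asm) nn_integral_0_iff_AE) auto
    then show ?thesis by eventually_elim auto
  qed
  then have "AE x in jumps_law m. \<forall>i\<in>{..m}. \<forall>j\<in>{..m}. i \<noteq> j \<longrightarrow> snd (x i) \<noteq> snd (x j)"
    by (intro AE_finite_allI) auto
  then show ?thesis by eventually_elim (auto simp: inj_on_def)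
qed

end

section \<open>The probability of an allocation\<close>

text \<open>
  The increasing enumeration of the indices of the non-allocated atoms.
\<close>
definition rest :: "nat \<Rightarrow> nat \<Rightarrow> (nat \<Rightarrow> nat) \<Rightarrow> nat \<Rightarrow> nat" where
  "rest m k l j = sorted_list_of_set ({..m} - l ` {..<k}) ! j"

lemma bij_betw_rest:
  assumes "l \<in> injections k m"
  shows "bij_betw (rest m k l) {..<m + 1 - k} ({..m} - l ` {..<k})"
proof -
  have "card ({..m} - l ` {..<k}) = m + 1 - k"
    using injectionsD(1,2)[OF assms] by (subst card_Diff_subset) (auto simp: card_image)
  then show ?thesis
    unfolding rest_def[abs_def] by (intro bij_betw_nth) auto
qed

context crm_sampling
begin

lemma AE_number_event_jumps:
  assumes "AE x in jumps_law m. P x"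
  shows "AE \<omega> in M. \<omega> \<in> number_event m \<longrightarrow> P (pos_atoms m \<omega>)"
proof -
  obtain Z where Z: "{x \<in> space (jumps_law m). \<not> P x} \<subseteq> Z" "emeasure (jumps_law m) Z = 0" "Z \<in> sets (jumps_law m)"
    using AE_E[OF assms] by blast
  have [measurable]: "Z \<in> sets (MX m)" using Z(3) by simp
  have "(\<integral>\<^sup>+\<omega>. indicator (number_event m) \<omega> * indicator Z (pos_atoms m \<omega>) \<partial>M) =
    ennreal (pmf (poisson_pmf \<Lambda>) m) * (\<integral>\<^sup>+x. indicator Z x \<partial>jumps_law m)"
    by (rule nn_integral_jumps) measurable
  also have "\<dots> = 0" using Z by simp
  finally have "AE \<omega> in M. indicator (number_event m) \<omega> * indicator Z (pos_atoms m \<omega>) = (0 :: ennreal)"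
    by (subst (asm) nn_integral_0_iff_AE) auto
  with AE_space show ?thesis
  proof eventually_elim
    case (elim \<omega>)
    have "pos_atoms m \<omega> \<in> space (jumps_law m)" using measurable_space[OF pos_atoms elim(1)] by (simp add: space_jumps_law)
    then show ?case using elim Z(1) by (auto simp: indicator_def split: if_splits)
  qed
qed

lemma prob_space_atoms:
  assumes "x \<in> space (MX m)"
  shows "prob_space (norm_atoms P0 {..m} (\<lambda>j. fst (x j)) (\<lambda>j. snd (x j)))"
  using space_MX[OF assms] by (intro prob_space_norm_atoms) auto

lemma dist_MX_measurable:
  assumes "i < n" "j \<le> m"
  shows "(\<lambda>z. dist (fst z i) (snd (snd z j))) \<in> borel_measurable (M\<theta> \<Otimes>\<^sub>M MX m)"
proof (rule borel_measurable_dist)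
  have "(\<lambda>z. fst z i) \<in> M\<theta> \<Otimes>\<^sub>M MX m \<rightarrow>\<^sub>M P0"
    using assms by (intro measurable_compose[OF measurable_fst measurable_component_singleton]) auto
  from measurable_compose[OF this P0_id] show "(\<lambda>z. fst z i) \<in> borel_measurable (M\<theta> \<Otimes>\<^sub>M MX m)" .
  have "(\<lambda>z. snd (snd z j)) \<in> M\<theta> \<Otimes>\<^sub>M MX m \<rightarrow>\<^sub>M P0" by (rule measurable_MX(2)[OF measurable_snd assms(2)])
  from measurable_compose[OF this P0_id] show "(\<lambda>z. snd (snd z j)) \<in> borel_measurable (M\<theta> \<Otimes>\<^sub>M MX m)" .
qed

text \<open>
  Given the atoms, an observation has a discrete law concentrated on their finitely many locations.
\<close>
lemma AE_sample_atoms: "AE \<omega> in M. \<omega> \<in> number_event m \<longrightarrow> (\<forall>i<n. \<theta> i \<omega> \<in> (\<lambda>j. \<tau> j \<omega>) ` {..m})"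
proof -
  define g :: "(nat \<Rightarrow> 'a) \<times> (nat \<Rightarrow> real \<times> 'a) \<Rightarrow> ennreal" where
    "g = (\<lambda>z. of_bool (\<exists>i\<in>{..<n}. \<forall>j\<in>{..m}. dist (fst z i) (snd (snd z j)) \<noteq> 0))"
  have [measurable]: "Measurable.pred (M\<theta> \<Otimes>\<^sub>M MX m) (\<lambda>z. \<exists>i\<in>{..<n}. \<forall>j\<in>{..m}. dist (fst z i) (snd (snd z j)) \<noteq> 0)"
  proof (intro pred_intros_finite finite_lessThan finite_atMost)
    fix i j assume "i \<in> {..<n}" "j \<in> {..m}"
    then have [measurable]: "(\<lambda>z. dist (fst z i) (snd (snd z j))) \<in> borel_measurable (M\<theta> \<Otimes>\<^sub>M MX m)"
      by (intro dist_MX_measurable) auto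
    show "Measurable.pred (M\<theta> \<Otimes>\<^sub>M MX m) (\<lambda>z. dist (fst z i) (snd (snd z j)) \<noteq> 0)"
      by measurable
  qed
  have g [measurable]: "g \<in> borel_measurable (M\<theta> \<Otimes>\<^sub>M MX m)"
    unfolding g_def by measurable
  have "(\<integral>\<^sup>+\<omega>. indicator (number_event m) \<omega> * g (sample_fun \<omega>, pos_atoms m \<omega>) \<partial>M) =
    ennreal (pmf (poisson_pmf \<Lambda>) m) * (\<integral>\<^sup>+x. \<integral>\<^sup>+t. g (t, x) \<partial>sample_kernel m x \<partial>jumps_law m)"
    by (rule nn_integral_sample) measurable
  also have "(\<integral>\<^sup>+x. \<integral>\<^sup>+t. g (t, x) \<partial>sample_kernel m x \<partial>jumps_law m) = (\<integral>\<^sup>+x. 0 \<partial>jumps_law m)"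
  proof (intro nn_integral_cong)
    fix x assume "x \<in> space (jumps_law m)"
    then have x: "x \<in> space (MX m)" by (simp add: space_jumps_law)
    let ?A = "norm_atoms P0 {..m} (\<lambda>j. fst (x j)) (\<lambda>j. snd (x j))"
    have fin: "(\<lambda>j. snd (x j)) ` {..m} \<in> sets P0"
    proof -
      have "(\<Union>j\<in>{..m}. {snd (x j)}) \<in> sets P0" using space_MX[OF x] by (intro sets.finite_UN) auto
      then show ?thesis by (simp add: UNION_singleton_eq_range)
    qed
    have "emeasure ?A (space P0 - (\<lambda>j. snd (x j)) ` {..m}) = 0"
      using fin space_MX[OF x] by (subst emeasure_norm_atoms) auto
    then have "AE t in ?A. t \<in> (\<lambda>j. snd (x j)) ` {..m}"
      using fin by (intro AE_I[where N="space P0 - (\<lambda>j. snd (x j)) ` {..m}"]) auto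
    then have "AE t in sample_kernel m x. \<forall>i\<in>{..<n}. t i \<in> (\<lambda>j. snd (x j)) ` {..m}"
      unfolding sample_kernel_def by (intro AE_finite_allI AE_PiM_component prob_space_atoms x) auto
    then have "AE t in sample_kernel m x. g (t, x) = 0"
      by eventually_elim (force simp: g_def)
    from nn_integral_cong_AE[OF this] show "(\<integral>\<^sup>+t. g (t, x) \<partial>sample_kernel m x) = 0" by simp
  qed
  finally have "(\<integral>\<^sup>+\<omega>. indicator (number_event m) \<omega> * g (sample_fun \<omega>, pos_atoms m \<omega>) \<partial>M) = 0" by simp
  then have "AE \<omega> in M. indicator (number_event m) \<omega> * g (sample_fun \<omega>, pos_atoms m \<omega>) = 0"
    by (subst (asm) nn_integral_0_iff_AE) auto
  then show ?thesis
  proof eventually_elim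
    case (elim \<omega>)
    show ?case
    proof safe
      fix i assume "\<omega> \<in> space M" "m = N \<omega>" "i < n"
      then have "\<exists>j\<le>m. \<theta> i \<omega> = \<tau> j \<omega>" using elim by (auto simp: g_def sample_fun_def pos_atoms_def)
      then show "\<theta> i \<omega> \<in> (\<lambda>j. \<tau> j \<omega>) ` {..N \<omega>}" using \<open>m = N \<omega>\<close> by auto
    qed
  qed
qed

lemma AE_gamma_pos: "AE \<omega> in M. 0 < \<Gamma> \<omega>"
proof -
  have "AE x in lborel. x \<noteq> (0 :: real)" by (rule AE_lborel_singleton)
  then have "AE x in density lborel (\<lambda>x. ennreal (erlang_density (n - 1) 1 x)). 0 < x"
    by (subst AE_density) (auto simp: erlang_density_def elim!: eventually_mono)
  then have "AE x in distr M lborel \<Gamma>. 0 < x"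
    by (simp only: distributed_distr_eq_density[OF \<Gamma>_law])
  then show ?thesis by (rule AE_distrD[rotated]) simp
qed

lemma AE_regular_aux: "AE \<omega> in M. (\<forall>j\<le>N \<omega>. 0 < J j \<omega>) \<and> inj_on (\<lambda>j. \<tau> j \<omega>) {..N \<omega>} \<and>
    (\<forall>i<n. \<theta> i \<omega> \<in> (\<lambda>j. \<tau> j \<omega>) ` {..N \<omega>}) \<and> 0 < \<Gamma> \<omega>"
proof -
  have 1: "AE \<omega> in M. \<forall>m. \<omega> \<in> number_event m \<longrightarrow> inj_on (\<lambda>j. snd (pos_atoms m \<omega> j)) {..m}"
    unfolding AE_all_countable using AE_number_event_jumps[OF AE_atoms_distinct_law] by blast
  have 2: "AE \<omega> in M. \<forall>m. \<omega> \<in> number_event m \<longrightarrow> (\<forall>i<n. \<theta> i \<omega> \<in> (\<lambda>j. \<tau> j \<omega>) ` {..m})"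
    unfolding AE_all_countable using AE_sample_atoms by blast
  from AE_space AE_jumps_pos 1 2 AE_gamma_pos show ?thesis
  proof eventually_elim
    case (elim \<omega>)
    have "inj_on (\<lambda>j. snd (pos_atoms (N \<omega>) \<omega> j)) {..N \<omega>}" using elim by auto
    then have "inj_on (\<lambda>j. \<tau> j \<omega>) {..N \<omega>}" by (simp add: pos_atoms_def inj_on_def)
    then show ?case using elim by auto
  qed
qed

text \<open>
  Given the atoms, observation \<open>i\<close> hits the atom \<open>l (c i)\<close> with probability jump over total mass, and atom
  \<open>l j\<close> is hit \<open>ns j\<close> times.
\<close>
lemma emeasure_sample_kernel_singleton:
  assumes x: "x \<in> space (MX m)" and inj: "inj_on (\<lambda>j. snd (x j)) {..m}"
    and l: "l \<in> injections k m" and c: "c \<in> patterns n k ns"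
  shows "emeasure (sample_kernel m x) {t\<in>space M\<theta>. \<forall>i<n. t i = snd (x (l (c i)))} =
    ennreal ((\<Prod>j<k. fst (x (l j)) ^ ns j) / (\<Sum>j\<le>m. fst (x j)) ^ n)"
proof -
  let ?A = "norm_atoms P0 {..m} (\<lambda>j. fst (x j)) (\<lambda>j. snd (x j))"
  interpret A: product_sigma_finite "\<lambda>_ :: nat. ?A"
    by (rule product_sigma_finite.intro, rule prob_space_imp_sigma_finite) (rule prob_space_atoms[OF x])
  have lc: "l (c i) \<le> m" if "i < n" for i using patternsD(1)[OF c that] injectionsD(2)[OF l] by auto
  have T: "0 < (\<Sum>j\<le>m. fst (x j))" using space_MX[OF x] by (intro sum_pos) auto
  have "{t\<in>space M\<theta>. \<forall>i<n. t i = snd (x (l (c i)))} = (\<Pi>\<^sub>E i\<in>{..<n}. {snd (x (l (c i)))})"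
    using space_MX[OF x lc] by (auto simp: space_PiM PiE_iff extensional_def)
  then have "emeasure (sample_kernel m x) {t\<in>space M\<theta>. \<forall>i<n. t i = snd (x (l (c i)))} =
      (\<Prod>i<n. emeasure ?A {snd (x (l (c i)))})"
    unfolding sample_kernel_def using space_MX[OF x lc] by (simp only:) (subst A.emeasure_PiM, auto)
  also have "\<dots> = (\<Prod>i<n. ennreal (fst (x (l (c i))) / (\<Sum>j\<le>m. fst (x j))))"
  proof (intro prod.cong refl)
    fix i assume "i \<in> {..<n}"
    then have i: "l (c i) \<le> m" using lc by auto
    have "emeasure ?A {snd (x (l (c i)))} =
      ennreal ((\<Sum>j\<le>m. fst (x j) * indicator {snd (x (l (c i)))} (snd (x j))) / (\<Sum>j\<le>m. fst (x j)))"
      using space_MX[OF x] i by (intro emeasure_norm_atoms_real) auto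
    also have "(\<Sum>j\<le>m. fst (x j) * indicator {snd (x (l (c i)))} (snd (x j))) = (\<Sum>j\<le>m. if j = l (c i) then fst (x j) else 0)"
      using inj_onD[OF inj] i by (intro sum.cong refl) (auto simp: indicator_def)
    also have "\<dots> = fst (x (l (c i)))" using i by simp
    finally show "emeasure ?A {snd (x (l (c i)))} = ennreal (fst (x (l (c i))) / (\<Sum>j\<le>m. fst (x j)))" .
  qed
  also have "\<dots> = ennreal (\<Prod>i<n. fst (x (l (c i))) / (\<Sum>j\<le>m. fst (x j)))"
    using space_MX[OF x lc] T by (intro prod_ennreal) (auto intro!: divide_nonneg_nonneg intro: less_imp_le)
  also have "(\<Prod>i<n. fst (x (l (c i))) / (\<Sum>j\<le>m. fst (x j))) = (\<Prod>j<k. (fst (x (l j)) / (\<Sum>j\<le>m. fst (x j))) ^ ns j)"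
    by (rule prod_pattern[OF c])
  also have "\<dots> = (\<Prod>j<k. fst (x (l j)) ^ ns j) / (\<Sum>j\<le>m. fst (x j)) ^ n"
    by (simp add: power_divide prod_dividef power_sum[symmetric] ns)
  finally show ?thesis .
qed

text \<open>
  The probability of an allocation is inserted for the conditional law of the sample, so that only the
  atoms and the gamma variable remain to be integrated.
\<close>
lemma nn_integral_pattern:
  assumes l: "l \<in> injections k m" and c: "c \<in> patterns n k ns"
    and h [measurable]: "h \<in> borel_measurable (MX m \<Otimes>\<^sub>M borel)"
  shows "(\<integral>\<^sup>+\<omega>. indicator (number_event m) \<omega> * (of_bool (\<forall>i<n. \<theta> i \<omega> = \<tau> (l (c i)) \<omega>) * h (pos_atoms m \<omega>, \<Gamma> \<omega>)) \<partial>M) =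
    ennreal (pmf (poisson_pmf \<Lambda>) m) *
    (\<integral>\<^sup>+x. ennreal ((\<Prod>j<k. fst (x (l j)) ^ ns j) / (\<Sum>j\<le>m. fst (x j)) ^ n) * (\<integral>\<^sup>+\<gamma>. h (x, \<gamma>) \<partial>gamma_law) \<partial>jumps_law m)"
proof -
  have lc: "l (c i) \<le> m" if "i < n" for i using patternsD(1)[OF c that] injectionsD(2)[OF l] by auto
  define B where "B = {z \<in> space (M\<theta> \<Otimes>\<^sub>M MX m). \<forall>i\<in>{..<n}. dist (fst z i) (snd (snd z (l (c i)))) = 0}"
  have "Measurable.pred (M\<theta> \<Otimes>\<^sub>M MX m) (\<lambda>z. \<forall>i\<in>{..<n}. dist (fst z i) (snd (snd z (l (c i)))) = 0)"
  proof (intro pred_intros_finite finite_lessThan)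
    fix i assume "i \<in> {..<n}"
    then have [measurable]: "(\<lambda>z. dist (fst z i) (snd (snd z (l (c i))))) \<in> borel_measurable (M\<theta> \<Otimes>\<^sub>M MX m)"
      using lc by (intro dist_MX_measurable) auto
    show "Measurable.pred (M\<theta> \<Otimes>\<^sub>M MX m) (\<lambda>z. dist (fst z i) (snd (snd z (l (c i)))) = 0)"
      by measurable
  qed
  then have B [measurable]: "B \<in> sets (M\<theta> \<Otimes>\<^sub>M MX m)" unfolding B_def by (rule predE)
  interpret G: prob_space gamma_law by (rule prob_space_gamma_law)
  have "(\<integral>\<^sup>+\<omega>. indicator (number_event m) \<omega> * (of_bool (\<forall>i<n. \<theta> i \<omega> = \<tau> (l (c i)) \<omega>) * h (pos_atoms m \<omega>, \<Gamma> \<omega>)) \<partial>M) =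
    (\<integral>\<^sup>+\<omega>. indicator (number_event m) \<omega> * (\<lambda>z. indicator B (fst z) * h (snd (fst z), snd z)) ((sample_fun \<omega>, pos_atoms m \<omega>), \<Gamma> \<omega>) \<partial>M)"
  proof (intro nn_integral_cong)
    fix \<omega> assume "\<omega> \<in> space M"
    then have "(sample_fun \<omega>, pos_atoms m \<omega>) \<in> space (M\<theta> \<Otimes>\<^sub>M MX m)"
      using measurable_space[OF pos_atoms] measurable_space[OF sample_fun] by (auto simp: space_pair_measure)
    then have "(sample_fun \<omega>, pos_atoms m \<omega>) \<in> B \<longleftrightarrow> (\<forall>i<n. \<theta> i \<omega> = \<tau> (l (c i)) \<omega>)"
      using lc by (auto simp: B_def sample_fun_def pos_atoms_def)
    then show "indicator (number_event m) \<omega> * (of_bool (\<forall>i<n. \<theta> i \<omega> = \<tau> (l (c i)) \<omega>) * h (pos_atoms m \<omega>, \<Gamma> \<omega>)) =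
      indicator (number_event m) \<omega> * (\<lambda>z. indicator B (fst z) * h (snd (fst z), snd z)) ((sample_fun \<omega>, pos_atoms m \<omega>), \<Gamma> \<omega>)"
      by (simp add: indicator_def)
  qed
  also have "\<dots> = ennreal (pmf (poisson_pmf \<Lambda>) m) * (\<integral>\<^sup>+x. \<integral>\<^sup>+t. \<integral>\<^sup>+\<gamma>. (\<lambda>z. indicator B (fst z) * h (snd (fst z), snd z)) ((t, x), \<gamma>)
      \<partial>gamma_law \<partial>sample_kernel m x \<partial>jumps_law m)"
    by (rule nn_integral_sample_gamma) measurable
  also have "(\<integral>\<^sup>+x. \<integral>\<^sup>+t. \<integral>\<^sup>+\<gamma>. (\<lambda>z. indicator B (fst z) * h (snd (fst z), snd z)) ((t, x), \<gamma>)
      \<partial>gamma_law \<partial>sample_kernel m x \<partial>jumps_law m) =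
    (\<integral>\<^sup>+x. ennreal ((\<Prod>j<k. fst (x (l j)) ^ ns j) / (\<Sum>j\<le>m. fst (x j)) ^ n) * (\<integral>\<^sup>+\<gamma>. h (x, \<gamma>) \<partial>gamma_law) \<partial>jumps_law m)"
  proof (rule nn_integral_cong_AE, rule AE_mp[OF AE_atoms_distinct_law], rule AE_I2, rule impI)
    fix x assume "x \<in> space (jumps_law m)" and inj: "inj_on (\<lambda>j. snd (x j)) {..m}"
    then have x: "x \<in> space (MX m)" by (simp add: space_jumps_law)
    have hx [measurable]: "(\<lambda>\<gamma>. h (x, \<gamma>)) \<in> borel_measurable borel" using x by measurable
    let ?S = "{t\<in>space M\<theta>. \<forall>i<n. t i = snd (x (l (c i)))}"
    have sk: "sets (sample_kernel m x) = sets M\<theta>" "space (sample_kernel m x) = space M\<theta>"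
      using subprob_measurableD[OF measurable_prob_algebraD[OF measurable_sample_kernel] x] by auto
    have S: "?S \<in> sets M\<theta>"
    proof -
      have "?S = (\<lambda>t. (t, x)) -` B \<inter> space M\<theta>" using x by (auto simp: B_def space_pair_measure)
      also have "\<dots> \<in> sets M\<theta>"
        by (rule measurable_sets[OF measurable_Pair2'[OF x] B])
      finally show ?thesis .
    qed
    have "(\<integral>\<^sup>+t. \<integral>\<^sup>+\<gamma>. (\<lambda>z. indicator B (fst z) * h (snd (fst z), snd z)) ((t, x), \<gamma>) \<partial>gamma_law \<partial>sample_kernel m x) =
      (\<integral>\<^sup>+t. (\<integral>\<^sup>+\<gamma>. h (x, \<gamma>) \<partial>gamma_law) * indicator ?S t \<partial>sample_kernel m x)"
    proof (intro nn_integral_cong)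
      fix t assume "t \<in> space (sample_kernel m x)"
      then have "(t, x) \<in> B \<longleftrightarrow> t \<in> ?S" using x by (auto simp: B_def space_pair_measure sk)
      then show "(\<integral>\<^sup>+\<gamma>. (\<lambda>z. indicator B (fst z) * h (snd (fst z), snd z)) ((t, x), \<gamma>) \<partial>gamma_law) =
        (\<integral>\<^sup>+\<gamma>. h (x, \<gamma>) \<partial>gamma_law) * indicator ?S t"
        by (cases "t \<in> ?S") simp_all
    qed
    also have "\<dots> = (\<integral>\<^sup>+\<gamma>. h (x, \<gamma>) \<partial>gamma_law) * emeasure (sample_kernel m x) ?S"
      using S sk by (intro nn_integral_cmult_indicator) simp
    also have "\<dots> = ennreal ((\<Prod>j<k. fst (x (l j)) ^ ns j) / (\<Sum>j\<le>m. fst (x j)) ^ n) * (\<integral>\<^sup>+\<gamma>. h (x, \<gamma>) \<partial>gamma_law)"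
      by (subst emeasure_sample_kernel_singleton[OF x inj l c]) (rule mult.commute)
    finally show "(\<integral>\<^sup>+t. \<integral>\<^sup>+\<gamma>. (\<lambda>z. indicator B (fst z) * h (snd (fst z), snd z)) ((t, x), \<gamma>) \<partial>gamma_law \<partial>sample_kernel m x) =
      ennreal ((\<Prod>j<k. fst (x (l j)) ^ ns j) / (\<Sum>j\<le>m. fst (x j)) ^ n) * (\<integral>\<^sup>+\<gamma>. h (x, \<gamma>) \<partial>gamma_law)" .
  qed
  finally show ?thesis .
qed

section \<open>Cancellation of the total mass\<close>

abbreviation Mt :: "(nat \<Rightarrow> 'a) measure" where "Mt \<equiv> Pi\<^sub>M {..<k} (\<lambda>_. P0)"
abbreviation MY :: "nat \<Rightarrow> (nat \<Rightarrow> real \<times> 'a) measure" where "MY r \<equiv> Pi\<^sub>M {..<r} (\<lambda>_. pos_borel \<Otimes>\<^sub>M P0)"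
abbreviation MA :: "(nat \<Rightarrow> real) measure" where "MA \<equiv> Pi\<^sub>M {..<k} (\<lambda>_. pos_borel)"
abbreviation latent_space :: "nat \<Rightarrow> ((nat \<Rightarrow> 'a) \<times> real \<times> (nat \<Rightarrow> real \<times> 'a) \<times> (nat \<Rightarrow> real)) measure" where
  "latent_space r \<equiv> Mt \<Otimes>\<^sub>M pos_borel \<Otimes>\<^sub>M MY r \<Otimes>\<^sub>M MA"

definition nonalloc_jumps :: "nat \<Rightarrow> real \<Rightarrow> (nat \<Rightarrow> real \<times> 'a) measure" where
  "nonalloc_jumps r u = Pi\<^sub>M {..<r} (\<lambda>_. size_biased 0 u \<Otimes>\<^sub>M P0)"

definition alloc_jumps :: "real \<Rightarrow> (nat \<Rightarrow> real) measure" where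
  "alloc_jumps u = Pi\<^sub>M {..<k} (\<lambda>j. size_biased (ns j) u)"

lemma nonalloc_jumps: "nonalloc_jumps r \<in> pos_borel \<rightarrow>\<^sub>M prob_algebra (MY r)"
  unfolding nonalloc_jumps_def[abs_def] by (rule measurable_PiM_marked) simp

lemma alloc_jumps: "alloc_jumps \<in> pos_borel \<rightarrow>\<^sub>M prob_algebra MA"
  unfolding alloc_jumps_def[abs_def] by (rule measurable_PiM_size_biased) simp

lemma sets_nonalloc_jumps [simp, measurable_cong]: "sets (nonalloc_jumps r u) = sets (MY r)"
  unfolding nonalloc_jumps_def by (intro sets_PiM_cong sets_pair_measure_cong) auto

lemma sets_alloc_jumps [simp, measurable_cong]: "sets (alloc_jumps u) = sets MA"
  unfolding alloc_jumps_def by (intro sets_PiM_cong) auto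

text \<open>
  The mean of \<open>g\<close> given distinct values \<open>t\<close>, \<open>U = u\<close> and \<open>r\<close> non-allocated jumps, under which the marked
  non-allocated jumps \<open>y\<close> and the allocated jumps \<open>a\<close> are independent.
\<close>
abbreviation cond_mean :: "nat \<Rightarrow> ((nat \<Rightarrow> 'a) \<times> real \<times> (nat \<Rightarrow> real \<times> 'a) \<times> (nat \<Rightarrow> real) \<Rightarrow> ennreal)
    \<Rightarrow> (nat \<Rightarrow> 'a) \<Rightarrow> real \<Rightarrow> ennreal" where
  "cond_mean r g t u \<equiv> \<integral>\<^sup>+y. \<integral>\<^sup>+a. g (t, u, y, a) \<partial>alloc_jumps u \<partial>nonalloc_jumps r u"

lemma prob_space_nonalloc_jumps: "0 < u \<Longrightarrow> prob_space (nonalloc_jumps r u)"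
  and prob_space_alloc_jumps: "0 < u \<Longrightarrow> prob_space (alloc_jumps u)"
  using measurable_space[OF nonalloc_jumps, of u r] measurable_space[OF alloc_jumps, of u] by (auto simp: space_prob_algebra space_pos_borel)

lemma prob_space_Mt: "prob_space Mt"
  by (rule prob_space_PiM) unfold_locales

text \<open>
  For fixed \<open>u\<close> the weight is a product with one factor per jump, hence a change of the law of
  each jump separately: size biasing for the allocated ones and tilting for the others.
\<close>
lemma nn_integral_tilted:
  assumes u: "0 < u" and g: "g \<in> borel_measurable (Mt \<Otimes>\<^sub>M MY r \<Otimes>\<^sub>M MA)"
  shows "(\<integral>\<^sup>+a. \<integral>\<^sup>+t. \<integral>\<^sup>+y. ennreal (\<Prod>j<k. a j ^ ns j * exp (- u * a j)) * (ennreal (\<Prod>j<r. exp (- u * fst (y j))) * g (t, y, a))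
      \<partial>atoms_law {..<r} \<partial>Mt \<partial>Pi\<^sub>M {..<k} (\<lambda>_. F)) =
    (\<Prod>j<k. tilted_moment (ns j) u) * tilted_moment 0 u ^ r * (\<integral>\<^sup>+t. \<integral>\<^sup>+y. \<integral>\<^sup>+a. g (t, y, a) \<partial>alloc_jumps u \<partial>nonalloc_jumps r u \<partial>Mt)"
proof -
  interpret Y: prob_space "nonalloc_jumps r u" by (rule prob_space_nonalloc_jumps[OF u])
  interpret A: prob_space "alloc_jumps u" by (rule prob_space_alloc_jumps[OF u])
  interpret T: prob_space Mt by (rule prob_space_Mt)
  interpret AT: pair_sigma_finite "alloc_jumps u" Mt ..
  interpret AY: pair_sigma_finite "alloc_jumps u" "nonalloc_jumps r u" ..
  have sR: "sets (atoms_law {..<r}) = sets (MY r)"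
    by (intro sets_PiM_cong sets_pair_measure_cong) (auto simp: sets_F)
  have sK: "sets (Pi\<^sub>M {..<k} (\<lambda>_. F)) = sets MA" by (intro sets_PiM_cong) (auto simp: sets_F)
  have gsec: "(\<lambda>y. g (t, y, a)) \<in> borel_measurable (MY r)" if "t \<in> space Mt" "a \<in> space MA" for t a
    by (rule measurable_compose[OF _ g]) (use that in measurable)
  have g3: "(\<lambda>z. g (snd (fst z), snd z, fst (fst z))) \<in> borel_measurable ((MA \<Otimes>\<^sub>M Mt) \<Otimes>\<^sub>M nonalloc_jumps r u)"
    by (rule measurable_compose[OF _ g]) measurable
  have gat: "(\<lambda>z. \<integral>\<^sup>+y. g (snd z, y, fst z) \<partial>nonalloc_jumps r u) \<in> borel_measurable (MA \<Otimes>\<^sub>M Mt)"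
    using Y.borel_measurable_nn_integral_fst[OF g3] by simp
  have ga: "(\<lambda>a. \<integral>\<^sup>+t. \<integral>\<^sup>+y. g (t, y, a) \<partial>nonalloc_jumps r u \<partial>Mt) \<in> borel_measurable MA"
    using T.borel_measurable_nn_integral_fst[OF gat] by simp
  have inner: "(\<integral>\<^sup>+t. \<integral>\<^sup>+y. ennreal (\<Prod>j<k. a j ^ ns j * exp (- u * a j)) * (ennreal (\<Prod>j<r. exp (- u * fst (y j))) * g (t, y, a))
      \<partial>atoms_law {..<r} \<partial>Mt) =
    ennreal (\<Prod>j<k. a j ^ ns j * exp (- u * a j)) * (tilted_moment 0 u ^ r * (\<integral>\<^sup>+t. \<integral>\<^sup>+y. g (t, y, a) \<partial>nonalloc_jumps r u \<partial>Mt))"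
    if a: "a \<in> space MA" for a
  proof -
    have gt: "(\<lambda>t. \<integral>\<^sup>+y. g (t, y, a) \<partial>nonalloc_jumps r u) \<in> borel_measurable Mt"
      using measurable_compose[OF measurable_Pair1'[OF a] gat] by simp
    have "(\<integral>\<^sup>+y. ennreal (\<Prod>j<k. a j ^ ns j * exp (- u * a j)) * (ennreal (\<Prod>j<r. exp (- u * fst (y j))) * g (t, y, a))
        \<partial>atoms_law {..<r}) =
      ennreal (\<Prod>j<k. a j ^ ns j * exp (- u * a j)) * (tilted_moment 0 u ^ r * (\<integral>\<^sup>+y. g (t, y, a) \<partial>nonalloc_jumps r u))"
      if t: "t \<in> space Mt" for t
    proof -
      have [measurable]: "(\<lambda>y. fst (y j)) \<in> borel_measurable (MY r)" if "j \<in> {..<r}" for j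
        using that by (intro measurable_compose[OF _ measurable_pos_borel_id]) measurable
      have [measurable]: "(\<lambda>y. g (t, y, a)) \<in> borel_measurable (MY r)" by (rule gsec[OF t a])
      have "(\<lambda>y. ennreal (\<Prod>j<r. exp (- u * fst (y j))) * g (t, y, a)) \<in> borel_measurable (MY r)" by measurable
      then have m: "(\<lambda>y. ennreal (\<Prod>j<r. exp (- u * fst (y j))) * g (t, y, a)) \<in> borel_measurable (atoms_law {..<r})"
        by (simp cong: measurable_cong_sets add: sR)
      show ?thesis
        unfolding nn_integral_cmult[OF m] nonalloc_jumps_def
        using nn_integral_PiM_marked[of "{..<r}" u "\<lambda>y. g (t, y, a)"] u by simp
    qed
    then have "(\<integral>\<^sup>+t. \<integral>\<^sup>+y. ennreal (\<Prod>j<k. a j ^ ns j * exp (- u * a j)) * (ennreal (\<Prod>j<r. exp (- u * fst (y j))) * g (t, y, a))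
        \<partial>atoms_law {..<r} \<partial>Mt) =
      (\<integral>\<^sup>+t. ennreal (\<Prod>j<k. a j ^ ns j * exp (- u * a j)) * (tilted_moment 0 u ^ r * (\<integral>\<^sup>+y. g (t, y, a) \<partial>nonalloc_jumps r u)) \<partial>Mt)"
      by (intro nn_integral_cong) auto
    also have "\<dots> = ennreal (\<Prod>j<k. a j ^ ns j * exp (- u * a j)) * (tilted_moment 0 u ^ r * (\<integral>\<^sup>+t. \<integral>\<^sup>+y. g (t, y, a) \<partial>nonalloc_jumps r u \<partial>Mt))"
      using gt by (simp add: nn_integral_cmult)
    finally show ?thesis .
  qed
  have "(\<integral>\<^sup>+a. \<integral>\<^sup>+t. \<integral>\<^sup>+y. ennreal (\<Prod>j<k. a j ^ ns j * exp (- u * a j)) * (ennreal (\<Prod>j<r. exp (- u * fst (y j))) * g (t, y, a))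
      \<partial>atoms_law {..<r} \<partial>Mt \<partial>Pi\<^sub>M {..<k} (\<lambda>_. F)) =
    (\<integral>\<^sup>+a. ennreal (\<Prod>j<k. a j ^ ns j * exp (- u * a j)) * (tilted_moment 0 u ^ r * (\<integral>\<^sup>+t. \<integral>\<^sup>+y. g (t, y, a) \<partial>nonalloc_jumps r u \<partial>Mt)) \<partial>Pi\<^sub>M {..<k} (\<lambda>_. F))"
    by (intro nn_integral_cong inner) (simp add: sets_eq_imp_space_eq[OF sK])
  also have "\<dots> = (\<Prod>j<k. tilted_moment (ns j) u) * (\<integral>\<^sup>+a. tilted_moment 0 u ^ r * (\<integral>\<^sup>+t. \<integral>\<^sup>+y. g (t, y, a) \<partial>nonalloc_jumps r u \<partial>Mt) \<partial>alloc_jumps u)"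
    unfolding alloc_jumps_def using ga by (intro nn_integral_PiM_size_biased u) auto
  also have "\<dots> = (\<Prod>j<k. tilted_moment (ns j) u) * tilted_moment 0 u ^ r * (\<integral>\<^sup>+a. \<integral>\<^sup>+t. \<integral>\<^sup>+y. g (t, y, a) \<partial>nonalloc_jumps r u \<partial>Mt \<partial>alloc_jumps u)"
    using ga by (subst nn_integral_cmult) (simp_all add: mult.assoc cong: measurable_cong_sets)
  also have "(\<integral>\<^sup>+a. \<integral>\<^sup>+t. \<integral>\<^sup>+y. g (t, y, a) \<partial>nonalloc_jumps r u \<partial>Mt \<partial>alloc_jumps u) = (\<integral>\<^sup>+t. \<integral>\<^sup>+a. \<integral>\<^sup>+y. g (t, y, a) \<partial>nonalloc_jumps r u \<partial>alloc_jumps u \<partial>Mt)"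
  proof (rule AT.Fubini'[symmetric])
    show "(\<lambda>(a, t). \<integral>\<^sup>+y. g (t, y, a) \<partial>nonalloc_jumps r u) \<in> borel_measurable (alloc_jumps u \<Otimes>\<^sub>M Mt)"
      using gat by (simp add: split_beta' cong: measurable_cong_sets sets_pair_measure_cong)
  qed
  also have "\<dots> = (\<integral>\<^sup>+t. \<integral>\<^sup>+y. \<integral>\<^sup>+a. g (t, y, a) \<partial>alloc_jumps u \<partial>nonalloc_jumps r u \<partial>Mt)"
  proof (intro nn_integral_cong AY.Fubini'[symmetric])
    fix t assume t: "t \<in> space Mt"
    have "(\<lambda>z. g (t, snd z, fst z)) \<in> borel_measurable (alloc_jumps u \<Otimes>\<^sub>M nonalloc_jumps r u)"
      by (rule measurable_compose[OF _ g]) (use t in measurable)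
    then show "(\<lambda>(a, y). g (t, y, a)) \<in> borel_measurable (alloc_jumps u \<Otimes>\<^sub>M nonalloc_jumps r u)" by (simp add: split_beta')
  qed
  finally show ?thesis .
qed

text \<open>
  Given \<open>N = r + k - 1\<close>, the density at \<open>u\<close> of \<open>U\<close> on the event that one particular injection and pattern
  explain the sample.
\<close>
definition allocation_weight :: "nat \<Rightarrow> real \<Rightarrow> ennreal" where
  "allocation_weight r u = ennreal (u ^ (n - 1) / fact (n - 1)) * ((\<Prod>j<k. tilted_moment (ns j) u) * tilted_moment 0 u ^ r)"

text \<open>
  The reason for introducing \<open>U\<close>.  In terms of \<open>u = \<gamma> / T\<close> the gamma density contributes
  \<open>T ^ n * u ^ (n - 1) * exp (- u * T) / (n - 1)!\<close>: the power of the total mass \<open>T\<close> cancels the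
  denominator of the allocation probability, and the exponential is a product over all jumps.  So,
  given \<open>u\<close>, the jumps are independent again, and the locations keep their law \<open>P0\<close>.
\<close>
lemma nn_integral_allocated:
  assumes l: "l \<in> injections k m" and h: "h \<in> borel_measurable (latent_space (m + 1 - k))"
  shows "(\<integral>\<^sup>+x. ennreal ((\<Prod>j<k. fst (x (l j)) ^ ns j) / (\<Sum>j\<le>m. fst (x j)) ^ n) *
      (\<integral>\<^sup>+\<gamma>. indicator {0<..} \<gamma> * h (\<lambda>j\<in>{..<k}. snd (x (l j)), \<gamma> / (\<Sum>j\<le>m. fst (x j)),
         \<lambda>j\<in>{..<m + 1 - k}. x (rest m k l j), \<lambda>j\<in>{..<k}. fst (x (l j))) \<partial>gamma_law) \<partial>jumps_law m) =
    (\<integral>\<^sup>+u. allocation_weight (m + 1 - k) u * (\<integral>\<^sup>+t. cond_mean (m + 1 - k) h t u \<partial>Mt) \<partial>pos_lborel)"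
proof -
  define r where "r = m + 1 - k"
  define b where "b = rest m k l"
  note h = h[folded r_def]
  have b: "bij_betw b {..<r} ({..m} - l ` {..<k})" unfolding b_def r_def by (rule bij_betw_rest[OF l])
  have lm: "l j \<le> m" if "j < k" for j using injectionsD(2)[OF l that] .
  have bm: "b j \<le> m" if "j < r" for j using bij_betwE[OF b] that by auto
  interpret X: prob_space "jumps_law m" by (rule prob_space_jumps_law)
  interpret L: sigma_finite_measure pos_lborel by (rule sigma_finite_pos_lborel)
  interpret XL: pair_sigma_finite pos_lborel "jumps_law m" ..
  define ts where "ts = (\<lambda>x :: nat \<Rightarrow> real \<times> 'a. \<lambda>j\<in>{..<k}. snd (x (l j)))"
  define ys where "ys = (\<lambda>x :: nat \<Rightarrow> real \<times> 'a. \<lambda>j\<in>{..<r}. x (b j))"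
  define as where "as = (\<lambda>x :: nat \<Rightarrow> real \<times> 'a. \<lambda>j\<in>{..<k}. fst (x (l j)))"
  have ts: "ts \<in> MX m \<rightarrow>\<^sub>M Mt" unfolding ts_def by (intro measurable_restrict measurable_MX(2)[where f="\<lambda>x. x" and m=m]) (auto intro: lm)
  have as: "as \<in> MX m \<rightarrow>\<^sub>M MA" unfolding as_def by (intro measurable_restrict measurable_MX(3)[where f="\<lambda>x. x" and m=m]) (auto intro: lm)
  have ys: "ys \<in> MX m \<rightarrow>\<^sub>M MY r" unfolding ys_def by (intro measurable_restrict measurable_component_singleton) (auto intro: bm)
  define G where "G = (\<lambda>(u, a :: nat \<Rightarrow> real, t, y :: nat \<Rightarrow> real \<times> 'a).
      ennreal (\<Prod>j<k. a j ^ ns j * exp (- u * a j)) * (ennreal (\<Prod>j<r. exp (- u * fst (y j))) * h (t, u, y, a)))"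
  have G: "G \<in> borel_measurable (pos_borel \<Otimes>\<^sub>M MA \<Otimes>\<^sub>M Mt \<Otimes>\<^sub>M MY r)"
  proof -
    let ?S = "pos_borel \<Otimes>\<^sub>M MA \<Otimes>\<^sub>M Mt \<Otimes>\<^sub>M MY r"
    have [measurable]: "fst \<in> borel_measurable ?S"
      by (rule measurable_compose[OF measurable_fst measurable_pos_borel_id])
    have [measurable]: "(\<lambda>z. fst (snd z) j) \<in> borel_measurable ?S" if "j \<in> {..<k}" for j
      using that by (intro measurable_compose[OF _ measurable_pos_borel_id]) measurable
    have [measurable]: "(\<lambda>z. fst (snd (snd (snd z)) j)) \<in> borel_measurable ?S" if "j \<in> {..<r}" for j
      using that by (intro measurable_compose[OF _ measurable_pos_borel_id]) measurable
    have [measurable]: "(\<lambda>z. h (fst (snd (snd z)), fst z, snd (snd (snd z)), fst (snd z))) \<in> borel_measurable ?S"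
      by (rule measurable_compose[OF _ h]) measurable
    show ?thesis unfolding G_def split_beta' by measurable
  qed
  have Gx: "(\<lambda>z. ennreal (fst z ^ (n - 1) / fact (n - 1)) * G (fst z, as (snd z), ts (snd z), ys (snd z))) \<in> borel_measurable (pos_lborel \<Otimes>\<^sub>M jumps_law m)"
  proof -
    have [measurable]: "(\<lambda>z. G (fst z, as (snd z), ts (snd z), ys (snd z))) \<in> borel_measurable (pos_borel \<Otimes>\<^sub>M MX m)"
      by (rule measurable_compose[OF _ G]) (intro measurable_Pair measurable_fst measurable_compose[OF measurable_snd] ts as ys)
    have [measurable]: "fst \<in> borel_measurable (pos_borel \<Otimes>\<^sub>M MX m)"
      by (rule measurable_compose[OF measurable_fst measurable_pos_borel_id])
    have "(\<lambda>z. ennreal (fst z ^ (n - 1) / fact (n - 1)) * G (fst z, as (snd z), ts (snd z), ys (snd z))) \<in> borel_measurable (pos_borel \<Otimes>\<^sub>M MX m)"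
      by measurable
    then show ?thesis
      by (simp cong: measurable_cong_sets sets_pair_measure_cong add: sets_pos_lborel)
  qed
  \<comment> \<open>For fixed atoms, the substitution in the gamma integral.\<close>
  have inner: "ennreal ((\<Prod>j<k. fst (x (l j)) ^ ns j) / (\<Sum>j\<le>m. fst (x j)) ^ n) *
      (\<integral>\<^sup>+\<gamma>. indicator {0<..} \<gamma> * h (ts x, \<gamma> / (\<Sum>j\<le>m. fst (x j)), ys x, as x) \<partial>gamma_law) =
    (\<integral>\<^sup>+u. ennreal (u ^ (n - 1) / fact (n - 1)) * G (u, as x, ts x, ys x) \<partial>pos_lborel)"
    if x: "x \<in> space (MX m)" for x
  proof -
    define T where "T = (\<Sum>j\<le>m. fst (x j))"
    have T: "0 < T" unfolding T_def using space_MX[OF x] by (intro sum_pos) auto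
    \<comment> \<open>Makes \<open>exp (- u * T)\<close> a product over allocated and non-allocated jumps.\<close>
    have Tsplit: "T = (\<Sum>j<k. as x j) + (\<Sum>j<r. fst (ys x j))"
    proof -
      have "T = (\<Sum>i\<in>l ` {..<k}. fst (x i)) + (\<Sum>i\<in>{..m} - l ` {..<k}. fst (x i))"
        unfolding T_def using lm by (subst sum.subset_diff[of "l ` {..<k}"]) (auto simp: add.commute)
      also have "(\<Sum>i\<in>l ` {..<k}. fst (x i)) = (\<Sum>j<k. as x j)"
        using injectionsD(1)[OF l] by (simp add: sum.reindex as_def)
      also have "(\<Sum>i\<in>{..m} - l ` {..<k}. fst (x i)) = (\<Sum>j<r. fst (ys x j))"
        by (subst sum.reindex_bij_betw[OF b, symmetric]) (simp add: ys_def)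
      finally show ?thesis .
    qed
    have sp: "ts x \<in> space Mt" "ys x \<in> space (MY r)" "as x \<in> space MA"
      using measurable_space[OF ts x] measurable_space[OF ys x] measurable_space[OF as x] by auto
    have g [measurable]: "(\<lambda>u. h (ts x, u, ys x, as x)) \<in> borel_measurable pos_borel"
      by (rule measurable_compose[OF _ h]) (use sp in measurable)
    have Gu: "(\<lambda>u. ennreal (T ^ n * u ^ (n - 1) * exp (- u * T) / fact (n - 1)) * h (ts x, u, ys x, as x)) \<in> borel_measurable pos_lborel"
      using g by (simp cong: measurable_cong_sets add: sets_pos_lborel)
    have P0: "0 \<le> (\<Prod>j<k. fst (x (l j)) ^ ns j)"
      using space_MX[OF x lm] by (intro prod_nonneg) (auto intro: less_imp_le)
    have "(\<integral>\<^sup>+\<gamma>. indicator {0<..} \<gamma> * h (ts x, \<gamma> / T, ys x, as x) \<partial>gamma_law) =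
      (\<integral>\<^sup>+\<gamma>. ennreal (erlang_density (n - 1) 1 \<gamma>) * (indicator {0<..} \<gamma> * h (ts x, \<gamma> / T, ys x, as x)) \<partial>lborel)"
      unfolding gamma_law_def
    proof (rule nn_integral_density)
      have g': "(\<lambda>u. indicator {0<..} u * h (ts x, u, ys x, as x)) \<in> borel_measurable borel"
        using g by (subst (asm) borel_measurable_restrict_space_iff_ennreal) (auto simp: mult.commute)
      have "(\<lambda>\<gamma>. indicator {0<..} (\<gamma> / T) * h (ts x, \<gamma> / T, ys x, as x)) \<in> borel_measurable borel"
        by (rule measurable_compose[OF _ g']) measurable
      then show "(\<lambda>\<gamma>. indicator {0<..} \<gamma> * h (ts x, \<gamma> / T, ys x, as x)) \<in> borel_measurable lborel"
        using T by (simp add: indicator_def zero_less_divide_iff)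
    qed simp
    also have "\<dots> = (\<integral>\<^sup>+u. ennreal (T ^ Suc (n - 1) * u ^ (n - 1) * exp (- u * T) / fact (n - 1)) * h (ts x, u, ys x, as x) \<partial>pos_lborel)"
      by (rule nn_integral_erlang_scale[OF T g])
    also have "Suc (n - 1) = n" using n by simp
    finally have "ennreal ((\<Prod>j<k. fst (x (l j)) ^ ns j) / T ^ n) *
        (\<integral>\<^sup>+\<gamma>. indicator {0<..} \<gamma> * h (ts x, \<gamma> / T, ys x, as x) \<partial>gamma_law) =
      (\<integral>\<^sup>+u. ennreal ((\<Prod>j<k. fst (x (l j)) ^ ns j) / T ^ n) *
        (ennreal (T ^ n * u ^ (n - 1) * exp (- u * T) / fact (n - 1)) * h (ts x, u, ys x, as x)) \<partial>pos_lborel)"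
      using Gu by (subst nn_integral_cmult) simp_all
    also have "\<dots> = (\<integral>\<^sup>+u. ennreal (u ^ (n - 1) / fact (n - 1)) * G (u, as x, ts x, ys x) \<partial>pos_lborel)"
    proof (intro nn_integral_cong)
      fix u assume "u \<in> space pos_lborel"
      then have u: "0 < u" by (simp add: space_pos_borel)
      have ax: "0 < as x j" if "j < k" for j using that space_MX[OF x lm] by (simp add: as_def)
      have "ennreal ((\<Prod>j<k. fst (x (l j)) ^ ns j) / T ^ n) * ennreal (T ^ n * u ^ (n - 1) * exp (- u * T) / fact (n - 1)) =
        ennreal ((\<Prod>j<k. as x j ^ ns j) * (u ^ (n - 1) * exp (- u * T) / fact (n - 1)))"
        using T u P0 by (subst ennreal_mult[symmetric]) (auto simp: as_def)
      also have "(\<Prod>j<k. as x j ^ ns j) * (u ^ (n - 1) * exp (- u * T) / fact (n - 1)) =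
        u ^ (n - 1) / fact (n - 1) * ((\<Prod>j<k. as x j ^ ns j * exp (- u * as x j)) * (\<Prod>j<r. exp (- u * fst (ys x j))))"
        by (simp add: prod.distrib exp_sum[symmetric] Tsplit exp_add[symmetric] sum_distrib_left sum_negf algebra_simps)
      also have "ennreal \<dots> = ennreal (u ^ (n - 1) / fact (n - 1)) *
        (ennreal (\<Prod>j<k. as x j ^ ns j * exp (- u * as x j)) * ennreal (\<Prod>j<r. exp (- u * fst (ys x j))))"
      proof -
        have p: "0 \<le> (\<Prod>j<k. as x j ^ ns j * exp (- u * as x j))"
          using ax by (intro prod_nonneg) (auto intro: less_imp_le)
        have q: "0 \<le> (\<Prod>j<r. exp (- u * fst (ys x j)))" by (intro prod_nonneg) auto
        have s: "0 \<le> u ^ (n - 1) / fact (n - 1)" using u by simp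
        show ?thesis by (simp only: ennreal_mult[OF s mult_nonneg_nonneg[OF p q]] ennreal_mult[OF p q])
      qed
      finally show "ennreal ((\<Prod>j<k. fst (x (l j)) ^ ns j) / T ^ n) *
          (ennreal (T ^ n * u ^ (n - 1) * exp (- u * T) / fact (n - 1)) * h (ts x, u, ys x, as x)) =
        ennreal (u ^ (n - 1) / fact (n - 1)) * G (u, as x, ts x, ys x)"
        by (simp add: G_def mult.assoc[symmetric])
    qed
    finally show ?thesis unfolding T_def .
  qed
  \<comment> \<open>For fixed \<open>u\<close>, independence of the allocated and the non-allocated atoms, and of jumps
    and locations.\<close>
  have split: "(\<integral>\<^sup>+x. G (u, as x, ts x, ys x) \<partial>jumps_law m) =
    (\<Prod>j<k. tilted_moment (ns j) u) * tilted_moment 0 u ^ r * (\<integral>\<^sup>+t. cond_mean r h t u \<partial>Mt)"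
    if u: "0 < u" for u
  proof -
    have u': "u \<in> space pos_borel" using u by (simp add: space_pos_borel)
    have sR: "sets (atoms_law {..<q}) = sets (MY q)" for q :: nat
      by (intro sets_PiM_cong sets_pair_measure_cong) (auto simp: sets_F)
    have sK: "sets (Pi\<^sub>M {..<k} (\<lambda>_. F)) = sets MA" by (intro sets_PiM_cong) (auto simp: sets_F)
    define fs where "fs = (\<lambda>a :: nat \<Rightarrow> real \<times> 'a. \<lambda>j\<in>{..<k}. fst (a j))"
    define ss where "ss = (\<lambda>a :: nat \<Rightarrow> real \<times> 'a. \<lambda>j\<in>{..<k}. snd (a j))"
    have fs: "fs \<in> MY k \<rightarrow>\<^sub>M MA" unfolding fs_def by (rule measurable_restrict) measurable
    have ss: "ss \<in> MY k \<rightarrow>\<^sub>M Mt" unfolding ss_def by (rule measurable_restrict) measurable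
    have GH: "(\<lambda>z. G (u, fs (fst z), ss (fst z), snd z)) \<in> borel_measurable (atoms_law {..<k} \<Otimes>\<^sub>M atoms_law {..<r})"
    proof -
      have "(\<lambda>z. G (u, fs (fst z), ss (fst z), snd z)) \<in> borel_measurable (MY k \<Otimes>\<^sub>M MY r)"
        by (rule measurable_compose[OF _ G])
          (intro measurable_Pair measurable_const u' measurable_snd measurable_compose[OF measurable_fst] fs ss)
      then show ?thesis by (simp cong: measurable_cong_sets sets_pair_measure_cong add: sR)
    qed
    interpret R: prob_space "atoms_law {..<r}" by (rule prob_space_PiM) (rule prob_space_marked)
    have G2: "(\<lambda>z. \<integral>\<^sup>+y. G (u, fst z, snd z, y) \<partial>atoms_law {..<r}) \<in> borel_measurable (Pi\<^sub>M {..<k} (\<lambda>_. F) \<Otimes>\<^sub>M Mt)"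
    proof -
      have "(\<lambda>z. G (u, fst (fst z), snd (fst z), snd z)) \<in> borel_measurable ((MA \<Otimes>\<^sub>M Mt) \<Otimes>\<^sub>M MY r)"
        by (rule measurable_compose[OF _ G]) (intro measurable_Pair measurable_const u', measurable)
      then have "(\<lambda>z. G (u, fst (fst z), snd (fst z), snd z)) \<in> borel_measurable ((Pi\<^sub>M {..<k} (\<lambda>_. F) \<Otimes>\<^sub>M Mt) \<Otimes>\<^sub>M atoms_law {..<r})"
        by (simp cong: measurable_cong_sets sets_pair_measure_cong add: sR sK)
      from R.borel_measurable_nn_integral_fst[OF this] show ?thesis by simp
    qed
    have "(\<integral>\<^sup>+x. G (u, as x, ts x, ys x) \<partial>jumps_law m) =
      (\<integral>\<^sup>+x. (\<lambda>z. G (u, fs (fst z), ss (fst z), snd z)) (\<lambda>j\<in>{..<k}. x (l j), \<lambda>j\<in>{..<r}. x (b j)) \<partial>atoms_law {..m})"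
      unfolding jumps_law_def
      by (intro nn_integral_cong arg_cong[where f=G]) (auto simp: as_def ts_def ys_def fs_def ss_def)
    also have "\<dots> = (\<integral>\<^sup>+a. \<integral>\<^sup>+y. (\<lambda>z. G (u, fs (fst z), ss (fst z), snd z)) (a, y) \<partial>atoms_law {..<r} \<partial>atoms_law {..<k})"
      using bij_betw_imp_inj_on[OF b] bij_betw_imp_surj_on[OF b] injectionsD(1)[OF l] lm
      by (intro nn_integral_PiM_split[OF prob_space_marked _ _ _ _ _ GH]) auto
    also have "\<dots> = (\<integral>\<^sup>+a. (\<lambda>z. \<integral>\<^sup>+y. G (u, fst z, snd z, y) \<partial>atoms_law {..<r}) (\<lambda>j\<in>{..<k}. fst (a j), \<lambda>j\<in>{..<k}. snd (a j)) \<partial>atoms_law {..<k})"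
      by (simp add: fs_def ss_def)
    also have "\<dots> = (\<integral>\<^sup>+a. \<integral>\<^sup>+t. (\<lambda>z. \<integral>\<^sup>+y. G (u, fst z, snd z, y) \<partial>atoms_law {..<r}) (a, t) \<partial>Mt \<partial>Pi\<^sub>M {..<k} (\<lambda>_. F))"
      by (rule nn_integral_PiM_unzip[OF prob_space_axioms P0.prob_space_axioms _ G2]) simp
    also have "\<dots> = (\<Prod>j<k. tilted_moment (ns j) u) * tilted_moment 0 u ^ r * (\<integral>\<^sup>+t. cond_mean r h t u \<partial>Mt)"
    proof -
      have "(\<lambda>z. h (fst z, u, fst (snd z), snd (snd z))) \<in> borel_measurable (Mt \<Otimes>\<^sub>M MY r \<Otimes>\<^sub>M MA)"
        by (rule measurable_compose[OF _ h]) (intro measurable_Pair measurable_const u', measurable)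
      from nn_integral_tilted[OF u this] show ?thesis by (simp add: G_def)
    qed
    finally show ?thesis .
  qed
  have "(\<integral>\<^sup>+x. ennreal ((\<Prod>j<k. fst (x (l j)) ^ ns j) / (\<Sum>j\<le>m. fst (x j)) ^ n) *
      (\<integral>\<^sup>+\<gamma>. indicator {0<..} \<gamma> * h (ts x, \<gamma> / (\<Sum>j\<le>m. fst (x j)), ys x, as x) \<partial>gamma_law) \<partial>jumps_law m) =
    (\<integral>\<^sup>+x. \<integral>\<^sup>+u. ennreal (u ^ (n - 1) / fact (n - 1)) * G (u, as x, ts x, ys x) \<partial>pos_lborel \<partial>jumps_law m)"
    by (intro nn_integral_cong inner) (simp add: space_jumps_law)
  also have "\<dots> = (\<integral>\<^sup>+u. \<integral>\<^sup>+x. ennreal (u ^ (n - 1) / fact (n - 1)) * G (u, as x, ts x, ys x) \<partial>jumps_law m \<partial>pos_lborel)"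
    using Gx by (intro XL.Fubini') (simp add: split_beta')
  also have "\<dots> = (\<integral>\<^sup>+u. allocation_weight r u * (\<integral>\<^sup>+t. cond_mean r h t u \<partial>Mt) \<partial>pos_lborel)"
  proof (intro nn_integral_cong)
    fix u assume "u \<in> space pos_lborel"
    then have u: "0 < u" by (simp add: space_pos_borel)
    then have u': "u \<in> space pos_borel" by (simp add: space_pos_borel)
    have "(\<lambda>x. G (u, as x, ts x, ys x)) \<in> borel_measurable (jumps_law m)"
    proof -
      have "(\<lambda>x. G (u, as x, ts x, ys x)) \<in> borel_measurable (MX m)"
        by (rule measurable_compose[OF _ G]) (intro measurable_Pair measurable_const u' as ts ys)
      then show ?thesis by (simp cong: measurable_cong_sets)
    qed
    then show "(\<integral>\<^sup>+x. ennreal (u ^ (n - 1) / fact (n - 1)) * G (u, as x, ts x, ys x) \<partial>jumps_law m) =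
      allocation_weight r u * (\<integral>\<^sup>+t. cond_mean r h t u \<partial>Mt)"
      by (subst nn_integral_cmult) (simp_all add: split[OF u] allocation_weight_def mult.assoc)
  qed
  finally show ?thesis unfolding ts_def ys_def as_def b_def r_def .
qed

section \<open>The joint law of the latent data\<close>

definition U :: "'w \<Rightarrow> real" where "U \<omega> = \<Gamma> \<omega> / crm_total N J \<omega>"

definition E :: "'w set" where
  "E = {\<omega>\<in>space M. length (distinct_values n \<theta> \<omega>) = k \<and> (\<forall>j<k. multiplicity_of n \<theta> j \<omega> = ns j)}"

definition \<theta>s :: "'w \<Rightarrow> nat \<Rightarrow> 'a" where "\<theta>s \<omega> = (\<lambda>j\<in>{..<k}. distinct_values n \<theta> \<omega> ! j)"

definition ls :: "'w \<Rightarrow> nat \<Rightarrow> nat" where "ls \<omega> = (\<lambda>j\<in>{..<k}. alloc_index N \<tau> n \<theta> j \<omega>)"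

definition Ja :: "'w \<Rightarrow> nat \<Rightarrow> real" where "Ja \<omega> = (\<lambda>j\<in>{..<k}. J (alloc_index N \<tau> n \<theta> j \<omega>) \<omega>)"

definition Yna :: "'w \<Rightarrow> nat \<Rightarrow> real \<times> 'a" where
  "Yna \<omega> = (\<lambda>j\<in>{..<N \<omega> + 1 - k}. (J (rest (N \<omega>) k (ls \<omega>) j) \<omega>, \<tau> (rest (N \<omega>) k (ls \<omega>) j) \<omega>))"

text \<open>
  The almost sure properties under which the sample determines its allocation and \<open>U\<close> is positive.
\<close>
definition regular :: "'w \<Rightarrow> bool" where
  "regular \<omega> \<longleftrightarrow> (\<forall>j\<le>N \<omega>. 0 < J j \<omega>) \<and> inj_on (\<lambda>j. \<tau> j \<omega>) {..N \<omega>} \<and>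
    (\<forall>i<n. \<theta> i \<omega> \<in> (\<lambda>j. \<tau> j \<omega>) ` {..N \<omega>}) \<and> 0 < \<Gamma> \<omega>"

lemma AE_regular: "AE \<omega> in M. regular \<omega>"
  using AE_regular_aux unfolding regular_def .

lemma regular_E:
  assumes "regular \<omega>" "\<omega> \<in> E"
  shows "ls \<omega> \<in> injections k (N \<omega>)" "\<And>j. j < k \<Longrightarrow> \<theta>s \<omega> j = \<tau> (ls \<omega> j) \<omega>"
    "\<And>j. j < k \<Longrightarrow> Ja \<omega> j = J (ls \<omega> j) \<omega>"
proof -
  obtain l c where lc: "l \<in> injections k (N \<omega>)" "c \<in> patterns n k ns" "\<And>i. i < n \<Longrightarrow> \<theta> i \<omega> = \<tau> (l (c i)) \<omega>"
  proof (rule pattern_of_sample[where \<tau>=\<tau> and N=N and \<theta>=\<theta> and \<omega>=\<omega> and n=n and k=k and ns=ns])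
  qed (use assms that in \<open>auto simp: regular_def E_def\<close>)
  have inj: "inj_on (\<lambda>j. \<tau> j \<omega>) {..N \<omega>}" using assms by (simp add: regular_def)
  note s = sample_of_pattern[where \<tau>=\<tau> and N=N and \<omega>=\<omega> and \<theta>=\<theta>, OF inj lc]
  have l: "ls \<omega> = l"
    using s(3) injectionsD(4)[OF lc(1)] by (auto simp: ls_def extensional_def fun_eq_iff)
  show "ls \<omega> \<in> injections k (N \<omega>)" using l lc by simp
  show "\<theta>s \<omega> j = \<tau> (ls \<omega> j) \<omega>" if "j < k" for j using that s(1) by (simp add: \<theta>s_def l)
  show "Ja \<omega> j = J (ls \<omega> j) \<omega>" if "j < k" for j using that by (simp add: Ja_def ls_def)
qed

text \<open>
  The joint law of \<open>N\<close>, the labels of the allocated atoms, the distinct values, \<open>U\<close> and both families of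
  jumps.  The event \<open>E\<close> is decomposed according to \<open>N\<close> and the explaining pair of an injection and a
  pattern; the contribution of the latter does not depend on the pattern, whence the factor
  \<open>card (patterns n k ns)\<close>.
\<close>
lemma nn_integral_joint_law:
  assumes h: "\<And>m l. l \<in> injections k m \<Longrightarrow> h m l \<in> borel_measurable (latent_space (m + 1 - k))"
  shows "(\<integral>\<^sup>+\<omega>. indicator E \<omega> * h (N \<omega>) (ls \<omega>) (\<theta>s \<omega>, U \<omega>, Yna \<omega>, Ja \<omega>) \<partial>M) =
    (\<integral>\<^sup>+m. (\<Sum>l\<in>injections k m. of_nat (card (patterns n k ns)) *
      (\<integral>\<^sup>+u. allocation_weight (m + 1 - k) u * (\<integral>\<^sup>+t. cond_mean (m + 1 - k) (h m l) t u \<partial>Mt) \<partial>pos_lborel))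
      \<partial>measure_pmf (poisson_pmf \<Lambda>))"
proof -
  \<comment> \<open>The indicator restricts to \<open>\<gamma> > 0\<close>, since \<open>h\<close> is only measurable where \<open>u > 0\<close>.\<close>
  define D where "D = (\<lambda>m l (x :: nat \<Rightarrow> real \<times> 'a, \<gamma> :: real). indicator {0<..} \<gamma> * h m l (\<lambda>j\<in>{..<k}. snd (x (l j)), \<gamma> / (\<Sum>j\<le>m. fst (x j)),
         \<lambda>j\<in>{..<m + 1 - k}. x (rest m k l j), \<lambda>j\<in>{..<k}. fst (x (l j))))"
  have D: "D m l \<in> borel_measurable (MX m \<Otimes>\<^sub>M borel)" if l: "l \<in> injections k m" for m l
  proof -
    have lm: "l j \<le> m" if "j < k" for j using injectionsD(2)[OF l that] .
    have bm: "rest m k l j \<le> m" if "j < m + 1 - k" for j using bij_betwE[OF bij_betw_rest[OF l]] that by auto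
    have fm: "fst \<in> MX m \<Otimes>\<^sub>M borel \<rightarrow>\<^sub>M MX m" by measurable
    have T [measurable]: "(\<lambda>z. \<Sum>j\<le>m. fst (fst z j)) \<in> borel_measurable (MX m \<Otimes>\<^sub>M (borel :: real measure))"
      by (intro borel_measurable_sum measurable_MX(1)[OF fm]) auto
    have Tp: "0 < (\<Sum>j\<le>m. fst (fst z j))" if "z \<in> space (MX m \<Otimes>\<^sub>M (borel :: real measure))" for z
      using that space_MX[of "fst z" m] by (intro sum_pos) (auto simp: space_pair_measure)
    \<comment> \<open>The value \<open>1\<close> for \<open>\<gamma> \<le> 0\<close> is immaterial, as the indicator in \<open>D\<close> vanishes there.\<close>
    have U: "(\<lambda>z. (if 0 < snd z then snd z else 1) / (\<Sum>j\<le>m. fst (fst z j))) \<in> MX m \<Otimes>\<^sub>M borel \<rightarrow>\<^sub>M pos_borel"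
      using Tp by (intro measurable_restrict_space2) auto
    have "(\<lambda>z. (\<lambda>j\<in>{..<k}. snd (fst z (l j)), (if 0 < snd z then snd z else 1) / (\<Sum>j\<le>m. fst (fst z j)),
         \<lambda>j\<in>{..<m + 1 - k}. fst z (rest m k l j), \<lambda>j\<in>{..<k}. fst (fst z (l j))))
      \<in> MX m \<Otimes>\<^sub>M borel \<rightarrow>\<^sub>M latent_space (m + 1 - k)"
      by (intro measurable_Pair U measurable_restrict measurable_MX(2,3)[OF fm] lm
          measurable_compose[OF measurable_fst measurable_component_singleton]) (use bm in auto)
    from measurable_compose[OF this h[OF l]]
    have [measurable]: "(\<lambda>z. h m l (\<lambda>j\<in>{..<k}. snd (fst z (l j)), (if 0 < snd z then snd z else 1) / (\<Sum>j\<le>m. fst (fst z j)),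
         \<lambda>j\<in>{..<m + 1 - k}. fst z (rest m k l j), \<lambda>j\<in>{..<k}. fst (fst z (l j)))) \<in> borel_measurable (MX m \<Otimes>\<^sub>M borel)" .
    have "(\<lambda>z. indicator {0<..} (snd z) * h m l (\<lambda>j\<in>{..<k}. snd (fst z (l j)), (if 0 < snd z then snd z else 1) / (\<Sum>j\<le>m. fst (fst z j)),
         \<lambda>j\<in>{..<m + 1 - k}. fst z (rest m k l j), \<lambda>j\<in>{..<k}. fst (fst z (l j)))) \<in> borel_measurable (MX m \<Otimes>\<^sub>M borel)"
      by measurable
    also have "(\<lambda>z. indicator {0<..} (snd z) * h m l (\<lambda>j\<in>{..<k}. snd (fst z (l j)), (if 0 < snd z then snd z else 1) / (\<Sum>j\<le>m. fst (fst z j)),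
         \<lambda>j\<in>{..<m + 1 - k}. fst z (rest m k l j), \<lambda>j\<in>{..<k}. fst (fst z (l j)))) = D m l"
      unfolding D_def split_beta' by (intro ext) (simp add: indicator_def)
    finally show ?thesis .
  qed
  \<comment> \<open>For regular \<open>\<omega>\<close> at most one summand is nonzero, by \<open>sum_patterns\<close>.\<close>
  define S where "S = (\<lambda>m \<omega>. \<Sum>l\<in>injections k m. \<Sum>c\<in>patterns n k ns.
      of_bool (\<forall>i<n. \<theta> i \<omega> = \<tau> (l (c i)) \<omega>) * D m l (pos_atoms m \<omega>, \<Gamma> \<omega>))"
  have pred: "Measurable.pred M (\<lambda>\<omega>. \<forall>i<n. \<theta> i \<omega> = \<tau> (f i) \<omega>)" for f :: "nat \<Rightarrow> nat"
  proof -
    have "Measurable.pred M (\<lambda>\<omega>. \<forall>i\<in>{..<n}. dist (\<theta> i \<omega>) (\<tau> (f i) \<omega>) = 0)"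
    proof (intro pred_intros_finite finite_lessThan)
      fix i assume "i \<in> {..<n}"
      then have [measurable]: "\<theta> i \<in> borel_measurable M" "\<tau> (f i) \<in> borel_measurable M"
        using measurable_compose[OF \<theta> P0_id] measurable_compose[OF \<tau> P0_id] by auto
      show "Measurable.pred M (\<lambda>\<omega>. dist (\<theta> i \<omega>) (\<tau> (f i) \<omega>) = 0)" by measurable
    qed
    then show ?thesis by (simp add: Ball_def)
  qed
  have summand: "(\<lambda>\<omega>. of_bool (\<forall>i<n. \<theta> i \<omega> = \<tau> (l (c i)) \<omega>) * D m l (pos_atoms m \<omega>, \<Gamma> \<omega>)) \<in> borel_measurable M"
    if l: "l \<in> injections k m" for m l and c :: "nat \<Rightarrow> nat"
  proof -
    have [measurable]: "(\<lambda>\<omega>. D m l (pos_atoms m \<omega>, \<Gamma> \<omega>)) \<in> borel_measurable M"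
      by (rule measurable_compose[OF _ D[OF l]]) measurable
    note [measurable] = pred[of "\<lambda>i. l (c i)"]
    show ?thesis by measurable
  qed
  have S: "S m \<in> borel_measurable M" for m
    unfolding S_def by (intro borel_measurable_sum summand)
  have "(\<integral>\<^sup>+\<omega>. indicator E \<omega> * h (N \<omega>) (ls \<omega>) (\<theta>s \<omega>, U \<omega>, Yna \<omega>, Ja \<omega>) \<partial>M) =
    (\<integral>\<^sup>+\<omega>. (\<Sum>m. S m \<omega> * indicator (number_event m) \<omega>) \<partial>M)"
  proof (rule nn_integral_cong_AE, rule AE_mp[OF AE_regular], rule AE_I2, rule impI)
    fix \<omega> assume \<omega>: "\<omega> \<in> space M" and regular: "regular \<omega>"
    have "(\<Sum>m. S m \<omega> * indicator (number_event m) \<omega>) = S (N \<omega>) \<omega>"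
      using \<omega> by (intro suminf_cmult_indicator) (auto simp: disjoint_family_on_def)
    also have "\<dots> = of_bool (length (distinct_values n \<theta> \<omega>) = k \<and> (\<forall>j<k. multiplicity_of n \<theta> j \<omega> = ns j)) *
      D (N \<omega>) (\<lambda>j\<in>{..<k}. alloc_index N \<tau> n \<theta> j \<omega>) (pos_atoms (N \<omega>) \<omega>, \<Gamma> \<omega>)"
      unfolding S_def using regular unfolding regular_def by (intro sum_patterns) auto
    also have "\<dots> = indicator E \<omega> * D (N \<omega>) (ls \<omega>) (pos_atoms (N \<omega>) \<omega>, \<Gamma> \<omega>)"
      using \<omega> by (auto simp: E_def ls_def indicator_def)
    also have "\<dots> = indicator E \<omega> * h (N \<omega>) (ls \<omega>) (\<theta>s \<omega>, U \<omega>, Yna \<omega>, Ja \<omega>)"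
    proof (cases "\<omega> \<in> E")
      case True
      note g = regular_E[OF regular True]
      have J: "0 < J j \<omega>" if "j \<le> N \<omega>" for j using regular that by (simp add: regular_def)
      have lm: "ls \<omega> j \<le> N \<omega>" if "j < k" for j using injectionsD(2)[OF g(1) that] .
      have bm: "rest (N \<omega>) k (ls \<omega>) j \<le> N \<omega>" if "j < N \<omega> + 1 - k" for j using bij_betwE[OF bij_betw_rest[OF g(1)]] that by auto
      have pos_atoms: "pos_atoms (N \<omega>) \<omega> j = (J j \<omega>, \<tau> j \<omega>)" if "j \<le> N \<omega>" for j using that J by (simp add: pos_atoms_def pos_jump_def)
      have "(\<lambda>j\<in>{..<k}. snd (pos_atoms (N \<omega>) \<omega> (ls \<omega> j))) = \<theta>s \<omega>"
        using g(2) lm pos_atoms by (auto simp: fun_eq_iff \<theta>s_def)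
      moreover have "\<Gamma> \<omega> / (\<Sum>j\<le>N \<omega>. fst (pos_atoms (N \<omega>) \<omega> j)) = U \<omega>"
        using pos_atoms by (simp add: U_def crm_total_def)
      moreover have "(\<lambda>j\<in>{..<N \<omega> + 1 - k}. pos_atoms (N \<omega>) \<omega> (rest (N \<omega>) k (ls \<omega>) j)) = Yna \<omega>"
        using pos_atoms bm by (auto simp: fun_eq_iff Yna_def)
      moreover have "(\<lambda>j\<in>{..<k}. fst (pos_atoms (N \<omega>) \<omega> (ls \<omega> j))) = Ja \<omega>"
        using g(3) lm pos_atoms by (auto simp: fun_eq_iff Ja_def)
      moreover have "0 < \<Gamma> \<omega>" using regular by (simp add: regular_def)
      ultimately show ?thesis by (simp add: D_def)
    qed simp
    finally show "indicator E \<omega> * h (N \<omega>) (ls \<omega>) (\<theta>s \<omega>, U \<omega>, Yna \<omega>, Ja \<omega>) = (\<Sum>m. S m \<omega> * indicator (number_event m) \<omega>)" ..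
  qed
  also have "\<dots> = (\<Sum>m. \<integral>\<^sup>+\<omega>. S m \<omega> * indicator (number_event m) \<omega> \<partial>M)"
    by (intro nn_integral_suminf borel_measurable_times_ennreal S borel_measurable_indicator number_event)
  also have "\<dots> = (\<Sum>m. ennreal (pmf (poisson_pmf \<Lambda>) m) * (\<Sum>l\<in>injections k m. of_nat (card (patterns n k ns)) *
      (\<integral>\<^sup>+u. allocation_weight (m + 1 - k) u * (\<integral>\<^sup>+t. cond_mean (m + 1 - k) (h m l) t u \<partial>Mt) \<partial>pos_lborel)))"
  proof (intro arg_cong[where f=suminf] ext)
    fix m
    have "(\<integral>\<^sup>+\<omega>. S m \<omega> * indicator (number_event m) \<omega> \<partial>M) =
      (\<integral>\<^sup>+\<omega>. (\<Sum>l\<in>injections k m. \<Sum>c\<in>patterns n k ns.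
        indicator (number_event m) \<omega> * (of_bool (\<forall>i<n. \<theta> i \<omega> = \<tau> (l (c i)) \<omega>) * D m l (pos_atoms m \<omega>, \<Gamma> \<omega>))) \<partial>M)"
      unfolding S_def by (intro nn_integral_cong) (simp only: mult.commute sum_distrib_left)
    also have "\<dots> = (\<Sum>l\<in>injections k m. \<Sum>c\<in>patterns n k ns.
        \<integral>\<^sup>+\<omega>. indicator (number_event m) \<omega> * (of_bool (\<forall>i<n. \<theta> i \<omega> = \<tau> (l (c i)) \<omega>) * D m l (pos_atoms m \<omega>, \<Gamma> \<omega>)) \<partial>M)"
    proof -
      have sm: "(\<lambda>\<omega>. indicator (number_event m) \<omega> * (of_bool (\<forall>i<n. \<theta> i \<omega> = \<tau> (l (c i)) \<omega>) * D m l (pos_atoms m \<omega>, \<Gamma> \<omega>))) \<in> borel_measurable M"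
        if "l \<in> injections k m" for l and c :: "nat \<Rightarrow> nat"
        by (intro borel_measurable_times_ennreal borel_measurable_indicator number_event summand that)
      have "(\<integral>\<^sup>+\<omega>. (\<Sum>l\<in>injections k m. \<Sum>c\<in>patterns n k ns.
          indicator (number_event m) \<omega> * (of_bool (\<forall>i<n. \<theta> i \<omega> = \<tau> (l (c i)) \<omega>) * D m l (pos_atoms m \<omega>, \<Gamma> \<omega>))) \<partial>M) =
        (\<Sum>l\<in>injections k m. \<integral>\<^sup>+\<omega>. (\<Sum>c\<in>patterns n k ns.
          indicator (number_event m) \<omega> * (of_bool (\<forall>i<n. \<theta> i \<omega> = \<tau> (l (c i)) \<omega>) * D m l (pos_atoms m \<omega>, \<Gamma> \<omega>))) \<partial>M)"
        by (intro nn_integral_sum borel_measurable_sum sm)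
      also have "\<dots> = (\<Sum>l\<in>injections k m. \<Sum>c\<in>patterns n k ns.
        \<integral>\<^sup>+\<omega>. indicator (number_event m) \<omega> * (of_bool (\<forall>i<n. \<theta> i \<omega> = \<tau> (l (c i)) \<omega>) * D m l (pos_atoms m \<omega>, \<Gamma> \<omega>)) \<partial>M)"
        by (intro sum.cong refl nn_integral_sum sm)
      finally show ?thesis .
    qed
    also have "\<dots> = (\<Sum>l\<in>injections k m. \<Sum>c\<in>patterns n k ns. ennreal (pmf (poisson_pmf \<Lambda>) m) *
      (\<integral>\<^sup>+u. allocation_weight (m + 1 - k) u * (\<integral>\<^sup>+t. cond_mean (m + 1 - k) (h m l) t u \<partial>Mt) \<partial>pos_lborel))"
    proof (intro sum.cong refl)
      fix l c assume l: "l \<in> injections k m" and c: "c \<in> patterns n k ns"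
      show "(\<integral>\<^sup>+\<omega>. indicator (number_event m) \<omega> * (of_bool (\<forall>i<n. \<theta> i \<omega> = \<tau> (l (c i)) \<omega>) * D m l (pos_atoms m \<omega>, \<Gamma> \<omega>)) \<partial>M) =
        ennreal (pmf (poisson_pmf \<Lambda>) m) *
        (\<integral>\<^sup>+u. allocation_weight (m + 1 - k) u * (\<integral>\<^sup>+t. cond_mean (m + 1 - k) (h m l) t u \<partial>Mt) \<partial>pos_lborel)"
        unfolding nn_integral_pattern[OF l c D[OF l]] nn_integral_allocated[OF l h[OF l], symmetric]
        by (simp add: D_def)
    qed
    also have "\<dots> = ennreal (pmf (poisson_pmf \<Lambda>) m) * (\<Sum>l\<in>injections k m. of_nat (card (patterns n k ns)) *
      (\<integral>\<^sup>+u. allocation_weight (m + 1 - k) u * (\<integral>\<^sup>+t. cond_mean (m + 1 - k) (h m l) t u \<partial>Mt) \<partial>pos_lborel))"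
      by (simp add: sum_distrib_left mult.left_commute)
    finally show "(\<integral>\<^sup>+\<omega>. S m \<omega> * indicator (number_event m) \<omega> \<partial>M) = ennreal (pmf (poisson_pmf \<Lambda>) m) * (\<Sum>l\<in>injections k m. of_nat (card (patterns n k ns)) *
      (\<integral>\<^sup>+u. allocation_weight (m + 1 - k) u * (\<integral>\<^sup>+t. cond_mean (m + 1 - k) (h m l) t u \<partial>Mt) \<partial>pos_lborel))" .
  qed
  also have "\<dots> = (\<integral>\<^sup>+m. (\<Sum>l\<in>injections k m. of_nat (card (patterns n k ns)) *
      (\<integral>\<^sup>+u. allocation_weight (m + 1 - k) u * (\<integral>\<^sup>+t. cond_mean (m + 1 - k) (h m l) t u \<partial>Mt) \<partial>pos_lborel))
      \<partial>measure_pmf (poisson_pmf \<Lambda>))"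
    by (simp add: nn_integral_measure_pmf nn_integral_count_space_nat)
  finally show ?thesis .
qed

end

section \<open>Summation over the number and the labels of the atoms\<close>

text \<open>
  The two components of the mixture have weights proportional to \<open>r\<close> and \<open>k\<close> at the point \<open>r\<close>: shifting
  a Poisson law by one amounts to multiplying its probabilities by \<open>r / L\<close>.
\<close>
lemma pmf_nonalloc_number_law:
  assumes "0 < L" "1 \<le> k"
  shows "pmf (nonalloc_number_law k L) r = real (r + k) * L ^ r / (fact r * (L + real k)) * exp (- L)"
proof -
  have p: "0 \<le> L / (real k + L)" "L / (real k + L) \<le> 1" using assms by auto
  have s0: "pmf (shifted_poisson 0 L) r = pmf (poisson_pmf L) r"
    by (simp add: shifted_poisson_def map_pmf_ident)
  have s1: "pmf (shifted_poisson 1 L) r = (if r = 0 then 0 else pmf (poisson_pmf L) (r - 1))"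
  proof (cases r)
    case 0
    then show ?thesis by (simp add: shifted_poisson_def pmf_eq_0_set_pmf)
  next
    case (Suc r')
    have "pmf (map_pmf (\<lambda>x. 1 + x) (poisson_pmf L)) (1 + r') = pmf (poisson_pmf L) r'"
      by (rule pmf_map_inj') (simp add: inj_def)
    then show ?thesis using Suc by (simp add: shifted_poisson_def)
  qed
  have "pmf (nonalloc_number_law k L) r =
    L / (real k + L) * pmf (shifted_poisson 1 L) r + (1 - L / (real k + L)) * pmf (shifted_poisson 0 L) r"
    unfolding nonalloc_number_law_def pmf_bind using p by (subst integral_measure_pmf[of UNIV]) (auto simp: UNIV_bool)
  also have "1 - L / (real k + L) = real k / (real k + L)" using assms by (simp add: field_simps)
  also have "L / (real k + L) * pmf (shifted_poisson 1 L) r + real k / (real k + L) * pmf (shifted_poisson 0 L) r =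
    real (r + k) * L ^ r / (fact r * (L + real k)) * exp (- L)"
  proof (cases r)
    case 0
    then show ?thesis unfolding s0 s1 using assms by (simp add: add.commute)
  next
    case (Suc r')
    have f: "fact (Suc r') = (real r' + 1) * fact r'" by (simp add: algebra_simps)
    have nz: "real k + L \<noteq> 0" "fact r' \<noteq> (0 :: real)" "real r' + 1 \<noteq> 0" using assms by auto
    have "L / (real k + L) * (L ^ r' / fact r' * exp (- L)) + real k / (real k + L) * (L ^ Suc r' / fact (Suc r') * exp (- L)) =
       (real (Suc r' + k) * L ^ Suc r' / (fact (Suc r') * (L + real k))) * exp (- L)"
      unfolding f using nz by (simp add: divide_simps) (simp add: algebra_simps)
    then show ?thesis unfolding s0 s1 using assms Suc by simp
  qed
  finally show ?thesis .
qed

lemma nn_integral_cond_pmf: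
  assumes "set_pmf p \<inter> S \<noteq> {}"
  shows "(\<integral>\<^sup>+x. indicator S x * f x \<partial>measure_pmf p) = emeasure (measure_pmf p) S * (\<integral>\<^sup>+x. f x \<partial>measure_pmf (cond_pmf p S))"
proof -
  have S0: "measure (measure_pmf p) S \<noteq> 0"
    using assms by (simp add: measure_pmf_zero_iff)
  have "emeasure (measure_pmf p) S * (\<integral>\<^sup>+x. f x \<partial>measure_pmf (cond_pmf p S)) =
    (\<integral>\<^sup>+x. emeasure (measure_pmf p) S * (ennreal (pmf (cond_pmf p S) x) * f x) \<partial>count_space UNIV)"
    by (simp add: nn_integral_measure_pmf nn_integral_cmult)
  also have "\<dots> = (\<integral>\<^sup>+x. ennreal (pmf p x) * (indicator S x * f x) \<partial>count_space UNIV)"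
  proof (intro nn_integral_cong)
    fix x
    have "emeasure (measure_pmf p) S * ennreal (pmf (cond_pmf p S) x) = ennreal (pmf p x) * indicator S x"
      using S0 by (auto simp: pmf_cond[OF assms] measure_pmf.emeasure_eq_measure ennreal_mult[symmetric] indicator_def)
    then show "emeasure (measure_pmf p) S * (ennreal (pmf (cond_pmf p S) x) * f x) = ennreal (pmf p x) * (indicator S x * f x)"
      by (simp add: mult.assoc[symmetric])
  qed
  finally show ?thesis by (simp add: nn_integral_measure_pmf)
qed

context crm_sampling
begin

text \<open>
  The parameter \<open>\<Lambda>\<close> of the tilted process.
\<close>
definition \<Lambda>u :: "real \<Rightarrow> real" where "\<Lambda>u u = \<Lambda> * enn2real (tilted_moment 0 u)"

abbreviation nonalloc_number :: "real \<Rightarrow> nat measure" where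
  "nonalloc_number u \<equiv> measure_pmf (nonalloc_number_law k (\<Lambda>u u))"

lemma tilted_moment_0: "0 < u \<Longrightarrow> tilted_moment 0 u = ennreal (\<Lambda>u u / \<Lambda>)"
  using tilted_moment_finite[of u 0] \<Lambda> by (simp add: \<Lambda>u_def less_top)

lemma \<Lambda>u_pos: "0 < u \<Longrightarrow> 0 < \<Lambda>u u"
  using tilted_moment_pos[of 0 u] tilted_moment_finite[of u 0] \<Lambda> by (simp add: \<Lambda>u_def enn2real_positive_iff less_top)

lemma measurable_\<Lambda>u [measurable]: "\<Lambda>u \<in> borel_measurable pos_borel"
  unfolding \<Lambda>u_def[abs_def] by measurable

text \<open>
  Powers of the Laplace transform tilt a Poisson law into another Poisson law.  The exponent
  \<open>m + 1 - k\<close> instead of \<open>m\<close> only changes the constant.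
\<close>
lemma pmf_poisson_tilted:
  assumes u: "0 < u" and mk: "k \<le> m + 1"
  shows "ennreal (pmf (poisson_pmf \<Lambda>) m) * tilted_moment 0 u ^ (m + 1 - k) =
    ennreal (exp (\<Lambda>u u - \<Lambda>) * (\<Lambda> / \<Lambda>u u) ^ (k - 1)) * ennreal (pmf (poisson_pmf (\<Lambda>u u)) m)"
proof -
  define r where "r = m + 1 - k"
  have m: "m = r + (k - 1)" using mk k by (simp add: r_def)
  have "pmf (poisson_pmf \<Lambda>) m * (\<Lambda>u u / \<Lambda>) ^ r =
    exp (\<Lambda>u u - \<Lambda>) * (\<Lambda> / \<Lambda>u u) ^ (k - 1) * pmf (poisson_pmf (\<Lambda>u u)) m"
    using \<Lambda> \<Lambda>u_pos[OF u] by (simp add: m power_add power_divide exp_diff exp_minus field_simps)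
  then show ?thesis
    unfolding tilted_moment_0[OF u] r_def[symmetric]
    using \<Lambda> \<Lambda>u_pos[OF u] by (simp add: ennreal_power ennreal_mult[symmetric])
qed

text \<open>
  There are \<open>(m + 1)! / r!\<close> injections, where \<open>m = r + k - 1\<close>, so dividing by the \<open>m!\<close> of the Poisson law leaves
  the factor \<open>m + 1 = r + k\<close>.  It turns the tilted Poisson law into the mixture of a shifted and an
  unshifted one, whose total mass contributes \<open>\<Lambda>u u + k\<close>.
\<close>
lemma pmf_poisson_injections:
  assumes u: "0 < u"
  shows "ennreal (pmf (poisson_pmf \<Lambda>) (r + (k - 1))) * of_nat (card (injections k (r + (k - 1)))) * tilted_moment 0 u ^ r =
    ennreal (\<Lambda> ^ (k - 1) * exp (\<Lambda>u u - \<Lambda>) * (\<Lambda>u u + real k)) * ennreal (pmf (nonalloc_number_law k (\<Lambda>u u)) r)"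
proof -
  define c where "c = real (card (injections k (r + (k - 1))))"
  have "c * fact (r + (k - 1) + 1 - k) = fact (r + (k - 1) + 1)"
    unfolding c_def using k by (intro card_injections) simp
  moreover have "r + (k - 1) + 1 - k = r" "r + (k - 1) + 1 = Suc (r + (k - 1))" using k by auto
  ultimately have c: "c = real (r + k) * fact (r + (k - 1)) / fact r"
    using k by (cases k) (simp_all add: eq_divide_eq ac_simps)
  have "pmf (poisson_pmf \<Lambda>) (r + (k - 1)) * c * (\<Lambda>u u / \<Lambda>) ^ r =
    \<Lambda> ^ (k - 1) * exp (\<Lambda>u u - \<Lambda>) * (\<Lambda>u u + real k) * pmf (nonalloc_number_law k (\<Lambda>u u)) r"
  proof -
    have "(\<Lambda>u u + real k) * pmf (nonalloc_number_law k (\<Lambda>u u)) r = real (r + k) * \<Lambda>u u ^ r / fact r * exp (- \<Lambda>u u)"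
      using \<Lambda>u_pos[OF u] by (simp add: pmf_nonalloc_number_law[OF \<Lambda>u_pos[OF u] k])
    moreover have "exp (\<Lambda>u u - \<Lambda>) * exp (- \<Lambda>u u) = exp (- \<Lambda>)" by (simp add: exp_add[symmetric])
    ultimately have "\<Lambda> ^ (k - 1) * exp (\<Lambda>u u - \<Lambda>) * (\<Lambda>u u + real k) * pmf (nonalloc_number_law k (\<Lambda>u u)) r =
      \<Lambda> ^ (k - 1) * (real (r + k) * \<Lambda>u u ^ r / fact r) * exp (- \<Lambda>)"
      by (simp add: mult.assoc mult.left_commute)
    also have "\<dots> = pmf (poisson_pmf \<Lambda>) (r + (k - 1)) * c * (\<Lambda>u u / \<Lambda>) ^ r"
      using \<Lambda> unfolding c by (simp add: power_add power_divide)
    finally show ?thesis ..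
  qed
  moreover have "0 \<le> c" by (simp add: c_def)
  moreover have "of_nat (card (injections k (r + (k - 1)))) = ennreal c" by (simp add: c_def ennreal_of_nat_eq_real_of_nat)
  ultimately show ?thesis
    unfolding tilted_moment_0[OF u] using \<Lambda> \<Lambda>u_pos[OF u]
    by (simp add: ennreal_power ennreal_mult[symmetric] del: ennreal_of_nat_eq_real_of_nat)
qed

text \<open>
  The part of the weight in the joint law that depends neither on the number of atoms nor on the labels.
\<close>
definition base_density :: "real \<Rightarrow> ennreal" where
  "base_density u = of_nat (card (patterns n k ns)) * ennreal (u ^ (n - 1) / fact (n - 1)) * (\<Prod>j<k. tilted_moment (ns j) u)"

lemma measurable_base_density [measurable]: "base_density \<in> borel_measurable pos_borel"
  unfolding base_density_def by measurable

lemma allocation_weight_eq: "of_nat (card (patterns n k ns)) * allocation_weight r u = base_density u * tilted_moment 0 u ^ r"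
  by (simp add: allocation_weight_def base_density_def mult.assoc)

text \<open>
  The density of \<open>U\<close> on the event \<open>E\<close>; its mass is the probability of \<open>E\<close>.
\<close>
definition joint_density :: "real \<Rightarrow> ennreal" where
  "joint_density u = base_density u * ennreal (\<Lambda> ^ (k - 1) * exp (\<Lambda>u u - \<Lambda>) * (\<Lambda>u u + real k))"

text \<open>
  The density of \<open>U\<close> before conditioning \<open>N\<close> on the labels: for each vector of labels it is to be
  multiplied by the probability that a Poisson variable of mean \<open>\<Lambda>u u\<close> is at least as large as all of them.
\<close>
definition labelled_density :: "real \<Rightarrow> ennreal" where
  "labelled_density u = base_density u * ennreal (exp (\<Lambda>u u - \<Lambda>) * (\<Lambda> / \<Lambda>u u) ^ (k - 1))"

lemma measurable_joint_density [measurable]: "joint_density \<in> borel_measurable pos_borel"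
  and measurable_labelled_density [measurable]: "labelled_density \<in> borel_measurable pos_borel"
  unfolding joint_density_def labelled_density_def by measurable

lemma measurable_cond_mean:
  assumes g: "g \<in> borel_measurable (latent_space r)"
  shows "(\<lambda>z. \<integral>\<^sup>+y. \<integral>\<^sup>+a. g (fst z, snd z, y, a) \<partial>alloc_jumps (snd z) \<partial>nonalloc_jumps r (snd z)) \<in> borel_measurable (Mt \<Otimes>\<^sub>M pos_borel)"
proof -
  have 1: "(\<lambda>w. \<integral>\<^sup>+a. g (fst (fst w), snd (fst w), snd w, a) \<partial>alloc_jumps (snd (fst w))) \<in> borel_measurable ((Mt \<Otimes>\<^sub>M pos_borel) \<Otimes>\<^sub>M MY r)"
  proof (rule nn_integral_measurable_subprob_algebra2)
    show "(\<lambda>(w, a). g (fst (fst w), snd (fst w), snd w, a)) \<in> borel_measurable (((Mt \<Otimes>\<^sub>M pos_borel) \<Otimes>\<^sub>M MY r) \<Otimes>\<^sub>M MA)"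
      unfolding split_beta' by (rule measurable_compose[OF _ g]) measurable
    show "(\<lambda>w. alloc_jumps (snd (fst w))) \<in> (Mt \<Otimes>\<^sub>M pos_borel) \<Otimes>\<^sub>M MY r \<rightarrow>\<^sub>M subprob_algebra MA"
      by (rule measurable_compose[OF _ measurable_prob_algebraD[OF alloc_jumps]]) measurable
  qed
  show ?thesis
  proof (rule nn_integral_measurable_subprob_algebra2)
    show "(\<lambda>(z, y). \<integral>\<^sup>+a. g (fst z, snd z, y, a) \<partial>alloc_jumps (snd z)) \<in> borel_measurable ((Mt \<Otimes>\<^sub>M pos_borel) \<Otimes>\<^sub>M MY r)"
      using 1 by (simp add: split_beta')
    show "(\<lambda>z. nonalloc_jumps r (snd z)) \<in> Mt \<Otimes>\<^sub>M pos_borel \<rightarrow>\<^sub>M subprob_algebra (MY r)"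
      by (rule measurable_compose[OF _ measurable_prob_algebraD[OF nonalloc_jumps]]) measurable
  qed
qed

lemma measurable_cond_mean_t:
  assumes "g \<in> borel_measurable (latent_space r)" "0 < u"
  shows "(\<lambda>t. cond_mean r g t u) \<in> borel_measurable Mt"
  using measurable_compose[OF measurable_Pair2'[of u pos_borel Mt] measurable_cond_mean[OF assms(1)]] assms(2)
  by (simp add: space_pos_borel)

lemma measurable_cond_mean_u:
  assumes "g \<in> borel_measurable (latent_space r)"
  shows "(\<lambda>u. \<integral>\<^sup>+t. cond_mean r g t u \<partial>Mt) \<in> borel_measurable pos_borel"
proof -
  interpret T: prob_space Mt by (rule prob_space_Mt)
  have "(\<lambda>z. (snd z, fst z)) \<in> pos_borel \<Otimes>\<^sub>M Mt \<rightarrow>\<^sub>M Mt \<Otimes>\<^sub>M pos_borel" by measurable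
  from measurable_compose[OF this measurable_cond_mean[OF assms]]
  have "(\<lambda>z. \<integral>\<^sup>+y. \<integral>\<^sup>+a. g (snd z, fst z, y, a) \<partial>alloc_jumps (fst z) \<partial>nonalloc_jumps r (fst z)) \<in> borel_measurable (pos_borel \<Otimes>\<^sub>M Mt)" by simp
  from T.borel_measurable_nn_integral_fst[OF this] show ?thesis by simp
qed

text \<open>
  For functions that do not depend on the labels, the sum over \<open>m\<close> and the injections becomes a mean
  under the law of the number of non-allocated jumps.  The distinct values \<open>t\<close> are integrated with their
  law \<open>P0\<close>, independently of everything else, so the posterior depends on them only as atoms.
\<close>
lemma nn_integral_posterior:
  assumes h: "\<And>r. h r \<in> borel_measurable (latent_space r)"
  shows "(\<integral>\<^sup>+\<omega>. indicator E \<omega> * h (N \<omega> + 1 - k) (\<theta>s \<omega>, U \<omega>, Yna \<omega>, Ja \<omega>) \<partial>M) =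
    (\<integral>\<^sup>+u. joint_density u * (\<integral>\<^sup>+t. \<integral>\<^sup>+r. cond_mean r (h r) t u
      \<partial>nonalloc_number u \<partial>Mt) \<partial>pos_lborel)"
proof -
  define I where "I = (\<lambda>r u. \<integral>\<^sup>+t. cond_mean r (h r) t u \<partial>Mt)"
  have I [measurable]: "I r \<in> borel_measurable pos_borel" for r
    unfolding I_def by (rule measurable_cond_mean_u[OF h])
  have sw [measurable]: "allocation_weight r \<in> borel_measurable pos_borel" for r
    unfolding allocation_weight_def by measurable
  define f where "f = (\<lambda>m. ennreal (pmf (poisson_pmf \<Lambda>) m) * (of_nat (card (injections k m)) *
      (of_nat (card (patterns n k ns)) * (\<integral>\<^sup>+u. allocation_weight (m + 1 - k) u * I (m + 1 - k) u \<partial>pos_lborel))))"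
  have "(\<integral>\<^sup>+\<omega>. indicator E \<omega> * h (N \<omega> + 1 - k) (\<theta>s \<omega>, U \<omega>, Yna \<omega>, Ja \<omega>) \<partial>M) =
    (\<integral>\<^sup>+m. (\<Sum>l\<in>injections k m. of_nat (card (patterns n k ns)) *
      (\<integral>\<^sup>+u. allocation_weight (m + 1 - k) u * I (m + 1 - k) u \<partial>pos_lborel)) \<partial>measure_pmf (poisson_pmf \<Lambda>))"
    unfolding I_def by (rule nn_integral_joint_law[of "\<lambda>m l. h (m + 1 - k)"]) (rule h)
  also have "\<dots> = (\<integral>\<^sup>+m. f m \<partial>count_space UNIV)"
    by (simp add: nn_integral_measure_pmf f_def)
  also have "\<dots> = (\<integral>\<^sup>+m. f m \<partial>count_space {k - 1..})"
  proof -
    have "f m = 0" if "m < k - 1" for m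
      using that injections_empty[of m k] by (simp add: f_def)
    then have "(\<integral>\<^sup>+m. f m \<partial>count_space UNIV) = (\<integral>\<^sup>+m. f m * indicator {k - 1..} m \<partial>count_space UNIV)"
      by (intro nn_integral_cong) (auto simp: indicator_def not_le)
    then show ?thesis by (simp add: nn_integral_count_space_indicator)
  qed
  also have "\<dots> = (\<integral>\<^sup>+r. f (r + (k - 1)) \<partial>count_space UNIV)"
  proof (rule nn_integral_bij_count_space[symmetric])
    show "bij_betw (\<lambda>r. r + (k - 1)) UNIV {k - 1..}"
      by (rule bij_betwI[where g="\<lambda>m. m - (k - 1)"]) auto
  qed
  also have "\<dots> = (\<Sum>r. f (r + (k - 1)))" by (rule nn_integral_count_space_nat)
  also have "\<dots> = (\<Sum>r. \<integral>\<^sup>+u. joint_density u * (ennreal (pmf (nonalloc_number_law k (\<Lambda>u u)) r) * I r u) \<partial>pos_lborel)"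
  proof (intro arg_cong[where f=suminf] ext)
    fix r
    have r: "r + (k - 1) + 1 - k = r" using k by simp
    have "f (r + (k - 1)) = (\<integral>\<^sup>+u. (ennreal (pmf (poisson_pmf \<Lambda>) (r + (k - 1))) * of_nat (card (injections k (r + (k - 1)))) *
        of_nat (card (patterns n k ns))) * (allocation_weight r u * I r u) \<partial>pos_lborel)"
      unfolding f_def r by (subst nn_integral_cmult) (measurable, simp add: mult.assoc)
    also have "\<dots> = (\<integral>\<^sup>+u. joint_density u * (ennreal (pmf (nonalloc_number_law k (\<Lambda>u u)) r) * I r u) \<partial>pos_lborel)"
    proof (intro nn_integral_cong)
      fix u assume "u \<in> space pos_lborel"
      then have u: "0 < u" by (simp add: space_pos_borel)
      have "(ennreal (pmf (poisson_pmf \<Lambda>) (r + (k - 1))) * of_nat (card (injections k (r + (k - 1)))) * of_nat (card (patterns n k ns))) * allocation_weight r u =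
        base_density u * (ennreal (pmf (poisson_pmf \<Lambda>) (r + (k - 1))) * of_nat (card (injections k (r + (k - 1)))) * tilted_moment 0 u ^ r)"
      proof -
        have "a * b * c * w = (c * w) * (a * b)" for a b c w :: ennreal by (simp only: ac_simps)
        note this[of "ennreal (pmf (poisson_pmf \<Lambda>) (r + (k - 1)))" "of_nat (card (injections k (r + (k - 1))))"
            "of_nat (card (patterns n k ns))" "allocation_weight r u"]
        also note allocation_weight_eq
        also have "base_density u * tilted_moment 0 u ^ r * (a * b) = base_density u * (a * b * tilted_moment 0 u ^ r)" for a b :: ennreal
          by (simp only: ac_simps)
        finally show ?thesis .
      qed
      also have "\<dots> = joint_density u * ennreal (pmf (nonalloc_number_law k (\<Lambda>u u)) r)"
        unfolding pmf_poisson_injections[OF u] by (simp add: joint_density_def mult.assoc)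
      finally show "(ennreal (pmf (poisson_pmf \<Lambda>) (r + (k - 1))) * of_nat (card (injections k (r + (k - 1)))) * of_nat (card (patterns n k ns))) * (allocation_weight r u * I r u) =
        joint_density u * (ennreal (pmf (nonalloc_number_law k (\<Lambda>u u)) r) * I r u)"
        by (simp add: mult.assoc[symmetric])
    qed
    finally show "f (r + (k - 1)) = (\<integral>\<^sup>+u. joint_density u * (ennreal (pmf (nonalloc_number_law k (\<Lambda>u u)) r) * I r u) \<partial>pos_lborel)" .
  qed
  also have "\<dots> = (\<integral>\<^sup>+u. (\<Sum>r. joint_density u * (ennreal (pmf (nonalloc_number_law k (\<Lambda>u u)) r) * I r u)) \<partial>pos_lborel)"
  proof (rule nn_integral_suminf[symmetric])
    fix r
    have "(\<lambda>u. pmf (nonalloc_number_law k (\<Lambda>u u)) r) \<in> borel_measurable pos_borel"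
    proof -
      have "(\<lambda>u. real (r + k) * \<Lambda>u u ^ r / (fact r * (\<Lambda>u u + real k)) * exp (- \<Lambda>u u)) \<in> borel_measurable pos_borel" by measurable
      then show ?thesis
        by (rule measurable_cong[THEN iffD1, rotated]) (simp add: pmf_nonalloc_number_law[OF \<Lambda>u_pos k] space_pos_borel)
    qed
    then show "(\<lambda>u. joint_density u * (ennreal (pmf (nonalloc_number_law k (\<Lambda>u u)) r) * I r u)) \<in> borel_measurable pos_lborel"
      by measurable
  qed
  also have "\<dots> = (\<integral>\<^sup>+u. joint_density u * (\<integral>\<^sup>+t. \<integral>\<^sup>+r. cond_mean r (h r) t u
      \<partial>nonalloc_number u \<partial>Mt) \<partial>pos_lborel)"
  proof (intro nn_integral_cong)
    fix u assume "u \<in> space pos_lborel"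
    then have u: "0 < u" by (simp add: space_pos_borel)
    note mt = measurable_cond_mean_t[OF h u]
    have "(\<integral>\<^sup>+t. \<integral>\<^sup>+r. cond_mean r (h r) t u \<partial>nonalloc_number u \<partial>Mt) =
      (\<integral>\<^sup>+t. (\<Sum>r. ennreal (pmf (nonalloc_number_law k (\<Lambda>u u)) r) * (cond_mean r (h r) t u)) \<partial>Mt)"
      by (simp add: nn_integral_measure_pmf nn_integral_count_space_nat)
    also have "\<dots> = (\<Sum>r. ennreal (pmf (nonalloc_number_law k (\<Lambda>u u)) r) * I r u)"
      unfolding I_def using mt by (subst nn_integral_suminf) (simp_all add: nn_integral_cmult)
    finally show "(\<Sum>r. joint_density u * (ennreal (pmf (nonalloc_number_law k (\<Lambda>u u)) r) * I r u)) =
      joint_density u * (\<integral>\<^sup>+t. \<integral>\<^sup>+r. cond_mean r (h r) t u \<partial>nonalloc_number u \<partial>Mt)"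
      by simp
  qed
  finally show ?thesis .
qed

definition all_injections :: "(nat \<Rightarrow> nat) set" where
  "all_injections = {l \<in> extensional {..<k}. inj_on l {..<k}}"

text \<open>
  Keeping the labels \<open>l\<close> and summing over \<open>m\<close> instead: \<open>l\<close> enters only through the condition that \<open>m\<close> is not
  smaller than any label.
\<close>
lemma nn_integral_labelled:
  assumes h: "\<And>m l. l \<in> injections k m \<Longrightarrow> h m l \<in> borel_measurable (latent_space (m + 1 - k))"
  shows "(\<integral>\<^sup>+\<omega>. indicator E \<omega> * h (N \<omega>) (ls \<omega>) (\<theta>s \<omega>, U \<omega>, Yna \<omega>, Ja \<omega>) \<partial>M) =
    (\<integral>\<^sup>+l. \<integral>\<^sup>+u. labelled_density u * (\<integral>\<^sup>+t. \<integral>\<^sup>+m. indicator {m. \<forall>i<k. l i \<le> m} m *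
       (cond_mean (m + 1 - k) (h m l) t u) \<partial>measure_pmf (poisson_pmf (\<Lambda>u u)) \<partial>Mt) \<partial>pos_lborel
      \<partial>count_space all_injections)"
proof -
  define V where "V = (\<lambda>l. {m. \<forall>i<k. l i \<le> (m :: nat)})"
  have inj_iff: "l \<in> injections k m \<longleftrightarrow> m \<in> V l" if "l \<in> all_injections" for l m
    using that by (auto simp: all_injections_def injections_def V_def PiE_iff)
  have inj_sub: "injections k m \<subseteq> all_injections" for m
    by (auto simp: all_injections_def injections_def PiE_iff)
  have sw [measurable]: "allocation_weight r \<in> borel_measurable pos_borel" for r
    unfolding allocation_weight_def by measurable
  define I where "I = (\<lambda>m l u. indicator (V l) m * (\<integral>\<^sup>+t. cond_mean (m + 1 - k) (h m l) t u \<partial>Mt))"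
  have I [measurable]: "I m l \<in> borel_measurable pos_borel" if "l \<in> all_injections" for m l
  proof (cases "m \<in> V l")
    case True
    then show ?thesis unfolding I_def using measurable_cond_mean_u[OF h[of l m]] inj_iff[OF that] by simp
  next
    case False
    then show ?thesis unfolding I_def by simp
  qed
  have "(\<integral>\<^sup>+\<omega>. indicator E \<omega> * h (N \<omega>) (ls \<omega>) (\<theta>s \<omega>, U \<omega>, Yna \<omega>, Ja \<omega>) \<partial>M) =
    (\<integral>\<^sup>+m. (\<Sum>l\<in>injections k m. of_nat (card (patterns n k ns)) *
      (\<integral>\<^sup>+u. allocation_weight (m + 1 - k) u * (\<integral>\<^sup>+t. cond_mean (m + 1 - k) (h m l) t u \<partial>Mt) \<partial>pos_lborel))
      \<partial>measure_pmf (poisson_pmf \<Lambda>))"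
    by (rule nn_integral_joint_law[OF h])
  also have "\<dots> = (\<integral>\<^sup>+m. (\<integral>\<^sup>+l. of_nat (card (patterns n k ns)) *
      (\<integral>\<^sup>+u. allocation_weight (m + 1 - k) u * I m l u \<partial>pos_lborel) \<partial>count_space all_injections) \<partial>measure_pmf (poisson_pmf \<Lambda>))"
  proof (intro nn_integral_cong)
    fix m
    have "(\<integral>\<^sup>+l. of_nat (card (patterns n k ns)) * (\<integral>\<^sup>+u. allocation_weight (m + 1 - k) u * I m l u \<partial>pos_lborel) \<partial>count_space all_injections) =
      (\<integral>\<^sup>+l. of_nat (card (patterns n k ns)) * (\<integral>\<^sup>+u. allocation_weight (m + 1 - k) u * I m l u \<partial>pos_lborel) \<partial>count_space (injections k m))"
      using inj_iff inj_sub by (intro nn_integral_count_space_eq) (auto simp: I_def)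
    also have "\<dots> = (\<Sum>l\<in>injections k m. of_nat (card (patterns n k ns)) * (\<integral>\<^sup>+u. allocation_weight (m + 1 - k) u * I m l u \<partial>pos_lborel))"
      by (rule nn_integral_count_space_finite) (rule finite_injections)
    also have "\<dots> = (\<Sum>l\<in>injections k m. of_nat (card (patterns n k ns)) *
      (\<integral>\<^sup>+u. allocation_weight (m + 1 - k) u * (\<integral>\<^sup>+t. cond_mean (m + 1 - k) (h m l) t u \<partial>Mt) \<partial>pos_lborel))"
    proof (intro sum.cong refl)
      fix l assume l: "l \<in> injections k m"
      then have "m \<in> V l" using inj_iff inj_sub by blast
      then show "of_nat (card (patterns n k ns)) * (\<integral>\<^sup>+u. allocation_weight (m + 1 - k) u * I m l u \<partial>pos_lborel) =
        of_nat (card (patterns n k ns)) *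
      (\<integral>\<^sup>+u. allocation_weight (m + 1 - k) u * (\<integral>\<^sup>+t. cond_mean (m + 1 - k) (h m l) t u \<partial>Mt) \<partial>pos_lborel)"
        by (simp add: I_def)
    qed
    finally show "(\<Sum>l\<in>injections k m. of_nat (card (patterns n k ns)) *
      (\<integral>\<^sup>+u. allocation_weight (m + 1 - k) u * (\<integral>\<^sup>+t. cond_mean (m + 1 - k) (h m l) t u \<partial>Mt) \<partial>pos_lborel)) =
      (\<integral>\<^sup>+l. of_nat (card (patterns n k ns)) * (\<integral>\<^sup>+u. allocation_weight (m + 1 - k) u * I m l u \<partial>pos_lborel) \<partial>count_space all_injections)" ..
  qed
  also have "\<dots> = (\<integral>\<^sup>+l. (\<Sum>m. ennreal (pmf (poisson_pmf \<Lambda>) m) * (of_nat (card (patterns n k ns)) *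
      (\<integral>\<^sup>+u. allocation_weight (m + 1 - k) u * I m l u \<partial>pos_lborel))) \<partial>count_space all_injections)"
    by (subst nn_integral_suminf) (simp_all add: nn_integral_measure_pmf nn_integral_count_space_nat nn_integral_cmult)
  also have "\<dots> = (\<integral>\<^sup>+l. \<integral>\<^sup>+u. labelled_density u * (\<integral>\<^sup>+t. \<integral>\<^sup>+m. indicator (V l) m *
       (cond_mean (m + 1 - k) (h m l) t u) \<partial>measure_pmf (poisson_pmf (\<Lambda>u u)) \<partial>Mt) \<partial>pos_lborel
      \<partial>count_space all_injections)"
  proof (intro nn_integral_cong)
    fix l assume "l \<in> space (count_space all_injections)"
    then have l: "l \<in> all_injections" by simp
    note [measurable] = I[OF l]
    have "(\<Sum>m. ennreal (pmf (poisson_pmf \<Lambda>) m) * (of_nat (card (patterns n k ns)) *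
        (\<integral>\<^sup>+u. allocation_weight (m + 1 - k) u * I m l u \<partial>pos_lborel))) =
      (\<Sum>m. \<integral>\<^sup>+u. (ennreal (pmf (poisson_pmf \<Lambda>) m) * of_nat (card (patterns n k ns))) *
        (allocation_weight (m + 1 - k) u * I m l u) \<partial>pos_lborel)"
      by (subst nn_integral_cmult) (measurable, simp add: mult.assoc)
    also have "\<dots> = (\<integral>\<^sup>+u. (\<Sum>m. (ennreal (pmf (poisson_pmf \<Lambda>) m) * of_nat (card (patterns n k ns))) *
        (allocation_weight (m + 1 - k) u * I m l u)) \<partial>pos_lborel)"
      by (rule nn_integral_suminf[symmetric]) measurable
    also have "\<dots> = (\<integral>\<^sup>+u. labelled_density u * (\<integral>\<^sup>+t. \<integral>\<^sup>+m. indicator (V l) m *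
       (cond_mean (m + 1 - k) (h m l) t u) \<partial>measure_pmf (poisson_pmf (\<Lambda>u u)) \<partial>Mt) \<partial>pos_lborel)"
    proof (intro nn_integral_cong)
      fix u assume "u \<in> space pos_lborel"
      then have u: "0 < u" by (simp add: space_pos_borel)
      have mt: "(\<lambda>t. indicator (V l) m * (cond_mean (m + 1 - k) (h m l) t u)) \<in> borel_measurable Mt" for m
        using measurable_cond_mean_t[OF h[of l m] u] inj_iff[OF l] by (cases "m \<in> V l") simp_all
      have It: "I m l u = (\<integral>\<^sup>+t. indicator (V l) m * (cond_mean (m + 1 - k) (h m l) t u) \<partial>Mt)" for m
        by (simp add: I_def indicator_def)
      have "(\<Sum>m. (ennreal (pmf (poisson_pmf \<Lambda>) m) * of_nat (card (patterns n k ns))) * (allocation_weight (m + 1 - k) u * I m l u)) =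
        (\<Sum>m. labelled_density u * (ennreal (pmf (poisson_pmf (\<Lambda>u u)) m) * I m l u))"
      proof (intro arg_cong[where f=suminf] ext)
        fix m
        show "(ennreal (pmf (poisson_pmf \<Lambda>) m) * of_nat (card (patterns n k ns))) * (allocation_weight (m + 1 - k) u * I m l u) =
          labelled_density u * (ennreal (pmf (poisson_pmf (\<Lambda>u u)) m) * I m l u)"
        proof (cases "m \<in> V l")
          case True
          then have mk: "k \<le> m + 1" using inj_iff[OF l] injectionsD(3) by blast
          have "(ennreal (pmf (poisson_pmf \<Lambda>) m) * of_nat (card (patterns n k ns))) * allocation_weight (m + 1 - k) u =
            base_density u * (ennreal (pmf (poisson_pmf \<Lambda>) m) * tilted_moment 0 u ^ (m + 1 - k))"
          proof -
            have "a * c * w = (c * w) * a" for a c w :: ennreal by (simp only: ac_simps)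
            note this[of "ennreal (pmf (poisson_pmf \<Lambda>) m)" "of_nat (card (patterns n k ns))" "allocation_weight (m + 1 - k) u"]
            also note allocation_weight_eq
            also have "base_density u * tilted_moment 0 u ^ (m + 1 - k) * a = base_density u * (a * tilted_moment 0 u ^ (m + 1 - k))" for a :: ennreal
              by (simp only: ac_simps)
            finally show ?thesis .
          qed
          also have "\<dots> = labelled_density u * ennreal (pmf (poisson_pmf (\<Lambda>u u)) m)"
            unfolding pmf_poisson_tilted[OF u mk] by (simp add: labelled_density_def mult.assoc)
          finally show ?thesis by (simp add: mult.assoc[symmetric])
        next
          case False
          then show ?thesis by (simp add: I_def)
        qed
      qed
      also have "\<dots> = labelled_density u * (\<Sum>m. ennreal (pmf (poisson_pmf (\<Lambda>u u)) m) * I m l u)" by simp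
      also have "(\<Sum>m. ennreal (pmf (poisson_pmf (\<Lambda>u u)) m) * I m l u) =
        (\<integral>\<^sup>+t. (\<Sum>m. ennreal (pmf (poisson_pmf (\<Lambda>u u)) m) * (indicator (V l) m * (cond_mean (m + 1 - k) (h m l) t u))) \<partial>Mt)"
        unfolding It using mt by (subst nn_integral_suminf) (simp_all add: nn_integral_cmult)
      finally show "(\<Sum>m. (ennreal (pmf (poisson_pmf \<Lambda>) m) * of_nat (card (patterns n k ns))) * (allocation_weight (m + 1 - k) u * I m l u)) =
        labelled_density u * (\<integral>\<^sup>+t. \<integral>\<^sup>+m. indicator (V l) m *
       (cond_mean (m + 1 - k) (h m l) t u) \<partial>measure_pmf (poisson_pmf (\<Lambda>u u)) \<partial>Mt)"
        by (simp add: nn_integral_measure_pmf nn_integral_count_space_nat)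
    qed
    finally show "(\<Sum>m. ennreal (pmf (poisson_pmf \<Lambda>) m) * (of_nat (card (patterns n k ns)) *
        (\<integral>\<^sup>+u. allocation_weight (m + 1 - k) u * I m l u \<partial>pos_lborel))) =
      (\<integral>\<^sup>+u. labelled_density u * (\<integral>\<^sup>+t. \<integral>\<^sup>+m. indicator (V l) m *
       (cond_mean (m + 1 - k) (h m l) t u) \<partial>measure_pmf (poisson_pmf (\<Lambda>u u)) \<partial>Mt) \<partial>pos_lborel)" .
  qed
  finally show ?thesis unfolding V_def .
qed

end

section \<open>Measurability on an event\<close>

text \<open>
  Measurability of \<open>f\<close> on \<open>E\<close> in the sense required of a conditional distribution.  Unlike a measurable
  map on \<open>restrict_space M E\<close>, \<open>f\<close> may take values outside \<open>space S\<close>; for instance the jumps need only be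
  positive almost surely.
\<close>
definition meas_on :: "'w measure \<Rightarrow> 'w set \<Rightarrow> ('w \<Rightarrow> 'x) \<Rightarrow> 'x measure \<Rightarrow> bool" where
  "meas_on M E f S \<longleftrightarrow> (\<forall>A\<in>sets S. {\<omega>\<in>E. f \<omega> \<in> A} \<in> sets M)"

lemma meas_on_cong:
  assumes "meas_on M E g S" "\<And>\<omega>. \<omega> \<in> E \<Longrightarrow> f \<omega> = g \<omega>"
  shows "meas_on M E f S"
proof -
  have "{\<omega>\<in>E. f \<omega> \<in> A} = {\<omega>\<in>E. g \<omega> \<in> A}" for A using assms(2) by auto
  then show ?thesis using assms(1) by (simp add: meas_on_def)
qed

lemma meas_on_measurable:
  assumes "E \<in> sets M" "f \<in> M \<rightarrow>\<^sub>M S"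
  shows "meas_on M E f S"
  unfolding meas_on_def
proof
  fix A assume "A \<in> sets S"
  then have "f -` A \<inter> space M \<in> sets M" using assms(2) by (rule measurable_sets[rotated])
  moreover have "{\<omega>\<in>E. f \<omega> \<in> A} = E \<inter> (f -` A \<inter> space M)"
    using sets.sets_into_space[OF assms(1)] by auto
  ultimately show "{\<omega>\<in>E. f \<omega> \<in> A} \<in> sets M" using assms(1) by auto
qed

text \<open>
  Points of \<open>E\<close> outside \<open>G\<close> belong to no preimage.
\<close>
lemma meas_on_restrict:
  assumes "E \<in> sets M" "G \<in> sets M" and f: "f \<in> restrict_space M G \<rightarrow>\<^sub>M S"
    and "\<And>\<omega>. \<omega> \<in> E \<Longrightarrow> \<omega> \<notin> G \<Longrightarrow> f \<omega> \<notin> space S"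
  shows "meas_on M E f S"
  unfolding meas_on_def
proof
  fix A assume A: "A \<in> sets S"
  have G: "G \<inter> space M = G" using sets.sets_into_space[OF assms(2)] by auto
  have "f -` A \<inter> G \<in> sets (restrict_space M G)"
    using measurable_sets[OF f A] G by (simp add: space_restrict_space Int_commute)
  then have "f -` A \<inter> G \<in> sets M" using assms(2) G by (simp add: sets_restrict_space_iff)
  moreover have "{\<omega>\<in>E. f \<omega> \<in> A} = E \<inter> (f -` A \<inter> G)"
    using assms(4) sets.sets_into_space[OF A] by auto
  ultimately show "{\<omega>\<in>E. f \<omega> \<in> A} \<in> sets M" using assms(1) by auto
qed

lemma meas_onD:
  assumes "meas_on M E f S" and E: "E \<in> sets M"
  shows "{\<omega>\<in>E. f \<omega> \<in> space S} \<in> sets M" "f \<in> restrict_space M {\<omega>\<in>E. f \<omega> \<in> space S} \<rightarrow>\<^sub>M S"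
proof -
  let ?G = "{\<omega>\<in>E. f \<omega> \<in> space S}"
  show G: "?G \<in> sets M" using assms by (auto simp: meas_on_def)
  then have sp: "space (restrict_space M ?G) = ?G"
    using sets.sets_into_space[OF G] by (auto simp: space_restrict_space)
  show "f \<in> restrict_space M ?G \<rightarrow>\<^sub>M S"
  proof (rule measurableI)
    show "f x \<in> space S" if "x \<in> space (restrict_space M ?G)" for x
      using that unfolding sp by auto
    fix A assume A: "A \<in> sets S"
    have "f -` A \<inter> ?G = {\<omega>\<in>E. f \<omega> \<in> A}" using sets.sets_into_space[OF A] by auto
    then have "f -` A \<inter> ?G \<in> sets M" using assms A by (auto simp: meas_on_def)
    moreover have "?G \<inter> space M \<in> sets M" using G by auto
    ultimately show "f -` A \<inter> space (restrict_space M ?G) \<in> sets (restrict_space M ?G)"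
      unfolding sp by (subst sets_restrict_space_iff) auto
  qed
qed

lemma meas_on_Pair:
  assumes E: "E \<in> sets M" and f: "meas_on M E f S" and g: "meas_on M E g T"
  shows "meas_on M E (\<lambda>\<omega>. (f \<omega>, g \<omega>)) (S \<Otimes>\<^sub>M T)"
proof (rule meas_on_restrict[OF E])
  let ?F = "{\<omega>\<in>E. f \<omega> \<in> space S}" and ?G = "{\<omega>\<in>E. g \<omega> \<in> space T}"
  show "?F \<inter> ?G \<in> sets M" using meas_onD(1)[OF f E] meas_onD(1)[OF g E] by auto
  have "f \<in> restrict_space M (?F \<inter> ?G) \<rightarrow>\<^sub>M S"
    by (rule measurable_restrict_mono[OF meas_onD(2)[OF f E]]) auto
  moreover have "g \<in> restrict_space M (?F \<inter> ?G) \<rightarrow>\<^sub>M T"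
    by (rule measurable_restrict_mono[OF meas_onD(2)[OF g E]]) auto
  ultimately show "(\<lambda>\<omega>. (f \<omega>, g \<omega>)) \<in> restrict_space M (?F \<inter> ?G) \<rightarrow>\<^sub>M S \<Otimes>\<^sub>M T" by simp
qed (auto simp: space_pair_measure)

lemma meas_on_PiM:
  assumes E: "E \<in> sets M" and I: "finite I" and f: "\<And>i. i \<in> I \<Longrightarrow> meas_on M E (\<lambda>\<omega>. f i \<omega>) (S i)"
  shows "meas_on M E (\<lambda>\<omega>. \<lambda>i\<in>I. f i \<omega>) (Pi\<^sub>M I S)"
proof (rule meas_on_restrict[OF E])
  let ?F = "\<lambda>i. {\<omega>\<in>E. f i \<omega> \<in> space (S i)}"
  let ?G = "{\<omega>\<in>E. \<forall>i\<in>I. f i \<omega> \<in> space (S i)}"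
  have "?G = E \<inter> (\<Inter>i\<in>I. ?F i) \<or> I = {} \<and> ?G = E" by auto
  moreover have "E \<inter> (\<Inter>i\<in>I. ?F i) \<in> sets M" if "I \<noteq> {}"
    using that I E meas_onD(1)[OF f E] by (intro sets.Int sets.finite_INT) auto
  ultimately show "?G \<in> sets M" using E by (cases "I = {}") auto
  have "f i \<in> restrict_space M ?G \<rightarrow>\<^sub>M S i" if "i \<in> I" for i
    by (rule measurable_restrict_mono[OF meas_onD(2)[OF f[OF that] E]]) (use that in auto)
  then show "(\<lambda>\<omega>. \<lambda>i\<in>I. f i \<omega>) \<in> restrict_space M ?G \<rightarrow>\<^sub>M Pi\<^sub>M I S" by (rule measurable_restrict)
qed (auto simp: space_PiM PiE_iff)

lemma meas_on_restrict_space: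
  assumes "E \<in> sets M" "f \<in> M \<rightarrow>\<^sub>M B" "S \<inter> space B \<in> sets B"
  shows "meas_on M E f (restrict_space B S)"
  using meas_on_measurable[OF assms(1,2)] assms(3)
  by (auto simp: meas_on_def sets_restrict_space_iff)

text \<open>
  Having total mass at most \<open>1\<close>, or equal to \<open>1\<close>, is a measurable condition.
\<close>
lemma meas_on_subprob_algebra:
  assumes E: "E \<in> sets M" and S: "space S \<noteq> {}" and sets: "\<And>\<omega>. sets (\<kappa> \<omega>) = sets S"
    and em: "\<And>A. A \<in> sets S \<Longrightarrow> (\<lambda>\<omega>. emeasure (\<kappa> \<omega>) A) \<in> borel_measurable M"
  shows "meas_on M E \<kappa> (subprob_algebra S)" "meas_on M E \<kappa> (prob_algebra S)"
proof -
  have sp: "space (\<kappa> \<omega>) = space S" for \<omega> using sets by (rule sets_eq_imp_space_eq)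
  have [measurable]: "(\<lambda>\<omega>. emeasure (\<kappa> \<omega>) (space S)) \<in> borel_measurable M" by (rule em) simp
  let ?G = "{\<omega>\<in>space M. emeasure (\<kappa> \<omega>) (space S) \<le> 1}" and ?H = "{\<omega>\<in>space M. emeasure (\<kappa> \<omega>) (space S) = 1}"
  have G: "?G \<in> sets M" "?H \<in> sets M" by measurable
  have sub: "subprob_space (\<kappa> \<omega>) \<longleftrightarrow> emeasure (\<kappa> \<omega>) (space S) \<le> 1" for \<omega>
    using S by (auto simp: sp intro!: subprob_spaceI dest: subprob_space.emeasure_space_le_1)
  have pr: "prob_space (\<kappa> \<omega>) \<longleftrightarrow> emeasure (\<kappa> \<omega>) (space S) = 1" for \<omega>
    by (auto simp: sp intro!: prob_spaceI dest: prob_space.emeasure_space_1)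
  have Esp: "E \<subseteq> space M" by (rule sets.sets_into_space[OF E])
  have \<kappa>: "\<kappa> \<in> restrict_space M X \<rightarrow>\<^sub>M subprob_algebra S" if "X \<subseteq> ?G" for X
    using that by (intro measurable_subprob_algebra measurable_restrict_space1 em sets) (auto simp: space_restrict_space sub)
  show "meas_on M E \<kappa> (subprob_algebra S)"
    by (rule meas_on_restrict[OF E G(1) \<kappa>]) (use Esp in \<open>auto simp: space_subprob_algebra sub\<close>)
  show "meas_on M E \<kappa> (prob_algebra S)"
  proof (rule meas_on_restrict[OF E G(2)])
    show "\<kappa> \<in> restrict_space M ?H \<rightarrow>\<^sub>M prob_algebra S"
      by (rule measurable_prob_algebraI[OF _ \<kappa>]) (auto simp: space_restrict_space pr)
  qed (use Esp in \<open>auto simp: space_prob_algebra pr\<close>)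
qed

lemma cond_distr_onI:
  assumes M: "prob_space M" and E: "E \<in> sets M" and K: "K \<in> MY \<rightarrow>\<^sub>M prob_algebra MX"
    and X: "meas_on M E X MX" and Y: "meas_on M E Y MY" and AEY: "AE \<omega> in M. \<omega> \<in> E \<longrightarrow> Y \<omega> \<in> space MY"
    and eq: "\<And>A B. A \<in> sets MX \<Longrightarrow> B \<in> sets MY \<Longrightarrow>
      (\<integral>\<^sup>+\<omega>. indicator E \<omega> * (indicator A (X \<omega>) * indicator B (Y \<omega>)) \<partial>M) =
      (\<integral>\<^sup>+\<omega>. indicator E \<omega> * (emeasure (K (Y \<omega>)) A * indicator B (Y \<omega>)) \<partial>M)"
  shows "cond_distr_on M E X MX Y MY K"
  unfolding cond_distr_on_def
proof (intro conjI ballI K AEY)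
  fix B assume B: "B \<in> sets MY"
  show YB: "{\<omega> \<in> E. Y \<omega> \<in> B} \<in> sets M" using Y B by (simp add: meas_on_def)
  fix A assume A: "A \<in> sets MX"
  have "{\<omega> \<in> E. X \<omega> \<in> A \<and> Y \<omega> \<in> B} = {\<omega> \<in> E. X \<omega> \<in> A} \<inter> {\<omega> \<in> E. Y \<omega> \<in> B}" by auto
  also have "\<dots> \<in> sets M" using X A YB by (auto simp: meas_on_def)
  finally show XYB: "{\<omega> \<in> E. X \<omega> \<in> A \<and> Y \<omega> \<in> B} \<in> sets M" .
  have "emeasure M {\<omega> \<in> E. X \<omega> \<in> A \<and> Y \<omega> \<in> B} = (\<integral>\<^sup>+\<omega>. indicator {\<omega> \<in> E. X \<omega> \<in> A \<and> Y \<omega> \<in> B} \<omega> \<partial>M)"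
    using XYB by simp
  also have "\<dots> = (\<integral>\<^sup>+\<omega>. indicator E \<omega> * (indicator A (X \<omega>) * indicator B (Y \<omega>)) \<partial>M)"
    by (intro nn_integral_cong) (auto simp: indicator_def)
  also have "\<dots> = (\<integral>\<^sup>+\<omega>. indicator E \<omega> * (emeasure (K (Y \<omega>)) A * indicator B (Y \<omega>)) \<partial>M)" by (rule eq[OF A B])
  also have "\<dots> = (\<integral>\<^sup>+\<omega>. emeasure (K (Y \<omega>)) A * indicator {\<omega> \<in> E. Y \<omega> \<in> B} \<omega> \<partial>M)"
    by (intro nn_integral_cong) (auto simp: indicator_def)
  finally show "emeasure M {\<omega> \<in> E. X \<omega> \<in> A \<and> Y \<omega> \<in> B} = \<dots>" .
qed

section \<open>Measurability of the distinct values and of the allocation\<close>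

lemma firsts_snoc: "firsts (xs @ [x]) = (if x \<in> set xs then firsts xs else firsts xs @ [x])"
  by (simp add: firsts_def)

lemma firsts_map_upt: "firsts (map f [0..<n]) = map f (filter (\<lambda>i. \<forall>j<i. f j \<noteq> f i) [0..<n])"
proof (induction n)
  case (Suc n)
  have "f n \<in> set (map f [0..<n]) \<longleftrightarrow> (\<exists>j<n. f j = f n)"
    by (simp add: image_iff Bex_def eq_commute[of "f n"])
  then show ?case using Suc by (simp add: firsts_snoc)
qed (simp add: firsts_def)

text \<open>
  Describes the event that a filtered list takes a given value by finitely many conditions, each on
  a single index.
\<close>
lemma filter_upt_eq_iff:
  "filter P [0..<n] = xs \<longleftrightarrow> (\<forall>i<n. P i \<longleftrightarrow> i \<in> set xs) \<and> xs = filter (\<lambda>i. i \<in> set xs) [0..<n]"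
proof
  assume xs: "filter P [0..<n] = xs"
  have s: "set xs = {i. i < n \<and> P i}" unfolding xs[symmetric] by auto
  have "filter P [0..<n] = filter (\<lambda>i. i \<in> set xs) [0..<n]" by (intro filter_cong) (auto simp: s)
  with s show "(\<forall>i<n. P i \<longleftrightarrow> i \<in> set xs) \<and> xs = filter (\<lambda>i. i \<in> set xs) [0..<n]"
    unfolding xs by blast
next
  assume *: "(\<forall>i<n. P i \<longleftrightarrow> i \<in> set xs) \<and> xs = filter (\<lambda>i. i \<in> set xs) [0..<n]"
  have "filter P [0..<n] = filter (\<lambda>i. i \<in> set xs) [0..<n]"
    using conjunct1[OF *] by (intro filter_cong) auto
  also have "\<dots> = xs" by (rule conjunct2[OF *, symmetric])
  finally show "filter P [0..<n] = xs" .
qed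

context crm_sampling
begin

lemma P0_eq_pred:
  assumes "f \<in> M \<rightarrow>\<^sub>M P0" "g \<in> M \<rightarrow>\<^sub>M P0"
  shows "Measurable.pred M (\<lambda>\<omega>. f \<omega> = g \<omega>)"
proof -
  have [measurable]: "f \<in> borel_measurable M" "g \<in> borel_measurable M"
    using measurable_compose[OF assms(1) P0_id] measurable_compose[OF assms(2) P0_id] by auto
  have "Measurable.pred M (\<lambda>\<omega>. dist (f \<omega>) (g \<omega>) = 0)" by measurable
  then show ?thesis by simp
qed

definition first_indices :: "'w \<Rightarrow> nat list" where
  "first_indices \<omega> = filter (\<lambda>i. \<forall>j<i. \<theta> j \<omega> \<noteq> \<theta> i \<omega>) [0..<n]"

lemma distinct_values_first_indices: "distinct_values n \<theta> \<omega> = map (\<lambda>i. \<theta> i \<omega>) (first_indices \<omega>)"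
  unfolding distinct_values_firsts first_indices_def by (rule firsts_map_upt)

lemma measurable_first_indices [measurable]: "first_indices \<in> M \<rightarrow>\<^sub>M count_space UNIV"
proof (subst measurable_count_space_eq2_countable, intro conjI ballI)
  fix xs :: "nat list"
  define C where "C \<longleftrightarrow> xs = filter (\<lambda>i. i \<in> set xs) [0..<n]"
  have "Measurable.pred M (\<lambda>\<omega>. (\<forall>i\<in>{..<n}. (\<forall>j\<in>{..<i}. \<theta> j \<omega> \<noteq> \<theta> i \<omega>) \<longleftrightarrow> i \<in> set xs) \<and> C)"
  proof (intro pred_intros_finite finite_lessThan pred_intros_logic)
    show "Measurable.pred M (\<lambda>\<omega>. \<theta> j \<omega> = \<theta> i \<omega>)" if "i \<in> {..<n}" "j \<in> {..<i}" for i j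
      using that by (intro P0_eq_pred \<theta>) auto
  qed auto
  then have "{\<omega>\<in>space M. (\<forall>i\<in>{..<n}. (\<forall>j\<in>{..<i}. \<theta> j \<omega> \<noteq> \<theta> i \<omega>) \<longleftrightarrow> i \<in> set xs) \<and> C} \<in> sets M"
    by (rule predE)
  moreover have "first_indices \<omega> = xs \<longleftrightarrow> (\<forall>i\<in>{..<n}. (\<forall>j\<in>{..<i}. \<theta> j \<omega> \<noteq> \<theta> i \<omega>) \<longleftrightarrow> i \<in> set xs) \<and> C" for \<omega>
    unfolding first_indices_def C_def Ball_def lessThan_iff by (rule filter_upt_eq_iff)
  then have "first_indices -` {xs} \<inter> space M =
    {\<omega>\<in>space M. (\<forall>i\<in>{..<n}. (\<forall>j\<in>{..<i}. \<theta> j \<omega> \<noteq> \<theta> i \<omega>) \<longleftrightarrow> i \<in> set xs) \<and> C}"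
    by auto
  ultimately show "first_indices -` {xs} \<inter> space M \<in> sets M" by simp
qed auto

text \<open>
  The distinct value of index \<open>j\<close> as a variable that is measurable everywhere: where there are
  fewer distinct values, a valid index of an observation is still selected.
\<close>
definition distinct_val :: "nat \<Rightarrow> 'w \<Rightarrow> 'a" where
  "distinct_val j \<omega> = \<theta> (if first_indices \<omega> ! j < n then first_indices \<omega> ! j else 0) \<omega>"

lemma measurable_distinct_val [measurable]: "distinct_val j \<in> M \<rightarrow>\<^sub>M P0"
proof -
  have 1: "\<theta> (if i < n then i else 0) \<in> M \<rightarrow>\<^sub>M P0" for i using n by (intro \<theta>) auto
  have 2: "(\<lambda>\<omega>. first_indices \<omega> ! j) \<in> M \<rightarrow>\<^sub>M count_space UNIV"
    by (rule measurable_compose[OF measurable_first_indices]) simp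
  show ?thesis
    unfolding distinct_val_def[abs_def] by (rule measurable_compose_countable[where f="\<lambda>i. \<theta> (if i < n then i else 0)", OF 1 2])
qed

lemma distinct_val:
  assumes "length (distinct_values n \<theta> \<omega>) = k" "j < k"
  shows "distinct_values n \<theta> \<omega> ! j = distinct_val j \<omega>"
proof -
  have len: "j < length (first_indices \<omega>)" using assms by (simp add: distinct_values_first_indices)
  then have "first_indices \<omega> ! j \<in> set (first_indices \<omega>)" by simp
  then have "first_indices \<omega> ! j < n" by (auto simp: first_indices_def)
  then show ?thesis using len by (simp add: distinct_values_first_indices distinct_val_def)
qed

lemma sets_E [measurable]: "E \<in> sets M"
proof -
  have eqp: "Measurable.pred M (\<lambda>\<omega>. \<theta> i \<omega> = distinct_val j \<omega>)" if "i < n" for i j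
    by (rule P0_eq_pred[OF \<theta>[OF that] measurable_distinct_val])
  have c: "(\<lambda>\<omega>. \<Sum>i<n. of_bool (\<theta> i \<omega> = distinct_val j \<omega>) :: real) \<in> borel_measurable M" for j
  proof (rule borel_measurable_sum)
    fix i assume "i \<in> {..<n}"
    then have [measurable]: "Measurable.pred M (\<lambda>\<omega>. \<theta> i \<omega> = distinct_val j \<omega>)" by (intro eqp) simp
    show "(\<lambda>\<omega>. of_bool (\<theta> i \<omega> = distinct_val j \<omega>) :: real) \<in> borel_measurable M" by measurable
  qed
  have "Measurable.pred M (\<lambda>\<omega>. length (first_indices \<omega>) = k \<and> (\<forall>j\<in>{..<k}. (\<Sum>i<n. of_bool (\<theta> i \<omega> = distinct_val j \<omega>) :: real) = real (ns j)))"
  proof (intro pred_intros_logic pred_intros_finite finite_lessThan)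
    show "Measurable.pred M (\<lambda>\<omega>. length (first_indices \<omega>) = k)" by measurable
    fix j note [measurable] = c[of j]
    show "Measurable.pred M (\<lambda>\<omega>. (\<Sum>i<n. of_bool (\<theta> i \<omega> = distinct_val j \<omega>) :: real) = real (ns j))" by measurable
  qed
  then have "{\<omega>\<in>space M. length (first_indices \<omega>) = k \<and> (\<forall>j\<in>{..<k}. (\<Sum>i<n. of_bool (\<theta> i \<omega> = distinct_val j \<omega>) :: real) = real (ns j))} \<in> sets M"
    by measurable
  also have "{\<omega>\<in>space M. length (first_indices \<omega>) = k \<and> (\<forall>j\<in>{..<k}. (\<Sum>i<n. of_bool (\<theta> i \<omega> = distinct_val j \<omega>) :: real) = real (ns j))} = E"
  proof -
    have "(\<Sum>i<n. of_bool (\<theta> i \<omega> = distinct_val j \<omega>) :: real) = real (multiplicity_of n \<theta> j \<omega>)"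
      if "length (distinct_values n \<theta> \<omega>) = k" "j < k" for j \<omega>
    proof -
      have "(\<Sum>i<n. of_bool (\<theta> i \<omega> = distinct_val j \<omega>) :: real) = real (card ({..<n} \<inter> {i. \<theta> i \<omega> = distinct_val j \<omega>}))"
        by (simp add: sum_of_bool_eq)
      also have "{..<n} \<inter> {i. \<theta> i \<omega> = distinct_val j \<omega>} = {i. i < n \<and> \<theta> i \<omega> = distinct_val j \<omega>}" by auto
      finally show ?thesis by (simp add: multiplicity_of_def distinct_val[OF that])
    qed
    then show ?thesis by (auto simp: E_def distinct_values_first_indices)
  qed
  finally show ?thesis .
qed

text \<open>
  Agrees with the index of the allocated atom on \<open>E\<close>, and is measurable everywhere.
\<close>
definition alloc :: "nat \<Rightarrow> 'w \<Rightarrow> nat" where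
  "alloc i \<omega> = (LEAST j. j \<le> N \<omega> \<and> \<tau> j \<omega> = distinct_val i \<omega>)"

lemma measurable_alloc [measurable]: "alloc i \<in> M \<rightarrow>\<^sub>M count_space UNIV"
proof -
  have [measurable]: "Measurable.pred M (\<lambda>\<omega>. \<tau> j \<omega> = distinct_val i \<omega>)" for j
    by (rule P0_eq_pred) measurable
  show ?thesis unfolding alloc_def[abs_def] by measurable
qed

lemma alloc: "\<omega> \<in> E \<Longrightarrow> i < k \<Longrightarrow> alloc_index N \<tau> n \<theta> i \<omega> = alloc i \<omega>"
  by (simp add: alloc_index_def alloc_def E_def distinct_val)

text \<open>
  A sum over a random set of indices is a sum over all \<open>j \<le> N \<omega>\<close> with an indicator, and \<open>N\<close> takes
  countably many values.
\<close>
lemma random_index_set: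
  assumes R: "\<And>j. Measurable.pred M (R j)"
  shows "(\<lambda>\<omega>. \<Sum>j\<in>{j. j \<le> N \<omega> \<and> R j \<omega>}. J j \<omega>) \<in> borel_measurable M"
    and "A \<in> sets P0 \<Longrightarrow> (\<lambda>\<omega>. emeasure (norm_atoms P0 {j. j \<le> N \<omega> \<and> R j \<omega>} (\<lambda>j. J j \<omega>) (\<lambda>j. \<tau> j \<omega>)) A) \<in> borel_measurable M"
proof -
  note [measurable] = R
  define S where "S = (\<lambda>\<omega>. \<Sum>j\<le>N \<omega>. of_bool (R j \<omega>) * J j \<omega>)"
  have "(\<lambda>\<omega>. (\<lambda>m \<omega>. \<Sum>j\<le>m. of_bool (R j \<omega>) * J j \<omega>) (N \<omega>) \<omega>) \<in> borel_measurable M"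
    by (rule measurable_compose_countable) measurable
  then have S [measurable]: "S \<in> borel_measurable M" by (simp add: S_def)
  have fin: "finite {j. j \<le> N \<omega> \<and> R j \<omega>}" for \<omega> by simp
  have Seq: "(\<Sum>j\<in>{j. j \<le> N \<omega> \<and> R j \<omega>}. J j \<omega>) = S \<omega>" for \<omega>
    unfolding S_def by (intro sum.mono_neutral_cong_left) auto
  then show "(\<lambda>\<omega>. \<Sum>j\<in>{j. j \<le> N \<omega> \<and> R j \<omega>}. J j \<omega>) \<in> borel_measurable M" using S by simp
  assume [measurable]: "A \<in> sets P0"
  have "(\<lambda>\<omega>. (\<lambda>m \<omega>. \<Sum>j\<le>m. of_bool (R j \<omega>) * (ennreal (J j \<omega> / S \<omega>) * indicator A (\<tau> j \<omega>))) (N \<omega>) \<omega>) \<in> borel_measurable M"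
    by (rule measurable_compose_countable) measurable
  then have "(\<lambda>\<omega>. \<Sum>j\<le>N \<omega>. of_bool (R j \<omega>) * (ennreal (J j \<omega> / S \<omega>) * indicator A (\<tau> j \<omega>))) \<in> borel_measurable M" .
  then show "(\<lambda>\<omega>. emeasure (norm_atoms P0 {j. j \<le> N \<omega> \<and> R j \<omega>} (\<lambda>j. J j \<omega>) (\<lambda>j. \<tau> j \<omega>)) A) \<in> borel_measurable M"
  proof (rule measurable_cong[THEN iffD1, rotated])
    fix \<omega> assume "\<omega> \<in> space M"
    then have "emeasure (norm_atoms P0 {j. j \<le> N \<omega> \<and> R j \<omega>} (\<lambda>j. J j \<omega>) (\<lambda>j. \<tau> j \<omega>)) A =
      (\<Sum>j\<in>{j. j \<le> N \<omega> \<and> R j \<omega>}. ennreal (J j \<omega> / S \<omega>) * indicator A (\<tau> j \<omega>))"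
      using measurable_space[OF \<tau>] by (subst emeasure_norm_atoms) (auto simp: Seq)
    also have "\<dots> = (\<Sum>j\<le>N \<omega>. of_bool (R j \<omega>) * (ennreal (J j \<omega> / S \<omega>) * indicator A (\<tau> j \<omega>)))"
      by (intro sum.mono_neutral_cong_left) auto
    finally show "(\<Sum>j\<le>N \<omega>. of_bool (R j \<omega>) * (ennreal (J j \<omega> / S \<omega>) * indicator A (\<tau> j \<omega>))) =
      emeasure (norm_atoms P0 {j. j \<le> N \<omega> \<and> R j \<omega>} (\<lambda>j. J j \<omega>) (\<lambda>j. \<tau> j \<omega>)) A" ..
  qed
qed

definition Pna :: "'w \<Rightarrow> 'a measure" where
  "Pna \<omega> = norm_atoms P0 (nonalloc_indices N \<tau> n \<theta> \<omega>) (\<lambda>j. J j \<omega>) (\<lambda>j. \<tau> j \<omega>)"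

definition Tna :: "'w \<Rightarrow> real" where
  "Tna \<omega> = (\<Sum>j\<in>nonalloc_indices N \<tau> n \<theta> \<omega>. J j \<omega>)"

lemma nonalloc_indices: "\<omega> \<in> E \<Longrightarrow> nonalloc_indices N \<tau> n \<theta> \<omega> = {j. j \<le> N \<omega> \<and> (\<forall>i\<in>{..<k}. j \<noteq> alloc i \<omega>)}"
  by (auto simp: nonalloc_indices_def E_def alloc image_iff)

lemma nonalloc_pred: "Measurable.pred M (\<lambda>\<omega>. \<forall>i\<in>{..<k}. j \<noteq> alloc i \<omega>)"
  by (intro pred_intros_finite finite_lessThan) measurable

lemma meas_on_Pna: "meas_on M E Pna (subprob_algebra P0)"
proof -
  have "meas_on M E (\<lambda>\<omega>. norm_atoms P0 {j. j \<le> N \<omega> \<and> (\<forall>i\<in>{..<k}. j \<noteq> alloc i \<omega>)} (\<lambda>j. J j \<omega>) (\<lambda>j. \<tau> j \<omega>)) (subprob_algebra P0)"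
    by (rule meas_on_subprob_algebra[OF sets_E P0.not_empty])
      (simp, rule random_index_set(2)[where R="\<lambda>j \<omega>. \<forall>i\<in>{..<k}. j \<noteq> alloc i \<omega>", OF nonalloc_pred])
  then show ?thesis by (rule meas_on_cong) (simp add: Pna_def nonalloc_indices)
qed

lemma meas_on_Tna: "meas_on M E Tna borel"
proof -
  have "meas_on M E (\<lambda>\<omega>. \<Sum>j\<in>{j. j \<le> N \<omega> \<and> (\<forall>i\<in>{..<k}. j \<noteq> alloc i \<omega>)}. J j \<omega>) borel"
    by (rule meas_on_measurable[OF sets_E random_index_set(1)[OF nonalloc_pred]])
  then show ?thesis by (rule meas_on_cong) (simp add: Tna_def nonalloc_indices)
qed

lemma meas_on_crm: "meas_on M E (crm_measure P0 N J \<tau>) (prob_algebra P0)"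
proof -
  have "meas_on M E (\<lambda>\<omega>. norm_atoms P0 {j. j \<le> N \<omega> \<and> True} (\<lambda>j. J j \<omega>) (\<lambda>j. \<tau> j \<omega>)) (prob_algebra P0)"
    by (rule meas_on_subprob_algebra[OF sets_E P0.not_empty])
      (simp, rule random_index_set(2)[where R="\<lambda>j \<omega>. True"], simp_all)
  then show ?thesis by (simp add: crm_measure_def[abs_def] atMost_def)
qed

lemma meas_on_U: "meas_on M E U pos_borel"
proof (rule meas_on_restrict_space[OF sets_E])
  have "(\<lambda>\<omega>. \<Sum>j\<in>{j. j \<le> N \<omega> \<and> True}. J j \<omega>) \<in> borel_measurable M"
    by (rule random_index_set(1)[where R="\<lambda>j \<omega>. True"]) simp
  then have "crm_total N J \<in> borel_measurable M" by (simp add: crm_total_def[abs_def] atMost_def)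
  then show "U \<in> borel_measurable M" unfolding U_def[abs_def] by measurable
qed simp

lemma meas_on_\<theta>s: "meas_on M E \<theta>s Mt"
proof -
  have "meas_on M E (\<lambda>\<omega>. \<lambda>j\<in>{..<k}. distinct_val j \<omega>) Mt"
    by (intro meas_on_measurable sets_E measurable_restrict measurable_distinct_val)
  then show ?thesis by (rule meas_on_cong) (auto simp: \<theta>s_def E_def distinct_val fun_eq_iff)
qed

lemma meas_on_ls: "meas_on M E ls (Pi\<^sub>M {..<k} (\<lambda>_. count_space UNIV))"
proof -
  have "meas_on M E (\<lambda>\<omega>. \<lambda>j\<in>{..<k}. alloc j \<omega>) (Pi\<^sub>M {..<k} (\<lambda>_. count_space UNIV))"
    by (intro meas_on_measurable sets_E measurable_restrict measurable_alloc)
  then show ?thesis by (rule meas_on_cong) (auto simp: ls_def alloc fun_eq_iff)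
qed

lemma meas_on_Ja: "meas_on M E Ja MA"
proof -
  have "(\<lambda>\<omega>. J (alloc j \<omega>) \<omega>) \<in> borel_measurable M" for j
    by (rule measurable_compose_countable[where f="\<lambda>i \<omega>. J i \<omega>"]) measurable
  then have "meas_on M E (\<lambda>\<omega>. \<lambda>j\<in>{..<k}. J (alloc j \<omega>) \<omega>) MA"
    by (intro meas_on_PiM sets_E meas_on_restrict_space) auto
  then show ?thesis by (rule meas_on_cong) (auto simp: Ja_def alloc fun_eq_iff)
qed

lemma meas_on_Nna: "meas_on M E (\<lambda>\<omega>. N \<omega> + 1 - k) (count_space UNIV)"
  by (intro meas_on_measurable sets_E) measurable

end

section \<open>Conditional distributions from the joint law\<close>

context crm_sampling
begin

abbreviation M\<theta>U :: "((nat \<Rightarrow> 'a) \<times> real) measure" where "M\<theta>U \<equiv> Mt \<Otimes>\<^sub>M pos_borel"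
abbreviation Ml :: "(nat \<Rightarrow> nat) measure" where "Ml \<equiv> Pi\<^sub>M {..<k} (\<lambda>_. count_space UNIV)"

lemma total_pos: "regular \<omega> \<Longrightarrow> 0 < crm_total N J \<omega>"
  unfolding crm_total_def regular_def by (intro sum_pos) auto

lemma AE_conditioning_space: "AE \<omega> in M. \<omega> \<in> E \<longrightarrow> \<theta>s \<omega> \<in> space Mt \<and> U \<omega> \<in> space pos_borel"
  using AE_space AE_regular
proof eventually_elim
  case (elim \<omega>)
  have "\<theta>s \<omega> \<in> space Mt" if E: "\<omega> \<in> E"
  proof -
    have "\<theta>s \<omega> j \<in> space P0" if "j < k" for j
      using regular_E(2)[OF elim(2) E that] measurable_space[OF \<tau> elim(1)] by simp
    then show ?thesis by (auto simp: space_PiM PiE_iff \<theta>s_def)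
  qed
  then show ?case
    using elim total_pos[OF elim(2)] by (auto simp: U_def regular_def space_pos_borel)
qed

lemma nonalloc_regular:
  assumes "regular \<omega>" "\<omega> \<in> E"
  shows "bij_betw (rest (N \<omega>) k (ls \<omega>)) {..<N \<omega> + 1 - k} (nonalloc_indices N \<tau> n \<theta> \<omega>)"
    and "nonalloc_indices N \<tau> n \<theta> \<omega> = {..N \<omega>} - ls \<omega> ` {..<k}"
proof -
  show eq: "nonalloc_indices N \<tau> n \<theta> \<omega> = {..N \<omega>} - ls \<omega> ` {..<k}"
    using assms(2) by (simp add: nonalloc_indices_def E_def ls_def)
  show "bij_betw (rest (N \<omega>) k (ls \<omega>)) {..<N \<omega> + 1 - k} (nonalloc_indices N \<tau> n \<theta> \<omega>)"
    unfolding eq by (rule bij_betw_rest[OF regular_E(1)[OF assms]])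
qed

text \<open>
  The non-allocated part of the process is a function of the vector \<open>Yna\<close>, which lists the same atoms
  with indices \<open>0, 1, \<dots>\<close>.
\<close>
lemma Pna_regular:
  assumes "regular \<omega>" "\<omega> \<in> E"
  shows "Pna \<omega> = norm_atoms P0 {..<N \<omega> + 1 - k} (\<lambda>j. fst (Yna \<omega> j)) (\<lambda>j. snd (Yna \<omega> j))"
    and "Tna \<omega> = (\<Sum>j<N \<omega> + 1 - k. fst (Yna \<omega> j))"
proof -
  have "\<omega> \<in> space M" using assms(2) by (simp add: E_def)
  then show "Pna \<omega> = norm_atoms P0 {..<N \<omega> + 1 - k} (\<lambda>j. fst (Yna \<omega> j)) (\<lambda>j. snd (Yna \<omega> j))"
    unfolding Pna_def
    by (intro norm_atoms_reindex[OF _ nonalloc_regular(1)[OF assms]]) (auto simp: Yna_def measurable_space[OF \<tau>])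
  show "Tna \<omega> = (\<Sum>j<N \<omega> + 1 - k. fst (Yna \<omega> j))"
    unfolding Tna_def by (subst sum.reindex_bij_betw[OF nonalloc_regular(1)[OF assms], symmetric]) (simp add: Yna_def)
qed

text \<open>
  The process splits path by path, according to the partition of its indices into allocated and
  non-allocated ones.
\<close>
lemma crm_measure_regular:
  assumes "regular \<omega>" "\<omega> \<in> E"
  shows "crm_measure P0 N J \<tau> \<omega> =
    mix_measure (nonalloc_weight (N \<omega> + 1 - k) (Tna \<omega>) (\<Sum>j<k. Ja \<omega> j)) (Pna \<omega>) (norm_atoms P0 {..<k} (Ja \<omega>) (\<theta>s \<omega>))"
proof -
  note g = regular_E[OF assms]
  note l = injectionsD[OF g(1)]
  have \<omega>: "\<omega> \<in> space M" using assms(2) by (simp add: E_def)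
  define R K where "R = nonalloc_indices N \<tau> n \<theta> \<omega>" and "K = ls \<omega> ` {..<k}"
  have RK: "R \<union> K = {..N \<omega>}" "R \<inter> K = {}" "finite R" "finite K" "K \<noteq> {}"
    unfolding R_def K_def nonalloc_regular(2)[OF assms] using l(2) k by (auto simp: lessThan_empty_iff)
  have J: "0 < J j \<omega>" if "j \<le> N \<omega>" for j using assms(1) that by (simp add: regular_def)
  have bK: "bij_betw (ls \<omega>) {..<k} K" using l(1) by (simp add: K_def bij_betw_def)
  have na: "norm_atoms P0 K (\<lambda>j. J j \<omega>) (\<lambda>j. \<tau> j \<omega>) = norm_atoms P0 {..<k} (Ja \<omega>) (\<theta>s \<omega>)"
    using g(2,3) measurable_space[OF \<tau> \<omega>] by (intro norm_atoms_reindex[OF _ bK]) auto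
  have sK: "(\<Sum>j\<in>K. J j \<omega>) = (\<Sum>j<k. Ja \<omega> j)"
    by (subst sum.reindex_bij_betw[OF bK, symmetric]) (simp add: g(3))
  have "crm_measure P0 N J \<tau> \<omega> = norm_atoms P0 (R \<union> K) (\<lambda>j. J j \<omega>) (\<lambda>j. \<tau> j \<omega>)"
    by (simp add: crm_measure_def RK)
  also have "\<dots> = mix_measure (Tna \<omega> / (Tna \<omega> + (\<Sum>j<k. Ja \<omega> j))) (Pna \<omega>) (norm_atoms P0 {..<k} (Ja \<omega>) (\<theta>s \<omega>))"
    using RK J measurable_space[OF \<tau> \<omega>]
    by (subst norm_atoms_disjoint_Un) (auto simp: na sK Tna_def Pna_def R_def)
  \<comment> \<open>For \<open>N \<omega> + 1 = k\<close> both weights are \<open>0\<close>, as \<open>Tna \<omega>\<close> is an empty sum.\<close>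
  also have "Tna \<omega> / (Tna \<omega> + (\<Sum>j<k. Ja \<omega> j)) = nonalloc_weight (N \<omega> + 1 - k) (Tna \<omega>) (\<Sum>j<k. Ja \<omega> j)"
    using Pna_regular(2)[OF assms] by (simp add: nonalloc_weight_def)
  finally show ?thesis .
qed

lemma cond_mean_const:
  assumes "0 < u"
  shows "(\<integral>\<^sup>+y. \<integral>\<^sup>+a. c \<partial>alloc_jumps u \<partial>nonalloc_jumps r u) = (c :: ennreal)"
  using prob_space.emeasure_space_1[OF prob_space_alloc_jumps[OF assms]] prob_space.emeasure_space_1[OF prob_space_nonalloc_jumps[OF assms]]
  by simp

text \<open>
  A kernel is a conditional distribution if integrals under the joint law of the latent data do not
  change when an event of \<open>X\<close> is replaced by its probability under the kernel.  The conditioning variable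
  consists of \<open>(\<theta>s, U)\<close> and a discrete part \<open>d\<close>, a function of the number of non-allocated jumps and
  of the labels; \<open>e\<close> puts the two parts together.
\<close>
lemma cond_distr_onI_latent:
  assumes K: "K \<in> Q \<rightarrow>\<^sub>M prob_algebra S" and X: "meas_on M E X S" and Y: "meas_on M E Y Q"
    and f: "\<And>r. f r \<in> latent_space r \<rightarrow>\<^sub>M S"
    and e: "\<And>r l. l \<in> extensional {..<k} \<Longrightarrow> e (d r l) \<in> M\<theta>U \<rightarrow>\<^sub>M Q"
    and Xf: "\<And>\<omega>. regular \<omega> \<Longrightarrow> \<omega> \<in> E \<Longrightarrow> X \<omega> = f (N \<omega> + 1 - k) (\<theta>s \<omega>, U \<omega>, Yna \<omega>, Ja \<omega>)"
    and Ye: "\<And>\<omega>. Y \<omega> = e (d (N \<omega> + 1 - k) (ls \<omega>)) (\<theta>s \<omega>, U \<omega>)"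
    and eq: "\<And>A B h1 h2. A \<in> sets S \<Longrightarrow>
      h1 = (\<lambda>r l (t, u, y, a). indicator A (f r (t, u, y, a)) * indicator B (e (d r l) (t, u)) :: ennreal) \<Longrightarrow>
      h2 = (\<lambda>r l (t, u, y, a). emeasure (K (e (d r l) (t, u))) A * indicator B (e (d r l) (t, u))) \<Longrightarrow>
      (\<And>r l. l \<in> extensional {..<k} \<Longrightarrow> h1 r l \<in> borel_measurable (latent_space r)) \<Longrightarrow>
      (\<And>r l. l \<in> extensional {..<k} \<Longrightarrow> h2 r l \<in> borel_measurable (latent_space r)) \<Longrightarrow>
      (\<integral>\<^sup>+\<omega>. indicator E \<omega> * h1 (N \<omega> + 1 - k) (ls \<omega>) (\<theta>s \<omega>, U \<omega>, Yna \<omega>, Ja \<omega>) \<partial>M) =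
      (\<integral>\<^sup>+\<omega>. indicator E \<omega> * h2 (N \<omega> + 1 - k) (ls \<omega>) (\<theta>s \<omega>, U \<omega>, Yna \<omega>, Ja \<omega>) \<partial>M)"
  shows "cond_distr_on M E X S Y Q K"
proof (rule cond_distr_onI[OF M.prob_space_axioms sets_E K X Y])
  have ls: "ls \<omega> \<in> extensional {..<k}" for \<omega> by (simp add: ls_def)
  show "AE \<omega> in M. \<omega> \<in> E \<longrightarrow> Y \<omega> \<in> space Q"
    using AE_conditioning_space by eventually_elim (auto simp: Ye space_pair_measure intro!: measurable_space[OF e[OF ls]])
  fix A B assume A: "A \<in> sets S" and B: "B \<in> sets Q"
  define h1 :: "nat \<Rightarrow> (nat \<Rightarrow> nat) \<Rightarrow> (nat \<Rightarrow> 'a) \<times> real \<times> (nat \<Rightarrow> real \<times> 'a) \<times> (nat \<Rightarrow> real) \<Rightarrow> ennreal"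
    where "h1 = (\<lambda>r l (t, u, y, a). indicator A (f r (t, u, y, a)) * indicator B (e (d r l) (t, u)))"
  define h2 :: "nat \<Rightarrow> (nat \<Rightarrow> nat) \<Rightarrow> (nat \<Rightarrow> 'a) \<times> real \<times> (nat \<Rightarrow> real \<times> 'a) \<times> (nat \<Rightarrow> real) \<Rightarrow> ennreal"
    where "h2 = (\<lambda>r l (t, u, y, a). emeasure (K (e (d r l) (t, u))) A * indicator B (e (d r l) (t, u)))"
  have me: "(\<lambda>(t, u, y, a). e (d r l) (t, u)) \<in> latent_space r \<rightarrow>\<^sub>M Q"
    if l: "l \<in> extensional {..<k}" for r l
    unfolding split_beta' by (rule measurable_compose[OF _ e[OF l]]) measurable
  have mB: "(\<lambda>(t, u, y, a). indicator B (e (d r l) (t, u)) :: ennreal) \<in> borel_measurable (latent_space r)"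
    if "l \<in> extensional {..<k}" for r l
    using measurable_compose[OF me[OF that] borel_measurable_indicator[OF B]] by (simp add: split_beta')
  have h1: "h1 r l \<in> borel_measurable (latent_space r)" if "l \<in> extensional {..<k}" for r l
  proof -
    have "(\<lambda>(t, u, y, a). indicator A (f r (t, u, y, a)) :: ennreal) \<in> borel_measurable (latent_space r)"
      using measurable_compose[OF f borel_measurable_indicator[OF A]] by (simp add: split_beta')
    then show ?thesis unfolding h1_def using mB[OF that, of r] by (simp add: split_beta')
  qed
  have h2: "h2 r l \<in> borel_measurable (latent_space r)" if "l \<in> extensional {..<k}" for r l
    unfolding h2_def
    using measurable_compose[OF me[OF that, of r] measurable_compose[OF measurable_prob_algebraD[OF K] measurable_emeasure_subprob_algebra[OF A]]] mB[OF that, of r]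
    by (simp add: split_beta')
  have "(\<integral>\<^sup>+\<omega>. indicator E \<omega> * (indicator A (X \<omega>) * indicator B (Y \<omega>)) \<partial>M) =
    (\<integral>\<^sup>+\<omega>. indicator E \<omega> * h1 (N \<omega> + 1 - k) (ls \<omega>) (\<theta>s \<omega>, U \<omega>, Yna \<omega>, Ja \<omega>) \<partial>M)"
    by (rule nn_integral_cong_AE, rule AE_mp[OF AE_regular], rule AE_I2) (auto simp: h1_def Xf Ye indicator_def)
  also have "\<dots> = (\<integral>\<^sup>+\<omega>. indicator E \<omega> * h2 (N \<omega> + 1 - k) (ls \<omega>) (\<theta>s \<omega>, U \<omega>, Yna \<omega>, Ja \<omega>) \<partial>M)"
    by (rule eq[OF A h1_def h2_def h1 h2])
  finally show "(\<integral>\<^sup>+\<omega>. indicator E \<omega> * (indicator A (X \<omega>) * indicator B (Y \<omega>)) \<partial>M) =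
    (\<integral>\<^sup>+\<omega>. indicator E \<omega> * (emeasure (K (Y \<omega>)) A * indicator B (Y \<omega>)) \<partial>M)"
    by (simp add: h2_def Ye)
qed

text \<open>
  A kernel that averages over the number and both families of jumps is the conditional distribution
  given the distinct values and \<open>U\<close>, because these variables separate in \<open>nn_integral_posterior\<close>.
\<close>
lemma cond_distr_posterior:
  assumes K: "K \<in> M\<theta>U \<rightarrow>\<^sub>M prob_algebra S" and X: "meas_on M E X S"
    and f: "\<And>r. f r \<in> latent_space r \<rightarrow>\<^sub>M S"
    and Xf: "\<And>\<omega>. regular \<omega> \<Longrightarrow> \<omega> \<in> E \<Longrightarrow> X \<omega> = f (N \<omega> + 1 - k) (\<theta>s \<omega>, U \<omega>, Yna \<omega>, Ja \<omega>)"
    and Kf: "\<And>t u A. t \<in> space Mt \<Longrightarrow> 0 < u \<Longrightarrow> A \<in> sets S \<Longrightarrow>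
      emeasure (K (t, u)) A = (\<integral>\<^sup>+r. \<integral>\<^sup>+y. \<integral>\<^sup>+a. indicator A (f r (t, u, y, a)) \<partial>alloc_jumps u \<partial>nonalloc_jumps r u \<partial>nonalloc_number u)"
  shows "cond_distr_on M E X S (\<lambda>\<omega>. (\<theta>s \<omega>, U \<omega>)) M\<theta>U K"
proof (rule cond_distr_onI_latent[where e="\<lambda>_ z. z" and d="\<lambda>_ _. ()", OF K X _ f _ Xf])
  fix A B and h1 h2 :: "nat \<Rightarrow> (nat \<Rightarrow> nat) \<Rightarrow> (nat \<Rightarrow> 'a) \<times> real \<times> (nat \<Rightarrow> real \<times> 'a) \<times> (nat \<Rightarrow> real) \<Rightarrow> ennreal"
  assume A: "A \<in> sets S"
    and h1: "h1 = (\<lambda>r l (t, u, y, a). indicator A (f r (t, u, y, a)) * indicator B (t, u) :: ennreal)"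
    and h2: "h2 = (\<lambda>r l (t, u, y, a). emeasure (K (t, u)) A * indicator B (t, u))"
    and m1: "\<And>r l. l \<in> extensional {..<k} \<Longrightarrow> h1 r l \<in> borel_measurable (latent_space r)"
    and m2: "\<And>r l. l \<in> extensional {..<k} \<Longrightarrow> h2 r l \<in> borel_measurable (latent_space r)"
  \<comment> \<open>The integrands do not involve the labels, so any fixed vector serves.\<close>
  have l0: "(\<lambda>j\<in>{..<k}. j) \<in> extensional {..<k}" by simp
  have *: "(\<integral>\<^sup>+r. cond_mean r (h1 r l) t u \<partial>nonalloc_number u) =
      (\<integral>\<^sup>+r. cond_mean r (h2 r l) t u \<partial>nonalloc_number u)"
    if t: "t \<in> space Mt" and u: "0 < u" for t u l
    using cond_mean_const[OF u]
    by (cases "(t, u) \<in> B") (simp_all add: h1 h2 Kf[OF t u A] measure_pmf.emeasure_space_1[simplified])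
  have l: "h1 r l = h1 r (\<lambda>j\<in>{..<k}. j)" "h2 r l = h2 r (\<lambda>j\<in>{..<k}. j)" for r l by (simp_all add: h1 h2)
  show "(\<integral>\<^sup>+\<omega>. indicator E \<omega> * h1 (N \<omega> + 1 - k) (ls \<omega>) (\<theta>s \<omega>, U \<omega>, Yna \<omega>, Ja \<omega>) \<partial>M) =
    (\<integral>\<^sup>+\<omega>. indicator E \<omega> * h2 (N \<omega> + 1 - k) (ls \<omega>) (\<theta>s \<omega>, U \<omega>, Yna \<omega>, Ja \<omega>) \<partial>M)"
    unfolding l[of _ "ls _"] nn_integral_posterior[OF m1[OF l0]] nn_integral_posterior[OF m2[OF l0]]
    by (rule nn_integral_cong, rule arg_cong2[where f="(*)", OF refl], rule nn_integral_cong)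
      (use * in \<open>simp add: space_pos_borel\<close>)
qed (auto intro!: meas_on_Pair sets_E meas_on_\<theta>s meas_on_U)

text \<open>
  Given the number of non-allocated jumps as well, only the jumps themselves are averaged.
\<close>
lemma cond_distr_posterior_number:
  assumes K: "K \<in> Mt \<Otimes>\<^sub>M pos_borel \<Otimes>\<^sub>M count_space UNIV \<rightarrow>\<^sub>M prob_algebra S" and X: "meas_on M E X S"
    and f: "\<And>r. f r \<in> latent_space r \<rightarrow>\<^sub>M S"
    and Xf: "\<And>\<omega>. regular \<omega> \<Longrightarrow> \<omega> \<in> E \<Longrightarrow> X \<omega> = f (N \<omega> + 1 - k) (\<theta>s \<omega>, U \<omega>, Yna \<omega>, Ja \<omega>)"
    and Kf: "\<And>t u r A. t \<in> space Mt \<Longrightarrow> 0 < u \<Longrightarrow> A \<in> sets S \<Longrightarrow>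
      emeasure (K (t, u, r)) A = (\<integral>\<^sup>+y. \<integral>\<^sup>+a. indicator A (f r (t, u, y, a)) \<partial>alloc_jumps u \<partial>nonalloc_jumps r u)"
  shows "cond_distr_on M E X S (\<lambda>\<omega>. (\<theta>s \<omega>, U \<omega>, N \<omega> + 1 - k)) (Mt \<Otimes>\<^sub>M pos_borel \<Otimes>\<^sub>M count_space UNIV) K"
proof (rule cond_distr_onI_latent[where e="\<lambda>r (t, u). (t, u, r)" and d="\<lambda>r _. r", OF K X _ f _ Xf])
  show "meas_on M E (\<lambda>\<omega>. (\<theta>s \<omega>, U \<omega>, N \<omega> + 1 - k)) (Mt \<Otimes>\<^sub>M pos_borel \<Otimes>\<^sub>M count_space UNIV)"
    by (intro meas_on_Pair sets_E meas_on_\<theta>s meas_on_U meas_on_Nna)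
  show "(\<lambda>(t, u). (t, u, r)) \<in> M\<theta>U \<rightarrow>\<^sub>M Mt \<Otimes>\<^sub>M pos_borel \<Otimes>\<^sub>M count_space UNIV" for r :: nat by measurable
  fix A B and h1 h2 :: "nat \<Rightarrow> (nat \<Rightarrow> nat) \<Rightarrow> (nat \<Rightarrow> 'a) \<times> real \<times> (nat \<Rightarrow> real \<times> 'a) \<times> (nat \<Rightarrow> real) \<Rightarrow> ennreal"
  assume A: "A \<in> sets S"
    and h1: "h1 = (\<lambda>r l (t, u, y, a). indicator A (f r (t, u, y, a)) * indicator B ((\<lambda>(t, u). (t, u, r)) (t, u)) :: ennreal)"
    and h2: "h2 = (\<lambda>r l (t, u, y, a). emeasure (K ((\<lambda>(t, u). (t, u, r)) (t, u))) A * indicator B ((\<lambda>(t, u). (t, u, r)) (t, u)))"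
    and m1: "\<And>r l. l \<in> extensional {..<k} \<Longrightarrow> h1 r l \<in> borel_measurable (latent_space r)"
    and m2: "\<And>r l. l \<in> extensional {..<k} \<Longrightarrow> h2 r l \<in> borel_measurable (latent_space r)"
  \<comment> \<open>The integrands do not involve the labels, so any fixed vector serves.\<close>
  have l0: "(\<lambda>j\<in>{..<k}. j) \<in> extensional {..<k}" by simp
  have *: "(cond_mean r (h1 r l) t u) = (cond_mean r (h2 r l) t u)"
    if t: "t \<in> space Mt" and u: "0 < u" for t u r l
    using cond_mean_const[OF u] by (cases "(t, u, r) \<in> B") (simp_all add: h1 h2 Kf[OF t u A])
  have l: "h1 r l = h1 r (\<lambda>j\<in>{..<k}. j)" "h2 r l = h2 r (\<lambda>j\<in>{..<k}. j)" for r l by (simp_all add: h1 h2)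
  show "(\<integral>\<^sup>+\<omega>. indicator E \<omega> * h1 (N \<omega> + 1 - k) (ls \<omega>) (\<theta>s \<omega>, U \<omega>, Yna \<omega>, Ja \<omega>) \<partial>M) =
    (\<integral>\<^sup>+\<omega>. indicator E \<omega> * h2 (N \<omega> + 1 - k) (ls \<omega>) (\<theta>s \<omega>, U \<omega>, Yna \<omega>, Ja \<omega>) \<partial>M)"
    unfolding l[of _ "ls _"] nn_integral_posterior[OF m1[OF l0]] nn_integral_posterior[OF m2[OF l0]]
    by (rule nn_integral_cong, rule arg_cong2[where f="(*)", OF refl], rule nn_integral_cong, rule nn_integral_cong)
      (use * in \<open>simp add: space_pos_borel\<close>)
qed auto

lemma set_pmf_poisson_labels: "0 < u \<Longrightarrow> set_pmf (poisson_pmf (\<Lambda>u u)) \<inter> {m. \<forall>i<k. l i \<le> (m :: nat)} \<noteq> {}"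
proof -
  assume "0 < u"
  then have "set_pmf (poisson_pmf (\<Lambda>u u)) = UNIV" using \<Lambda>u_pos by simp
  moreover have "(\<Sum>i<k. l i) \<in> {m. \<forall>i<k. l i \<le> m}" by (auto intro!: member_le_sum)
  ultimately show ?thesis by blast
qed

text \<open>
  The law of \<open>N\<close> given \<open>U = u\<close> and the labels \<open>l\<close> of the allocated atoms, which reveal only a lower bound.
\<close>
definition number_given_labels :: "real \<Rightarrow> (nat \<Rightarrow> nat) \<Rightarrow> nat pmf" where
  "number_given_labels u l = cond_pmf (poisson_pmf (\<Lambda>u u)) {m. \<forall>i<k. l i \<le> m}"

text \<open>
  The mean over \<open>N\<close>, under its law given the labels, comes first, and then both families of jumps are
  averaged independently.
\<close>
lemma cond_distr_labelled:
  assumes K: "K \<in> Mt \<Otimes>\<^sub>M pos_borel \<Otimes>\<^sub>M Ml \<rightarrow>\<^sub>M prob_algebra S" and X: "meas_on M E X S"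
    and f: "\<And>r. f r \<in> latent_space r \<rightarrow>\<^sub>M S"
    and Xf: "\<And>\<omega>. regular \<omega> \<Longrightarrow> \<omega> \<in> E \<Longrightarrow> X \<omega> = f (N \<omega> + 1 - k) (\<theta>s \<omega>, U \<omega>, Yna \<omega>, Ja \<omega>)"
    and Kf: "\<And>t u l A. t \<in> space Mt \<Longrightarrow> 0 < u \<Longrightarrow> l \<in> space Ml \<Longrightarrow> A \<in> sets S \<Longrightarrow>
      emeasure (K (t, u, l)) A = (\<integral>\<^sup>+m. \<integral>\<^sup>+y. \<integral>\<^sup>+a. indicator A (f (m + 1 - k) (t, u, y, a)) \<partial>alloc_jumps u \<partial>nonalloc_jumps (m + 1 - k) u \<partial>measure_pmf (number_given_labels u l))"
  shows "cond_distr_on M E X S (\<lambda>\<omega>. (\<theta>s \<omega>, U \<omega>, ls \<omega>)) (Mt \<Otimes>\<^sub>M pos_borel \<Otimes>\<^sub>M Ml) K"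
proof (rule cond_distr_onI_latent[where e="\<lambda>l (t, u). (t, u, l)" and d="\<lambda>_ l. l", OF K X _ f _ Xf])
  have ext: "l \<in> space Ml" if "l \<in> extensional {..<k}" for l using that by (simp add: space_PiM PiE_iff)
  show "(\<lambda>(t, u). (t, u, l)) \<in> M\<theta>U \<rightarrow>\<^sub>M Mt \<Otimes>\<^sub>M pos_borel \<Otimes>\<^sub>M Ml" if "l \<in> extensional {..<k}" for l
    using ext[OF that] by measurable
  fix A B and h1 h2 :: "nat \<Rightarrow> (nat \<Rightarrow> nat) \<Rightarrow> (nat \<Rightarrow> 'a) \<times> real \<times> (nat \<Rightarrow> real \<times> 'a) \<times> (nat \<Rightarrow> real) \<Rightarrow> ennreal"
  assume A: "A \<in> sets S"
    and h1: "h1 = (\<lambda>r l (t, u, y, a). indicator A (f r (t, u, y, a)) * indicator B ((\<lambda>(t, u). (t, u, l)) (t, u)) :: ennreal)"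
    and h2: "h2 = (\<lambda>r l (t, u, y, a). emeasure (K ((\<lambda>(t, u). (t, u, l)) (t, u))) A * indicator B ((\<lambda>(t, u). (t, u, l)) (t, u)))"
    and m1: "\<And>r l. l \<in> extensional {..<k} \<Longrightarrow> h1 r l \<in> borel_measurable (latent_space r)"
    and m2: "\<And>r l. l \<in> extensional {..<k} \<Longrightarrow> h2 r l \<in> borel_measurable (latent_space r)"
  have *: "(\<integral>\<^sup>+m. indicator {m. \<forall>i<k. l i \<le> m} m * (cond_mean (m + 1 - k) (h1 (m + 1 - k) l) t u) \<partial>measure_pmf (poisson_pmf (\<Lambda>u u))) =
      (\<integral>\<^sup>+m. indicator {m. \<forall>i<k. l i \<le> m} m * (cond_mean (m + 1 - k) (h2 (m + 1 - k) l) t u) \<partial>measure_pmf (poisson_pmf (\<Lambda>u u)))"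
    if l: "l \<in> all_injections" and t: "t \<in> space Mt" and u: "0 < u" for t u l
  proof -
    have l': "l \<in> space Ml" using l by (auto simp: all_injections_def intro: ext)
    show ?thesis
      unfolding nn_integral_cond_pmf[OF set_pmf_poisson_labels[OF u, of l]] number_given_labels_def[symmetric]
      using cond_mean_const[OF u]
      by (cases "(t, u, l) \<in> B") (simp_all add: h1 h2 Kf[OF t u l' A] measure_pmf.emeasure_space_1[simplified])
  qed
  have m: "h1 (m + 1 - k) l \<in> borel_measurable (latent_space (m + 1 - k))"
    "h2 (m + 1 - k) l \<in> borel_measurable (latent_space (m + 1 - k))" if "l \<in> injections k m" for m l
    using m1 m2 injectionsD(4)[OF that] by auto
  show "(\<integral>\<^sup>+\<omega>. indicator E \<omega> * h1 (N \<omega> + 1 - k) (ls \<omega>) (\<theta>s \<omega>, U \<omega>, Yna \<omega>, Ja \<omega>) \<partial>M) =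
    (\<integral>\<^sup>+\<omega>. indicator E \<omega> * h2 (N \<omega> + 1 - k) (ls \<omega>) (\<theta>s \<omega>, U \<omega>, Yna \<omega>, Ja \<omega>) \<partial>M)"
    by (rule trans[OF nn_integral_labelled[of "\<lambda>m. h1 (m + 1 - k)"]], erule m(1),
        rule trans[OF _ nn_integral_labelled[of "\<lambda>m. h2 (m + 1 - k)", symmetric]], rule nn_integral_cong,
        rule nn_integral_cong, rule arg_cong2[where f="(*)", OF refl], rule nn_integral_cong, rule *,
        simp, simp, simp add: space_pos_borel, erule m(2))
qed (auto intro!: meas_on_Pair sets_E meas_on_\<theta>s meas_on_U meas_on_ls)

text \<open>
  Integrating out everything but \<open>U\<close> leaves \<open>joint_density\<close>.  As \<open>U\<close> and the distinct values are
  independent given \<open>E\<close>, the conditional law is this density normalized, and a constant factor \<open>c\<close> drops out.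
\<close>
lemma cond_distr_U:
  assumes g: "g \<in> borel_measurable pos_borel" and jd: "\<And>u. 0 < u \<Longrightarrow> joint_density u = c * g u"
    and g0: "(\<integral>\<^sup>+u. g u \<partial>pos_lborel) \<noteq> 0" and gf: "(\<integral>\<^sup>+u. g u \<partial>pos_lborel) \<noteq> \<infinity>"
  shows "cond_distr_on M E U pos_borel \<theta>s Mt (\<lambda>_. density pos_lborel (\<lambda>u. g u / (\<integral>\<^sup>+u. g u \<partial>pos_lborel)))"
proof (rule cond_distr_onI[OF M.prob_space_axioms sets_E _ meas_on_U meas_on_\<theta>s])
  define I where "I = (\<integral>\<^sup>+u. g u \<partial>pos_lborel)"
  define K where "K = density pos_lborel (\<lambda>u. g u / I)"
  have g' [measurable]: "g \<in> borel_measurable pos_lborel" using g by (simp cong: measurable_cong_sets add: sets_pos_lborel)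
  have KA: "emeasure K A = (\<integral>\<^sup>+u. g u * indicator A u \<partial>pos_lborel) / I" if "A \<in> sets pos_borel" for A
  proof -
    have [measurable]: "A \<in> sets pos_lborel" using that by (simp add: sets_pos_lborel)
    have "emeasure K A = (\<integral>\<^sup>+u. g u / I * indicator A u \<partial>pos_lborel)"
      unfolding K_def by (rule emeasure_density) measurable
    also have "\<dots> = (\<integral>\<^sup>+u. g u * indicator A u / I \<partial>pos_lborel)"
      by (intro nn_integral_cong) (simp add: indicator_def)
    also have "\<dots> = (\<integral>\<^sup>+u. g u * indicator A u \<partial>pos_lborel) / I" by (rule nn_integral_divide) measurable
    finally show ?thesis .
  qed
  have "prob_space K"
  proof (rule prob_spaceI)
    have "emeasure K (space pos_borel) = (\<integral>\<^sup>+u. g u * indicator (space pos_borel) u \<partial>pos_lborel) / I" by (rule KA[OF sets.top])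
    also have "(\<integral>\<^sup>+u. g u * indicator (space pos_borel) u \<partial>pos_lborel) = I"
      unfolding I_def by (intro nn_integral_cong) (simp add: space_pos_borel)
    also have "I / I = 1" using g0 gf by (intro ennreal_divide_self) (auto simp: I_def less_top)
    finally show "emeasure K (space K) = 1" by (simp add: K_def space_pos_borel)
  qed
  then have "K \<in> space (prob_algebra pos_borel)" by (simp add: space_prob_algebra K_def sets_pos_lborel)
  then show "(\<lambda>_. density pos_lborel (\<lambda>u. g u / (\<integral>\<^sup>+u. g u \<partial>pos_lborel))) \<in> Mt \<rightarrow>\<^sub>M prob_algebra pos_borel"
    unfolding K_def I_def by (rule measurable_const)
  show "AE \<omega> in M. \<omega> \<in> E \<longrightarrow> \<theta>s \<omega> \<in> space Mt" using AE_conditioning_space by eventually_elim auto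
  fix A B assume A: "A \<in> sets pos_borel" and B: "B \<in> sets Mt"
  let ?M4 = "\<lambda>r. latent_space r"
  have mB: "(\<lambda>z. indicator B (fst z) :: ennreal) \<in> borel_measurable (?M4 r)" for r
    by (rule measurable_compose[OF measurable_fst borel_measurable_indicator[OF B]])
  have mA: "(\<lambda>z. indicator A (fst (snd z)) :: ennreal) \<in> borel_measurable (?M4 r)" for r
    by (rule measurable_compose[OF measurable_compose[OF measurable_snd measurable_fst] borel_measurable_indicator[OF A]])
  have post: "(\<integral>\<^sup>+\<omega>. indicator E \<omega> * (\<phi> (U \<omega>) * indicator B (\<theta>s \<omega>)) \<partial>M) = c * (\<integral>\<^sup>+u. g u * \<phi> u \<partial>pos_lborel) * emeasure Mt B"
    if \<phi>: "\<phi> \<in> borel_measurable pos_borel" for \<phi> :: "real \<Rightarrow> ennreal"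
  proof -
    have [measurable]: "\<phi> \<in> borel_measurable pos_lborel" using \<phi> by (simp cong: measurable_cong_sets add: sets_pos_lborel)
    have m: "(\<lambda>z. \<phi> (fst (snd z)) * indicator B (fst z)) \<in> borel_measurable (?M4 r)" for r
      by (intro borel_measurable_times_ennreal mB measurable_compose[OF measurable_compose[OF measurable_snd measurable_fst] \<phi>])
    have "(\<integral>\<^sup>+\<omega>. indicator E \<omega> * (\<phi> (U \<omega>) * indicator B (\<theta>s \<omega>)) \<partial>M) =
      (\<integral>\<^sup>+u. joint_density u * (\<integral>\<^sup>+t. \<integral>\<^sup>+r. \<integral>\<^sup>+y. \<integral>\<^sup>+a. \<phi> u * indicator B t \<partial>alloc_jumps u \<partial>nonalloc_jumps r u
        \<partial>nonalloc_number u \<partial>Mt) \<partial>pos_lborel)"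
      using nn_integral_posterior[OF m] by simp
    also have "\<dots> = (\<integral>\<^sup>+u. c * (g u * \<phi> u) * emeasure Mt B \<partial>pos_lborel)"
    proof (intro nn_integral_cong)
      fix u assume "u \<in> space pos_lborel"
      then have u: "0 < u" by (simp add: space_pos_borel)
      have "(\<integral>\<^sup>+t. \<integral>\<^sup>+r. \<integral>\<^sup>+y. \<integral>\<^sup>+a. \<phi> u * indicator B t \<partial>alloc_jumps u \<partial>nonalloc_jumps r u \<partial>nonalloc_number u \<partial>Mt) =
        (\<integral>\<^sup>+t. \<phi> u * indicator B t \<partial>Mt)"
        unfolding cond_mean_const[OF u] by (simp add: measure_pmf.emeasure_space_1[simplified])
      also have "\<dots> = \<phi> u * emeasure Mt B" using B by (rule nn_integral_cmult_indicator)
      finally show "joint_density u * (\<integral>\<^sup>+t. \<integral>\<^sup>+r. \<integral>\<^sup>+y. \<integral>\<^sup>+a. \<phi> u * indicator B t \<partial>alloc_jumps u \<partial>nonalloc_jumps r u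
        \<partial>nonalloc_number u \<partial>Mt) = c * (g u * \<phi> u) * emeasure Mt B"
        by (simp add: jd[OF u] mult.assoc)
    qed
    also have "\<dots> = c * (\<integral>\<^sup>+u. g u * \<phi> u \<partial>pos_lborel) * emeasure Mt B"
      by (simp add: nn_integral_multc nn_integral_cmult)
    finally show ?thesis .
  qed
  have "(\<integral>\<^sup>+\<omega>. indicator E \<omega> * (indicator A (U \<omega>) * indicator B (\<theta>s \<omega>)) \<partial>M) =
    c * (\<integral>\<^sup>+u. g u * indicator A u \<partial>pos_lborel) * emeasure Mt B"
    using A by (intro post) simp
  also have "(\<integral>\<^sup>+u. g u * indicator A u \<partial>pos_lborel) = (\<integral>\<^sup>+u. g u * emeasure K A \<partial>pos_lborel)"
  proof -
    have "(\<integral>\<^sup>+u. g u * emeasure K A \<partial>pos_lborel) = I * emeasure K A"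
      unfolding I_def by (rule nn_integral_multc) measurable
    also have "\<dots> = (\<integral>\<^sup>+u. g u * indicator A u \<partial>pos_lborel)"
      unfolding KA[OF A] using g0 gf
      by (metis I_def ennreal_mult_divide_eq ennreal_times_divide infinity_ennreal_def mult.commute)
    finally show ?thesis ..
  qed
  also have "c * \<dots> * emeasure Mt B = (\<integral>\<^sup>+\<omega>. indicator E \<omega> * (emeasure K A * indicator B (\<theta>s \<omega>)) \<partial>M)"
    by (rule post[symmetric]) simp
  finally show "(\<integral>\<^sup>+\<omega>. indicator E \<omega> * (indicator A (U \<omega>) * indicator B (\<theta>s \<omega>)) \<partial>M) =
    (\<integral>\<^sup>+\<omega>. indicator E \<omega> * (emeasure (density pos_lborel (\<lambda>u. g u / (\<integral>\<^sup>+u. g u \<partial>pos_lborel))) A * indicator B (\<theta>s \<omega>)) \<partial>M)"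
    unfolding K_def I_def .
qed

end

section \<open>The posterior kernels\<close>

lemma measurable_measure_pmf_kernel:
  fixes p :: "'z \<Rightarrow> nat pmf"
  assumes [measurable]: "\<And>r. (\<lambda>z. pmf (p z) r) \<in> borel_measurable Z"
  shows "(\<lambda>z. measure_pmf (p z)) \<in> Z \<rightarrow>\<^sub>M prob_algebra (count_space UNIV)"
proof (rule measurable_prob_algebraI[OF _ measurable_subprob_algebra])
  fix A :: "nat set"
  have "emeasure (measure_pmf (p z)) A = (\<Sum>r. ennreal (pmf (p z) r) * indicator A r)" for z
  proof -
    have "emeasure (measure_pmf (p z)) A = (\<integral>\<^sup>+r. indicator A r \<partial>measure_pmf (p z))" by simp
    also have "\<dots> = (\<Sum>r. ennreal (pmf (p z) r) * indicator A r)"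
      unfolding nn_integral_measure_pmf nn_integral_count_space_nat ..
    finally show ?thesis .
  qed
  then show "(\<lambda>z. emeasure (measure_pmf (p z)) A) \<in> borel_measurable Z" by simp
qed (auto intro: measure_pmf.prob_space_axioms measure_pmf.subprob_space_axioms)

lemma emeasure_measure_pmf_bind:
  assumes "\<And>r. f r \<in> space (prob_algebra S)" "A \<in> sets S"
  shows "emeasure (measure_pmf p \<bind> f) A = (\<integral>\<^sup>+r. emeasure (f r) A \<partial>measure_pmf p)"
  using assms by (intro emeasure_bind[where N=S])
    (auto simp: space_prob_algebra space_subprob_algebra intro: prob_space_imp_subprob_space)

context crm_sampling
begin

definition posterior_map :: "nat \<Rightarrow> (nat \<Rightarrow> 'a) \<Rightarrow> (nat \<Rightarrow> real \<times> 'a) \<times> (nat \<Rightarrow> real) \<Rightarrow> 'a measure" where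
  "posterior_map r t = (\<lambda>(y, a). mix_measure (nonalloc_weight r (\<Sum>j<r. fst (y j)) (\<Sum>j<k. a j))
     (norm_atoms P0 {..<r} (\<lambda>j. fst (y j)) (\<lambda>j. snd (y j))) (norm_atoms P0 {..<k} a t))"

definition nonalloc_map :: "nat \<Rightarrow> (nat \<Rightarrow> real \<times> 'a) \<Rightarrow> 'a measure \<times> real" where
  "nonalloc_map r y = (norm_atoms P0 {..<r} (\<lambda>j. fst (y j)) (\<lambda>j. snd (y j)), \<Sum>j<r. fst (y j))"

lemma measurable_MY:
  assumes "f \<in> Z \<rightarrow>\<^sub>M MY r" "j < r"
  shows "(\<lambda>x. fst (f x j)) \<in> borel_measurable Z" "(\<lambda>x. snd (f x j)) \<in> Z \<rightarrow>\<^sub>M P0"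
    "x \<in> space Z \<Longrightarrow> 0 < fst (f x j)"
proof -
  have *: "(\<lambda>x. f x j) \<in> Z \<rightarrow>\<^sub>M pos_borel \<Otimes>\<^sub>M P0"
    using assms by (intro measurable_compose[OF assms(1)] measurable_component_singleton) auto
  have 1: "(\<lambda>x. fst (f x j)) \<in> Z \<rightarrow>\<^sub>M pos_borel" using * by measurable
  show "(\<lambda>x. snd (f x j)) \<in> Z \<rightarrow>\<^sub>M P0" using * by measurable
  from measurable_compose[OF 1 measurable_pos_borel_id] show "(\<lambda>x. fst (f x j)) \<in> borel_measurable Z" .
  show "0 < fst (f x j)" if "x \<in> space Z" using measurable_space[OF 1 that] by (simp add: space_pos_borel)
qed

lemma measurable_MA:
  assumes "f \<in> Z \<rightarrow>\<^sub>M MA" "j < k"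
  shows "(\<lambda>x. f x j) \<in> borel_measurable Z" "x \<in> space Z \<Longrightarrow> 0 < f x j"
proof -
  have 1: "(\<lambda>x. f x j) \<in> Z \<rightarrow>\<^sub>M pos_borel"
    using assms by (intro measurable_compose[OF assms(1)] measurable_component_singleton) auto
  from measurable_compose[OF 1 measurable_pos_borel_id] show "(\<lambda>x. f x j) \<in> borel_measurable Z" .
  show "0 < f x j" if "x \<in> space Z" using measurable_space[OF 1 that] by (simp add: space_pos_borel)
qed

lemma measurable_nonalloc_map:
  assumes "f \<in> Z \<rightarrow>\<^sub>M MY r"
  shows "(\<lambda>x. nonalloc_map r (f x)) \<in> Z \<rightarrow>\<^sub>M subprob_algebra P0 \<Otimes>\<^sub>M borel"
  unfolding nonalloc_map_def using measurable_MY[OF assms] P0.not_empty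
  by (intro measurable_Pair measurable_norm_atoms_subprob borel_measurable_sum) auto

lemma measurable_posterior_map:
  assumes t: "t \<in> Z \<rightarrow>\<^sub>M Mt" and y: "y \<in> Z \<rightarrow>\<^sub>M MY r" and a: "a \<in> Z \<rightarrow>\<^sub>M MA"
  shows "(\<lambda>x. posterior_map r (t x) (y x, a x)) \<in> Z \<rightarrow>\<^sub>M prob_algebra P0"
proof -
  have ty: "(\<lambda>x. t x j) \<in> Z \<rightarrow>\<^sub>M P0" if "j < k" for j
    using that by (intro measurable_compose[OF t] measurable_component_singleton) auto
  have sT: "(\<lambda>x. \<Sum>j<r. fst (y x j)) \<in> borel_measurable Z"
    using measurable_MY[OF y] by (intro borel_measurable_sum) auto
  have sS: "(\<lambda>x. \<Sum>j<k. a x j) \<in> borel_measurable Z"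
    using measurable_MA[OF a] by (intro borel_measurable_sum) auto
  show ?thesis
    unfolding posterior_map_def split
  proof (rule measurable_mix_measure)
    show "(\<lambda>x. nonalloc_weight r (\<Sum>j<r. fst (y x j)) (\<Sum>j<k. a x j)) \<in> borel_measurable Z"
      unfolding nonalloc_weight_def using sT sS by (cases "r = 0") simp_all
    show "0 \<le> nonalloc_weight r (\<Sum>j<r. fst (y x j)) (\<Sum>j<k. a x j) \<and> nonalloc_weight r (\<Sum>j<r. fst (y x j)) (\<Sum>j<k. a x j) \<le> 1"
      if x: "x \<in> space Z" for x
    proof -
      have "0 \<le> (\<Sum>j<r. fst (y x j))" using measurable_MY(3)[OF y _ x] by (intro sum_nonneg) (auto intro: less_imp_le)
      moreover have "0 \<le> (\<Sum>j<k. a x j)" using measurable_MA(2)[OF a _ x] by (intro sum_nonneg) (auto intro: less_imp_le)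
      ultimately show ?thesis by (simp add: nonalloc_weight_def divide_le_eq)
    qed
    show "(\<lambda>x. norm_atoms P0 {..<r} (\<lambda>j. fst (y x j)) (\<lambda>j. snd (y x j))) \<in> Z \<rightarrow>\<^sub>M subprob_algebra P0"
      using measurable_MY[OF y] P0.not_empty by (intro measurable_norm_atoms_subprob) auto
    show "(\<lambda>x. norm_atoms P0 {..<k} (a x) (t x)) \<in> Z \<rightarrow>\<^sub>M prob_algebra P0"
      using measurable_MA[OF a] ty k by (intro measurable_norm_atoms_prob) (auto simp: lessThan_empty_iff)
    fix x assume x: "x \<in> space Z" and w: "nonalloc_weight r (\<Sum>j<r. fst (y x j)) (\<Sum>j<k. a x j) \<noteq> 0"
    from w have "r \<noteq> 0" by (simp add: nonalloc_weight_def split: if_splits)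
    then show "prob_space (norm_atoms P0 {..<r} (\<lambda>j. fst (y x j)) (\<lambda>j. snd (y x j)))"
      using measurable_MY(3)[OF y _ x] measurable_space[OF measurable_MY(2)[OF y] x]
      by (intro prob_space_norm_atoms) (auto simp: lessThan_empty_iff)
  qed
qed

definition nonalloc_kernel :: "nat \<Rightarrow> real \<Rightarrow> ('a measure \<times> real) measure" where
  "nonalloc_kernel r u = distr (nonalloc_jumps r u) (subprob_algebra P0 \<Otimes>\<^sub>M borel) (nonalloc_map r)"

definition posterior_kernel :: "(nat \<Rightarrow> 'a) \<Rightarrow> real \<Rightarrow> 'a measure measure" where
  "posterior_kernel t u = nonalloc_number u \<bind>
     (\<lambda>r. distr (nonalloc_jumps r u \<Otimes>\<^sub>M alloc_jumps u) (prob_algebra P0) (posterior_map r t))"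

lemma measurable_nonalloc_kernel: "nonalloc_kernel r \<in> pos_borel \<rightarrow>\<^sub>M prob_algebra (subprob_algebra P0 \<Otimes>\<^sub>M borel)"
  unfolding nonalloc_kernel_def[abs_def]
proof (rule measurable_distr_prob_space2[OF nonalloc_jumps])
  show "(\<lambda>(u, y). nonalloc_map r y) \<in> pos_borel \<Otimes>\<^sub>M MY r \<rightarrow>\<^sub>M subprob_algebra P0 \<Otimes>\<^sub>M borel"
    unfolding split_beta' by (rule measurable_nonalloc_map) measurable
qed

lemma nn_integral_nonalloc_kernel:
  assumes "0 < u" "g \<in> borel_measurable (subprob_algebra P0 \<Otimes>\<^sub>M borel)"
  shows "(\<integral>\<^sup>+p. g p \<partial>nonalloc_kernel r u) = (\<integral>\<^sup>+y. g (nonalloc_map r y) \<partial>nonalloc_jumps r u)"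
proof -
  have "nonalloc_map r \<in> MY r \<rightarrow>\<^sub>M subprob_algebra P0 \<Otimes>\<^sub>M borel" by (rule measurable_nonalloc_map) simp
  then have "nonalloc_map r \<in> nonalloc_jumps r u \<rightarrow>\<^sub>M subprob_algebra P0 \<Otimes>\<^sub>M borel" by (simp cong: measurable_cong_sets)
  then show ?thesis unfolding nonalloc_kernel_def using assms(2) by (intro nn_integral_distr) simp_all
qed

lemma measurable_nonalloc_number: "(\<lambda>u. nonalloc_number u) \<in> pos_borel \<rightarrow>\<^sub>M prob_algebra (count_space UNIV)"
proof (rule measurable_measure_pmf_kernel)
  fix r
  have "(\<lambda>u. real (r + k) * \<Lambda>u u ^ r / (fact r * (\<Lambda>u u + real k)) * exp (- \<Lambda>u u)) \<in> borel_measurable pos_borel" by measurable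
  then show "(\<lambda>u. pmf (nonalloc_number_law k (\<Lambda>u u)) r) \<in> borel_measurable pos_borel"
    by (rule measurable_cong[THEN iffD1, rotated]) (simp add: pmf_nonalloc_number_law[OF \<Lambda>u_pos k] space_pos_borel)
qed

lemma measurable_posterior_distr:
  "(\<lambda>(t, u). distr (nonalloc_jumps r u \<Otimes>\<^sub>M alloc_jumps u) (prob_algebra P0) (posterior_map r t)) \<in> M\<theta>U \<rightarrow>\<^sub>M prob_algebra (prob_algebra P0)"
  unfolding split_beta'
proof (rule measurable_distr_prob_space2[where M="MY r \<Otimes>\<^sub>M MA"])
  show "(\<lambda>z. nonalloc_jumps r (snd z) \<Otimes>\<^sub>M alloc_jumps (snd z)) \<in> M\<theta>U \<rightarrow>\<^sub>M prob_algebra (MY r \<Otimes>\<^sub>M MA)"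
    by (intro measurable_pair_prob measurable_compose[OF measurable_snd] nonalloc_jumps alloc_jumps)
  have "(\<lambda>z. posterior_map r (fst (fst z)) (fst (snd z), snd (snd z))) \<in> M\<theta>U \<Otimes>\<^sub>M (MY r \<Otimes>\<^sub>M MA) \<rightarrow>\<^sub>M prob_algebra P0"
    by (rule measurable_posterior_map) measurable
  then show "(\<lambda>(z, w). posterior_map r (fst z) w) \<in> M\<theta>U \<Otimes>\<^sub>M (MY r \<Otimes>\<^sub>M MA) \<rightarrow>\<^sub>M prob_algebra P0"
    by (simp add: split_beta')
qed

lemma measurable_posterior_kernel: "(\<lambda>(t, u). posterior_kernel t u) \<in> M\<theta>U \<rightarrow>\<^sub>M prob_algebra (prob_algebra P0)"
  unfolding posterior_kernel_def split_beta'
proof (rule measurable_bind_prob_space2[where N="count_space UNIV"])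
  show "(\<lambda>z. measure_pmf (nonalloc_number_law k (\<Lambda>u (snd z)))) \<in> M\<theta>U \<rightarrow>\<^sub>M prob_algebra (count_space UNIV)"
    by (rule measurable_compose[OF measurable_snd measurable_nonalloc_number])
  have 1: "(\<lambda>w. distr (nonalloc_jumps r (snd (fst w)) \<Otimes>\<^sub>M alloc_jumps (snd (fst w))) (prob_algebra P0) (posterior_map r (fst (fst w))))
      \<in> M\<theta>U \<Otimes>\<^sub>M count_space UNIV \<rightarrow>\<^sub>M prob_algebra (prob_algebra P0)" for r
    using measurable_compose[OF measurable_fst measurable_posterior_distr] by (simp add: split_beta')
  have "(\<lambda>w. (\<lambda>r w. distr (nonalloc_jumps r (snd (fst w)) \<Otimes>\<^sub>M alloc_jumps (snd (fst w))) (prob_algebra P0) (posterior_map r (fst (fst w)))) (snd w) w)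
      \<in> M\<theta>U \<Otimes>\<^sub>M count_space (UNIV :: nat set) \<rightarrow>\<^sub>M prob_algebra (prob_algebra P0)"
    by (rule measurable_compose_countable[OF 1 measurable_snd])
  then show "(\<lambda>(z, r). distr (nonalloc_jumps r (snd z) \<Otimes>\<^sub>M alloc_jumps (snd z)) (prob_algebra P0) (posterior_map r (fst z)))
      \<in> M\<theta>U \<Otimes>\<^sub>M count_space UNIV \<rightarrow>\<^sub>M prob_algebra (prob_algebra P0)"
    by (simp add: split_beta')
qed

lemma emeasure_posterior_kernel:
  assumes t: "t \<in> space Mt" and u: "0 < u" and A: "A \<in> sets (prob_algebra P0)"
  shows "emeasure (posterior_kernel t u) A =
    (\<integral>\<^sup>+r. \<integral>\<^sup>+y. \<integral>\<^sup>+a. indicator A (posterior_map r t (y, a)) \<partial>alloc_jumps u \<partial>nonalloc_jumps r u \<partial>nonalloc_number u)"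
proof -
  have tu: "(t, u) \<in> space M\<theta>U" using t u by (simp add: space_pair_measure space_pos_borel)
  have "emeasure (posterior_kernel t u) A =
    (\<integral>\<^sup>+r. emeasure (distr (nonalloc_jumps r u \<Otimes>\<^sub>M alloc_jumps u) (prob_algebra P0) (posterior_map r t)) A \<partial>nonalloc_number u)"
    unfolding posterior_kernel_def
    by (rule emeasure_measure_pmf_bind[OF _ A]) (use measurable_space[OF measurable_posterior_distr tu] in simp)
  also have "\<dots> = (\<integral>\<^sup>+r. \<integral>\<^sup>+y. \<integral>\<^sup>+a. indicator A (posterior_map r t (y, a)) \<partial>alloc_jumps u \<partial>nonalloc_jumps r u \<partial>nonalloc_number u)"
  proof (rule nn_integral_cong)
    fix r
    interpret A: prob_space "alloc_jumps u" by (rule prob_space_alloc_jumps[OF u])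
    have "(\<lambda>z. posterior_map r t (fst z, snd z)) \<in> MY r \<Otimes>\<^sub>M MA \<rightarrow>\<^sub>M prob_algebra P0"
      by (rule measurable_posterior_map) (use t in measurable)
    then have pm: "posterior_map r t \<in> nonalloc_jumps r u \<Otimes>\<^sub>M alloc_jumps u \<rightarrow>\<^sub>M prob_algebra P0"
      by (simp cong: measurable_cong_sets sets_pair_measure_cong)
    have ind: "(\<lambda>z. indicator A (posterior_map r t z) :: ennreal) \<in> borel_measurable (nonalloc_jumps r u \<Otimes>\<^sub>M alloc_jumps u)"
      by (rule measurable_compose[OF pm borel_measurable_indicator[OF A]])
    have "emeasure (distr (nonalloc_jumps r u \<Otimes>\<^sub>M alloc_jumps u) (prob_algebra P0) (posterior_map r t)) A =
      (\<integral>\<^sup>+z. indicator A z \<partial>distr (nonalloc_jumps r u \<Otimes>\<^sub>M alloc_jumps u) (prob_algebra P0) (posterior_map r t))"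
      using A by simp
    also have "\<dots> = (\<integral>\<^sup>+z. indicator A (posterior_map r t z) \<partial>(nonalloc_jumps r u \<Otimes>\<^sub>M alloc_jumps u))"
      by (rule nn_integral_distr[OF pm]) (use A in simp)
    also have "\<dots> = (\<integral>\<^sup>+y. \<integral>\<^sup>+a. indicator A (posterior_map r t (y, a)) \<partial>alloc_jumps u \<partial>nonalloc_jumps r u)"
      by (rule A.nn_integral_fst[OF ind, symmetric])
    finally show "emeasure (distr (nonalloc_jumps r u \<Otimes>\<^sub>M alloc_jumps u) (prob_algebra P0) (posterior_map r t)) A =
      (\<integral>\<^sup>+y. \<integral>\<^sup>+a. indicator A (posterior_map r t (y, a)) \<partial>alloc_jumps u \<partial>nonalloc_jumps r u)" .
  qed
  finally show ?thesis .
qed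

lemma cond_distr_crm_measure:
  "cond_distr_on M E (crm_measure P0 N J \<tau>) (prob_algebra P0) (\<lambda>\<omega>. (\<theta>s \<omega>, U \<omega>)) M\<theta>U (\<lambda>(t, u). posterior_kernel t u)"
proof (rule cond_distr_posterior[OF measurable_posterior_kernel meas_on_crm, where f="\<lambda>r (t, u, y, a). posterior_map r t (y, a)"])
  show "(\<lambda>(t, u, y, a). posterior_map r t (y, a)) \<in> latent_space r \<rightarrow>\<^sub>M prob_algebra P0" for r
    unfolding split_beta' by (rule measurable_posterior_map) measurable
  fix \<omega> assume g: "regular \<omega>" "\<omega> \<in> E"
  show "crm_measure P0 N J \<tau> \<omega> = (\<lambda>(t, u, y, a). posterior_map (N \<omega> + 1 - k) t (y, a)) (\<theta>s \<omega>, U \<omega>, Yna \<omega>, Ja \<omega>)"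
    unfolding crm_measure_regular[OF g] Pna_regular[OF g] posterior_map_def by simp
qed (simp add: emeasure_posterior_kernel)

lemma cond_distr_nonalloc:
  "cond_distr_on M E (\<lambda>\<omega>. (Pna \<omega>, Tna \<omega>)) (subprob_algebra P0 \<Otimes>\<^sub>M borel) (\<lambda>\<omega>. (\<theta>s \<omega>, U \<omega>, N \<omega> + 1 - k))
     (Mt \<Otimes>\<^sub>M pos_borel \<Otimes>\<^sub>M count_space UNIV) (\<lambda>(t, u, r). nonalloc_kernel r u)"
proof (rule cond_distr_posterior_number[where f="\<lambda>r (t, u, y, a). nonalloc_map r y"])
  show "(\<lambda>(t, u, r). nonalloc_kernel r u) \<in> Mt \<Otimes>\<^sub>M pos_borel \<Otimes>\<^sub>M count_space UNIV \<rightarrow>\<^sub>M prob_algebra (subprob_algebra P0 \<Otimes>\<^sub>M borel)"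
  proof -
    have "(\<lambda>w. (\<lambda>r w. nonalloc_kernel r (fst (snd w))) (snd (snd w)) w) \<in> Mt \<Otimes>\<^sub>M pos_borel \<Otimes>\<^sub>M count_space (UNIV :: nat set) \<rightarrow>\<^sub>M prob_algebra (subprob_algebra P0 \<Otimes>\<^sub>M borel)"
      by (rule measurable_compose_countable)
        (intro measurable_compose[OF _ measurable_nonalloc_kernel], measurable)
    then show ?thesis by (simp add: split_beta')
  qed
  show "meas_on M E (\<lambda>\<omega>. (Pna \<omega>, Tna \<omega>)) (subprob_algebra P0 \<Otimes>\<^sub>M borel)"
    by (intro meas_on_Pair sets_E meas_on_Pna meas_on_Tna)
  show "(\<lambda>(t, u, y, a). nonalloc_map r y) \<in> latent_space r \<rightarrow>\<^sub>M subprob_algebra P0 \<Otimes>\<^sub>M borel" for r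
    unfolding split_beta' by (rule measurable_nonalloc_map) measurable
  show "(Pna \<omega>, Tna \<omega>) = (\<lambda>(t, u, y, a). nonalloc_map (N \<omega> + 1 - k) y) (\<theta>s \<omega>, U \<omega>, Yna \<omega>, Ja \<omega>)" if "regular \<omega>" "\<omega> \<in> E" for \<omega>
    unfolding Pna_regular[OF that] by (simp add: nonalloc_map_def)
  fix t u r A assume u: "0 < (u :: real)" and A: "A \<in> sets (subprob_algebra P0 \<Otimes>\<^sub>M (borel :: real measure))"
  have "emeasure (nonalloc_kernel r u) A = (\<integral>\<^sup>+p. indicator A p \<partial>nonalloc_kernel r u)"
    using A by (simp add: nonalloc_kernel_def)
  also have "\<dots> = (\<integral>\<^sup>+y. \<integral>\<^sup>+a. indicator A (nonalloc_map r y) \<partial>alloc_jumps u \<partial>nonalloc_jumps r u)"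
    using nn_integral_nonalloc_kernel[OF u borel_measurable_indicator[OF A]] prob_space.emeasure_space_1[OF prob_space_alloc_jumps[OF u]]
    by simp
  finally show "emeasure ((\<lambda>(t, u, r). nonalloc_kernel r u) (t, u, r)) A =
    (\<integral>\<^sup>+y. \<integral>\<^sup>+a. indicator A ((\<lambda>(t, u, y, a). nonalloc_map r y) (t, u, y, a)) \<partial>alloc_jumps u \<partial>nonalloc_jumps r u)" by simp
qed

lemma cond_distr_nonalloc_number:
  "cond_distr_on M E (\<lambda>\<omega>. N \<omega> + 1 - k) (count_space UNIV) (\<lambda>\<omega>. (\<theta>s \<omega>, U \<omega>)) M\<theta>U
     (\<lambda>(t, u). nonalloc_number u)"
proof (rule cond_distr_posterior[where f="\<lambda>r _. r"])
  show "(\<lambda>(t, u). nonalloc_number u) \<in> M\<theta>U \<rightarrow>\<^sub>M prob_algebra (count_space UNIV)"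
    using measurable_compose[OF measurable_snd measurable_nonalloc_number] by (simp add: split_beta')
  show "meas_on M E (\<lambda>\<omega>. N \<omega> + 1 - k) (count_space UNIV)" by (rule meas_on_Nna)
  fix t u A assume "0 < (u :: real)"
  then show "emeasure ((\<lambda>(t, u). nonalloc_number u) (t, u)) A =
    (\<integral>\<^sup>+r. \<integral>\<^sup>+y. \<integral>\<^sup>+a. indicator A r \<partial>alloc_jumps u \<partial>nonalloc_jumps r u \<partial>nonalloc_number u)"
    by (simp only: cond_mean_const) simp
qed auto

lemma measurable_alloc_map: "(\<lambda>(t, u, y, a). a) \<in> latent_space r \<rightarrow>\<^sub>M MA"
  by measurable

lemma emeasure_alloc_jumps_eq:
  assumes u: "0 < u" and A: "A \<in> sets MA"
  shows "emeasure (alloc_jumps u) A = (\<integral>\<^sup>+y. \<integral>\<^sup>+a. indicator A a \<partial>alloc_jumps u \<partial>nonalloc_jumps r u)"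
  using A prob_space.emeasure_space_1[OF prob_space_nonalloc_jumps[OF u]] by simp

lemma cond_distr_alloc_jumps:
  "cond_distr_on M E Ja MA (\<lambda>\<omega>. (\<theta>s \<omega>, U \<omega>)) M\<theta>U (\<lambda>(t, u). alloc_jumps u)"
proof (rule cond_distr_posterior[OF _ meas_on_Ja measurable_alloc_map])
  show "(\<lambda>(t, u). alloc_jumps u) \<in> M\<theta>U \<rightarrow>\<^sub>M prob_algebra MA"
    using measurable_compose[OF measurable_snd alloc_jumps] by (simp add: split_beta')
  fix t u A assume u: "0 < (u :: real)" and A: "A \<in> sets MA"
  show "emeasure ((\<lambda>(t, u). alloc_jumps u) (t, u)) A =
    (\<integral>\<^sup>+r. \<integral>\<^sup>+y. \<integral>\<^sup>+a. indicator A ((\<lambda>(t, u, y, a). a) (t, u, y, a)) \<partial>alloc_jumps u \<partial>nonalloc_jumps r u \<partial>nonalloc_number u)"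
    by (simp only: prod.case emeasure_alloc_jumps_eq[OF u A, symmetric]) simp
qed auto

definition labelled_kernel :: "real \<Rightarrow> (nat \<Rightarrow> nat) \<Rightarrow> ('a measure \<times> real) measure" where
  "labelled_kernel u l = measure_pmf (number_given_labels u l) \<bind> (\<lambda>m. nonalloc_kernel (m + 1 - k) u)"

lemma measurable_number_given_labels:
  "(\<lambda>z. measure_pmf (number_given_labels (fst z) (snd z))) \<in> pos_borel \<Otimes>\<^sub>M Ml \<rightarrow>\<^sub>M prob_algebra (count_space UNIV)"
proof (rule measurable_measure_pmf_kernel)
  fix m :: nat
  let ?Z = "pos_borel \<Otimes>\<^sub>M Ml"
  define V where "V = (\<lambda>l. {m :: nat. \<forall>i\<in>{..<k}. l i \<le> m})"
  have V: "V l = {m. \<forall>i<k. l i \<le> m}" for l by (auto simp: V_def)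
  have pV [measurable]: "Measurable.pred ?Z (\<lambda>z. m \<in> V (snd z))" for m
    unfolding V_def mem_Collect_eq
  proof (intro pred_intros_finite finite_lessThan)
    fix i assume "i \<in> {..<k}"
    then have [measurable]: "(\<lambda>z. snd z i) \<in> ?Z \<rightarrow>\<^sub>M count_space UNIV"
      by (intro measurable_compose[OF measurable_snd measurable_component_singleton])
    show "Measurable.pred ?Z (\<lambda>z. snd z i \<le> m)" by measurable
  qed
  have pm [measurable]: "(\<lambda>z. pmf (poisson_pmf (\<Lambda>u (fst z))) m) \<in> borel_measurable ?Z" for m
  proof -
    have "(\<lambda>z. \<Lambda>u (fst z) ^ m / fact m * exp (- \<Lambda>u (fst z))) \<in> borel_measurable ?Z"
      using measurable_compose[OF measurable_fst measurable_\<Lambda>u] by measurable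
    then show ?thesis
      by (rule measurable_cong[THEN iffD1, rotated]) (auto simp: space_pair_measure space_pos_borel dest: \<Lambda>u_pos)
  qed
  have em: "measure (measure_pmf p) S = enn2real (\<Sum>m. ennreal (pmf p m) * indicator S m)" for p :: "nat pmf" and S
  proof -
    have "emeasure (measure_pmf p) S = (\<integral>\<^sup>+r. indicator S r \<partial>measure_pmf p)" by simp
    also have "\<dots> = (\<Sum>r. ennreal (pmf p r) * indicator S r)"
      unfolding nn_integral_measure_pmf nn_integral_count_space_nat ..
    finally show ?thesis by (simp add: measure_def)
  qed
  have ind [measurable]: "(\<lambda>z. indicator (V (snd z)) m :: ennreal) \<in> borel_measurable ?Z" for m
    using pV[of m] unfolding indicator_def by measurable
  have "(\<lambda>z. if m \<in> V (snd z) then pmf (poisson_pmf (\<Lambda>u (fst z))) m / enn2real (\<Sum>m. ennreal (pmf (poisson_pmf (\<Lambda>u (fst z))) m) * indicator (V (snd z)) m) else 0)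
    \<in> borel_measurable ?Z"
    by measurable
  then show "(\<lambda>z. pmf (number_given_labels (fst z) (snd z)) m) \<in> borel_measurable ?Z"
  proof (rule measurable_cong[THEN iffD1, rotated])
    fix z assume "z \<in> space ?Z"
    then have u: "0 < fst z" by (auto simp: space_pair_measure space_pos_borel)
    show "(if m \<in> V (snd z) then pmf (poisson_pmf (\<Lambda>u (fst z))) m / enn2real (\<Sum>m. ennreal (pmf (poisson_pmf (\<Lambda>u (fst z))) m) * indicator (V (snd z)) m) else 0) =
      pmf (number_given_labels (fst z) (snd z)) m"
      unfolding number_given_labels_def pmf_cond[OF set_pmf_poisson_labels[OF u]] em V ..
  qed
qed

lemma measurable_labelled_kernel:
  "(\<lambda>(t, u, l). labelled_kernel u l) \<in> Mt \<Otimes>\<^sub>M pos_borel \<Otimes>\<^sub>M Ml \<rightarrow>\<^sub>M prob_algebra (subprob_algebra P0 \<Otimes>\<^sub>M borel)"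
  unfolding labelled_kernel_def split_beta'
proof (rule measurable_bind_prob_space2[where N="count_space UNIV"])
  let ?Z = "Mt \<Otimes>\<^sub>M pos_borel \<Otimes>\<^sub>M Ml"
  show "(\<lambda>z. measure_pmf (number_given_labels (fst (snd z)) (snd (snd z)))) \<in> ?Z \<rightarrow>\<^sub>M prob_algebra (count_space UNIV)"
    by (rule measurable_compose[OF measurable_snd measurable_number_given_labels])
  have 1: "(\<lambda>w. nonalloc_kernel (m + 1 - k) (fst (snd (fst w)))) \<in> ?Z \<Otimes>\<^sub>M count_space (UNIV :: nat set) \<rightarrow>\<^sub>M prob_algebra (subprob_algebra P0 \<Otimes>\<^sub>M borel)" for m
    by (rule measurable_compose[OF _ measurable_nonalloc_kernel]) measurable
  have "(\<lambda>w. (\<lambda>m w. nonalloc_kernel (m + 1 - k) (fst (snd (fst w)))) (snd w) w) \<in> ?Z \<Otimes>\<^sub>M count_space (UNIV :: nat set) \<rightarrow>\<^sub>M prob_algebra (subprob_algebra P0 \<Otimes>\<^sub>M borel)"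
    by (rule measurable_compose_countable[OF 1 measurable_snd])
  then show "(\<lambda>(z, m). nonalloc_kernel (m + 1 - k) (fst (snd z))) \<in> ?Z \<Otimes>\<^sub>M count_space UNIV \<rightarrow>\<^sub>M prob_algebra (subprob_algebra P0 \<Otimes>\<^sub>M borel)"
    by (simp add: split_beta')
qed

lemma nn_integral_labelled_kernel:
  assumes u: "0 < u" and g: "g \<in> borel_measurable (subprob_algebra P0 \<Otimes>\<^sub>M borel)"
  shows "(\<integral>\<^sup>+p. g p \<partial>labelled_kernel u l) = (\<integral>\<^sup>+m. \<integral>\<^sup>+y. g (nonalloc_map (m + 1 - k) y) \<partial>nonalloc_jumps (m + 1 - k) u \<partial>measure_pmf (number_given_labels u l))"
proof -
  have "nonalloc_kernel r u \<in> space (prob_algebra (subprob_algebra P0 \<Otimes>\<^sub>M borel))" for r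
    by (rule measurable_space[OF measurable_nonalloc_kernel]) (simp add: space_pos_borel u)
  then have "nonalloc_kernel r u \<in> space (subprob_algebra (subprob_algebra P0 \<Otimes>\<^sub>M borel))" for r
    by (auto simp: space_prob_algebra space_subprob_algebra intro: prob_space_imp_subprob_space)
  then have "(\<integral>\<^sup>+p. g p \<partial>labelled_kernel u l) = (\<integral>\<^sup>+m. \<integral>\<^sup>+p. g p \<partial>nonalloc_kernel (m + 1 - k) u \<partial>measure_pmf (number_given_labels u l))"
    unfolding labelled_kernel_def by (intro nn_integral_bind[OF g]) auto
  then show ?thesis by (simp only: nn_integral_nonalloc_kernel[OF u g])
qed

lemma sets_labelled_kernel: "0 < u \<Longrightarrow> l \<in> space Ml \<Longrightarrow> sets (labelled_kernel u l) = sets (subprob_algebra P0 \<Otimes>\<^sub>M borel)"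
proof -
  assume "0 < u" "l \<in> space Ml"
  obtain t where "t \<in> space Mt" using prob_space.not_empty[OF prob_space_Mt] by blast
  then have "(t, u, l) \<in> space (Mt \<Otimes>\<^sub>M pos_borel \<Otimes>\<^sub>M Ml)"
    using \<open>0 < u\<close> \<open>l \<in> space Ml\<close> by (simp add: space_pair_measure space_pos_borel)
  from measurable_space[OF measurable_labelled_kernel this] show ?thesis by (simp add: space_prob_algebra)
qed

text \<open>
  Both families of jumps are independent given the number of atoms.  The labels influence that number,
  and it in turn affects only the non-allocated family; so the joint kernel is a product.
\<close>
lemma cond_indep_nonalloc_alloc:
  "cond_indep_on M E (\<lambda>\<omega>. (Pna \<omega>, Tna \<omega>)) (subprob_algebra P0 \<Otimes>\<^sub>M borel) Ja MA (\<lambda>\<omega>. (\<theta>s \<omega>, U \<omega>, ls \<omega>)) (Mt \<Otimes>\<^sub>M pos_borel \<Otimes>\<^sub>M Ml)"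
  unfolding cond_indep_on_def
proof (intro exI conjI)
  let ?S = "subprob_algebra P0 \<Otimes>\<^sub>M (borel :: real measure)" and ?Z = "Mt \<Otimes>\<^sub>M pos_borel \<Otimes>\<^sub>M Ml"
  have mP: "meas_on M E (\<lambda>\<omega>. (Pna \<omega>, Tna \<omega>)) ?S"
    by (intro meas_on_Pair sets_E meas_on_Pna meas_on_Tna)
  have mmap: "(\<lambda>(t, u, y, a). nonalloc_map r y) \<in> latent_space r \<rightarrow>\<^sub>M ?S" for r
    unfolding split_beta' by (rule measurable_nonalloc_map) measurable
  have map: "(Pna \<omega>, Tna \<omega>) = (\<lambda>(t, u, y, a). nonalloc_map (N \<omega> + 1 - k) y) (\<theta>s \<omega>, U \<omega>, Yna \<omega>, Ja \<omega>)" if "regular \<omega>" "\<omega> \<in> E" for \<omega>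
    unfolding Pna_regular[OF that] by (simp add: nonalloc_map_def)
  have K: "(\<lambda>(t, u, l). labelled_kernel u l) \<in> ?Z \<rightarrow>\<^sub>M prob_algebra ?S" by (rule measurable_labelled_kernel)
  have L: "(\<lambda>(t, u, l). alloc_jumps u) \<in> ?Z \<rightarrow>\<^sub>M prob_algebra MA"
    using measurable_compose[OF measurable_compose[OF measurable_snd measurable_fst] alloc_jumps] by (simp add: split_beta')
  show "cond_distr_on M E (\<lambda>\<omega>. (Pna \<omega>, Tna \<omega>)) ?S (\<lambda>\<omega>. (\<theta>s \<omega>, U \<omega>, ls \<omega>)) ?Z (\<lambda>(t, u, l). labelled_kernel u l)"
  proof (rule cond_distr_labelled[OF K mP mmap map])
    fix t :: "nat \<Rightarrow> 'a" and u :: real and l :: "nat \<Rightarrow> nat" and A assume u: "0 < u" and l: "l \<in> space Ml" and A: "A \<in> sets ?S"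
    have "emeasure (labelled_kernel u l) A = (\<integral>\<^sup>+p. indicator A p \<partial>labelled_kernel u l)"
      using A sets_labelled_kernel[OF u l] by simp
    also have "\<dots> = (\<integral>\<^sup>+m. \<integral>\<^sup>+y. \<integral>\<^sup>+a. indicator A (nonalloc_map (m + 1 - k) y) \<partial>alloc_jumps u \<partial>nonalloc_jumps (m + 1 - k) u \<partial>measure_pmf (number_given_labels u l))"
      using prob_space.emeasure_space_1[OF prob_space_alloc_jumps[OF u]]
      by (simp only: nn_integral_labelled_kernel[OF u borel_measurable_indicator[OF A]] nn_integral_const mult_1_right)
    finally show "emeasure ((\<lambda>(t, u, l). labelled_kernel u l) (t, u, l)) A =
      (\<integral>\<^sup>+m. \<integral>\<^sup>+y. \<integral>\<^sup>+a. indicator A ((\<lambda>(t, u, y, a). nonalloc_map (m + 1 - k) y) (t, u, y, a)) \<partial>alloc_jumps u \<partial>nonalloc_jumps (m + 1 - k) u \<partial>measure_pmf (number_given_labels u l))"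
      by simp
  qed
  show "cond_distr_on M E Ja MA (\<lambda>\<omega>. (\<theta>s \<omega>, U \<omega>, ls \<omega>)) ?Z (\<lambda>(t, u, l). alloc_jumps u)"
  proof (rule cond_distr_labelled[OF L meas_on_Ja measurable_alloc_map])
    fix t :: "nat \<Rightarrow> 'a" and u :: real and l :: "nat \<Rightarrow> nat" and A assume u: "0 < u" and A: "A \<in> sets MA"
    show "emeasure ((\<lambda>(t, u, l). alloc_jumps u) (t, u, l)) A =
      (\<integral>\<^sup>+m. \<integral>\<^sup>+y. \<integral>\<^sup>+a. indicator A ((\<lambda>(t, u, y, a). a) (t, u, y, a)) \<partial>alloc_jumps u \<partial>nonalloc_jumps (m + 1 - k) u \<partial>measure_pmf (number_given_labels u l))"
      by (simp only: prod.case emeasure_alloc_jumps_eq[OF u A, symmetric]) simp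
  qed auto
  show "cond_distr_on M E (\<lambda>\<omega>. ((Pna \<omega>, Tna \<omega>), Ja \<omega>)) (?S \<Otimes>\<^sub>M MA) (\<lambda>\<omega>. (\<theta>s \<omega>, U \<omega>, ls \<omega>)) ?Z
    (\<lambda>z. (\<lambda>(t, u, l). labelled_kernel u l) z \<Otimes>\<^sub>M (\<lambda>(t, u, l). alloc_jumps u) z)"
  proof (rule cond_distr_labelled[where f="\<lambda>r (t, u, y, a). (nonalloc_map r y, a)"])
    show "(\<lambda>z. (\<lambda>(t, u, l). labelled_kernel u l) z \<Otimes>\<^sub>M (\<lambda>(t, u, l). alloc_jumps u) z) \<in> ?Z \<rightarrow>\<^sub>M prob_algebra (?S \<Otimes>\<^sub>M MA)"
      by (rule measurable_pair_prob[OF K L])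
    show "meas_on M E (\<lambda>\<omega>. ((Pna \<omega>, Tna \<omega>), Ja \<omega>)) (?S \<Otimes>\<^sub>M MA)"
      by (intro meas_on_Pair[OF sets_E mP] meas_on_Ja)
    show "(\<lambda>(t, u, y, a). (nonalloc_map r y, a)) \<in> latent_space r \<rightarrow>\<^sub>M ?S \<Otimes>\<^sub>M MA" for r
      using measurable_Pair[OF mmap measurable_alloc_map] by (simp add: split_beta')
    show "((Pna \<omega>, Tna \<omega>), Ja \<omega>) = (\<lambda>(t, u, y, a). (nonalloc_map (N \<omega> + 1 - k) y, a)) (\<theta>s \<omega>, U \<omega>, Yna \<omega>, Ja \<omega>)" if "regular \<omega>" "\<omega> \<in> E" for \<omega>
      using map[OF that] by simp
    fix t :: "nat \<Rightarrow> 'a" and u :: real and l :: "nat \<Rightarrow> nat" and A assume u: "0 < u" and l: "l \<in> space Ml" and A: "A \<in> sets (?S \<Otimes>\<^sub>M MA)"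
    interpret A: prob_space "alloc_jumps u" by (rule prob_space_alloc_jumps[OF u])
    note sK = sets_labelled_kernel[OF u l]
    have A': "A \<in> sets (labelled_kernel u l \<Otimes>\<^sub>M alloc_jumps u)" using A by (simp add: sK cong: sets_pair_measure_cong)
    have "(\<lambda>z. indicator A (fst z, snd z) :: ennreal) \<in> borel_measurable (?S \<Otimes>\<^sub>M alloc_jumps u)"
      using A by (simp cong: measurable_cong_sets sets_pair_measure_cong)
    from A.borel_measurable_nn_integral_fst[OF this]
    have g: "(\<lambda>p. \<integral>\<^sup>+a. indicator A (p, a) \<partial>alloc_jumps u) \<in> borel_measurable ?S" by simp
    have "emeasure (labelled_kernel u l \<Otimes>\<^sub>M alloc_jumps u) A = (\<integral>\<^sup>+p. \<integral>\<^sup>+a. indicator A (p, a) \<partial>alloc_jumps u \<partial>labelled_kernel u l)"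
      by (rule A.emeasure_pair_measure[OF A'])
    also have "\<dots> = (\<integral>\<^sup>+m. \<integral>\<^sup>+y. \<integral>\<^sup>+a. indicator A (nonalloc_map (m + 1 - k) y, a) \<partial>alloc_jumps u \<partial>nonalloc_jumps (m + 1 - k) u \<partial>measure_pmf (number_given_labels u l))"
      by (rule nn_integral_labelled_kernel[OF u g])
    finally show "emeasure ((\<lambda>(t, u, l). labelled_kernel u l) (t, u, l) \<Otimes>\<^sub>M (\<lambda>(t, u, l). alloc_jumps u) (t, u, l)) A =
      (\<integral>\<^sup>+m. \<integral>\<^sup>+y. \<integral>\<^sup>+a. indicator A ((\<lambda>(t, u, y, a). (nonalloc_map (m + 1 - k) y, a)) (t, u, y, a)) \<partial>alloc_jumps u \<partial>nonalloc_jumps (m + 1 - k) u \<partial>measure_pmf (number_given_labels u l))"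
      by simp
  qed
qed

end

section \<open>Jump laws given by an intensity\<close>

lemma non_atomic_null:
  assumes "non_atomic P" "{x} \<in> sets P"
  shows "emeasure P {x} = 0"
proof (rule ccontr)
  assume "emeasure P {x} \<noteq> 0"
  then have "0 < emeasure P {x}" by (simp add: zero_less_iff_neq_zero)
  then obtain B where "B \<subseteq> {x}" "0 < emeasure P B" "emeasure P B < emeasure P {x}"
    using assms unfolding non_atomic_def by blast
  then show False by (auto dest!: subset_singletonD)
qed

locale levy_density =
  fixes \<rho> :: "real \<Rightarrow> real" and \<kappa> \<epsilon> :: real
  assumes \<kappa>: "0 < \<kappa>" and \<epsilon>: "0 < \<epsilon>"
    and \<rho>: "\<rho> \<in> borel_measurable (restrict_space borel {0<..})" and \<rho>_nonneg: "\<And>s. 0 < s \<Longrightarrow> 0 \<le> \<rho> s"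
    and Lam_pos: "0 < Lam \<rho> \<kappa> \<epsilon>"
begin

text \<open>
  The intensity \<open>\<rho>\<close> is measurable on the half-line only; cutting it off at \<open>\<epsilon> > 0\<close> makes the product
  measurable on the real line.
\<close>
lemma measurable_weighted:
  assumes "g \<in> borel_measurable borel"
  shows "(\<lambda>s. g s * \<rho> s * indicator {\<epsilon><..} s) \<in> borel_measurable borel"
proof -
  have "(\<lambda>s. indicator {0<..} s *\<^sub>R \<rho> s) \<in> borel_measurable borel"
    using \<rho> by (subst (asm) borel_measurable_restrict_space_iff) auto
  then have "(\<lambda>s. g s * (indicator {0<..} s *\<^sub>R \<rho> s) * indicator {\<epsilon><..} s) \<in> borel_measurable borel"
    using assms by measurable
  also have "(\<lambda>s. g s * (indicator {0<..} s *\<^sub>R \<rho> s) * indicator {\<epsilon><..} s) = (\<lambda>s. g s * \<rho> s * indicator {\<epsilon><..} s)"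
    using \<epsilon> by (auto simp: fun_eq_iff indicator_def)
  finally show ?thesis .
qed

lemma set_integral_weighted:
  assumes g: "g \<in> borel_measurable borel" "\<And>s. 0 < s \<Longrightarrow> 0 \<le> g s"
  shows "(LINT s:{\<epsilon><..}|lborel. g s * \<rho> s) = enn2real (\<integral>\<^sup>+s. ennreal (g s * \<rho> s * indicator {\<epsilon><..} s) \<partial>pos_lborel)"
proof -
  have "(LINT s:{\<epsilon><..}|lborel. g s * \<rho> s) = (LINT s|lborel. g s * \<rho> s * indicator {\<epsilon><..} s)"
    unfolding set_lebesgue_integral_def by (simp add: mult.commute)
  also have "\<dots> = enn2real (\<integral>\<^sup>+s. ennreal (g s * \<rho> s * indicator {\<epsilon><..} s) \<partial>lborel)"
    using measurable_weighted[OF g(1)] g(2) \<rho>_nonneg \<epsilon>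
    by (intro integral_eq_nn_integral) (auto simp: indicator_def)
  also have "(\<integral>\<^sup>+s. ennreal (g s * \<rho> s * indicator {\<epsilon><..} s) \<partial>lborel) = (\<integral>\<^sup>+s. ennreal (g s * \<rho> s * indicator {\<epsilon><..} s) \<partial>pos_lborel)"
    using \<epsilon> by (subst nn_integral_restrict_space) (auto intro!: nn_integral_cong simp: indicator_def)
  finally show ?thesis .
qed

lemma measurable_weighted_pos:
  assumes "g \<in> borel_measurable borel"
  shows "(\<lambda>s. g s * \<rho> s * indicator {\<epsilon><..} s) \<in> borel_measurable pos_lborel"
proof -
  have "(\<lambda>s. g s * \<rho> s * indicator {\<epsilon><..} s) \<in> borel_measurable pos_borel"
    by (rule measurable_restrict_space1[OF measurable_weighted[OF assms]])
  then show ?thesis by (simp cong: measurable_cong_sets add: sets_pos_lborel)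
qed

lemma prob_space_jump_law: "prob_space (jump_law \<rho> \<kappa> \<epsilon>)"
proof (rule prob_spaceI)
  define I where "I = (\<integral>\<^sup>+s. ennreal (1 * \<rho> s * indicator {\<epsilon><..} s) \<partial>pos_lborel)"
  have L: "Lam \<rho> \<kappa> \<epsilon> = \<kappa> * enn2real I"
    unfolding Lam_def I_def using set_integral_weighted[of "\<lambda>_. 1"] by simp
  then have I: "0 < enn2real I" using Lam_pos \<kappa> by (simp add: zero_less_mult_iff)
  then have If: "I = ennreal (enn2real I)" by (cases I) auto
  have m: "(\<lambda>s. \<kappa> / Lam \<rho> \<kappa> \<epsilon> * \<rho> s * indicator {\<epsilon><..} s) \<in> borel_measurable pos_lborel"
    by (rule measurable_weighted_pos) simp
  have "emeasure (jump_law \<rho> \<kappa> \<epsilon>) (space (jump_law \<rho> \<kappa> \<epsilon>)) = (\<integral>\<^sup>+s. ennreal (\<kappa> / Lam \<rho> \<kappa> \<epsilon> * \<rho> s * indicator {\<epsilon><..} s) \<partial>pos_lborel)"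
  proof -
    have "space (jump_law \<rho> \<kappa> \<epsilon>) = space pos_lborel" by (simp add: jump_law_def)
    moreover have "emeasure (jump_law \<rho> \<kappa> \<epsilon>) (space pos_lborel) =
      (\<integral>\<^sup>+s. ennreal (\<kappa> * \<rho> s / Lam \<rho> \<kappa> \<epsilon> * indicator {\<epsilon><..} s) * indicator (space pos_lborel) s \<partial>pos_lborel)"
      unfolding jump_law_def by (rule emeasure_density[OF _ sets.top]) (use m in simp)
    moreover have "\<dots> = (\<integral>\<^sup>+s. ennreal (\<kappa> / Lam \<rho> \<kappa> \<epsilon> * \<rho> s * indicator {\<epsilon><..} s) \<partial>pos_lborel)"
      by (intro nn_integral_cong) simp
    ultimately show ?thesis by simp
  qed
  also have "\<dots> = (\<integral>\<^sup>+s. ennreal (\<kappa> / Lam \<rho> \<kappa> \<epsilon>) * ennreal (1 * \<rho> s * indicator {\<epsilon><..} s) \<partial>pos_lborel)"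
    using \<kappa> Lam_pos \<rho>_nonneg by (intro nn_integral_cong) (auto simp: ennreal_mult[symmetric] space_pos_borel indicator_def)
  also have "\<dots> = ennreal (\<kappa> / Lam \<rho> \<kappa> \<epsilon>) * I"
    unfolding I_def using measurable_weighted_pos[of "\<lambda>_. 1"] by (intro nn_integral_cmult) simp
  also have "\<dots> = ennreal (\<kappa> / Lam \<rho> \<kappa> \<epsilon> * enn2real I)"
    using \<kappa> Lam_pos by (subst If, subst ennreal_mult) auto
  also have "\<dots> = 1" using \<kappa> I by (simp add: L)
  finally show "emeasure (jump_law \<rho> \<kappa> \<epsilon>) (space (jump_law \<rho> \<kappa> \<epsilon>)) = 1" .
qed

sublocale jump_distribution "jump_law \<rho> \<kappa> \<epsilon>"
  by (intro jump_distribution.intro jump_distribution_axioms.intro prob_space_jump_law)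
    (simp add: jump_law_def sets_pos_lborel)

lemma density_jump_law:
  assumes f: "f \<in> borel_measurable pos_lborel"
  shows "density (jump_law \<rho> \<kappa> \<epsilon>) f =
    density pos_lborel (\<lambda>s. ennreal (\<kappa> * \<rho> s / Lam \<rho> \<kappa> \<epsilon> * indicator {\<epsilon><..} s) * f s)"
proof -
  have "(\<lambda>s. \<kappa> / Lam \<rho> \<kappa> \<epsilon> * \<rho> s * indicator {\<epsilon><..} s) \<in> borel_measurable pos_lborel"
    by (rule measurable_weighted_pos) simp
  then show ?thesis unfolding jump_law_def using f by (intro density_density_eq) simp_all
qed

lemma nn_integral_weighted:
  assumes g [measurable]: "g \<in> borel_measurable borel" and g0: "\<And>s. 0 < s \<Longrightarrow> 0 \<le> g s"
  shows "(\<integral>\<^sup>+s. ennreal (\<kappa> * (g s * \<rho> s * indicator {\<epsilon><..} s)) \<partial>pos_lborel) =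
    ennreal (Lam \<rho> \<kappa> \<epsilon>) * (\<integral>\<^sup>+s. ennreal (g s) \<partial>jump_law \<rho> \<kappa> \<epsilon>)"
proof -
  have m: "(\<lambda>s. \<kappa> / Lam \<rho> \<kappa> \<epsilon> * \<rho> s * indicator {\<epsilon><..} s) \<in> borel_measurable pos_lborel"
    by (rule measurable_weighted_pos) simp
  have gp: "(\<lambda>s. ennreal (g s)) \<in> borel_measurable pos_lborel"
    using g by (intro measurable_restrict_space1) simp
  have gp': "(\<lambda>s. g s) \<in> borel_measurable pos_lborel"
    using g by (intro measurable_restrict_space1) simp
  have "ennreal (Lam \<rho> \<kappa> \<epsilon>) * (\<integral>\<^sup>+s. ennreal (g s) \<partial>jump_law \<rho> \<kappa> \<epsilon>) =
    ennreal (Lam \<rho> \<kappa> \<epsilon>) * (\<integral>\<^sup>+s. ennreal (\<kappa> * \<rho> s / Lam \<rho> \<kappa> \<epsilon> * indicator {\<epsilon><..} s) * ennreal (g s) \<partial>pos_lborel)"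
    unfolding jump_law_def using m gp by (subst nn_integral_density) simp_all
  also have "\<dots> = (\<integral>\<^sup>+s. ennreal (Lam \<rho> \<kappa> \<epsilon>) * (ennreal (\<kappa> * \<rho> s / Lam \<rho> \<kappa> \<epsilon> * indicator {\<epsilon><..} s) * ennreal (g s)) \<partial>pos_lborel)"
    using m gp by (intro nn_integral_cmult[symmetric]) simp_all
  also have "\<dots> = (\<integral>\<^sup>+s. ennreal (\<kappa> * (g s * \<rho> s * indicator {\<epsilon><..} s)) \<partial>pos_lborel)"
    using \<kappa> Lam_pos \<rho>_nonneg g0
    by (intro nn_integral_cong) (auto simp: ennreal_mult[symmetric] space_pos_borel indicator_def)
  finally show ?thesis ..
qed

lemma tilted_moment_integral:
  "(LINT s:{\<epsilon><..}|lborel. \<kappa> * s ^ d * exp (- u * s) * \<rho> s) = Lam \<rho> \<kappa> \<epsilon> * enn2real (tilted_moment d u)"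
proof -
  have "(LINT s:{\<epsilon><..}|lborel. \<kappa> * s ^ d * exp (- u * s) * \<rho> s) =
    enn2real (\<integral>\<^sup>+s. ennreal (\<kappa> * s ^ d * exp (- u * s) * \<rho> s * indicator {\<epsilon><..} s) \<partial>pos_lborel)"
    using \<kappa> by (intro set_integral_weighted) auto
  also have "(\<integral>\<^sup>+s. ennreal (\<kappa> * s ^ d * exp (- u * s) * \<rho> s * indicator {\<epsilon><..} s) \<partial>pos_lborel) =
    ennreal (Lam \<rho> \<kappa> \<epsilon>) * tilted_moment d u"
    unfolding tilted_moment_def using nn_integral_weighted[of "\<lambda>s. s ^ d * exp (- u * s)"] by (simp add: mult.assoc)
  finally show ?thesis using Lam_pos by (simp add: enn2real_mult)
qed

lemma Lam_tilt: "Lam (tilt u \<rho>) \<kappa> \<epsilon> = Lam \<rho> \<kappa> \<epsilon> * enn2real (tilted_moment 0 u)"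
proof -
  have "Lam (tilt u \<rho>) \<kappa> \<epsilon> = (LINT s:{\<epsilon><..}|lborel. \<kappa> * s ^ 0 * exp (- u * s) * \<rho> s)"
    unfolding Lam_def tilt_def by (subst set_integral_mult_right[symmetric]) (simp add: mult.assoc)
  then show ?thesis by (simp only: tilted_moment_integral)
qed

text \<open>
  The constant \<open>\<kappa> / Lam \<rho> \<kappa> \<epsilon>\<close> cancels in the normalization.
\<close>
lemma density_propto_eq_size_biased:
  assumes "0 < u"
  shows "density_propto (\<lambda>s. s ^ d * exp (- u * s) * \<rho> s * indicator {\<epsilon><..} s) = size_biased d u"
proof -
  let ?L = "Lam \<rho> \<kappa> \<epsilon>"
  have m: "(\<lambda>s. \<kappa> / Lam \<rho> \<kappa> \<epsilon> * \<rho> s * indicator {\<epsilon><..} s) \<in> borel_measurable pos_lborel"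
    by (rule measurable_weighted_pos) simp
  have I: "(\<integral>\<^sup>+s. ennreal (s ^ d * exp (- u * s) * \<rho> s * indicator {\<epsilon><..} s) \<partial>pos_lborel) = ennreal (?L / \<kappa>) * tilted_moment d u"
  proof -
    have mm: "(\<lambda>s. s ^ d * exp (- u * s) * \<rho> s * indicator {\<epsilon><..} s) \<in> borel_measurable pos_lborel"
      by (rule measurable_weighted_pos) simp
    have "ennreal \<kappa> * (\<integral>\<^sup>+s. ennreal (s ^ d * exp (- u * s) * \<rho> s * indicator {\<epsilon><..} s) \<partial>pos_lborel) =
      (\<integral>\<^sup>+s. ennreal \<kappa> * ennreal (s ^ d * exp (- u * s) * \<rho> s * indicator {\<epsilon><..} s) \<partial>pos_lborel)"
      using mm by (intro nn_integral_cmult[symmetric]) simp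
    also have "\<dots> = (\<integral>\<^sup>+s. ennreal (\<kappa> * (s ^ d * exp (- u * s) * \<rho> s * indicator {\<epsilon><..} s)) \<partial>pos_lborel)"
      using \<kappa> \<rho>_nonneg by (intro nn_integral_cong) (auto simp: ennreal_mult' space_pos_borel)
    also have "\<dots> = ennreal ?L * tilted_moment d u"
      unfolding tilted_moment_def by (rule nn_integral_weighted) auto
    finally have *: "ennreal \<kappa> * (\<integral>\<^sup>+s. ennreal (s ^ d * exp (- u * s) * \<rho> s * indicator {\<epsilon><..} s) \<partial>pos_lborel) = ennreal ?L * tilted_moment d u" .
    have "x = ennreal (1 / \<kappa>) * (ennreal \<kappa> * x)" for x
      using \<kappa> by (simp add: mult.assoc[symmetric] ennreal_mult[symmetric])
    from this[of "\<integral>\<^sup>+s. ennreal (s ^ d * exp (- u * s) * \<rho> s * indicator {\<epsilon><..} s) \<partial>pos_lborel"] show ?thesis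
      unfolding * using \<kappa> Lam_pos by (simp add: mult.assoc[symmetric] ennreal_mult[symmetric])
  qed
  obtain q where q: "tilted_moment d u = ennreal q" "0 < q"
    using tilted_moment_pos[of d u] tilted_moment_finite[OF assms, of d] by (cases "tilted_moment d u") auto
  have sm: "(\<lambda>s. ennreal (s ^ d * exp (- u * s)) / tilted_moment d u) \<in> borel_measurable pos_lborel"
    by (intro measurable_restrict_space1) simp
  have "size_biased d u = density pos_lborel (\<lambda>s. ennreal (\<kappa> * \<rho> s / ?L * indicator {\<epsilon><..} s) * (ennreal (s ^ d * exp (- u * s)) / tilted_moment d u))"
    unfolding size_biased_def by (rule density_jump_law[OF sm])
  also have "\<dots> = density_propto (\<lambda>s. s ^ d * exp (- u * s) * \<rho> s * indicator {\<epsilon><..} s)"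
    unfolding density_propto_def I
  proof (rule density_cong)
    show "(\<lambda>s. ennreal (\<kappa> * \<rho> s / ?L * indicator {\<epsilon><..} s) * (ennreal (s ^ d * exp (- u * s)) / tilted_moment d u)) \<in> borel_measurable pos_lborel"
      using m sm by (intro borel_measurable_times_ennreal) simp_all
    have "(\<lambda>s. s ^ d * exp (- u * s) * \<rho> s * indicator {\<epsilon><..} s) \<in> borel_measurable pos_lborel"
      by (rule measurable_weighted_pos) simp
    then show "(\<lambda>s. ennreal (s ^ d * exp (- u * s) * \<rho> s * indicator {\<epsilon><..} s) / (ennreal (?L / \<kappa>) * tilted_moment d u)) \<in> borel_measurable pos_lborel"
      by measurable
    show "AE s in pos_lborel. ennreal (\<kappa> * \<rho> s / ?L * indicator {\<epsilon><..} s) * (ennreal (s ^ d * exp (- u * s)) / tilted_moment d u) =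
      ennreal (s ^ d * exp (- u * s) * \<rho> s * indicator {\<epsilon><..} s) / (ennreal (?L / \<kappa>) * tilted_moment d u)"
    proof (rule AE_I2)
      fix s assume "s \<in> space pos_lborel"
      then have s: "0 < s" by (simp add: space_pos_borel)
      define i :: real where "i = indicator {\<epsilon><..} s"
      have i: "0 \<le> i" by (simp add: i_def)
      show "ennreal (\<kappa> * \<rho> s / ?L * indicator {\<epsilon><..} s) * (ennreal (s ^ d * exp (- u * s)) / tilted_moment d u) =
        ennreal (s ^ d * exp (- u * s) * \<rho> s * indicator {\<epsilon><..} s) / (ennreal (?L / \<kappa>) * tilted_moment d u)"
        unfolding q i_def[symmetric] using s q(2) \<kappa> Lam_pos \<rho>_nonneg[OF s] i
        by (simp add: ennreal_mult[symmetric] divide_ennreal field_simps)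
    qed
  qed
  finally show ?thesis ..
qed

lemma jump_law_tilt:
  assumes "0 < u"
  shows "jump_law (tilt u \<rho>) \<kappa> \<epsilon> = size_biased 0 u"
proof -
  let ?L = "Lam \<rho> \<kappa> \<epsilon>"
  obtain q where q: "tilted_moment 0 u = ennreal q" "0 < q"
    using tilted_moment_pos[of 0 u] tilted_moment_finite[OF assms, of 0] by (cases "tilted_moment 0 u") auto
  have m: "(\<lambda>s. \<kappa> / ?L * \<rho> s * indicator {\<epsilon><..} s) \<in> borel_measurable pos_lborel"
    by (rule measurable_weighted_pos) simp
  have sm: "(\<lambda>s. ennreal (s ^ 0 * exp (- u * s)) / tilted_moment 0 u) \<in> borel_measurable pos_lborel"
    by (intro measurable_restrict_space1) simp
  have tm: "(\<lambda>s. \<kappa> / (?L * q) * exp (- u * s) * \<rho> s * indicator {\<epsilon><..} s) \<in> borel_measurable pos_lborel"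
    by (rule measurable_weighted_pos) simp
  have "size_biased 0 u = density pos_lborel (\<lambda>s. ennreal (\<kappa> * \<rho> s / ?L * indicator {\<epsilon><..} s) * (ennreal (s ^ 0 * exp (- u * s)) / tilted_moment 0 u))"
    unfolding size_biased_def by (rule density_jump_law[OF sm])
  also have "\<dots> = density pos_lborel (\<lambda>s. ennreal (\<kappa> * tilt u \<rho> s / (?L * enn2real (tilted_moment 0 u)) * indicator {\<epsilon><..} s))"
  proof (rule density_cong)
    show "(\<lambda>s. ennreal (\<kappa> * \<rho> s / ?L * indicator {\<epsilon><..} s) * (ennreal (s ^ 0 * exp (- u * s)) / tilted_moment 0 u)) \<in> borel_measurable pos_lborel"
      using m sm by (intro borel_measurable_times_ennreal) simp_all
    show "(\<lambda>s. ennreal (\<kappa> * tilt u \<rho> s / (?L * enn2real (tilted_moment 0 u)) * indicator {\<epsilon><..} s)) \<in> borel_measurable pos_lborel"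
      using tm q by (simp add: tilt_def mult.assoc)
    show "AE s in pos_lborel. ennreal (\<kappa> * \<rho> s / ?L * indicator {\<epsilon><..} s) * (ennreal (s ^ 0 * exp (- u * s)) / tilted_moment 0 u) =
      ennreal (\<kappa> * tilt u \<rho> s / (?L * enn2real (tilted_moment 0 u)) * indicator {\<epsilon><..} s)"
    proof (rule AE_I2)
      fix s assume "s \<in> space pos_lborel"
      then have s: "0 < s" by (simp add: space_pos_borel)
      show "ennreal (\<kappa> * \<rho> s / ?L * indicator {\<epsilon><..} s) * (ennreal (s ^ 0 * exp (- u * s)) / tilted_moment 0 u) =
        ennreal (\<kappa> * tilt u \<rho> s / (?L * enn2real (tilted_moment 0 u)) * indicator {\<epsilon><..} s)"
        unfolding q using s q(2) \<kappa> Lam_pos \<rho>_nonneg[OF s]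
        by (simp add: ennreal_mult[symmetric] divide_ennreal tilt_def indicator_def)
    qed
  qed
  also have "\<dots> = jump_law (tilt u \<rho>) \<kappa> \<epsilon>"
    by (simp only: jump_law_def[of "tilt u \<rho>"] Lam_tilt)
  finally show ?thesis ..
qed

end

context crm_sampling
begin

lemma tilted_moment_0_le_1: "0 < u \<Longrightarrow> tilted_moment 0 u \<le> 1"
proof -
  assume "0 < u"
  then have "tilted_moment 0 u \<le> (\<integral>\<^sup>+s. 1 \<partial>F)"
    unfolding tilted_moment_def by (intro nn_integral_mono) (auto simp: space_F)
  then show "tilted_moment 0 u \<le> 1" by (simp add: emeasure_space_1)
qed

lemma \<Lambda>u_le: "0 < u \<Longrightarrow> \<Lambda>u u \<le> \<Lambda>"
  using tilted_moment_0_le_1[of u] \<Lambda> unfolding \<Lambda>u_def by (cases "tilted_moment 0 u") (auto simp: mult_left_le)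

text \<open>
  Up to the constant \<open>card (patterns n k ns) / (n - 1)!\<close>, \<open>joint_density\<close> is the density \<open>g\<close>: each of
  the \<open>k\<close> integrals in \<open>g\<close> equals \<open>\<Lambda>\<close> times a tilted moment, and one of the \<open>k\<close> factors \<open>\<Lambda>\<close> is cancelled by the
  denominator.  Integrability follows from \<open>nn_integral_tilted_moment_le\<close>, since \<open>\<Lambda>u u \<le> \<Lambda>\<close> bounds the
  remaining factor.
\<close>
lemma cond_distr_U_density:
  assumes g: "\<And>u. 0 < u \<Longrightarrow> g u = u ^ (n - 1) * exp (\<Lambda>u u - \<Lambda>) * ((\<Lambda>u u + real k) / \<Lambda>) * (\<Prod>j<k. \<Lambda> * enn2real (tilted_moment (ns j) u))"
  shows "cond_distr_on M E U pos_borel \<theta>s Mt (\<lambda>_. density_propto g)"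
proof -
  define b where "b = (\<lambda>u. \<Lambda> ^ (k - 1) * exp (\<Lambda>u u - \<Lambda>) * (\<Lambda>u u + real k))"
  have eq: "ennreal (g u) = ennreal (b u) * (ennreal (u ^ (n - 1)) * (\<Prod>j<k. tilted_moment (ns j) u))" if u: "0 < u" for u
  proof -
    have tm: "(\<Prod>j<k. tilted_moment (ns j) u) = ennreal (\<Prod>j<k. enn2real (tilted_moment (ns j) u))"
    proof -
      have "tilted_moment (ns j) u = ennreal (enn2real (tilted_moment (ns j) u))" for j
        using tilted_moment_finite[OF u, of "ns j"] by (simp add: less_top)
      then have "(\<Prod>j<k. tilted_moment (ns j) u) = (\<Prod>j<k. ennreal (enn2real (tilted_moment (ns j) u)))" by simp
      also have "\<dots> = ennreal (\<Prod>j<k. enn2real (tilted_moment (ns j) u))" by (rule prod_ennreal) simp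
      finally show ?thesis .
    qed
    have "g u = b u * (u ^ (n - 1) * (\<Prod>j<k. enn2real (tilted_moment (ns j) u)))"
    proof -
      have "\<Lambda> ^ k = \<Lambda> ^ (k - 1) * \<Lambda>" using k by (cases k) auto
      then have "(\<Lambda>u u + real k) / \<Lambda> * \<Lambda> ^ k = \<Lambda> ^ (k - 1) * (\<Lambda>u u + real k)" using \<Lambda> by simp
      moreover have "g u = u ^ (n - 1) * exp (\<Lambda>u u - \<Lambda>) * ((\<Lambda>u u + real k) / \<Lambda> * \<Lambda> ^ k) * (\<Prod>j<k. enn2real (tilted_moment (ns j) u))"
        unfolding g[OF u] prod.distrib by simp
      ultimately show ?thesis unfolding b_def by (simp only: mult_ac)
    qed
    moreover have "0 \<le> b u" using \<Lambda> \<Lambda>u_pos[OF u] by (simp add: b_def)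
    moreover have "0 \<le> (\<Prod>j<k. enn2real (tilted_moment (ns j) u))" by (rule prod_nonneg) simp
    ultimately show ?thesis using u by (simp add: tm ennreal_mult)
  qed
  have b: "b \<in> borel_measurable pos_borel" unfolding b_def by measurable
  have "(\<lambda>u. ennreal (b u) * (ennreal (u ^ (n - 1)) * (\<Prod>j<k. tilted_moment (ns j) u))) \<in> borel_measurable pos_borel"
    using b by measurable
  then have m: "(\<lambda>u. ennreal (g u)) \<in> borel_measurable pos_borel"
    by (rule measurable_cong[THEN iffD1, rotated]) (simp add: eq space_pos_borel)
  have m': "(\<lambda>u. ennreal (g u)) \<in> borel_measurable pos_lborel"
    using m by (simp cong: measurable_cong_sets add: sets_pos_lborel)
  have jd: "joint_density u = (of_nat (card (patterns n k ns)) * ennreal (1 / fact (n - 1))) * ennreal (g u)" if u: "0 < u" for u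
  proof -
    have "ennreal (u ^ (n - 1) / fact (n - 1)) = ennreal (1 / fact (n - 1)) * ennreal (u ^ (n - 1))"
      using u by (subst ennreal_mult[symmetric]) auto
    then show ?thesis
      unfolding joint_density_def base_density_def eq[OF u] b_def by (simp only: ac_simps)
  qed
  have pos: "(\<integral>\<^sup>+u. ennreal (g u) \<partial>pos_lborel) \<noteq> 0"
  proof
    assume "(\<integral>\<^sup>+u. ennreal (g u) \<partial>pos_lborel) = 0"
    then have "AE u in pos_lborel. ennreal (g u) = 0"
      using m' by (subst (asm) nn_integral_0_iff_AE) auto
    moreover have "AE u in pos_lborel. ennreal (g u) \<noteq> 0"
    proof (rule AE_I2)
      fix u assume "u \<in> space pos_lborel"
      then have u: "0 < u" by (simp add: space_pos_borel)
      have t0: "tilted_moment (ns j) u \<noteq> 0" for j using tilted_moment_pos[of "ns j" u] by auto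
      have "0 < b u" using \<Lambda> \<Lambda>u_pos[OF u] by (simp add: b_def)
      then show "ennreal (g u) \<noteq> 0"
        unfolding eq[OF u] using u t0 by (simp add: ennreal_eq_0_iff not_le)
    qed
    ultimately have "AE u in pos_lborel. False" by eventually_elim simp
    then have "emeasure pos_lborel (space pos_lborel) = 0"
      using AE_iff_measurable[OF sets.top, where M=pos_lborel and P="\<lambda>_. False"] by (simp add: greaterThan_def)
    moreover have "emeasure pos_lborel (space pos_lborel) = emeasure lborel {0 :: real<..}"
      by (subst emeasure_restrict_space) (auto simp: space_pos_borel)
    moreover have "emeasure lborel {0<..<1 :: real} \<le> emeasure lborel {0 :: real<..}"
      by (intro emeasure_mono) auto
    ultimately show False by simp
  qed
  have fin: "(\<integral>\<^sup>+u. ennreal (g u) \<partial>pos_lborel) \<noteq> \<infinity>"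
  proof -
    let ?h = "\<lambda>u. ennreal (u ^ (n - 1)) * (\<Prod>j<k. tilted_moment (ns j) u)"
    have hm: "?h \<in> borel_measurable pos_lborel"
    proof -
      have "?h \<in> borel_measurable pos_borel" by measurable
      then show ?thesis by (simp cong: measurable_cong_sets add: sets_pos_lborel)
    qed
    have "(\<integral>\<^sup>+u. ennreal (g u) \<partial>pos_lborel) \<le> (\<integral>\<^sup>+u. ennreal (\<Lambda> ^ (k - 1) * (\<Lambda> + real k)) * ?h u \<partial>pos_lborel)"
    proof (intro nn_integral_mono)
      fix u assume "u \<in> space pos_lborel"
      then have u: "0 < u" by (simp add: space_pos_borel)
      have "b u \<le> \<Lambda> ^ (k - 1) * 1 * (\<Lambda> + real k)"
        unfolding b_def using \<Lambda> \<Lambda>u_le[OF u] \<Lambda>u_pos[OF u] by (intro mult_mono) auto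
      then show "ennreal (g u) \<le> ennreal (\<Lambda> ^ (k - 1) * (\<Lambda> + real k)) * ?h u"
        unfolding eq[OF u] by (intro mult_right_mono ennreal_leI) auto
    qed
    also have "\<dots> = ennreal (\<Lambda> ^ (k - 1) * (\<Lambda> + real k)) * (\<integral>\<^sup>+u. ?h u \<partial>pos_lborel)"
      by (rule nn_integral_cmult[OF hm])
    also have "\<dots> \<le> ennreal (\<Lambda> ^ (k - 1) * (\<Lambda> + real k)) * fact (n - 1)"
      by (intro mult_left_mono nn_integral_tilted_moment_le ns n k) simp
    also have "\<dots> < \<infinity>" by (simp add: ennreal_mult_less_top ennreal_fact[symmetric] del: ennreal_fact)
    finally show ?thesis by simp
  qed
  show ?thesis
    unfolding density_propto_def by (rule cond_distr_U[OF m jd pos fin])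
qed

end

section \<open>The posterior distribution of the process\<close>

theorem proposition4:
  fixes M :: "'w measure"
    and \<Theta> :: "(real ^ 'm) set" and P0 :: "(real ^ 'm) measure"
    and \<rho> :: "real \<Rightarrow> real" and \<kappa> \<epsilon> :: real
    and N :: "'w \<Rightarrow> nat" and J :: "nat \<Rightarrow> 'w \<Rightarrow> real" and \<tau> \<theta> :: "nat \<Rightarrow> 'w \<Rightarrow> real ^ 'm"
    and \<Gamma> :: "'w \<Rightarrow> real" and n k :: nat and ns :: "nat \<Rightarrow> nat"
  assumes "prob_space M"
    and "\<Theta> \<in> sets borel" and "prob_space P0" and "sets P0 = sets (restrict_space borel \<Theta>)"
    and "non_atomic P0"
    and "\<kappa> > 0"
    and "\<rho> \<in> borel_measurable (restrict_space borel {0<..})" and "\<And>s. s > 0 \<Longrightarrow> \<rho> s \<ge> 0"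
    and "(\<integral>\<^sup>+s\<in>{0<..}. ennreal (min 1 s * \<rho> s) \<partial>lborel) < \<infinity>"
    and "(\<integral>\<^sup>+s\<in>{0<..}. ennreal (\<rho> s) \<partial>lborel) = \<infinity>"
    and "\<epsilon> > 0" and "Lam \<rho> \<kappa> \<epsilon> > 0"
    and "n \<ge> 1"
    and "eps_NormCRM M \<rho> \<kappa> P0 \<epsilon> N J \<tau>"
    and "crm_sample M P0 N J \<tau> n \<theta>"
    and "distributed M lborel \<Gamma> (erlang_density (n - 1) 1)"
    and "prob_space.indep_set M
           (sets (vimage_algebra (space M) \<Gamma> borel))
           (sets (vimage_algebra (space M)
              (\<lambda>\<omega>. (N \<omega>, \<lambda>j. (J j \<omega>, \<tau> j \<omega>), \<lambda>i\<in>{..<n}. \<theta> i \<omega>))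
              (count_space UNIV \<Otimes>\<^sub>M Pi\<^sub>M UNIV (\<lambda>_. borel \<Otimes>\<^sub>M P0) \<Otimes>\<^sub>M Pi\<^sub>M {..<n} (\<lambda>_. P0))))"
    and "k \<ge> 1" and "\<And>j. j < k \<Longrightarrow> ns j \<ge> 1" and "(\<Sum>j<k. ns j) = n"
  shows
    "let U = (\<lambda>\<omega>. \<Gamma> \<omega> / crm_total N J \<omega>);
         E = {\<omega>\<in>space M. length (distinct_values n \<theta> \<omega>) = k \<and>
                (\<forall>j<k. multiplicity_of n \<theta> j \<omega> = ns j)};
         \<theta>s = (\<lambda>\<omega>. \<lambda>j\<in>{..<k}. distinct_values n \<theta> \<omega> ! j);
         ls = (\<lambda>\<omega>. \<lambda>j\<in>{..<k}. alloc_index N \<tau> n \<theta> j \<omega>);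
         Ja = (\<lambda>\<omega>. \<lambda>j\<in>{..<k}. J (alloc_index N \<tau> n \<theta> j \<omega>) \<omega>);
         Nna = (\<lambda>\<omega>. N \<omega> + 1 - k);
         Pna = (\<lambda>\<omega>. norm_atoms P0 (nonalloc_indices N \<tau> n \<theta> \<omega>) (\<lambda>j. J j \<omega>) (\<lambda>j. \<tau> j \<omega>));
         Tna = (\<lambda>\<omega>. \<Sum>j\<in>nonalloc_indices N \<tau> n \<theta> \<omega>. J j \<omega>);
         w = (\<lambda>\<omega>. nonalloc_weight (Nna \<omega>) (Tna \<omega>) (\<Sum>j<k. Ja \<omega> j));
         \<Theta>k = Pi\<^sub>M {..<k} (\<lambda>_. P0)
     in
       cond_distr_on M E (crm_measure P0 N J \<tau>) (prob_algebra P0)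
         (\<lambda>\<omega>. (\<theta>s \<omega>, U \<omega>)) (\<Theta>k \<Otimes>\<^sub>M pos_borel)
         (\<lambda>(t, u). posterior_law \<rho> \<kappa> P0 \<epsilon> k ns t u)
     \<and> (AE \<omega> in M. \<omega> \<in> E \<longrightarrow>
          crm_measure P0 N J \<tau> \<omega> = mix_measure (w \<omega>) (Pna \<omega>) (norm_atoms P0 {..<k} (Ja \<omega>) (\<theta>s \<omega>)))
     \<and> cond_distr_on M E (\<lambda>\<omega>. (Pna \<omega>, Tna \<omega>)) (subprob_algebra P0 \<Otimes>\<^sub>M borel)
         (\<lambda>\<omega>. (\<theta>s \<omega>, U \<omega>, Nna \<omega>)) (\<Theta>k \<Otimes>\<^sub>M pos_borel \<Otimes>\<^sub>M count_space UNIV)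
         (\<lambda>(t, u, r). NormCRM_given (tilt u \<rho>) \<kappa> P0 \<epsilon> r)
     \<and> cond_distr_on M E Nna (count_space UNIV)
         (\<lambda>\<omega>. (\<theta>s \<omega>, U \<omega>)) (\<Theta>k \<Otimes>\<^sub>M pos_borel)
         (\<lambda>(t, u). measure_pmf (nonalloc_number_law k (Lam (tilt u \<rho>) \<kappa> \<epsilon>)))
     \<and> cond_distr_on M E Ja (Pi\<^sub>M {..<k} (\<lambda>_. pos_borel))
         (\<lambda>\<omega>. (\<theta>s \<omega>, U \<omega>)) (\<Theta>k \<Otimes>\<^sub>M pos_borel)
         (\<lambda>(t, u). alloc_jumps_law \<rho> \<epsilon> k ns u)
     \<and> cond_indep_on M E (\<lambda>\<omega>. (Pna \<omega>, Tna \<omega>)) (subprob_algebra P0 \<Otimes>\<^sub>M borel)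
         Ja (Pi\<^sub>M {..<k} (\<lambda>_. pos_borel))
         (\<lambda>\<omega>. (\<theta>s \<omega>, U \<omega>, ls \<omega>)) (\<Theta>k \<Otimes>\<^sub>M pos_borel \<Otimes>\<^sub>M Pi\<^sub>M {..<k} (\<lambda>_. count_space UNIV))
     \<and> cond_distr_on M E U pos_borel \<theta>s \<Theta>k
         (\<lambda>_. density_propto (U_posterior_density \<rho> \<kappa> \<epsilon> n k ns))"
proof -
  interpret M: prob_space M by fact
  interpret P0: prob_space P0 by fact
  interpret levy_density \<rho> \<kappa> \<epsilon>
    by (rule levy_density.intro) (use assms(6-8,11,12) in auto)
  have spP0: "space P0 = \<Theta>"
    using sets_eq_imp_space_eq[OF assms(4)] by (simp add: space_restrict_space)
  have sing: "{x} \<in> sets P0" if "x \<in> space P0" for x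
    using that assms(2) unfolding assms(4) by (subst sets_restrict_space_iff) (auto simp: spP0)
  interpret S: crm_sampling "jump_law \<rho> \<kappa> \<epsilon>" P0 M "Lam \<rho> \<kappa> \<epsilon>" N J \<tau> \<theta> \<Gamma> n k ns
  proof (intro_locales)
    show "crm_sampling_axioms (jump_law \<rho> \<kappa> \<epsilon>) P0 M (Lam \<rho> \<kappa> \<epsilon>) N J \<tau> \<theta> \<Gamma> n k ns"
    proof
      show "(\<lambda>x. x) \<in> P0 \<rightarrow>\<^sub>M borel"
        using assms(4) by (simp add: measurable_restrict_space1 cong: measurable_cong_sets)
      show "{x} \<in> sets P0" "emeasure P0 {x} = 0" if "x \<in> space P0" for x
        using sing[OF that] non_atomic_null[OF assms(5)] by auto
    qed (use assms in \<open>auto simp: eps_NormCRM_def\<close>)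
  qed
  \<comment> \<open>The abstract kernels of the sampling model are those defined from \<open>\<rho>\<close>.\<close>
  have \<Lambda>u: "S.\<Lambda>u u = Lam (tilt u \<rho>) \<kappa> \<epsilon>" for u
    by (simp add: S.\<Lambda>u_def Lam_tilt)
  have nonalloc_jumps: "S.nonalloc_jumps r u = jumps_given (tilt u \<rho>) \<kappa> P0 \<epsilon> r" if "0 < u" for r u
    by (simp add: S.nonalloc_jumps_def jumps_given_def jump_law_tilt[OF that])
  have alloc_jumps: "S.alloc_jumps u = alloc_jumps_law \<rho> \<epsilon> k ns u" if "0 < u" for u
    unfolding S.alloc_jumps_def alloc_jumps_law_def by (simp only: density_propto_eq_size_biased[OF that])
  have post: "S.posterior_kernel t u = posterior_law \<rho> \<kappa> P0 \<epsilon> k ns t u" if "0 < u" for t u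
    unfolding S.posterior_kernel_def posterior_law_def S.posterior_map_def by (simp add: \<Lambda>u nonalloc_jumps[OF that] alloc_jumps[OF that])
  have nak: "S.nonalloc_kernel r u = NormCRM_given (tilt u \<rho>) \<kappa> P0 \<epsilon> r" if "0 < u" for r u
    unfolding S.nonalloc_kernel_def NormCRM_given_def S.nonalloc_map_def[abs_def] by (simp add: nonalloc_jumps[OF that])
  \<comment> \<open>Kernels matter only on the conditioning space, where \<open>u > 0\<close>.\<close>
  have cong: "cond_distr_on M S.E X MX Y MY K'"
    if c: "cond_distr_on M S.E X MX Y MY K" and K: "\<And>y. y \<in> space MY \<Longrightarrow> K y = K' y"
    for X :: "'w \<Rightarrow> 'x" and MX and Y :: "'w \<Rightarrow> 'y" and MY K K'
  proof -
    have m: "K' \<in> MY \<rightarrow>\<^sub>M prob_algebra MX"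
      using c K unfolding cond_distr_on_def by (simp cong: measurable_cong)
    have "(\<integral>\<^sup>+\<omega>. emeasure (K' (Y \<omega>)) A * indicator {\<omega>\<in>S.E. Y \<omega> \<in> B} \<omega> \<partial>M) =
      (\<integral>\<^sup>+\<omega>. emeasure (K (Y \<omega>)) A * indicator {\<omega>\<in>S.E. Y \<omega> \<in> B} \<omega> \<partial>M)" if "B \<in> sets MY" for A B
      using sets.sets_into_space[OF that] K by (intro nn_integral_cong) (auto simp: indicator_def)
    then show ?thesis using c m unfolding cond_distr_on_def by simp
  qed
  show ?thesis
    unfolding Let_def S.E_def[symmetric] S.U_def[symmetric] S.\<theta>s_def[symmetric] S.ls_def[symmetric]
      S.Ja_def[symmetric] S.Pna_def[symmetric] S.Tna_def[symmetric]
  proof (intro conjI)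
    show "cond_distr_on M S.E (crm_measure P0 N J \<tau>) (prob_algebra P0) (\<lambda>\<omega>. (S.\<theta>s \<omega>, S.U \<omega>)) S.M\<theta>U
        (\<lambda>(t, u). posterior_law \<rho> \<kappa> P0 \<epsilon> k ns t u)"
      by (rule cong[OF S.cond_distr_crm_measure]) (auto simp: space_pair_measure space_pos_borel post)
    show "AE \<omega> in M. \<omega> \<in> S.E \<longrightarrow> crm_measure P0 N J \<tau> \<omega> =
        mix_measure (nonalloc_weight (N \<omega> + 1 - k) (S.Tna \<omega>) (\<Sum>j<k. S.Ja \<omega> j)) (S.Pna \<omega>)
          (norm_atoms P0 {..<k} (S.Ja \<omega>) (S.\<theta>s \<omega>))"
      using S.AE_regular by eventually_elim (simp add: S.crm_measure_regular)
    show "cond_distr_on M S.E (\<lambda>\<omega>. (S.Pna \<omega>, S.Tna \<omega>)) (subprob_algebra P0 \<Otimes>\<^sub>M borel)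
        (\<lambda>\<omega>. (S.\<theta>s \<omega>, S.U \<omega>, N \<omega> + 1 - k)) (S.Mt \<Otimes>\<^sub>M pos_borel \<Otimes>\<^sub>M count_space UNIV)
        (\<lambda>(t, u, r). NormCRM_given (tilt u \<rho>) \<kappa> P0 \<epsilon> r)"
      by (rule cong[OF S.cond_distr_nonalloc]) (auto simp: space_pair_measure space_pos_borel nak)
    show "cond_distr_on M S.E (\<lambda>\<omega>. N \<omega> + 1 - k) (count_space UNIV) (\<lambda>\<omega>. (S.\<theta>s \<omega>, S.U \<omega>)) S.M\<theta>U
        (\<lambda>(t, u). measure_pmf (nonalloc_number_law k (Lam (tilt u \<rho>) \<kappa> \<epsilon>)))"
      using S.cond_distr_nonalloc_number by (simp only: \<Lambda>u)
    show "cond_distr_on M S.E S.Ja S.MA (\<lambda>\<omega>. (S.\<theta>s \<omega>, S.U \<omega>)) S.M\<theta>U (\<lambda>(t, u). alloc_jumps_law \<rho> \<epsilon> k ns u)"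
      by (rule cong[OF S.cond_distr_alloc_jumps]) (auto simp: space_pair_measure space_pos_borel alloc_jumps)
    show "cond_indep_on M S.E (\<lambda>\<omega>. (S.Pna \<omega>, S.Tna \<omega>)) (subprob_algebra P0 \<Otimes>\<^sub>M borel) S.Ja S.MA
        (\<lambda>\<omega>. (S.\<theta>s \<omega>, S.U \<omega>, S.ls \<omega>)) (S.Mt \<Otimes>\<^sub>M pos_borel \<Otimes>\<^sub>M S.Ml)"
      by (rule S.cond_indep_nonalloc_alloc)
    show "cond_distr_on M S.E S.U pos_borel S.\<theta>s S.Mt
        (\<lambda>_. density_propto (U_posterior_density \<rho> \<kappa> \<epsilon> n k ns))"
      by (rule S.cond_distr_U_density) (simp only: U_posterior_density_def \<Lambda>u tilted_moment_integral)
  qed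
qed

end
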